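(* Let $T>0$, $x_0\in\mathbb{R}$, and let $F,G:[0,\infty)\times\mathbb{R}\to\mathbb{R}$ be jointly continuous with $F,\ G,\ GG_x\in C^{1,2}$. Let $h:[0,\infty)\to[0,\infty)$ and $k:[0,\infty)\to(0,\infty)$ be continuous and nondecreasing functions such that for all $u\ge0$ and $x,y\in\mathbb{R}$: - $|F(u,x)-F(u,y)|+|G(u,x)-G(u,y)|\le h(u)|x-y|$; - $|F(u,x)|+|G(u,x)|\le h(u)(1+|x|)$; - $|(GG_x)(u,x)-(GG_x)(u,y)|\le h(u)|x-y|$; - $|(GG_x)(u,x)|\le h(u)(1+|x|)$; - $|g(u,x)|\le k(u)(1+|x|)$ for each of the five functions $g$ given by $$F_u+F_xF+\tfrac12F_{xx}G^2,\qquad F_xG,\qquad G_u+G_xF+\tfrac12G^2G_{xx},$$ $$(G_xG)_u+(G_xG)_xF+\tfrac12(G_xG)_{xx}G^2,\qquad (G_xG)_xG.$$ Let $X$ be the solution of the SDE $$X_t=x_0+\int_0^tF(E_r,X_r)\,\mathrm{d}E_r+\int_0^tG(E_r,X_r)\,\mathrm{d}B_{E_r},\qquad t\in[0,T].$$ Assume that the Laplace exponent $\psi$ of $D$ is regularly varying at $\infty$ with index $\beta\in(0,1)$ and that one of the following conditions holds: (a) $h$ and $k$ are constant and $\beta\in(1/2,1)$; (b) $h$ and $k$ are continuous and nondecreasing, $h$ and $\log k$ are regularly varying at $\infty$ with indices $q\ge0$ and $\tilde q\ge0$, respectively, and $\beta\in\left(\frac{q_{**}-1}{q_{**}},1\right)$,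 where $q_{**}:=\max\{2q+2,\tilde q\}$. For $\delta\in(0,1)$ let $X^\delta=(X^\delta_t)_{t\in[0,T]}$ be the Milstein-type approximation process with step size $\delta$ and continuous interpolation defined in the context. Then there exists a constant $C>0$ not depending on $\delta$ such that for all $\delta\in(0,1)$, $$\mathbb{E}\Big[\sup_{0\le s\le T}|X_s-X^\delta_s|\Big]\le C\,\delta.$$ Thus, $X^\delta$ converges strongly to $X$ uniformly on $[0,T]$ with order $1$.
   Context: Setting. $(\Omega,\mathcal{F},\mathbb{P})$ is a complete probability space with a filtration $(\mathcal{F}_t)_{t\ge0}$ satisfying the usual conditions; $B$ is a one-dimensional $(\mathcal{F}_t)$-adapted Brownian motion, independent of an $(\mathcal{F}_t)$-adapted subordinator $D$ with $D_0=0$, killing rate $0$, drift $0$ and infinite Lévy measure $\nu$. Its Laplace exponent is $\psi(s)=\int_0^\infty(1-e^{-sy})\,\nu(\mathrm{d}y)$, so $\mathbb{E}[e^{-sD_t}]=e^{-t\psi(s)}$. The probability space is the product $(\Omega_B\times\Omega_D,\mathcal{F}_B\times\mathcal{F}_D,\mathbb{P}_B\times\mathbb{P}_D)$, with $B$ depending only on the first coordinate and $D$ only on the second. The inverse of $D$ is $E_t:=\inf\{u>0:D_u>t\}$, which has continuous nondecreasing paths; $B\circ E=(B_{E_t})$ is a continuous $(\mathcal{F}_{E_t})$-martingale, and SDEs are understood as driven by continuous $(\mathcal{F}_{E_t})$-semimartingales. Under the stated assumptions the SDE has a unique strong solution, which is continuous. A function $f:(0,\infty)\to(0,\infty)$ is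 regularly varying at $\infty$ with index $p\in\mathbb{R}$ if $\lim_{s\to\infty}f(cs)/f(s)=c^p$ for every $c>0$. Subscripts $u,x$ denote partial derivatives in the first and second variable; $C^{1,2}$ means $C^1$ in $u$ and $C^2$ in $x$. Approximation. Fix $\delta\in(0,1)$. Put $\tau_n:=D_{n\delta}$, $n=0,1,2,\dots$, and let $N$ be the random nonnegative integer with $T\in[D_{N\delta},D_{(N+1)\delta})$. Note $E_{\tau_n}=n\delta$ a.s. Set $X^\delta_0:=x_0$ and for $n=0,1,\dots,N-1$, $$X^\delta_{\tau_{n+1}}:=X^\delta_{\tau_n}+F(n\delta,X^\delta_{\tau_n})\delta+G(n\delta,X^\delta_{\tau_n})(B_{(n+1)\delta}-B_{n\delta})+\tfrac12(GG_x)(n\delta,X^\delta_{\tau_n})\big((B_{(n+1)\delta}-B_{n\delta})^2-\delta\big).$$ Continuous interpolation: for $s\in[\tau_n,\tau_{n+1})$, $$X^\delta_s:=X^\delta_{\tau_n}+\int_{\tau_n}^sF(E_{\tau_n},X^\delta_{\tau_n})\,\mathrm{d}E_r+\int_{\tau_n}^sG(E_{\tau_n},X^\delta_{\tau_n})\,\mathrm{d}B_{E_r}+\int_{\tau_n}^s\int_{\tau_n}^{r_2}(GG_x)(E_{\tau_n},X^\delta_{\tau_n})\,\mathrm{d}B_{E_{r_1}}\mathrm{d}B_{E_{r_2}}.$$ Strong convergence: $X^\delta$ converges strongly to $X$ uniformly on $[0,T]$ with order $\eta\in(0,\infty)$ if there exist finite positive constants $C,\delta_0$ such that $\mathbb{E}[\sup_{0\le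 t\le T}|X_t-X^\delta_t|]\le C\delta^\eta$ for all $\delta\in(0,\delta_0)$. *)

theory Defs
  imports "HOL-Probability.Probability"
begin

section \<open>Analytic notions\<close>

definition regularly_varying :: "(real \<Rightarrow> real) \<Rightarrow> real \<Rightarrow> bool" where
  "regularly_varying f p \<longleftrightarrow>
     (\<forall>s>0. f s > 0) \<and> (\<forall>c>0. ((\<lambda>s. f (c * s) / f s) \<longlongrightarrow> c powr p) at_top)"

text \<open>Coefficients live on \<open>[0,\<infinity>) \<times> \<real>\<close> and are represented by total functions of which only the
  values at \<open>u \<ge> 0\<close> are used; in particular the derivative in \<open>u\<close> at \<open>u = 0\<close> is one-sided.\<close>

definition partial_u :: "(real \<Rightarrow> real \<Rightarrow> real) \<Rightarrow> real \<Rightarrow> real \<Rightarrow> real" where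
  "partial_u f u x = vector_derivative (\<lambda>v. f v x) (at u within {0..})"

definition partial_x :: "(real \<Rightarrow> real \<Rightarrow> real) \<Rightarrow> real \<Rightarrow> real \<Rightarrow> real" where
  "partial_x f u x = deriv (f u) x"

definition jointly_continuous :: "(real \<Rightarrow> real \<Rightarrow> real) \<Rightarrow> bool" where
  "jointly_continuous f \<longleftrightarrow> continuous_on ({0..} \<times> UNIV) (\<lambda>(u, x). f u x)"

definition C12 :: "(real \<Rightarrow> real \<Rightarrow> real) \<Rightarrow> bool" where
  "C12 f \<longleftrightarrow>
     (\<forall>u\<ge>0. \<forall>x. (\<lambda>v. f v x) differentiable (at u within {0..})
        \<and> f u field_differentiable (at x)
        \<and> partial_x f u field_differentiable (at x)) \<and>
     jointly_continuous f \<and> jointly_continuous (partial_u f) \<and>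
     jointly_continuous (partial_x f) \<and> jointly_continuous (partial_x (partial_x f))"

definition G_Gx :: "(real \<Rightarrow> real \<Rightarrow> real) \<Rightarrow> real \<Rightarrow> real \<Rightarrow> real" where
  "G_Gx G u x = G u x * partial_x G u x"

section \<open>Brownian motion, subordinators and the setting\<close>

text \<open>Processes are functions of a real time parameter; only times \<open>t \<ge> 0\<close> (or \<open>0 \<le> t \<le> T\<close>) are
  meaningful.\<close>

definition generated_sets :: "'a measure \<Rightarrow> (real \<Rightarrow> 'a \<Rightarrow> real) \<Rightarrow> real set \<Rightarrow> 'a set set" where
  "generated_sets M Z I = sigma_sets (space M) (\<Union>t\<in>I. {Z t -` A \<inter> space M | A. A \<in> sets borel})"

definition adapted_process ::
    "(real \<Rightarrow> 'a measure) \<Rightarrow> real set \<Rightarrow> (real \<Rightarrow> 'a \<Rightarrow> real) \<Rightarrow> bool" where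
  "adapted_process \<F> I Z \<longleftrightarrow> (\<forall>t\<in>I. Z t \<in> borel_measurable (\<F> t))"

text \<open>The filtration is indexed by all of \<open>\<real>\<close> so that the library locale applies; a filtration given
  on \<open>[0,\<infinity>)\<close> is extended by \<open>\<F> t = \<F> 0\<close> for \<open>t < 0\<close>.\<close>

definition usual_conditions :: "'a measure \<Rightarrow> (real \<Rightarrow> 'a measure) \<Rightarrow> bool" where
  "usual_conditions M \<F> \<longleftrightarrow>
     filtration (space M) \<F> \<and>
     (\<forall>t. sets (\<F> t) \<subseteq> sets M \<and> null_sets M \<subseteq> sets (\<F> t)) \<and>
     (\<forall>t\<ge>0. sets (\<F> t) = (\<Inter>s\<in>{t<..}. sets (\<F> s)))"

text \<open>A Brownian motion with respect to \<open>\<F>\<close>: its increments are independent of the past of \<open>\<F>\<close>,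
  not only of its own past. This is what makes the time-changed process a martingale.\<close>

definition brownian_motion ::
    "'a measure \<Rightarrow> (real \<Rightarrow> 'a measure) \<Rightarrow> (real \<Rightarrow> 'a \<Rightarrow> real) \<Rightarrow> bool" where
  "brownian_motion M \<F> B \<longleftrightarrow>
     adapted_process \<F> {0..} B \<and>
     (AE \<omega> in M. B 0 \<omega> = 0) \<and>
     (AE \<omega> in M. continuous_on {0..} (\<lambda>t. B t \<omega>)) \<and>
     (\<forall>s\<ge>0. \<forall>t>s.
        distributed M lborel (\<lambda>\<omega>. B t \<omega> - B s \<omega>) (normal_density 0 (sqrt (t - s))) \<and>
        prob_space.indep_set M (sets (\<F> s))
          {(\<lambda>\<omega>. B t \<omega> - B s \<omega>) -` A \<inter> space M | A. A \<in> sets borel})"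

definition levy_measure :: "real measure \<Rightarrow> bool" where
  "levy_measure \<nu> \<longleftrightarrow>
     sets \<nu> = sets borel \<and> emeasure \<nu> {..0} = 0 \<and> (\<integral>\<^sup>+ y. ennreal (min 1 y) \<partial>\<nu>) < \<infinity>"

definition laplace_exponent :: "real measure \<Rightarrow> real \<Rightarrow> real" where
  "laplace_exponent \<nu> s = (LINT y:{0<..}|\<nu>. 1 - exp (- s * y))"

text \<open>Zero drift is expressed by the absence of a linear term in the exponent, zero killing rate by
  the paths being real-valued.\<close>

definition driftless_subordinator ::
    "'a measure \<Rightarrow> real measure \<Rightarrow> (real \<Rightarrow> 'a \<Rightarrow> real) \<Rightarrow> bool" where
  "driftless_subordinator M \<nu> D \<longleftrightarrow>
     levy_measure \<nu> \<and>
     (\<forall>t\<ge>0. D t \<in> borel_measurable M) \<and>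
     (AE \<omega> in M. D 0 \<omega> = 0) \<and>
     (AE \<omega> in M. mono_on {0..} (\<lambda>t. D t \<omega>) \<and> (\<forall>t\<ge>0. continuous (at_right t) (\<lambda>r. D r \<omega>))) \<and>
     (\<forall>s\<ge>0. \<forall>t>s.
        distr M borel (\<lambda>\<omega>. D t \<omega> - D s \<omega>) = distr M borel (D (t - s)) \<and>
        prob_space.indep_set M (generated_sets M D {0..s})
          {(\<lambda>\<omega>. D t \<omega> - D s \<omega>) -` A \<inter> space M | A. A \<in> sets borel}) \<and>
     (\<forall>s\<ge>0. \<forall>t\<ge>0. (LINT \<omega>|M. exp (- s * D t \<omega>)) = exp (- t * laplace_exponent \<nu> s))"

locale time_change_setting =
  fixes PB :: "'b measure" and PD :: "'d measure" and M :: "('b \<times> 'd) measure"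
    and \<F> :: "real \<Rightarrow> ('b \<times> 'd) measure"
    and B D :: "real \<Rightarrow> 'b \<times> 'd \<Rightarrow> real"
    and \<nu> :: "real measure"
  assumes prob_PB: "prob_space PB" and prob_PD: "prob_space PD"
    \<comment> \<open>the product space, made complete\<close>
    and M_eq: "M = completion (PB \<Otimes>\<^sub>M PD)"
    and usual: "usual_conditions M \<F>"
    and B_first: "\<exists>b. \<forall>t\<ge>0. b t \<in> borel_measurable PB \<and> (\<forall>\<omega>\<in>space M. B t \<omega> = b t (fst \<omega>))"
    and D_second: "\<exists>d. \<forall>t\<ge>0. d t \<in> borel_measurable PD \<and> (\<forall>\<omega>\<in>space M. D t \<omega> = d t (snd \<omega>))"
    and BM: "brownian_motion M \<F> B"
    and sub: "driftless_subordinator M \<nu> D"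
    and D_adapted: "adapted_process \<F> {0..} D"
    and infinite_levy: "emeasure \<nu> UNIV = \<infinity>"
    and indep: "prob_space.indep_set M (generated_sets M B {0..}) (generated_sets M D {0..})"

definition inverse_process :: "(real \<Rightarrow> 'a \<Rightarrow> real) \<Rightarrow> real \<Rightarrow> 'a \<Rightarrow> real" where
  "inverse_process D t \<omega> = Inf {u. u > 0 \<and> D u \<omega> > t}"

definition time_changed_filtration ::
    "'a measure \<Rightarrow> (real \<Rightarrow> 'a measure) \<Rightarrow> (real \<Rightarrow> 'a \<Rightarrow> real) \<Rightarrow> real \<Rightarrow> 'a measure" where
  "time_changed_filtration M \<F> D t = filtration.pre_sigma (space M) \<F> (inverse_process D t)"

definition time_changed_process ::
    "(real \<Rightarrow> 'a \<Rightarrow> real) \<Rightarrow> (real \<Rightarrow> 'a \<Rightarrow> real) \<Rightarrow> real \<Rightarrow> 'a \<Rightarrow> real" where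
  "time_changed_process B D t \<omega> = B (inverse_process D t \<omega>) \<omega>"

section \<open>Stochastic integration on a finite horizon\<close>

text \<open>Protter's definition: the integral of simple predictable processes is extended by continuity,
  with respect to uniform convergence in probability on \<open>[0,T]\<close>, to adapted left-continuous processes
  with right limits. Simple predictable processes jump at stopping times \<open>\<theta> i\<close>, and their value \<open>\<xi> i\<close>
  on the interval from \<open>\<theta> i\<close> to \<open>\<theta> (Suc i)\<close> is measurable with respect to the \<open>\<sigma>\<close>-algebra of
  events prior to \<open>\<theta> i\<close>.\<close>

definition simple_predictable ::
    "'a measure \<Rightarrow> (real \<Rightarrow> 'a measure) \<Rightarrow> real \<Rightarrow> nat \<Rightarrow> ('a \<Rightarrow> real) \<Rightarrow> (nat \<Rightarrow> 'a \<Rightarrow> real)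
      \<Rightarrow> (nat \<Rightarrow> 'a \<Rightarrow> real) \<Rightarrow> bool" where
  "simple_predictable M \<H> T n \<xi>0 \<theta> \<xi> \<longleftrightarrow>
     \<xi>0 \<in> borel_measurable (\<H> 0) \<and>
     (\<forall>i\<le>n. stopping_time \<H> (\<theta> i) \<and> (\<forall>\<omega>\<in>space M. 0 \<le> \<theta> i \<omega> \<and> \<theta> i \<omega> \<le> T)) \<and>
     (\<forall>i<n. \<forall>\<omega>\<in>space M. \<theta> i \<omega> \<le> \<theta> (Suc i) \<omega>) \<and>
     (\<forall>i<n. \<xi> i \<in> borel_measurable (filtration.pre_sigma (space M) \<H> (\<theta> i)))"

definition simple_process ::
    "nat \<Rightarrow> ('a \<Rightarrow> real) \<Rightarrow> (nat \<Rightarrow> 'a \<Rightarrow> real) \<Rightarrow> (nat \<Rightarrow> 'a \<Rightarrow> real) \<Rightarrow> real \<Rightarrow> 'a \<Rightarrow> real" where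
  "simple_process n \<xi>0 \<theta> \<xi> t \<omega> =
     \<xi>0 \<omega> * indicator {0} t + (\<Sum>i<n. \<xi> i \<omega> * indicator {\<theta> i \<omega><..\<theta> (Suc i) \<omega>} t)"

text \<open>Integral over \<open>(0,t]\<close>: the value of the integrand at time \<open>0\<close> does not contribute.\<close>

definition simple_integral ::
    "(real \<Rightarrow> 'a \<Rightarrow> real) \<Rightarrow> nat \<Rightarrow> (nat \<Rightarrow> 'a \<Rightarrow> real) \<Rightarrow> (nat \<Rightarrow> 'a \<Rightarrow> real) \<Rightarrow> real \<Rightarrow> 'a \<Rightarrow> real"
  where
  "simple_integral Z n \<theta> \<xi> t \<omega> =
     (\<Sum>i<n. \<xi> i \<omega> * (Z (min t (\<theta> (Suc i) \<omega>)) \<omega> - Z (min t (\<theta> i \<omega>)) \<omega>))"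

text \<open>The outer measure makes the notion robust when the supremum is not known to be measurable.\<close>

definition ucp_converges ::
    "'a measure \<Rightarrow> real \<Rightarrow> (nat \<Rightarrow> real \<Rightarrow> 'a \<Rightarrow> real) \<Rightarrow> (real \<Rightarrow> 'a \<Rightarrow> real) \<Rightarrow> bool" where
  "ucp_converges M T S H \<longleftrightarrow>
     (\<forall>\<epsilon>>0. (\<lambda>j. outer_measure_of M
        {\<omega> \<in> space M. \<exists>t\<in>{0..T}. \<bar>S j t \<omega> - H t \<omega>\<bar> > \<epsilon>}) \<longlonglongrightarrow> 0)"

definition left_cont_right_lim :: "real \<Rightarrow> (real \<Rightarrow> real) \<Rightarrow> bool" where
  "left_cont_right_lim T z \<longleftrightarrow>
     (\<forall>t\<in>{0<..T}. (z \<longlongrightarrow> z t) (at_left t)) \<and> (\<forall>t\<in>{0..<T}. \<exists>l. (z \<longlongrightarrow> l) (at_right t))"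

text \<open>\<open>Y\<close> is (a version of) the stochastic integral process of \<open>H\<close> with respect to the continuous
  semimartingale \<open>Z\<close> of the filtration \<open>\<H>\<close> on \<open>[0,T]\<close>. Simple predictable processes are dense among
  the admissible integrands, so \<open>Y\<close> is determined up to indistinguishability.\<close>

definition stochastic_integral ::
    "'a measure \<Rightarrow> (real \<Rightarrow> 'a measure) \<Rightarrow> real \<Rightarrow> (real \<Rightarrow> 'a \<Rightarrow> real) \<Rightarrow> (real \<Rightarrow> 'a \<Rightarrow> real)
      \<Rightarrow> (real \<Rightarrow> 'a \<Rightarrow> real) \<Rightarrow> bool" where
  "stochastic_integral M \<H> T Z H Y \<longleftrightarrow>
     adapted_process \<H> {0..T} H \<and> (AE \<omega> in M. left_cont_right_lim T (\<lambda>t. H t \<omega>)) \<and>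
     adapted_process \<H> {0..T} Y \<and> (AE \<omega> in M. continuous_on {0..T} (\<lambda>t. Y t \<omega>)) \<and>
     (\<forall>n \<xi>0 \<theta> \<xi>.
        (\<forall>j. simple_predictable M \<H> T (n j) (\<xi>0 j) (\<theta> j) (\<xi> j)) \<longrightarrow>
        ucp_converges M T (\<lambda>j. simple_process (n j) (\<xi>0 j) (\<theta> j) (\<xi> j)) H \<longrightarrow>
        ucp_converges M T (\<lambda>j. simple_integral Z (n j) (\<theta> j) (\<xi> j)) Y)"

text \<open>Pathwise Lebesgue--Stieltjes integral \<open>\<integral>\<^sub>a\<^sup>b f(r) dA(r)\<close> over \<open>(a,b]\<close>.\<close>

definition stieltjes_integral ::
    "(real \<Rightarrow> real) \<Rightarrow> real \<Rightarrow> real \<Rightarrow> (real \<Rightarrow> real) \<Rightarrow> real" where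
  "stieltjes_integral A a b f = (LINT r:{a<..b}|interval_measure A. f r)"

section \<open>The equation and its Milstein-type approximation\<close>

definition sde_solution ::
    "'a measure \<Rightarrow> (real \<Rightarrow> 'a measure) \<Rightarrow> (real \<Rightarrow> 'a \<Rightarrow> real) \<Rightarrow> (real \<Rightarrow> 'a \<Rightarrow> real) \<Rightarrow> real \<Rightarrow> real
      \<Rightarrow> (real \<Rightarrow> real \<Rightarrow> real) \<Rightarrow> (real \<Rightarrow> real \<Rightarrow> real) \<Rightarrow> (real \<Rightarrow> 'a \<Rightarrow> real) \<Rightarrow> bool" where
  "sde_solution M \<F> B D T x0 F G X \<longleftrightarrow>
     (let \<H> = time_changed_filtration M \<F> D; E = inverse_process D in
      adapted_process \<H> {0..T} X \<and>
      (AE \<omega> in M. continuous_on {0..T} (\<lambda>t. X t \<omega>)) \<and>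
      (\<exists>Y. stochastic_integral M \<H> T (time_changed_process B D) (\<lambda>r \<omega>. G (E r \<omega>) (X r \<omega>)) Y \<and>
        (AE \<omega> in M. \<forall>t\<in>{0..T}.
           X t \<omega> = x0
             + stieltjes_integral (\<lambda>r. E r \<omega>) 0 t (\<lambda>r. F (E r \<omega>) (X r \<omega>))
             + Y t \<omega>)))"

text \<open>Values at the grid times \<open>\<tau>\<^sub>n = D\<^sub>n\<^sub>\<delta>\<close>. The recursion is run for all \<open>n\<close>; only the indices up
  to \<open>N\<close>, i.e. those with \<open>\<tau>\<^sub>n \<le> T\<close>, enter the approximation on \<open>[0,T]\<close>.\<close>

primrec milstein_grid ::
    "(real \<Rightarrow> 'a \<Rightarrow> real) \<Rightarrow> real \<Rightarrow> (real \<Rightarrow> real \<Rightarrow> real) \<Rightarrow> (real \<Rightarrow> real \<Rightarrow> real) \<Rightarrow> real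
      \<Rightarrow> nat \<Rightarrow> 'a \<Rightarrow> real" where
  "milstein_grid B x0 F G \<delta> 0 \<omega> = x0"
| "milstein_grid B x0 F G \<delta> (Suc n) \<omega> =
     (let y = milstein_grid B x0 F G \<delta> n \<omega>;
          u = real n * \<delta>;
          \<Delta> = B (real (Suc n) * \<delta>) \<omega> - B (real n * \<delta>) \<omega>
      in y + F u y * \<delta> + G u y * \<Delta> + 1 / 2 * G_Gx G u y * (\<Delta>\<^sup>2 - \<delta>))"

text \<open>For \<open>s\<close> in \<open>[\<tau>\<^sub>n, \<tau>\<^sub>n\<^sub>+\<^sub>1)\<close>, an integral from \<open>\<tau>\<^sub>n\<close> to \<open>s\<close> with respect to the time-changed
  Brownian motion is the value at \<open>s\<close> of the integral process of the integrand multiplied by the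
  indicator of \<open>(\<tau>\<^sub>n, \<infinity>)\<close>. \<open>I\<close> is the single integral, \<open>K\<close> the inner and \<open>J\<close> the outer iterated
  integral.\<close>

definition milstein_approximation ::
    "'a measure \<Rightarrow> (real \<Rightarrow> 'a measure) \<Rightarrow> (real \<Rightarrow> 'a \<Rightarrow> real) \<Rightarrow> (real \<Rightarrow> 'a \<Rightarrow> real) \<Rightarrow> real \<Rightarrow> real
      \<Rightarrow> (real \<Rightarrow> real \<Rightarrow> real) \<Rightarrow> (real \<Rightarrow> real \<Rightarrow> real) \<Rightarrow> real \<Rightarrow> (real \<Rightarrow> 'a \<Rightarrow> real) \<Rightarrow> bool" where
  "milstein_approximation M \<F> B D T x0 F G \<delta> X\<delta> \<longleftrightarrow>
     (let \<H> = time_changed_filtration M \<F> D; E = inverse_process D; W = time_changed_process B D;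
          \<tau> = (\<lambda>n \<omega>. D (real n * \<delta>) \<omega>);
          y = milstein_grid B x0 F G \<delta>
      in \<forall>n. \<exists>I K J.
        stochastic_integral M \<H> T W
          (\<lambda>r \<omega>. indicator {\<tau> n \<omega><..} r * G (E (\<tau> n \<omega>) \<omega>) (y n \<omega>)) I \<and>
        stochastic_integral M \<H> T W
          (\<lambda>r \<omega>. indicator {\<tau> n \<omega><..} r * G_Gx G (E (\<tau> n \<omega>) \<omega>) (y n \<omega>)) K \<and>
        stochastic_integral M \<H> T W
          (\<lambda>r \<omega>. indicator {\<tau> n \<omega><..} r * K r \<omega>) J \<and>
        (AE \<omega> in M. \<forall>s\<in>{0..T} \<inter> {\<tau> n \<omega>..<\<tau> (Suc n) \<omega>}.
           X\<delta> s \<omega> = y n \<omega>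
             + stieltjes_integral (\<lambda>r. E r \<omega>) (\<tau> n \<omega>) s (\<lambda>r. F (E (\<tau> n \<omega>) \<omega>) (y n \<omega>))
             + I s \<omega> + J s \<omega>))"

definition mean_sup_error ::
    "'a measure \<Rightarrow> real \<Rightarrow> (real \<Rightarrow> 'a \<Rightarrow> real) \<Rightarrow> (real \<Rightarrow> 'a \<Rightarrow> real) \<Rightarrow> ennreal" where
  "mean_sup_error M T X Y = (\<integral>\<^sup>+ \<omega>. (SUP t\<in>{0..T}. ennreal \<bar>X t \<omega> - Y t \<omega>\<bar>) \<partial>M)"

definition strongly_converges_with_order ::
    "'a measure \<Rightarrow> real \<Rightarrow> (real \<Rightarrow> real \<Rightarrow> 'a \<Rightarrow> real) \<Rightarrow> (real \<Rightarrow> 'a \<Rightarrow> real) \<Rightarrow> real \<Rightarrow> bool" where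
  "strongly_converges_with_order M T Xd X \<eta> \<longleftrightarrow>
     \<eta> > 0 \<and>
     (\<exists>C \<delta>0. C > 0 \<and> \<delta>0 > 0 \<and>
        (\<forall>\<delta>\<in>{0<..<\<delta>0}. mean_sup_error M T X (Xd \<delta>) \<le> ennreal (C * \<delta> powr \<eta>)))"

end

theory Submission
  imports Defs "HOL-Real_Asymp.Real_Asymp"
begin

text \<open>In the inner time \<open>u = E\<^sub>t\<close> the equation becomes a classical one: \<open>X\<^sub>t = Y (E\<^sub>t)\<close> with \<open>Y\<^sub>u = X\<^bsub>min T (D u)\<^esub>\<close>, and the
  approximation becomes the classical Milstein scheme with step \<open>\<delta>\<close> driven by \<open>B\<close>. No stochastic
  integral in inner time is needed: the definition of the integral by approximation shows that \<open>Y\<close>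
  is, uniformly and almost surely along a subsequence, the limit of Riemann sums over grids of step
  \<open>\<delta> / L\<close>. On such a grid both schemes are driven by independent Gaussian increments, and a discrete
  Ito expansion of \<open>F\<close>, \<open>G\<close> and \<open>G G\<^sub>x\<close>, Doob's maximal inequality and Gronwall's lemma bound the mean square of the
  maximal error by \<open>C\<^sub>m \<delta>\<^sup>2\<close> up to inner time \<open>m + 1\<close>, uniformly in \<open>L\<close>. The limit \<open>L \<rightarrow> \<infinity>\<close> is taken with Fatou's lemma.

  Finally one sums over the events \<open>m < E\<^sub>T \<le> m + 1\<close>. Here \<open>ln C\<^sub>m\<close> grows at most like \<open>m\<^sup>\<rho>\<close>, where \<open>\<rho>\<close> can be chosen
  below \<open>1 / (1 - \<beta>)\<close> by the condition on \<open>\<beta>\<close>, whereas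
  \<open>P (E\<^sub>T > m) \<le> P (D\<^sub>m \<le> T) \<le> exp (a T - m \<psi>(a))\<close>, optimised in \<open>a\<close>, decays like \<open>exp (- c m\<^sup>r)\<close> for every
  \<open>r < 1 / (1 - \<beta>)\<close>.\<close>

section \<open>Second moments\<close>

text \<open>In inner time the exact solution is known only as an almost sure limit of sums, along a
  subsequence and without rate or moment bound. The discretised solution is therefore stopped when
  the clock passes \<open>E T\<close>, when \<open>Y\<close> leaves [-R, R], or when the sums differ
  from \<open>Y\<close> by more than \<kappa>. These events are known at the grid point where they
  occur, so the martingale structure survives, and the constants depend on neither R nor \<kappa>.

  Order one has two sources. Along the solution G has diffusion coefficient G G_x, so the Milstein
  correction cancels the part of the error in G of order sqrt \<delta>. For F that part survives,
  but it is integrated in time, and summation by parts over the blocks gains the missing half order.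

  The condition on \<beta> balances two exponents. Gronwall's lemma gives the exponent T^2 H^2, one
  factor T from Cauchy-Schwarz on the drift and one from the length of the interval; with h of index
  q this is m^(2q+2). The bound k enters as a square, hence through log k. So \<rho> lies above max
  (2q+2, q'), and \<rho> < 1/(1-\<beta>) means \<beta> > (\<rho>-1)/\<rho>.\<close>

definition second_moment :: "'a measure \<Rightarrow> ('a \<Rightarrow> real) \<Rightarrow> ennreal" where
  "second_moment M f = (\<integral>\<^sup>+ z. ennreal ((f z)\<^sup>2) \<partial>M)"

lemma second_moment_mono:
  assumes "\<And>z. z \<in> space M \<Longrightarrow> \<bar>f z\<bar> \<le> \<bar>g z\<bar>"
  shows "second_moment M f \<le> second_moment M g"
  unfolding second_moment_def
  by (intro nn_integral_mono ennreal_leI) (use assms abs_le_square_iff in blast)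

lemma second_moment_cmult:
  assumes [measurable]: "f \<in> borel_measurable M"
  shows "second_moment M (\<lambda>z. c * f z) = ennreal (c\<^sup>2) * second_moment M f"
  unfolding second_moment_def power_mult_distrib
  by (simp add: ennreal_mult nn_integral_cmult)

lemma sum_sq_le_card:
  fixes f :: "'i \<Rightarrow> real"
  shows "(\<Sum>i\<in>A. f i)\<^sup>2 \<le> real (card A) * (\<Sum>i\<in>A. (f i)\<^sup>2)"
  using Cauchy_Schwarz_ineq_sum[of f "\<lambda>_. 1" A] by (simp add: mult.commute)

lemma second_moment_sum_bound:
  assumes f: "\<And>i. i \<in> A \<Longrightarrow> f i \<in> borel_measurable M"
    and le: "\<And>z. z \<in> space M \<Longrightarrow> \<bar>g z\<bar> \<le> (\<Sum>i\<in>A. \<bar>f i z\<bar>)"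
  shows "second_moment M g \<le> ennreal (real (card A)) * (\<Sum>i\<in>A. second_moment M (f i))"
proof -
  have "(g z)\<^sup>2 \<le> real (card A) * (\<Sum>i\<in>A. (f i z)\<^sup>2)" if "z \<in> space M" for z
  proof -
    have "(g z)\<^sup>2 = \<bar>g z\<bar>\<^sup>2" by simp
    also have "\<dots> \<le> (\<Sum>i\<in>A. \<bar>f i z\<bar>)\<^sup>2"
      by (intro power_mono le that) auto
    also have "\<dots> \<le> real (card A) * (\<Sum>i\<in>A. \<bar>f i z\<bar>\<^sup>2)" by (rule sum_sq_le_card)
    finally show ?thesis by simp
  qed
  then have "second_moment M g \<le> (\<integral>\<^sup>+ z. ennreal (real (card A) * (\<Sum>i\<in>A. (f i z)\<^sup>2)) \<partial>M)"
    unfolding second_moment_def by (intro nn_integral_mono ennreal_leI)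
  also have "\<dots> = (\<integral>\<^sup>+ z. ennreal (real (card A)) * (\<Sum>i\<in>A. ennreal ((f i z)\<^sup>2)) \<partial>M)"
    by (intro nn_integral_cong) (simp add: ennreal_mult sum_nonneg)
  also have "\<dots> = ennreal (real (card A)) * (\<Sum>i\<in>A. second_moment M (f i))"
    unfolding second_moment_def using f
    by (subst nn_integral_cmult) (auto simp: nn_integral_sum simp del: sum_ennreal)
  finally show ?thesis .
qed

lemma second_moment_finite_iff:
  assumes [measurable]: "f \<in> borel_measurable M"
  shows "second_moment M f < \<infinity> \<longleftrightarrow> integrable M (\<lambda>z. (f z)\<^sup>2)"
  unfolding second_moment_def integrable_iff_bounded by simp

lemma integrable_of_squares:
  fixes f g :: "'a \<Rightarrow> real"
  assumes [measurable]: "f \<in> borel_measurable M" "g \<in> borel_measurable M"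
    and int: "integrable M (\<lambda>z. (f z)\<^sup>2)" "integrable M (\<lambda>z. (g z)\<^sup>2)"
  shows "integrable M (\<lambda>z. f z * g z)"
proof (rule Bochner_Integration.integrable_bound[OF Bochner_Integration.integrable_add[OF int]])
  show "AE z in M. norm (f z * g z) \<le> norm ((f z)\<^sup>2 + (g z)\<^sup>2)"
  proof (rule AE_I2)
    fix z
    have "2 * \<bar>f z\<bar> * \<bar>g z\<bar> \<le> (f z)\<^sup>2 + (g z)\<^sup>2"
      using sum_squares_bound[of "\<bar>f z\<bar>" "\<bar>g z\<bar>"] by simp
    moreover have "0 \<le> \<bar>f z\<bar> * \<bar>g z\<bar>" by simp
    ultimately show "norm (f z * g z) \<le> norm ((f z)\<^sup>2 + (g z)\<^sup>2)"
      unfolding real_norm_def abs_mult by linarith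
  qed
qed simp

lemma integrable_square_add:
  fixes f g :: "'a \<Rightarrow> real"
  assumes [measurable]: "f \<in> borel_measurable M" "g \<in> borel_measurable M"
    and int: "integrable M (\<lambda>z. (f z)\<^sup>2)" "integrable M (\<lambda>z. (g z)\<^sup>2)"
  shows "integrable M (\<lambda>z. (f z + g z)\<^sup>2)"
  unfolding power2_sum using integrable_of_squares[OF assms] int by (auto simp: mult.assoc)

section \<open>A pathwise form of Doob's maximal inequality\<close>

definition running_max :: "(nat \<Rightarrow> real) \<Rightarrow> nat \<Rightarrow> real" where
  "running_max x n = Max ((\<lambda>i. \<bar>x i\<bar>) ` {..n})"

lemma running_max_0: "running_max x 0 = \<bar>x 0\<bar>"
  by (simp add: running_max_def)

lemma running_max_Suc: "running_max x (Suc n) = max (running_max x n) \<bar>x (Suc n)\<bar>"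
proof -
  have "{..Suc n} = insert (Suc n) {..n}" by auto
  then show ?thesis unfolding running_max_def
    by (simp add: max.commute)
qed

lemma running_max_ge: "i \<le> n \<Longrightarrow> \<bar>x i\<bar> \<le> running_max x n"
  unfolding running_max_def by (intro Max_ge) auto

lemma running_max_nonneg: "0 \<le> running_max x n"
  using running_max_ge[of 0 n x] by linarith

lemma running_max_leI: "(\<And>i. i \<le> n \<Longrightarrow> \<bar>x i\<bar> \<le> c) \<Longrightarrow> running_max x n \<le> c"
  unfolding running_max_def by (subst Max_le_iff) auto

lemma measurable_running_max [measurable (raw)]:
  assumes "\<And>i. i \<le> n \<Longrightarrow> f i \<in> borel_measurable M"
  shows "(\<lambda>z. running_max (\<lambda>i. f i z) n) \<in> borel_measurable M"
  using assms
proof (induction n)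
  case 0
  then show ?case by (auto simp: running_max_0)
next
  case (Suc n)
  then have [measurable]: "(\<lambda>z. running_max (\<lambda>i. f i z) n) \<in> borel_measurable M" "f (Suc n) \<in> borel_measurable M"
    by auto
  show ?case unfolding running_max_Suc by measurable
qed

text \<open>Summation by parts of the running maximum against |x|. For a martingale the subtracted
  sum is a martingale transform of mean zero, so integration yields Doob's inequality with its
  constant 4, without any stopping argument.\<close>

lemma running_max_sq_bound:
  assumes x0: "x 0 = 0"
  shows "(running_max x n)\<^sup>2
    \<le> 4 * (x n)\<^sup>2 - 4 * (\<Sum>k<n. running_max x k * sgn (x k) * (x (Suc k) - x k))"
proof -
  let ?S = "running_max x"
  have "(?S n)\<^sup>2 / 2 + (\<Sum>k<n. ?S k * (\<bar>x (Suc k)\<bar> - \<bar>x k\<bar>)) \<le> ?S n * \<bar>x n\<bar>"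
  proof (induction n)
    case 0
    then show ?case using x0 by (simp add: running_max_0)
  next
    case (Suc n)
    \<comment> \<open>The maximum moves only when it equals the new |x|, so the growth of its square
      is paid for by the boundary term.\<close>
    have "(?S (Suc n))\<^sup>2 / 2 - (?S n)\<^sup>2 / 2 \<le> (?S (Suc n) - ?S n) * \<bar>x (Suc n)\<bar>"
    proof (cases "\<bar>x (Suc n)\<bar> \<le> ?S n")
      case True
      then show ?thesis by (simp add: running_max_Suc)
    next
      case False
      then have eq: "?S (Suc n) = \<bar>x (Suc n)\<bar>" by (simp add: running_max_Suc)
      have "0 \<le> (\<bar>x (Suc n)\<bar> - ?S n)\<^sup>2" by simp
      then show ?thesis unfolding eq by (simp add: power2_eq_square field_simps)
    qed
    with Suc show ?case by (simp add: algebra_simps)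
  qed
  moreover have "(\<Sum>k<n. ?S k * sgn (x k) * (x (Suc k) - x k)) \<le> (\<Sum>k<n. ?S k * (\<bar>x (Suc k)\<bar> - \<bar>x k\<bar>))"
  proof (intro sum_mono)
    fix k
    \<comment> \<open>\<open>sgn (x k)\<close> is a subgradient of the absolute value at
      \<open>x k\<close>.\<close>
    have "sgn (x k) * (x (Suc k) - x k) \<le> \<bar>x (Suc k)\<bar> - \<bar>x k\<bar>"
      by (cases "x k" "0::real" rule: linorder_cases) auto
    then show "?S k * sgn (x k) * (x (Suc k) - x k) \<le> ?S k * (\<bar>x (Suc k)\<bar> - \<bar>x k\<bar>)"
      using running_max_nonneg[of x k] by (simp add: mult.assoc mult_left_mono)
  qed
  \<comment> \<open>Young's inequality leaves a quarter of the squared maximum on the left, whence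
    the factor 4.\<close>
  moreover have "?S n * \<bar>x n\<bar> \<le> (?S n)\<^sup>2 / 4 + (x n)\<^sup>2"
  proof -
    have "0 \<le> (?S n / 2 - \<bar>x n\<bar>)\<^sup>2" by simp
    then show ?thesis by (simp add: power2_eq_square field_simps)
  qed
  ultimately show ?thesis by simp
qed

section \<open>Gaussian increments on a grid\<close>

text \<open>\<open>\<G> j\<close> is the information at grid point j, before the increment
  \<open>w j\<close>. Independence of the whole \<sigma>-algebra is required because the weights of
  the transforms depend on the subordinator as well as on earlier increments.\<close>

locale gaussian_increments = prob_space M for M :: "'a measure" +
  fixes \<G> :: "nat \<Rightarrow> 'a measure" and w :: "nat \<Rightarrow> 'a \<Rightarrow> real" and \<epsilon> :: real
  assumes eps_pos: "\<epsilon> > 0"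
    and space_G: "\<And>j. space (\<G> j) = space M"
    and sets_G_Suc: "\<And>j. sets (\<G> j) \<subseteq> sets (\<G> (Suc j))"
    and sets_G: "\<And>j. sets (\<G> j) \<subseteq> sets M"
    and w_adapted: "\<And>j. w j \<in> borel_measurable (\<G> (Suc j))"
    and w_normal: "\<And>j. distributed M lborel (w j) (normal_density 0 (sqrt \<epsilon>))"
    and w_indep: "\<And>j. indep_set (sets (\<G> j)) {w j -` A \<inter> space M | A. A \<in> sets borel}"
begin

lemma sets_G_mono: "i \<le> j \<Longrightarrow> sets (\<G> i) \<subseteq> sets (\<G> j)"
  by (rule lift_Suc_mono_le[of "\<lambda>j. sets (\<G> j)"]) (use sets_G_Suc in auto)

lemma measurable_G_mono: "i \<le> j \<Longrightarrow> f \<in> measurable (\<G> i) N \<Longrightarrow> f \<in> measurable (\<G> j) N"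
  using sets_G_mono[of i j] by (auto simp: measurable_def space_G)

lemma measurable_G: "f \<in> measurable (\<G> i) N \<Longrightarrow> f \<in> measurable M N"
  using sets_G[of i] by (auto simp: measurable_def space_G)

lemma w_measurable [measurable]: "w j \<in> borel_measurable M"
  using w_adapted measurable_G by blast

lemma indep_var_w:
  assumes f: "f \<in> borel_measurable (\<G> j)"
  shows "indep_var borel f borel (w j)"
proof -
  have "indep_set {f -` A \<inter> space M | A. A \<in> sets borel} {w j -` A \<inter> space M | A. A \<in> sets borel}"
  proof -
    have "{f -` A \<inter> space M | A. A \<in> sets borel} \<subseteq> sets (\<G> j)"
      using measurable_sets[OF f] space_G by auto
    then show ?thesis
      using w_indep[of j] unfolding indep_sets2_eq by blast
  qed
  moreover have "Int_stable {g -` A \<inter> space M | A. A \<in> sets borel}" for g :: "'a \<Rightarrow> 'd::topological_space"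
  proof (rule Int_stableI)
    fix a b assume "a \<in> {g -` A \<inter> space M | A. A \<in> sets borel}" "b \<in> {g -` A \<inter> space M | A. A \<in> sets borel}"
    then obtain A B where "A \<in> sets borel" "B \<in> sets borel" "a = g -` A \<inter> space M" "b = g -` B \<inter> space M"
      by blast
    then have "a \<inter> b = g -` (A \<inter> B) \<inter> space M" "A \<inter> B \<in> sets borel" by auto
    then show "a \<inter> b \<in> {g -` A \<inter> space M | A. A \<in> sets borel}" by blast
  qed
  ultimately show ?thesis
    unfolding indep_var_eq
    by (intro conjI measurable_G[OF f] w_measurable indep_set_sigma_sets)
qed

text \<open>Nonnegative integrals allow its use before the product is known to be square
  integrable.\<close>

lemma nn_integral_indep_w:
  assumes [measurable]: "f \<in> borel_measurable (\<G> j)" "\<phi> \<in> borel_measurable borel"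
  shows "second_moment M (\<lambda>z. f z * \<phi> (w j z)) = second_moment M f * second_moment M (\<lambda>z. \<phi> (w j z))"
proof -
  have iv: "indep_var borel ((\<lambda>x. ennreal (x\<^sup>2)) \<circ> f) borel ((\<lambda>x. ennreal ((\<phi> x)\<^sup>2)) \<circ> w j)"
    by (rule indep_var_compose[OF indep_var_w]) auto
  have cb: "(\<lambda>_. borel) = case_bool borel borel"
    by (auto simp: fun_eq_iff split: bool.split)
  have "second_moment M (\<lambda>z. f z * \<phi> (w j z)) = (\<integral>\<^sup>+z. (\<Prod>i\<in>UNIV. case_bool ((\<lambda>x. ennreal (x\<^sup>2)) \<circ> f) ((\<lambda>x. ennreal ((\<phi> x)\<^sup>2)) \<circ> w j) i z) \<partial>M)"
    unfolding second_moment_def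
    by (intro nn_integral_cong) (simp add: UNIV_bool power_mult_distrib ennreal_mult mult.commute)
  also have "(\<integral>\<^sup>+z. (\<Prod>i\<in>UNIV. case_bool ((\<lambda>x. ennreal (x\<^sup>2)) \<circ> f) ((\<lambda>x. ennreal ((\<phi> x)\<^sup>2)) \<circ> w j) i z) \<partial>M)
    = (\<Prod>i\<in>UNIV. \<integral>\<^sup>+z. case_bool ((\<lambda>x. ennreal (x\<^sup>2)) \<circ> f) ((\<lambda>x. ennreal ((\<phi> x)\<^sup>2)) \<circ> w j) i z \<partial>M)"
    using iv[unfolded indep_var_def cb[symmetric]] by (intro indep_vars_nn_integral) auto
  also have "\<dots> = second_moment M f * second_moment M (\<lambda>z. \<phi> (w j z))"
    by (simp add: UNIV_bool second_moment_def comp_def mult.commute)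
  finally show ?thesis .
qed

lemma integral_indep_w:
  fixes f :: "'a \<Rightarrow> real" and \<phi> :: "real \<Rightarrow> real"
  assumes f: "f \<in> borel_measurable (\<G> j)" and \<phi>: "\<phi> \<in> borel_measurable borel"
    and int: "integrable M f" "integrable M (\<lambda>z. \<phi> (w j z))"
    and zero: "(\<integral>z. \<phi> (w j z) \<partial>M) = 0"
  shows "(\<integral>z. f z * \<phi> (w j z) \<partial>M) = 0"
proof -
  have "indep_var borel (id \<circ> f) borel (\<phi> \<circ> w j)"
    by (rule indep_var_compose[OF indep_var_w[OF f]]) (use \<phi> in auto)
  then have "(\<integral>z. (id \<circ> f) z * (\<phi> \<circ> w j) z \<partial>M) = (\<integral>z. (id \<circ> f) z \<partial>M) * (\<integral>z. (\<phi> \<circ> w j) z \<partial>M)"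
    by (rule indep_var_lebesgue_integral) (use int in \<open>auto simp: comp_def\<close>)
  then show ?thesis using zero by (simp add: comp_def)
qed

text \<open>A martingale transform: \<open>f j\<close> is known before the increment \<open>w j\<close>, and \<open>\<phi>\<close> is centred.\<close>

lemma doob_second_moment:
  assumes f: "\<And>j. j < n \<Longrightarrow> f j \<in> borel_measurable (\<G> j)"
    and \<phi>[measurable]: "\<phi> \<in> borel_measurable borel"
    and \<phi>int: "\<And>j. integrable M (\<lambda>z. \<phi> (w j z))"
    and zero: "\<And>j. (\<integral>z. \<phi> (w j z) \<partial>M) = 0"
    and s: "s > 0" "\<And>j. second_moment M (\<lambda>z. \<phi> (w j z)) = ennreal s"
  shows "second_moment M (\<lambda>z. running_max (\<lambda>l. \<Sum>j<l. f j z * \<phi> (w j z)) n)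
    \<le> 4 * ennreal s * (\<Sum>j<n. second_moment M (f j))"
\<comment> \<open>An infinite second moment makes the right-hand side infinite, because
  \<open>s > 0\<close>; otherwise every \<open>f j\<close> is square integrable.\<close>
proof (cases "\<exists>j<n. second_moment M (f j) = \<infinity>")
  case True
  then obtain j where "j < n" "second_moment M (f j) = \<infinity>" by blast
  moreover from this have "second_moment M (f j) \<le> (\<Sum>j<n. second_moment M (f j))"
    by (intro member_le_sum) auto
  ultimately have S: "(\<Sum>j<n. second_moment M (f j)) = \<infinity>"
    by (simp add: top_unique)
  have T: "4 * ennreal s * \<infinity> = \<infinity>"
    using s(1) by (simp add: ennreal_mult_top)
  show ?thesis unfolding S T by simp
next
  case False
  define X where "X l z = (\<Sum>j<l. f j z * \<phi> (w j z))" for l z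
  have fM[measurable]: "f j \<in> borel_measurable M" if "j < n" for j
    using measurable_G f that by blast
  have fsq: "integrable M (\<lambda>z. (f j z)\<^sup>2)" if "j < n" for j
    using False that second_moment_finite_iff[OF fM[OF that]] by (auto simp: less_top)
  have dsq: "integrable M (\<lambda>z. (f j z * \<phi> (w j z))\<^sup>2)" if "j < n" for j
  proof -
    have [measurable]: "f j \<in> borel_measurable M" using fM that .
    have "second_moment M (\<lambda>z. f j z * \<phi> (w j z)) < \<infinity>"
      using False that s nn_integral_indep_w[OF f[OF that] \<phi>]
      by (simp add: ennreal_mult_eq_top_iff less_top[symmetric])
    then show ?thesis by (subst (asm) second_moment_finite_iff) measurable
  qed
  have Xad: "X l \<in> borel_measurable (\<G> l)" if "l \<le> n" for l
  proof -
    have "(\<lambda>z. f j z * \<phi> (w j z)) \<in> borel_measurable (\<G> l)" if "j < l" for j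
    proof -
      have [measurable]: "f j \<in> borel_measurable (\<G> l)"
        using measurable_G_mono[OF less_imp_le[OF that] f] \<open>j < l\<close> \<open>l \<le> n\<close> by auto
      have [measurable]: "w j \<in> borel_measurable (\<G> l)"
        using measurable_G_mono[OF Suc_leI[OF that] w_adapted] .
      show ?thesis by measurable
    qed
    then show ?thesis unfolding X_def by (intro borel_measurable_sum) auto
  qed
  have XM: "X l \<in> borel_measurable M" if "l \<le> n" for l
    using measurable_G Xad that by blast
  have dM: "(\<lambda>z. f j z * \<phi> (w j z)) \<in> borel_measurable M" if "j < n" for j
  proof -
    have [measurable]: "f j \<in> borel_measurable M" using fM that .
    show ?thesis by measurable
  qed
  have Xsq: "integrable M (\<lambda>z. (X l z)\<^sup>2)" if "l \<le> n" for l
    using that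
  proof (induction l)
    case 0
    then show ?case by (simp add: X_def)
  next
    case (Suc l)
    have "integrable M (\<lambda>z. (X l z + f l z * \<phi> (w l z))\<^sup>2)"
      using Suc by (intro integrable_square_add XM dM dsq) auto
    then show ?case by (simp add: X_def)
  qed
  have transform: "integrable M (\<lambda>z. H z * (f k z * \<phi> (w k z)))"
      "(\<integral>z. H z * (f k z * \<phi> (w k z)) \<partial>M) = 0"
    if k: "k < n" and H: "H \<in> borel_measurable (\<G> k)" "integrable M (\<lambda>z. (H z)\<^sup>2)" for k H
  proof -
    show "integrable M (\<lambda>z. H z * (f k z * \<phi> (w k z)))"
      using measurable_G[OF H(1)] dM[OF k] H(2) dsq[OF k] by (rule integrable_of_squares)
    have "integrable M (\<lambda>z. H z * f k z)"
      using measurable_G[OF H(1)] fM[OF k] H(2) fsq[OF k] by (rule integrable_of_squares)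
    moreover have "(\<lambda>z. H z * f k z) \<in> borel_measurable (\<G> k)"
      using H(1) f[OF k] by measurable
    ultimately have "(\<integral>z. (H z * f k z) * \<phi> (w k z) \<partial>M) = 0"
      by (intro integral_indep_w \<phi> \<phi>int zero)
    then show "(\<integral>z. H z * (f k z * \<phi> (w k z)) \<partial>M) = 0" by (simp add: mult.assoc)
  qed
  \<comment> \<open>Ito isometry: the cross terms vanish by \<open>transform\<close>.\<close>
  have EX: "(\<integral>z. (X l z)\<^sup>2 \<partial>M) = s * (\<Sum>j<l. \<integral>z. (f j z)\<^sup>2 \<partial>M)" if "l \<le> n" for l
    using that
  proof (induction l)
    case 0
    then show ?case by (simp add: X_def)
  next
    case (Suc l)
    then have l: "l < n" "l \<le> n" by auto
    have d2: "(\<integral>z. (f l z * \<phi> (w l z))\<^sup>2 \<partial>M) = s * (\<integral>z. (f l z)\<^sup>2 \<partial>M)"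
    proof -
      have "ennreal (\<integral>z. (f l z * \<phi> (w l z))\<^sup>2 \<partial>M) = second_moment M (\<lambda>z. f l z * \<phi> (w l z))"
        unfolding second_moment_def using dsq[OF l(1)] by (subst nn_integral_eq_integral) auto
      also have "\<dots> = second_moment M (f l) * ennreal s"
        using nn_integral_indep_w[OF f[OF l(1)] \<phi>] s by simp
      also have "second_moment M (f l) = ennreal (\<integral>z. (f l z)\<^sup>2 \<partial>M)"
        unfolding second_moment_def using fsq[OF l(1)] by (subst nn_integral_eq_integral) auto
      finally show ?thesis using s by (simp add: ennreal_mult[symmetric] mult.commute)
    qed
    have "(\<integral>z. (X (Suc l) z)\<^sup>2 \<partial>M) = (\<integral>z. (X l z)\<^sup>2 + (f l z * \<phi> (w l z))\<^sup>2 + 2 * (X l z * (f l z * \<phi> (w l z))) \<partial>M)"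
      by (intro Bochner_Integration.integral_cong) (auto simp: X_def power2_sum)
    also have "\<dots> = (\<integral>z. (X l z)\<^sup>2 \<partial>M) + (\<integral>z. (f l z * \<phi> (w l z))\<^sup>2 \<partial>M)"
      using Xsq[OF l(2)] dsq[OF l(1)] transform[OF l(1) Xad[OF l(2)] Xsq[OF l(2)]] by simp
    finally show ?case using Suc l d2 by (simp add: algebra_simps)
  qed
  define S where "S l z = running_max (\<lambda>l. X l z) l" for l z
  have Sad: "S l \<in> borel_measurable (\<G> l)" if "l \<le> n" for l
    unfolding S_def using that by (intro measurable_running_max measurable_G_mono[OF _ Xad]) auto
  have Ssq: "integrable M (\<lambda>z. (S l z)\<^sup>2)" if "l \<le> n" for l
  proof (rule Bochner_Integration.integrable_bound)
    show "integrable M (\<lambda>z. \<Sum>i\<le>l. (X i z)\<^sup>2)"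
      using that by (intro Bochner_Integration.integrable_sum Xsq) auto
    show "(\<lambda>z. (S l z)\<^sup>2) \<in> borel_measurable M"
      using measurable_G[OF Sad[OF that]] by measurable
    show "AE z in M. norm ((S l z)\<^sup>2) \<le> norm (\<Sum>i\<le>l. (X i z)\<^sup>2)"
    proof (rule AE_I2)
      fix z
      have "running_max (\<lambda>l. X l z) l \<in> (\<lambda>i. \<bar>X i z\<bar>) ` {..l}"
        unfolding running_max_def by (intro Max_in) auto
      then obtain i where i: "i \<le> l" "S l z = \<bar>X i z\<bar>" unfolding S_def by auto
      have "(S l z)\<^sup>2 = (X i z)\<^sup>2" using i by simp
      also have "\<dots> \<le> (\<Sum>i\<le>l. (X i z)\<^sup>2)"
        using i by (intro member_le_sum) auto
      finally show "norm ((S l z)\<^sup>2) \<le> norm (\<Sum>i\<le>l. (X i z)\<^sup>2)"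
        by (simp add: sum_nonneg)
    qed
  qed
  \<comment> \<open>The integrand of the pathwise inequality; known at step k, it meets a centred
    increment, so its sum has mean zero.\<close>
  define H where "H k z = S k z * sgn (X k z)" for k z
  have Had: "H k \<in> borel_measurable (\<G> k)" if "k < n" for k
  proof -
    have [measurable]: "S k \<in> borel_measurable (\<G> k)" "X k \<in> borel_measurable (\<G> k)"
      using Sad[of k] Xad[of k] that by auto
    show ?thesis unfolding H_def sgn_if by measurable
  qed
  have Hsq: "integrable M (\<lambda>z. (H k z)\<^sup>2)" if "k < n" for k
  proof (rule Bochner_Integration.integrable_bound[OF Ssq])
    show "k \<le> n" using that by simp
    show "(\<lambda>z. (H k z)\<^sup>2) \<in> borel_measurable M"
      using measurable_G[OF Had[OF that]] by measurable
    show "AE z in M. norm ((H k z)\<^sup>2) \<le> norm ((S k z)\<^sup>2)"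
      by (intro AE_I2) (auto simp: H_def power_mult_distrib sgn_if)
  qed
  have Hint: "integrable M (\<lambda>z. H k z * (f k z * \<phi> (w k z)))"
      "(\<integral>z. H k z * (f k z * \<phi> (w k z)) \<partial>M) = 0" if "k < n" for k
    using transform[OF that Had Hsq] that by auto
  have "second_moment M (S n) = ennreal (\<integral>z. (S n z)\<^sup>2 \<partial>M)"
    unfolding second_moment_def using Ssq[of n] by (subst nn_integral_eq_integral) auto
  also have "(\<integral>z. (S n z)\<^sup>2 \<partial>M) \<le> (\<integral>z. 4 * (X n z)\<^sup>2 - 4 * (\<Sum>k<n. H k z * (f k z * \<phi> (w k z))) \<partial>M)"
  proof (rule integral_mono)
    show "integrable M (\<lambda>z. 4 * (X n z)\<^sup>2 - 4 * (\<Sum>k<n. H k z * (f k z * \<phi> (w k z))))"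
      using Xsq Hint by (intro Bochner_Integration.integrable_diff integrable_mult_right Bochner_Integration.integrable_sum) auto
    show "(S n z)\<^sup>2 \<le> 4 * (X n z)\<^sup>2 - 4 * (\<Sum>k<n. H k z * (f k z * \<phi> (w k z)))" for z
      using running_max_sq_bound[of "\<lambda>l. X l z" n] by (simp add: S_def H_def X_def)
  qed (use Ssq in auto)
  also have "\<dots> = 4 * (\<integral>z. (X n z)\<^sup>2 \<partial>M)"
    using Xsq[of n] Hint by (subst Bochner_Integration.integral_diff) auto
  also have "\<dots> = 4 * s * (\<Sum>j<n. \<integral>z. (f j z)\<^sup>2 \<partial>M)" using EX[of n] by simp
  also have "ennreal \<dots> = 4 * ennreal s * (\<Sum>j<n. second_moment M (f j))"
  proof -
    have "(\<Sum>j<n. second_moment M (f j)) = (\<Sum>j<n. ennreal (\<integral>z. (f j z)\<^sup>2 \<partial>M))"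
      unfolding second_moment_def using fsq by (intro sum.cong refl nn_integral_eq_integral) auto
    then show ?thesis using s by (simp add: ennreal_mult sum_nonneg)
  qed
  finally show ?thesis unfolding S_def X_def by (simp add: ennreal_leI)
qed

lemma w_moment:
  "integrable M (\<lambda>z. (w j z) ^ k)"
  "(\<integral>z. (w j z) ^ (2 * k) \<partial>M) = fact (2 * k) / (2 ^ k * fact k) * \<epsilon> ^ k"
  "(\<integral>z. w j z \<partial>M) = 0"
proof -
  have sd: "0 < sqrt \<epsilon>" using eps_pos by simp
  have "integrable lborel (\<lambda>x. normal_density 0 (sqrt \<epsilon>) x * x ^ k)" for k
    using integrable_normal_moment[OF sd, of 0 k] by simp
  then show "integrable M (\<lambda>z. (w j z) ^ k)"
    using distributed_integrable[OF w_normal, of "\<lambda>x. x ^ k"] by simp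
  show "(\<integral>z. (w j z) ^ (2 * k) \<partial>M) = fact (2 * k) / (2 ^ k * fact k) * \<epsilon> ^ k"
    using distributed_integral[OF w_normal, of "\<lambda>x. x ^ (2 * k)"]
      has_bochner_integral_integral_eq[OF normal_moment_even[OF sd, of 0 k]] eps_pos
    by (simp add: power_divide field_simps)
  show "(\<integral>z. w j z \<partial>M) = 0"
    using distributed_integral[OF w_normal, of "\<lambda>x. x"]
      has_bochner_integral_integral_eq[OF normal_moment_nz_1[OF sd, of 0]] by simp
qed

lemma second_moment_w_power:
  "second_moment M (\<lambda>z. (w j z) ^ k) = ennreal (fact (2 * k) / (2 ^ k * fact k) * \<epsilon> ^ k)"
  unfolding second_moment_def w_moment(2)[of j k, symmetric]
  using w_moment(1)[of j "2 * k"]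
  by (subst nn_integral_eq_integral[symmetric]) (auto simp: power_mult[symmetric] mult.commute[of _ 2] zero_le_even_power)

lemma doob_w:
  assumes "\<And>j. j < n \<Longrightarrow> f j \<in> borel_measurable (\<G> j)"
  shows "second_moment M (\<lambda>z. running_max (\<lambda>l. \<Sum>j<l. f j z * w j z) n)
    \<le> ennreal (4 * \<epsilon>) * (\<Sum>j<n. second_moment M (f j))"
proof -
  have "second_moment M (\<lambda>z. w j z) = ennreal \<epsilon>" for j
    using second_moment_w_power[of j 1] by (simp add: numeral_2_eq_2)
  then show ?thesis
    using doob_second_moment[OF assms, of n "\<lambda>x. x" \<epsilon>] w_moment(1)[of _ 1] w_moment(3) eps_pos
    by (simp add: ennreal_mult)
qed

text \<open>The variance of \<open>w\<^sup>2 - \<epsilon>\<close> is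
  \<open>3 * \<epsilon>\<^sup>2 - \<epsilon>\<^sup>2\<close>. Compared with \<open>doob_w\<close>
  there is one more factor \<epsilon>, so sums of compensated squares vanish as the fine grid is
  refined.\<close>

lemma doob_w_sq:
  assumes "\<And>j. j < n \<Longrightarrow> f j \<in> borel_measurable (\<G> j)"
  shows "second_moment M (\<lambda>z. running_max (\<lambda>l. \<Sum>j<l. f j z * ((w j z)\<^sup>2 - \<epsilon>)) n)
    \<le> ennreal (8 * \<epsilon>\<^sup>2) * (\<Sum>j<n. second_moment M (f j))"
proof -
  have i2: "(\<integral>z. (w j z)\<^sup>2 \<partial>M) = \<epsilon>" for j
    using w_moment(2)[of j 1] by (simp add: numeral_2_eq_2)
  have i4: "(\<integral>z. (w j z)^4 \<partial>M) = 3 * \<epsilon>\<^sup>2" for j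
    using w_moment(2)[of j 2] by (simp add: fact_numeral)
  have "second_moment M (\<lambda>z. (w j z)\<^sup>2 - \<epsilon>) = ennreal (2 * \<epsilon>\<^sup>2)" for j
  proof -
    have eq: "((w j z)\<^sup>2 - \<epsilon>)\<^sup>2 = (w j z)^4 - 2 * \<epsilon> * (w j z)\<^sup>2 + \<epsilon>\<^sup>2" for z
      by (simp add: power2_eq_square power4_eq_xxxx algebra_simps)
    have "second_moment M (\<lambda>z. (w j z)\<^sup>2 - \<epsilon>) = ennreal (\<integral>z. ((w j z)\<^sup>2 - \<epsilon>)\<^sup>2 \<partial>M)"
    proof -
      have "integrable M (\<lambda>z. ((w j z)\<^sup>2 - \<epsilon>)\<^sup>2)"
        unfolding eq using w_moment(1) by auto
      then show ?thesis
        unfolding second_moment_def by (intro nn_integral_eq_integral) auto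
    qed
    also have "(\<integral>z. ((w j z)\<^sup>2 - \<epsilon>)\<^sup>2 \<partial>M) = 2 * \<epsilon>\<^sup>2"
      unfolding eq using w_moment(1) by (simp add: i2 i4 prob_space) (simp add: power2_eq_square)
    finally show ?thesis .
  qed
  then show ?thesis
    using doob_second_moment[OF assms, of n "\<lambda>x. x\<^sup>2 - \<epsilon>" "2 * \<epsilon>\<^sup>2"] w_moment(1)[of _ 2] i2 eps_pos
    by (simp add: ennreal_mult prob_space mult.assoc[symmetric])
qed

end

section \<open>Second-order expansion along one grid step\<close>

text \<open>What Ito's formula leaves over on one step. The square of the increment is split into
  its mean \<epsilon> and a centred rest, so that the coefficient of \<epsilon> is the generator
  applied to \<Phi>.\<close>

definition ito_remainder ::
    "(real \<Rightarrow> real \<Rightarrow> real) \<Rightarrow> real \<Rightarrow> real \<Rightarrow> real \<Rightarrow> real \<Rightarrow> real \<Rightarrow> real \<Rightarrow> real" where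
  "ito_remainder \<Phi> u x \<epsilon> f g w =
     \<Phi> (u + \<epsilon>) (x + f * \<epsilon> + g * w) - \<Phi> u x
     - ((partial_u \<Phi> u x + partial_x \<Phi> u x * f + 1 / 2 * partial_x (partial_x \<Phi>) u x * g\<^sup>2) * \<epsilon>
        + partial_x \<Phi> u x * g * w + 1 / 2 * partial_x (partial_x \<Phi>) u x * g\<^sup>2 * (w\<^sup>2 - \<epsilon>))"

lemma C12_bounded:
  assumes "jointly_continuous f"
  obtains A where "A \<ge> 1" "\<And>u x. 0 \<le> u \<Longrightarrow> u \<le> U \<Longrightarrow> \<bar>x\<bar> \<le> R \<Longrightarrow> \<bar>f u x\<bar> \<le> A"
proof -
  have "continuous_on ({0..U} \<times> {-R..R}) (\<lambda>(u, x). f u x)"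
    using assms unfolding jointly_continuous_def by (rule continuous_on_subset) auto
  then have "compact ((\<lambda>(u, x). f u x) ` ({0..U} \<times> {-R..R}))"
    by (intro compact_continuous_image compact_Times) auto
  then obtain B where B: "\<And>y. y \<in> (\<lambda>(u, x). f u x) ` ({0..U} \<times> {-R..R}) \<Longrightarrow> norm y \<le> B"
    by (meson compact_imp_bounded bounded_iff)
  show ?thesis
  proof
    show "max 1 B \<ge> 1" by simp
    fix u x assume "0 \<le> u" "u \<le> U" "\<bar>x\<bar> \<le> R"
    then have "f u x \<in> (\<lambda>(u, x). f u x) ` ({0..U} \<times> {-R..R})"
      by (intro image_eqI[of _ _ "(u, x)"]) auto
    from B[OF this] show "\<bar>f u x\<bar> \<le> max 1 B" by simp
  qed
qed

lemma C12_uniformly_continuous: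
  assumes "jointly_continuous f" "\<theta> > 0"
  obtains s where "s > 0" "s < 1"
    "\<And>u x u' x'. 0 \<le> u \<Longrightarrow> u \<le> U \<Longrightarrow> \<bar>x\<bar> \<le> R \<Longrightarrow> 0 \<le> u' \<Longrightarrow> u' \<le> U \<Longrightarrow> \<bar>x'\<bar> \<le> R \<Longrightarrow>
      \<bar>u' - u\<bar> + \<bar>x' - x\<bar> < s \<Longrightarrow> \<bar>f u' x' - f u x\<bar> < \<theta>"
proof -
  have "continuous_on ({0..U} \<times> {-R..R}) (\<lambda>(u, x). f u x)"
    using assms(1) unfolding jointly_continuous_def by (rule continuous_on_subset) auto
  then have "uniformly_continuous_on ({0..U} \<times> {-R..R}) (\<lambda>(u, x). f u x)"
    by (intro compact_uniformly_continuous compact_Times) auto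
  then obtain d where d: "d > 0" "\<And>p q. p \<in> {0..U} \<times> {-R..R} \<Longrightarrow> q \<in> {0..U} \<times> {-R..R} \<Longrightarrow>
      dist q p < d \<Longrightarrow> dist (case q of (u, x) \<Rightarrow> f u x) (case p of (u, x) \<Rightarrow> f u x) < \<theta>"
    using \<open>\<theta> > 0\<close> unfolding uniformly_continuous_on_def by meson
  show ?thesis
  proof
    show "min d (1/2) > 0" "min d (1/2) < 1" using d by auto
    fix u x u' x' :: real
    assume *: "0 \<le> u" "u \<le> U" "\<bar>x\<bar> \<le> R" "0 \<le> u'" "u' \<le> U" "\<bar>x'\<bar> \<le> R"
      and lt: "\<bar>u' - u\<bar> + \<bar>x' - x\<bar> < min d (1/2)"
    have "dist (u', x') (u, x) \<le> \<bar>u' - u\<bar> + \<bar>x' - x\<bar>"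
      unfolding dist_Pair_Pair dist_real_def
      using sqrt_sum_squares_le_sum_abs[of "\<bar>u' - u\<bar>" "\<bar>x' - x\<bar>"] by simp
    then have "dist (u', x') (u, x) < d" using lt by simp
    from d(2)[OF _ _ this] show "\<bar>f u' x' - f u x\<bar> < \<theta>"
      using * by (auto simp: dist_real_def abs_le_iff)
  qed
qed

text \<open>Time is moved first, at the new point x + d, then space at the old time u. Thus one
  derivative in u and two in x suffice and no mixed derivative appears.\<close>

lemma C12_taylor:
  assumes C: "C12 \<Phi>" and u: "u \<ge> 0" and e: "\<epsilon> > 0"
  shows "\<exists>u' x'. u \<le> u' \<and> u' \<le> u + \<epsilon> \<and> \<bar>x' - x\<bar> \<le> \<bar>d\<bar> \<and>
    \<Phi> (u + \<epsilon>) (x + d) - \<Phi> u x = partial_u \<Phi> u' (x + d) * \<epsilon> + partial_x \<Phi> u x * d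
       + 1 / 2 * partial_x (partial_x \<Phi>) u x' * d\<^sup>2"
proof -
  have "\<exists>u'\<in>{u<..<u + \<epsilon>}. \<Phi> (u + \<epsilon>) (x + d) - \<Phi> u (x + d) = (u + \<epsilon> - u) * partial_u \<Phi> u' (x + d)"
  proof (rule mvt_simple)
    show "u < u + \<epsilon>" using e by simp
    fix v assume v: "u \<le> v" "v \<le> u + \<epsilon>"
    have "((\<lambda>v. \<Phi> v (x + d)) has_vector_derivative partial_u \<Phi> v (x + d)) (at v within {0..})"
      unfolding partial_u_def
      using C v u by (intro vector_derivative_works[THEN iffD1]) (auto simp: C12_def)
    then have "((\<lambda>v. \<Phi> v (x + d)) has_vector_derivative partial_u \<Phi> v (x + d)) (at v within {u..u + \<epsilon>})"
      by (rule has_vector_derivative_within_subset) (use u in auto)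
    then show "((\<lambda>v. \<Phi> v (x + d)) has_derivative (\<lambda>h. h * partial_u \<Phi> v (x + d))) (at v within {u..u + \<epsilon>})"
      by (simp add: has_vector_derivative_def)
  qed
  then obtain u' where u': "u < u'" "u' < u + \<epsilon>"
    "\<Phi> (u + \<epsilon>) (x + d) - \<Phi> u (x + d) = partial_u \<Phi> u' (x + d) * \<epsilon>"
    by (auto simp: mult.commute)
  have D1: "(\<Phi> u has_real_derivative partial_x \<Phi> u y) (at y)" for y
    using C u by (auto simp: C12_def partial_x_def field_differentiable_derivI)
  have D2: "(partial_x \<Phi> u has_real_derivative partial_x (partial_x \<Phi>) u y) (at y)" for y
  proof -
    have "partial_x \<Phi> u field_differentiable at y" using C u by (auto simp: C12_def)
    then show ?thesis unfolding partial_x_def[of "partial_x \<Phi>"] by (rule field_differentiable_derivI)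
  qed
  have "\<exists>x'. \<bar>x' - x\<bar> \<le> \<bar>d\<bar> \<and> \<Phi> u (x + d) - \<Phi> u x = partial_x \<Phi> u x * d + 1 / 2 * partial_x (partial_x \<Phi>) u x' * d\<^sup>2"
  proof (cases "d = 0")
    case True
    then show ?thesis by (intro exI[of _ x]) simp
  next
    case False
    define dd where "dd m = (if m = 0 then \<Phi> u else if m = 1 then partial_x \<Phi> u else partial_x (partial_x \<Phi>) u)" for m :: nat
    have "\<exists>t. (if x + d < x then x + d < t \<and> t < x else x < t \<and> t < x + d) \<and>
       \<Phi> u (x + d) = (\<Sum>m<2. (dd m x / fact m) * ((x + d) - x)^m) + (dd 2 t / fact 2) * ((x + d) - x)^2"
    proof (rule Taylor[where a="min x (x+d)" and b="max x (x+d)"])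
      show "\<forall>m t. m < 2 \<and> min x (x+d) \<le> t \<and> t \<le> max x (x+d) \<longrightarrow> DERIV (dd m) t :> dd (Suc m) t"
        using D1 D2 by (auto simp: dd_def less_2_cases_iff)
    qed (use False in \<open>auto simp: dd_def\<close>)
    then obtain t where t: "if x + d < x then x + d < t \<and> t < x else x < t \<and> t < x + d"
      "\<Phi> u (x + d) = (\<Sum>m<2. (dd m x / fact m) * ((x + d) - x)^m) + (dd 2 t / fact 2) * ((x + d) - x)^2"
      by blast
    have "\<bar>t - x\<bar> \<le> \<bar>d\<bar>" using t(1) by (auto split: if_splits)
    moreover have "\<Phi> u (x + d) - \<Phi> u x = partial_x \<Phi> u x * d + 1 / 2 * partial_x (partial_x \<Phi>) u t * d\<^sup>2"
      using t(2) by (simp add: dd_def numeral_2_eq_2)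
    ultimately show ?thesis by blast
  qed
  then obtain x' where x': "\<bar>x' - x\<bar> \<le> \<bar>d\<bar>"
    "\<Phi> u (x + d) - \<Phi> u x = partial_x \<Phi> u x * d + 1 / 2 * partial_x (partial_x \<Phi>) u x' * d\<^sup>2" by blast
  show ?thesis
    using u' x' by (intro exI[of _ u'] exI[of _ x']) auto
qed

text \<open>The derivatives are only continuous, so the remainder is o(\<epsilon> + w^2) without a
  rate; this is the free factor \<theta>. Large increments are handled by linear growth of \<Phi>, a
  crude bound that w^4 absorbs. The mean squares of \<epsilon> |w| and w^4 are of order \<epsilon>^3
  and \<epsilon>^4, negligible against \<epsilon>^2.\<close>

lemma ito_remainder_small:
  assumes C: "C12 \<Phi>" and grow: "\<And>u x. 0 \<le> u \<Longrightarrow> u \<le> U \<Longrightarrow> \<bar>\<Phi> u x\<bar> \<le> H * (1 + \<bar>x\<bar>)"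
    and H: "H \<ge> 0" and R: "R \<ge> 1" and \<theta>: "\<theta> > 0"
  obtains C \<epsilon>0 where "C \<ge> 0" "\<epsilon>0 > 0" "\<epsilon>0 \<le> 1"
    "\<And>u x \<epsilon> f g w. 0 < \<epsilon> \<Longrightarrow> \<epsilon> < \<epsilon>0 \<Longrightarrow> 0 \<le> u \<Longrightarrow> u + \<epsilon> \<le> U \<Longrightarrow> \<bar>x\<bar> \<le> R \<Longrightarrow> \<bar>f\<bar> \<le> R \<Longrightarrow> \<bar>g\<bar> \<le> R \<Longrightarrow>
      \<bar>ito_remainder \<Phi> u x \<epsilon> f g w\<bar> \<le> \<theta> * (\<epsilon> + w\<^sup>2) + C * (\<epsilon> * \<bar>w\<bar> + w ^ 4)"
proof -
  have jc: "jointly_continuous (partial_u \<Phi>)" "jointly_continuous (partial_x \<Phi>)" "jointly_continuous (partial_x (partial_x \<Phi>))"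
    using C by (auto simp: C12_def)
  obtain A1 where A1: "A1 \<ge> 1" "\<And>u x. 0 \<le> u \<Longrightarrow> u \<le> U \<Longrightarrow> \<bar>x\<bar> \<le> R \<Longrightarrow> \<bar>partial_u \<Phi> u x\<bar> \<le> A1"
    using C12_bounded[OF jc(1), of U R] by blast
  obtain A2 where A2: "A2 \<ge> 1" "\<And>u x. 0 \<le> u \<Longrightarrow> u \<le> U \<Longrightarrow> \<bar>x\<bar> \<le> R \<Longrightarrow> \<bar>partial_x \<Phi> u x\<bar> \<le> A2"
    using C12_bounded[OF jc(2), of U R] by blast
  obtain A3 where A3: "A3 \<ge> 1" "\<And>u x. 0 \<le> u \<Longrightarrow> u \<le> U \<Longrightarrow> \<bar>x\<bar> \<le> R \<Longrightarrow> \<bar>partial_x (partial_x \<Phi>) u x\<bar> \<le> A3"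
    using C12_bounded[OF jc(3), of U R] by blast
  define A where "A = A1 + A2 + A3"
  have A: "A \<ge> 1" "\<And>u x. 0 \<le> u \<Longrightarrow> u \<le> U \<Longrightarrow> \<bar>x\<bar> \<le> R \<Longrightarrow> \<bar>partial_u \<Phi> u x\<bar> \<le> A"
    "\<And>u x. 0 \<le> u \<Longrightarrow> u \<le> U \<Longrightarrow> \<bar>x\<bar> \<le> R \<Longrightarrow> \<bar>partial_x \<Phi> u x\<bar> \<le> A"
    "\<And>u x. 0 \<le> u \<Longrightarrow> u \<le> U \<Longrightarrow> \<bar>x\<bar> \<le> R \<Longrightarrow> \<bar>partial_x (partial_x \<Phi>) u x\<bar> \<le> A"
  proof -
    show "A \<ge> 1" using A1(1) A2(1) A3(1) by (simp add: A_def)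
    fix u x assume *: "0 \<le> u" "u \<le> U" "\<bar>x\<bar> \<le> R"
    show "\<bar>partial_u \<Phi> u x\<bar> \<le> A" using A1(2)[OF *] A2(1) A3(1) by (simp add: A_def)
    show "\<bar>partial_x \<Phi> u x\<bar> \<le> A" using A2(2)[OF *] A1(1) A3(1) by (simp add: A_def)
    show "\<bar>partial_x (partial_x \<Phi>) u x\<bar> \<le> A" using A3(2)[OF *] A1(1) A2(1) by (simp add: A_def)
  qed
  \<comment> \<open>Makes the error from the time derivative at most \<theta>/4 times \<epsilon>,
    and that from the second space derivative at most \<theta>/4 times (\<epsilon> + w^2).\<close>
  define \<theta>' where "\<theta>' = \<theta> / (4 * R\<^sup>2)"
  have \<theta>': "\<theta>' > 0" using \<theta> R by (simp add: \<theta>'_def)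
  obtain s1 where s1: "s1 > 0" "s1 < 1"
    "\<And>u x u' x'. 0 \<le> u \<Longrightarrow> u \<le> U \<Longrightarrow> \<bar>x\<bar> \<le> R + 1 \<Longrightarrow> 0 \<le> u' \<Longrightarrow> u' \<le> U \<Longrightarrow> \<bar>x'\<bar> \<le> R + 1 \<Longrightarrow>
      \<bar>u' - u\<bar> + \<bar>x' - x\<bar> < s1 \<Longrightarrow> \<bar>partial_u \<Phi> u' x' - partial_u \<Phi> u x\<bar> < \<theta>'"
    using C12_uniformly_continuous[OF jc(1) \<theta>', of U "R + 1"] by blast
  obtain s2 where s2: "s2 > 0" "s2 < 1"
    "\<And>u x u' x'. 0 \<le> u \<Longrightarrow> u \<le> U \<Longrightarrow> \<bar>x\<bar> \<le> R + 1 \<Longrightarrow> 0 \<le> u' \<Longrightarrow> u' \<le> U \<Longrightarrow> \<bar>x'\<bar> \<le> R + 1 \<Longrightarrow>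
      \<bar>u' - u\<bar> + \<bar>x' - x\<bar> < s2 \<Longrightarrow> \<bar>partial_x (partial_x \<Phi>) u' x' - partial_x (partial_x \<Phi>) u x\<bar> < \<theta>'"
    using C12_uniformly_continuous[OF jc(3) \<theta>', of U "R + 1"] by blast
  define s where "s = min s1 s2"
  have s: "s > 0" "s < 1" "s \<le> s1" "s \<le> s2" using s1 s2 by (auto simp: s_def)
  \<comment> \<open>The displacement is at most R (\<epsilon> + |w|), hence below s/2 if \<epsilon>
    and |w| are below \<rho>.\<close>
  define \<rho> where "\<rho> = s / (4 * R)"
  have \<rho>: "\<rho> > 0" "\<rho> \<le> 1" using s R by (auto simp: \<rho>_def divide_le_eq)
  \<comment> \<open>The second entry makes the term of order \<epsilon>^2 at most \<theta>/4 times
    \<epsilon>.\<close>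
  define \<epsilon>0 where "\<epsilon>0 = min \<rho> (\<theta> / (4 * A * R\<^sup>2))"
  have e0: "\<epsilon>0 > 0" "\<epsilon>0 \<le> \<rho>" "\<epsilon>0 \<le> \<theta> / (4 * A * R\<^sup>2)" using \<rho> \<theta> A(1) R by (auto simp: \<epsilon>0_def)
  \<comment> \<open>For large increments: two values of \<Phi>, bounded through \<open>H\<close>,
    and three derivative terms, bounded through \<open>A\<close>.\<close>
  define K where "K = (2 * H + 3 * A) * (4 * R\<^sup>2)"
  have K: "K \<ge> 0" using H A(1) by (simp add: K_def)
  define C' where "C' = A * R\<^sup>2 + K * (2 / \<rho> ^ 4)"
  have R2: "R \<le> R\<^sup>2" "1 \<le> R\<^sup>2"
  proof -
    have "R * 1 \<le> R * R" using R by (intro mult_left_mono) auto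
    then show "R \<le> R\<^sup>2" "1 \<le> R\<^sup>2" using R unfolding power2_eq_square by linarith+
  qed
  show ?thesis
  proof
    show "C' \<ge> 0" using K A(1) R \<rho> by (simp add: C'_def)
    show "\<epsilon>0 > 0" "\<epsilon>0 \<le> 1" using e0 \<rho> by auto
    fix u x \<epsilon> f g w :: real
    assume eps: "0 < \<epsilon>" "\<epsilon> < \<epsilon>0" and u: "0 \<le> u" "u + \<epsilon> \<le> U" and x: "\<bar>x\<bar> \<le> R" and f: "\<bar>f\<bar> \<le> R" and g: "\<bar>g\<bar> \<le> R"
    have e1: "\<epsilon> \<le> 1" "\<epsilon> < \<rho>" using eps e0 \<rho> by auto
    define d where "d = f * \<epsilon> + g * w"
    have fe: "\<bar>f * \<epsilon>\<bar> \<le> R * \<epsilon>" using f eps by (simp add: abs_mult mult_right_mono)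
    have gw: "\<bar>g * w\<bar> \<le> R * \<bar>w\<bar>" using g by (simp add: abs_mult mult_right_mono)
    have dle: "\<bar>d\<bar> \<le> R * \<epsilon> + R * \<bar>w\<bar>" unfolding d_def using fe gw by linarith
    let ?pu = "partial_u \<Phi> u x" and ?px = "partial_x \<Phi> u x" and ?pxx = "partial_x (partial_x \<Phi>) u x"
    have B: "\<bar>?pu\<bar> \<le> A" "\<bar>?px\<bar> \<le> A" "\<bar>?pxx\<bar> \<le> A" using A u x eps by auto
    have g2: "g\<^sup>2 \<le> R\<^sup>2" using g R by (simp add: abs_le_square_iff[symmetric])
    have w0: "0 \<le> w^4" "0 \<le> \<epsilon> * \<bar>w\<bar>" using eps by auto
    show "\<bar>ito_remainder \<Phi> u x \<epsilon> f g w\<bar> \<le> \<theta> * (\<epsilon> + w\<^sup>2) + C' * (\<epsilon> * \<bar>w\<bar> + w ^ 4)"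
    proof (cases "\<bar>w\<bar> < \<rho>")
      case True
      have "R * \<epsilon> + R * \<bar>w\<bar> < R * \<rho> + R * \<rho>" using e1 True R by (intro add_strict_mono) auto
      also have "\<dots> = s / 2" using R by (simp add: \<rho>_def)
      finally have ds: "\<bar>d\<bar> < s / 2" using dle by simp
      obtain u' x' where t: "u \<le> u'" "u' \<le> u + \<epsilon>" "\<bar>x' - x\<bar> \<le> \<bar>d\<bar>"
        "\<Phi> (u + \<epsilon>) (x + d) - \<Phi> u x = partial_u \<Phi> u' (x + d) * \<epsilon> + ?px * d
           + 1 / 2 * partial_x (partial_x \<Phi>) u x' * d\<^sup>2"
        using C12_taylor[OF C u(1) eps(1), of x d] by blast
      have es: "\<epsilon> < s / 2"
      proof -
        have "s / (4 * R) \<le> s / 2" using s R by (intro divide_left_mono) auto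
        then show ?thesis using e1 by (simp add: \<rho>_def)
      qed
      have d1: "\<bar>partial_u \<Phi> u' (x + d) - ?pu\<bar> \<le> \<theta>'"
        by (rule less_imp_le, rule s1(3)) (use u x t(1-3) ds es s in linarith)+
      have d2: "\<bar>partial_x (partial_x \<Phi>) u x' - ?pxx\<bar> \<le> \<theta>'"
        by (rule less_imp_le, rule s2(3)) (use u x t(1-3) ds es s eps in linarith)+
      have eq: "ito_remainder \<Phi> u x \<epsilon> f g w = (partial_u \<Phi> u' (x + d) - ?pu) * \<epsilon>
          + 1 / 2 * (partial_x (partial_x \<Phi>) u x' - ?pxx) * d\<^sup>2
          + 1 / 2 * ?pxx * (d\<^sup>2 - g\<^sup>2 * w\<^sup>2)"
        using t(4) unfolding ito_remainder_def d_def add.assoc[symmetric]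
        by (simp add: field_simps)
      have b1: "\<bar>(partial_u \<Phi> u' (x + d) - ?pu) * \<epsilon>\<bar> \<le> \<theta>' * \<epsilon>"
        using d1 eps by (simp add: abs_mult mult_right_mono)
      have dsq: "d\<^sup>2 \<le> 2 * R\<^sup>2 * (\<epsilon> + w\<^sup>2)"
      proof -
        have "d\<^sup>2 \<le> (R * \<epsilon> + R * \<bar>w\<bar>)\<^sup>2" using dle by (simp add: abs_le_square_iff[symmetric])
        also have "\<dots> \<le> 2 * R\<^sup>2 * (\<epsilon>\<^sup>2 + w\<^sup>2)"
          using sum_squares_bound[of "R * \<epsilon>" "R * \<bar>w\<bar>"] by (simp add: power2_sum power_mult_distrib algebra_simps)
        also have "\<epsilon>\<^sup>2 \<le> \<epsilon>" using e1 eps by (simp add: power2_eq_square)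
        finally show ?thesis using R2 by (simp add: mult_left_mono)
      qed
      have b2: "\<bar>1 / 2 * (partial_x (partial_x \<Phi>) u x' - ?pxx) * d\<^sup>2\<bar> \<le> \<theta>' * R\<^sup>2 * (\<epsilon> + w\<^sup>2)"
      proof -
        have "\<bar>partial_x (partial_x \<Phi>) u x' - ?pxx\<bar> * d\<^sup>2 \<le> \<theta>' * (2 * R\<^sup>2 * (\<epsilon> + w\<^sup>2))"
          using d2 dsq \<theta>' by (intro mult_mono) auto
        then show ?thesis by (simp add: abs_mult)
      qed
      have b3: "\<bar>1 / 2 * ?pxx * (d\<^sup>2 - g\<^sup>2 * w\<^sup>2)\<bar> \<le> A * R\<^sup>2 * \<epsilon>\<^sup>2 + A * R\<^sup>2 * (\<epsilon> * \<bar>w\<bar>)"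
      proof -
        have "d\<^sup>2 - g\<^sup>2 * w\<^sup>2 = (f * \<epsilon>)\<^sup>2 + 2 * ((f * \<epsilon>) * (g * w))"
          unfolding d_def by (simp add: power2_sum power_mult_distrib)
        moreover have "\<bar>(f * \<epsilon>)\<^sup>2\<bar> \<le> R\<^sup>2 * \<epsilon>\<^sup>2"
        proof -
          have "(f * \<epsilon>)\<^sup>2 \<le> (R * \<epsilon>)\<^sup>2" using fe R eps by (subst abs_le_square_iff[symmetric]) simp
          then show ?thesis by (simp add: power_mult_distrib)
        qed
        moreover have "\<bar>(f * \<epsilon>) * (g * w)\<bar> \<le> (R * \<epsilon>) * (R * \<bar>w\<bar>)"
          unfolding abs_mult[of "f * \<epsilon>"] using fe gw by (intro mult_mono) auto
        ultimately have "\<bar>d\<^sup>2 - g\<^sup>2 * w\<^sup>2\<bar> \<le> R\<^sup>2 * \<epsilon>\<^sup>2 + 2 * (R\<^sup>2 * (\<epsilon> * \<bar>w\<bar>))"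
        proof -
          assume a: "d\<^sup>2 - g\<^sup>2 * w\<^sup>2 = (f * \<epsilon>)\<^sup>2 + 2 * ((f * \<epsilon>) * (g * w))"
            "\<bar>(f * \<epsilon>)\<^sup>2\<bar> \<le> R\<^sup>2 * \<epsilon>\<^sup>2" "\<bar>(f * \<epsilon>) * (g * w)\<bar> \<le> (R * \<epsilon>) * (R * \<bar>w\<bar>)"
          have "(R * \<epsilon>) * (R * \<bar>w\<bar>) = R\<^sup>2 * (\<epsilon> * \<bar>w\<bar>)" by (simp add: power2_eq_square)
          then show ?thesis using a by linarith
        qed
        then have "\<bar>?pxx\<bar> * \<bar>d\<^sup>2 - g\<^sup>2 * w\<^sup>2\<bar> \<le> A * (R\<^sup>2 * \<epsilon>\<^sup>2 + 2 * (R\<^sup>2 * (\<epsilon> * \<bar>w\<bar>)))"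
          using B A(1) by (intro mult_mono) auto
        moreover have "0 \<le> A * (R\<^sup>2 * \<epsilon>\<^sup>2)" using A(1) by simp
        moreover have "\<bar>1 / 2 * ?pxx * (d\<^sup>2 - g\<^sup>2 * w\<^sup>2)\<bar> = (\<bar>?pxx\<bar> * \<bar>d\<^sup>2 - g\<^sup>2 * w\<^sup>2\<bar>) / 2"
          by (simp add: abs_mult)
        ultimately show ?thesis by (simp add: distrib_left mult.assoc)
      qed
      have b4: "A * R\<^sup>2 * \<epsilon>\<^sup>2 \<le> \<theta> / 4 * \<epsilon>"
      proof -
        have "A * R\<^sup>2 * \<epsilon> \<le> A * R\<^sup>2 * (\<theta> / (4 * A * R\<^sup>2))"
          using eps e0(3) A(1) by (intro mult_left_mono) auto
        also have "\<dots> = \<theta> / 4" using A(1) R by simp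
        finally show ?thesis using eps by (simp add: power2_eq_square mult.assoc[symmetric] mult_right_mono)
      qed
      have b5: "\<theta>' * \<epsilon> \<le> \<theta> / 4 * \<epsilon>" "\<theta>' * R\<^sup>2 * (\<epsilon> + w\<^sup>2) = \<theta> / 4 * (\<epsilon> + w\<^sup>2)"
        using R R2 \<theta> eps by (auto simp: \<theta>'_def divide_le_eq)
      have "0 \<le> K * (2 / \<rho> ^ 4)" using K \<rho> by simp
      then have b6: "A * R\<^sup>2 * (\<epsilon> * \<bar>w\<bar>) \<le> C' * (\<epsilon> * \<bar>w\<bar> + w ^ 4)"
        unfolding C'_def using w0 A(1) R2 by (intro mult_mono) auto
      have "\<bar>ito_remainder \<Phi> u x \<epsilon> f g w\<bar> \<le> \<theta>' * \<epsilon> + \<theta>' * R\<^sup>2 * (\<epsilon> + w\<^sup>2) + (A * R\<^sup>2 * \<epsilon>\<^sup>2 + A * R\<^sup>2 * (\<epsilon> * \<bar>w\<bar>))"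
        unfolding eq using b1 b2 b3 by linarith
      also have "\<dots> \<le> \<theta> / 4 * \<epsilon> + \<theta> / 4 * (\<epsilon> + w\<^sup>2) + (\<theta> / 4 * \<epsilon> + C' * (\<epsilon> * \<bar>w\<bar> + w ^ 4))"
        using b4 b5 b6 by linarith
      also have "\<dots> \<le> \<theta> * (\<epsilon> + w\<^sup>2) + C' * (\<epsilon> * \<bar>w\<bar> + w ^ 4)"
      proof -
        have "0 \<le> \<theta> * \<epsilon>" "0 \<le> \<theta> * w\<^sup>2" using \<theta> eps by auto
        then show ?thesis unfolding distrib_left by linarith
      qed
      finally show ?thesis .
    next
      case False
      have w1: "\<bar>w\<bar> \<le> 1 + w\<^sup>2" "0 \<le> w\<^sup>2" using sum_squares_bound[of 1 "\<bar>w\<bar>"] by auto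
      have p1: "\<bar>\<Phi> (u + \<epsilon>) (x + f * \<epsilon> + g * w)\<bar> \<le> H * (4 * R\<^sup>2 * (1 + w\<^sup>2))"
      proof -
        have "\<bar>\<Phi> (u + \<epsilon>) (x + f * \<epsilon> + g * w)\<bar> \<le> H * (1 + \<bar>x + f * \<epsilon> + g * w\<bar>)"
          using u eps by (intro grow) auto
        also have "1 + \<bar>x + f * \<epsilon> + g * w\<bar> \<le> R + (R + R * 1 + R * \<bar>w\<bar>)"
          using x fe gw R e1 mult_left_mono[OF e1(1), of R] by linarith
        also have "\<dots> \<le> 4 * R * (1 + w\<^sup>2)"
        proof -
          have "R * \<bar>w\<bar> \<le> R * (1 + w\<^sup>2)" "0 \<le> R * w\<^sup>2" using w1 R by (auto intro!: mult_left_mono)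
          then show ?thesis unfolding distrib_left by linarith
        qed
        also have "\<dots> \<le> 4 * R\<^sup>2 * (1 + w\<^sup>2)"
          using R2 by (intro mult_right_mono) auto
        finally show ?thesis using H by (simp add: mult_left_mono)
      qed
      have p2: "\<bar>\<Phi> u x\<bar> \<le> H * (4 * R\<^sup>2 * (1 + w\<^sup>2))"
      proof -
        have "\<bar>\<Phi> u x\<bar> \<le> H * (1 + \<bar>x\<bar>)"
          using u eps by (intro grow) auto
        also have "1 + \<bar>x\<bar> \<le> 4 * R\<^sup>2 * 1" using x R R2 by linarith
        also have "\<dots> \<le> 4 * R\<^sup>2 * (1 + w\<^sup>2)"
          by (intro mult_left_mono) auto
        finally show ?thesis using H by (simp add: mult_left_mono)
      qed
      have p3: "\<bar>(?pu + ?px * f + 1 / 2 * ?pxx * g\<^sup>2) * \<epsilon>\<bar> \<le> A * (4 * R\<^sup>2 * (1 + w\<^sup>2))"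
      proof -
        have "\<bar>?px * f\<bar> \<le> A * R\<^sup>2" unfolding abs_mult using B f R2 A(1) by (intro mult_mono) auto
        moreover have "\<bar>?pxx * g\<^sup>2\<bar> \<le> A * R\<^sup>2" unfolding abs_mult using B g2 A(1) by (intro mult_mono) auto
        moreover have "\<bar>?pu\<bar> \<le> A * R\<^sup>2" using B mult_left_mono[OF R2(2), of A] A(1) by linarith
        ultimately have *: "\<bar>?pu + ?px * f + 1 / 2 * ?pxx * g\<^sup>2\<bar> \<le> 3 * (A * R\<^sup>2)" by linarith
        have "\<bar>(?pu + ?px * f + 1 / 2 * ?pxx * g\<^sup>2) * \<epsilon>\<bar> \<le> 3 * (A * R\<^sup>2) * 1"
          unfolding abs_mult[of _ \<epsilon>] using * e1 eps by (intro mult_mono) auto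
        also have "\<dots> \<le> A * (4 * R\<^sup>2 * (1 + w\<^sup>2))"
        proof -
          have "A * (4 * R\<^sup>2 * (1 + w\<^sup>2)) = 4 * (A * R\<^sup>2) + 4 * (A * R\<^sup>2 * w\<^sup>2)" by (simp add: algebra_simps)
          moreover have "0 \<le> A * R\<^sup>2" "0 \<le> A * R\<^sup>2 * w\<^sup>2" using A(1) by auto
          ultimately show ?thesis by linarith
        qed
        finally show ?thesis .
      qed
      have p4: "\<bar>?px * g * w\<bar> \<le> A * (4 * R\<^sup>2 * (1 + w\<^sup>2))"
      proof -
        have "\<bar>?px * g * w\<bar> \<le> A * R * (1 + w\<^sup>2)" unfolding abs_mult using B g R A(1) w1 by (intro mult_mono) auto
        also have "\<dots> \<le> A * (4 * R\<^sup>2) * (1 + w\<^sup>2)" using R2 A(1) by (intro mult_right_mono mult_left_mono) auto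
        finally show ?thesis by simp
      qed
      have p5: "\<bar>1 / 2 * ?pxx * g\<^sup>2 * (w\<^sup>2 - \<epsilon>)\<bar> \<le> A * (4 * R\<^sup>2 * (1 + w\<^sup>2))"
      proof -
        have "\<bar>w\<^sup>2 - \<epsilon>\<bar> \<le> 1 + w\<^sup>2" using e1 eps w1(2) by linarith
        moreover have "\<bar>?pxx * g\<^sup>2\<bar> \<le> A * R\<^sup>2" unfolding abs_mult using B g2 A(1) by (intro mult_mono) auto
        ultimately have "\<bar>?pxx * g\<^sup>2\<bar> * \<bar>w\<^sup>2 - \<epsilon>\<bar> \<le> A * R\<^sup>2 * (1 + w\<^sup>2)" using A(1) by (intro mult_mono) auto
        moreover have "0 \<le> A * R\<^sup>2 * (1 + w\<^sup>2)" using A(1) by simp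
        ultimately show ?thesis by (simp add: abs_mult)
      qed
      have "\<bar>ito_remainder \<Phi> u x \<epsilon> f g w\<bar> \<le> 2 * (H * (4 * R\<^sup>2 * (1 + w\<^sup>2))) + 3 * (A * (4 * R\<^sup>2 * (1 + w\<^sup>2)))"
        unfolding ito_remainder_def using p1 p2 p3 p4 p5 by linarith
      also have "\<dots> = K * (1 + w\<^sup>2)" unfolding K_def by (simp add: algebra_simps)
      \<comment> \<open>Since |w| \<ge> \<rho> and \<rho> \<le> 1, both 1 and w^2 times \<rho>^4 are
        at most w^4.\<close>
      also have "1 + w\<^sup>2 \<le> 2 / \<rho> ^ 4 * w ^ 4"
      proof -
        have e4: "z ^ 4 = z\<^sup>2 * z\<^sup>2" for z :: real by (simp add: power_add[symmetric])
        have a: "\<rho>\<^sup>2 \<le> w\<^sup>2" using False \<rho> by (subst abs_le_square_iff[symmetric]) simp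
        have "\<rho>\<^sup>2 \<le> 1" using \<rho> by (simp add: power_le_one)
        then have "\<rho>\<^sup>2 * \<rho>\<^sup>2 \<le> 1 * w\<^sup>2" using a by (intro mult_mono) auto
        then have "(\<rho>\<^sup>2 * \<rho>\<^sup>2) * w\<^sup>2 \<le> (1 * w\<^sup>2) * w\<^sup>2" by (intro mult_right_mono) auto
        moreover have "\<rho>\<^sup>2 * \<rho>\<^sup>2 \<le> w\<^sup>2 * w\<^sup>2" using a by (intro mult_mono) auto
        ultimately have "\<rho>^4 * (1 + w\<^sup>2) \<le> 2 * w^4" unfolding e4 distrib_left by linarith
        then show ?thesis using \<rho>(1) by (simp add: pos_le_divide_eq mult.commute)
      qed
      finally have "\<bar>ito_remainder \<Phi> u x \<epsilon> f g w\<bar> \<le> K * (2 / \<rho> ^ 4 * w ^ 4)" using K by (simp add: mult_left_mono)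
      also have "\<dots> \<le> C' * (\<epsilon> * \<bar>w\<bar> + w ^ 4)"
      proof -
        have "0 \<le> A * R\<^sup>2" using A(1) by simp
        then have "K * (2 / \<rho> ^ 4) \<le> C'" unfolding C'_def by linarith
        moreover have "0 \<le> K * (2 / \<rho> ^ 4)" using K \<rho> by simp
        ultimately have "K * (2 / \<rho> ^ 4) * w ^ 4 \<le> C' * (\<epsilon> * \<bar>w\<bar> + w ^ 4)"
          using w0 by (intro mult_mono) linarith+
        then show ?thesis by (simp only: mult.assoc)
      qed
      finally have "\<bar>ito_remainder \<Phi> u x \<epsilon> f g w\<bar> \<le> C' * (\<epsilon> * \<bar>w\<bar> + w ^ 4)" .
      moreover have "0 \<le> \<theta> * (\<epsilon> + w\<^sup>2)" using \<theta> eps by simp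
      ultimately show ?thesis by linarith
    qed
  qed
qed

section \<open>Error propagation on the fine grid\<close>

lemma second_moment_le2:
  assumes [measurable]: "f1 \<in> borel_measurable M" "f2 \<in> borel_measurable M"
    and le: "\<And>z. z \<in> space M \<Longrightarrow> \<bar>g z\<bar> \<le> \<bar>f1 z\<bar> + \<bar>f2 z\<bar>"
    and m: "second_moment M f1 \<le> x1" "second_moment M f2 \<le> x2"
  shows "second_moment M g \<le> 2 * (x1 + x2)"
proof -
  have "second_moment M g \<le> ennreal (real (card {..<2::nat})) * (\<Sum>i<2::nat. second_moment M (if i = 0 then f1 else f2))"
    using le by (intro second_moment_sum_bound) (auto simp: numeral_2_eq_2)
  also have "\<dots> \<le> 2 * (x1 + x2)"
    using m by (auto simp: numeral_2_eq_2 ennreal_numeral[symmetric] simp del: ennreal_numeral intro!: mult_left_mono add_mono)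
  finally show ?thesis .
qed

lemma second_moment_le3:
  assumes [measurable]: "f1 \<in> borel_measurable M" "f2 \<in> borel_measurable M" "f3 \<in> borel_measurable M"
    and le: "\<And>z. z \<in> space M \<Longrightarrow> \<bar>g z\<bar> \<le> \<bar>f1 z\<bar> + \<bar>f2 z\<bar> + \<bar>f3 z\<bar>"
    and m: "second_moment M f1 \<le> x1" "second_moment M f2 \<le> x2" "second_moment M f3 \<le> x3"
  shows "second_moment M g \<le> 3 * (x1 + x2 + x3)"
proof -
  have "second_moment M g \<le> ennreal (real (card {..<3::nat})) *
      (\<Sum>i<3::nat. second_moment M (if i = 0 then f1 else if i = 1 then f2 else f3))"
    using le by (intro second_moment_sum_bound) (auto simp: numeral_3_eq_3)
  also have "\<dots> = 3 * (second_moment M f1 + second_moment M f2 + second_moment M f3)"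
    by (simp add: numeral_3_eq_3)
  also have "\<dots> \<le> 3 * (x1 + x2 + x3)"
    using m by (intro mult_left_mono add_mono) auto
  finally show ?thesis .
qed

lemma second_moment_le4:
  assumes [measurable]: "f1 \<in> borel_measurable M" "f2 \<in> borel_measurable M" "f3 \<in> borel_measurable M" "f4 \<in> borel_measurable M"
    and le: "\<And>z. z \<in> space M \<Longrightarrow> \<bar>g z\<bar> \<le> \<bar>f1 z\<bar> + \<bar>f2 z\<bar> + \<bar>f3 z\<bar> + \<bar>f4 z\<bar>"
    and m: "second_moment M f1 \<le> x1" "second_moment M f2 \<le> x2" "second_moment M f3 \<le> x3" "second_moment M f4 \<le> x4"
  shows "second_moment M g \<le> 4 * (x1 + x2 + x3 + x4)"
proof -
  have "second_moment M g \<le> ennreal (real (card {..<4::nat})) *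
      (\<Sum>i<4::nat. second_moment M (if i = 0 then f1 else if i = 1 then f2 else if i = 2 then f3 else f4))"
    using le by (intro second_moment_sum_bound) (auto simp: eval_nat_numeral)
  also have "\<dots> = 4 * (second_moment M f1 + second_moment M f2 + second_moment M f3 + second_moment M f4)"
    by (simp add: eval_nat_numeral)
  also have "\<dots> \<le> 4 * (x1 + x2 + x3 + x4)"
    using m by (intro mult_left_mono add_mono) auto
  finally show ?thesis .
qed

lemma second_moment_le6:
  assumes [measurable]: "f1 \<in> borel_measurable M" "f2 \<in> borel_measurable M" "f3 \<in> borel_measurable M"
      "f4 \<in> borel_measurable M" "f5 \<in> borel_measurable M" "f6 \<in> borel_measurable M"
    and le: "\<And>z. z \<in> space M \<Longrightarrow> \<bar>g z\<bar> \<le> \<bar>f1 z\<bar> + \<bar>f2 z\<bar> + \<bar>f3 z\<bar> + \<bar>f4 z\<bar> + \<bar>f5 z\<bar> + \<bar>f6 z\<bar>"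
    and m: "second_moment M f1 \<le> x1" "second_moment M f2 \<le> x2" "second_moment M f3 \<le> x3"
      "second_moment M f4 \<le> x4" "second_moment M f5 \<le> x5" "second_moment M f6 \<le> x6"
  shows "second_moment M g \<le> 6 * (x1 + x2 + x3 + x4 + x5 + x6)"
proof -
  have "second_moment M g \<le> ennreal (real (card {..<6::nat})) *
      (\<Sum>i<6::nat. second_moment M (if i = 0 then f1 else if i = 1 then f2 else if i = 2 then f3
        else if i = 3 then f4 else if i = 4 then f5 else f6))"
    using le by (intro second_moment_sum_bound) (auto simp: eval_nat_numeral)
  also have "\<dots> = 6 * (second_moment M f1 + second_moment M f2 + second_moment M f3 + second_moment M f4
      + second_moment M f5 + second_moment M f6)"
    by (simp add: eval_nat_numeral)
  also have "\<dots> \<le> 6 * (x1 + x2 + x3 + x4 + x5 + x6)"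
    using m by (intro mult_left_mono add_mono) auto
  finally show ?thesis .
qed

lemma second_moment_sum_const:
  fixes M :: "'a measure"
  assumes f: "\<And>i. i \<in> A \<Longrightarrow> f i \<in> borel_measurable M"
    and le: "\<And>z. z \<in> space M \<Longrightarrow> \<bar>g z\<bar> \<le> (\<Sum>i\<in>A. \<bar>f i z\<bar>)"
    and m: "\<And>i. i \<in> A \<Longrightarrow> second_moment M (f i) \<le> ennreal c" and card: "real (card A) \<le> k" and c: "c \<ge> 0"
  shows "second_moment M g \<le> ennreal (k\<^sup>2 * c)"
proof -
  have "second_moment M g \<le> ennreal (real (card A)) * (\<Sum>i\<in>A. second_moment M (f i))"
    using f le by (rule second_moment_sum_bound)
  also have "\<dots> \<le> ennreal (real (card A)) * (\<Sum>i\<in>A. ennreal c)"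
    using m by (intro mult_left_mono sum_mono) auto
  also have "\<dots> = ennreal (real (card A) * (real (card A) * c))"
    using c by (simp add: ennreal_mult ennreal_of_nat_eq_real_of_nat)
  also have "real (card A) * (real (card A) * c) \<le> k * (k * c)"
    using card c by (intro mult_mono) auto
  finally show ?thesis by (simp add: power2_eq_square mult.assoc ennreal_leI)
qed

text \<open>With values in \<open>ennreal\<close>, finiteness is part of the conclusion; no
  integrability of the errors has to be known beforehand.\<close>

lemma gronwall_ennreal:
  fixes \<phi> :: "nat \<Rightarrow> ennreal"
  assumes "\<And>l. l \<le> n \<Longrightarrow> \<phi> l \<le> ennreal A + ennreal c * (\<Sum>j<l. \<phi> j)" and A: "A \<ge> 0" and c: "c \<ge> 0"
  shows "l \<le> n \<Longrightarrow> \<phi> l \<le> ennreal (A * exp (c * real l))"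
proof -
  have *: "\<phi> l \<le> ennreal (A * (1 + c) ^ l)" if "l \<le> n" for l
    using that
  proof (induction l rule: less_induct)
    case (less l)
    have "(\<Sum>j<l. \<phi> j) \<le> (\<Sum>j<l. ennreal (A * (1 + c) ^ j))"
      using less by (intro sum_mono) auto
    also have "\<dots> = ennreal (\<Sum>j<l. A * (1 + c) ^ j)"
      using A c by (intro sum_ennreal) auto
    finally have "\<phi> l \<le> ennreal A + ennreal c * ennreal (\<Sum>j<l. A * (1 + c) ^ j)"
      using assms(1)[OF less.prems] by (meson add_left_mono mult_left_mono order_trans zero_le)
    also have "\<dots> = ennreal (A + c * (\<Sum>j<l. A * (1 + c) ^ j))"
      using A c by (simp add: ennreal_mult[symmetric] ennreal_plus[symmetric] sum_nonneg del: ennreal_plus)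
    also have "A + c * (\<Sum>j<l. A * (1 + c) ^ j) = A * (1 + c) ^ l"
      by (induction l) (auto simp: algebra_simps)
    finally show ?case .
  qed
  assume l: "l \<le> n"
  have "(1 + c) ^ l \<le> exp c ^ l" using c exp_ge_add_one_self[of c] by (intro power_mono) auto
  also have "\<dots> = exp (c * real l)" by (simp add: exp_of_nat_mult[symmetric] mult.commute)
  finally have "A * (1 + c) ^ l \<le> A * exp (c * real l)" using A by (rule mult_left_mono)
  then show ?thesis using *[OF l] by (meson ennreal_leI order_trans)
qed

context gaussian_increments
begin

text \<open>Doob's inequality for a sum restarted at \<open>m\<close>, with weights set to zero
  before. \<open>k\<close> bounds the elapsed time, so a martingale sum over a block has mean square
  of order \<delta>.\<close>

lemma partial_sum_w:
  assumes f: "\<And>i. i \<in> {m..<j} \<Longrightarrow> f i \<in> borel_measurable (\<G> i)"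
    and c: "\<And>i. i \<in> {m..<j} \<Longrightarrow> second_moment M (f i) \<le> ennreal c" and k: "real (j - m) * \<epsilon> \<le> k" "c \<ge> 0"
  shows "second_moment M (\<lambda>z. \<Sum>i\<in>{m..<j}. f i z * w i z) \<le> ennreal (4 * k * c)"
proof -
  define g where "g i z = (if m \<le> i then f i z else 0)" for i z
  have g: "g i \<in> borel_measurable (\<G> i)" if "i < j" for i
    using f[of i] that unfolding g_def by (cases "m \<le> i") auto
  have "(\<Sum>i\<in>{m..<j}. f i z * w i z) = (\<Sum>i<j. g i z * w i z)" for z
    unfolding g_def by (intro sum.mono_neutral_cong_left) auto
  moreover have "\<bar>\<Sum>i<j. g i z * w i z\<bar> \<le> \<bar>running_max (\<lambda>l. \<Sum>i<l. g i z * w i z) j\<bar>" for z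
    using running_max_ge[of j j "\<lambda>l. \<Sum>i<l. g i z * w i z"] by simp
  ultimately have "second_moment M (\<lambda>z. \<Sum>i\<in>{m..<j}. f i z * w i z)
      \<le> second_moment M (\<lambda>z. running_max (\<lambda>l. \<Sum>i<l. g i z * w i z) j)"
    by (intro second_moment_mono) simp
  also have "\<dots> \<le> ennreal (4 * \<epsilon>) * (\<Sum>i<j. second_moment M (g i))"
    by (rule doob_w) (use g in auto)
  also have "(\<Sum>i<j. second_moment M (g i)) = (\<Sum>i\<in>{m..<j}. second_moment M (f i))"
    unfolding g_def by (intro sum.mono_neutral_cong_right) (auto simp: second_moment_def)
  also have "\<dots> \<le> (\<Sum>i\<in>{m..<j}. ennreal c)" using c by (intro sum_mono) auto
  also have "\<dots> = ennreal (real (j - m) * c)"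
    using k by (simp add: ennreal_mult ennreal_of_nat_eq_real_of_nat)
  also have "ennreal (4 * \<epsilon>) * ennreal (real (j - m) * c) = ennreal (4 * (real (j - m) * \<epsilon>) * c)"
    using k eps_pos by (simp add: ennreal_mult[symmetric] mult_ac)
  also have "\<dots> \<le> ennreal (4 * k * c)"
    using k by (intro ennreal_leI mult_right_mono) auto
  finally show ?thesis by (simp add: mult_left_mono)
qed

lemma partial_sum_w_sq:
  assumes f: "\<And>i. i \<in> {m..<j} \<Longrightarrow> f i \<in> borel_measurable (\<G> i)"
    and c: "\<And>i. i \<in> {m..<j} \<Longrightarrow> second_moment M (f i) \<le> ennreal c" and k: "real (j - m) * \<epsilon> \<le> k" "c \<ge> 0"
  shows "second_moment M (\<lambda>z. \<Sum>i\<in>{m..<j}. f i z * ((w i z)\<^sup>2 - \<epsilon>)) \<le> ennreal (8 * \<epsilon> * k * c)"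
proof -
  define g where "g i z = (if m \<le> i then f i z else 0)" for i z
  have g: "g i \<in> borel_measurable (\<G> i)" if "i < j" for i
    using f[of i] that unfolding g_def by (cases "m \<le> i") auto
  have "(\<Sum>i\<in>{m..<j}. f i z * ((w i z)\<^sup>2 - \<epsilon>)) = (\<Sum>i<j. g i z * ((w i z)\<^sup>2 - \<epsilon>))" for z
    unfolding g_def by (intro sum.mono_neutral_cong_left) auto
  moreover have "\<bar>\<Sum>i<j. g i z * ((w i z)\<^sup>2 - \<epsilon>)\<bar> \<le> \<bar>running_max (\<lambda>l. \<Sum>i<l. g i z * ((w i z)\<^sup>2 - \<epsilon>)) j\<bar>" for z
    using running_max_ge[of j j "\<lambda>l. \<Sum>i<l. g i z * ((w i z)\<^sup>2 - \<epsilon>)"] by simp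
  ultimately have "second_moment M (\<lambda>z. \<Sum>i\<in>{m..<j}. f i z * ((w i z)\<^sup>2 - \<epsilon>))
      \<le> second_moment M (\<lambda>z. running_max (\<lambda>l. \<Sum>i<l. g i z * ((w i z)\<^sup>2 - \<epsilon>)) j)"
    by (intro second_moment_mono) simp
  also have "\<dots> \<le> ennreal (8 * \<epsilon>\<^sup>2) * (\<Sum>i<j. second_moment M (g i))"
    by (rule doob_w_sq) (use g in auto)
  also have "(\<Sum>i<j. second_moment M (g i)) = (\<Sum>i\<in>{m..<j}. second_moment M (f i))"
    unfolding g_def by (intro sum.mono_neutral_cong_right) (auto simp: second_moment_def)
  also have "\<dots> \<le> (\<Sum>i\<in>{m..<j}. ennreal c)" using c by (intro sum_mono) auto
  also have "\<dots> = ennreal (real (j - m) * c)"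
    using k by (simp add: ennreal_mult ennreal_of_nat_eq_real_of_nat)
  also have "ennreal (8 * \<epsilon>\<^sup>2) * ennreal (real (j - m) * c) = ennreal (8 * \<epsilon> * (real (j - m) * \<epsilon>) * c)"
    using k eps_pos by (simp add: ennreal_mult[symmetric] power2_eq_square mult_ac)
  also have "\<dots> \<le> ennreal (8 * \<epsilon> * k * c)"
    using k eps_pos by (intro ennreal_leI mult_right_mono mult_left_mono) auto
  finally show ?thesis by (simp add: mult_left_mono)
qed

end

text \<open>Left end points of the coarse steps, each consisting of \<open>L\<close> fine steps.\<close>

definition block :: "nat \<Rightarrow> nat \<Rightarrow> nat" where
  "block L j = j div L * L"

lemma block_le: "block L j \<le> j"
  by (simp add: block_def div_times_less_eq_dividend)

lemma block_gap: "L > 0 \<Longrightarrow> j - block L j < L"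
  by (simp add: block_def minus_div_mult_eq_mod)

lemma block_eq:
  assumes "block L j \<le> i" "i \<le> j" shows "block L i = block L j"
proof -
  have "j div L \<le> i div L"
    using assms(1) unfolding block_def by (cases "L = 0") (auto simp: less_eq_div_iff_mult_less_eq)
  moreover have "i div L \<le> j div L" using assms(2) by (rule div_le_mono)
  ultimately show ?thesis by (simp add: block_def)
qed

lemma block_Suc:
  assumes "L > 0"
  shows "block L (Suc j) = (if Suc j = block L j + L then Suc j else block L j)"
proof -
  have j: "j = block L j + j mod L" by (simp add: block_def)
  show ?thesis
  proof (cases "Suc (j mod L) = L")
    case True
    then have "Suc j div L = Suc (j div L)" by (simp add: div_Suc mod_Suc)
    then have "block L (Suc j) = block L j + L" by (simp add: block_def)
    then show ?thesis using True j by simp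
  next
    case False
    then have "Suc j div L = j div L" by (simp add: div_Suc mod_Suc)
    then have "block L (Suc j) = block L j" by (simp add: block_def)
    moreover have "Suc j \<noteq> block L j + L" using False j by linarith
    ultimately show ?thesis by simp
  qed
qed

text \<open>Summation by parts for a double sum over the blocks: up to the current, incomplete block it is
  a martingale transform whose weights are at most one block length.\<close>

lemma block_double_sum:
  fixes x :: "nat \<Rightarrow> real"
  assumes "L > 0"
  shows "(\<Sum>j<l. \<Sum>i\<in>{block L j..<j}. x i)
    = (\<Sum>i<l. x i * (real (block L i) + real L - 1 - real i))
      - (real (block L l) + real L - real l) * (\<Sum>i\<in>{block L l..<l}. x i)"
proof (induction l)
  case 0
  then show ?case by (simp add: block_def)
next
  case (Suc l)
  have sp: "(\<Sum>i\<in>{block L l..<Suc l}. x i) = (\<Sum>i\<in>{block L l..<l}. x i) + x l"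
    using block_le[of L l] by (simp add: sum.atLeastLessThan_Suc)
  show ?case
  proof (cases "Suc l = block L l + L")
    case True
    then have b: "block L (Suc l) = Suc l" using block_Suc[OF assms, of l] by simp
    \<comment> \<open>The last index of a block has weight zero: no later j of the same block sees
      its increment.\<close>
    have r: "real (block L l) + real L - 1 - real l = 0" using True by linarith
    then have r': "real (block L l) + real L - real l = 1" by linarith
    show ?thesis using Suc b r r' by simp
  next
    case False
    then have b: "block L (Suc l) = block L l" using block_Suc[OF assms, of l] by simp
    show ?thesis using Suc b sp by (simp add: algebra_simps)
  qed
qed

lemma ennreal_numeral_mult:
  "x \<ge> 0 \<Longrightarrow> numeral k * ennreal x = ennreal (numeral k * x)"
  by (simp add: ennreal_mult)

lemma ennreal_numeral_mult_sum:
  "x \<ge> 0 \<Longrightarrow> y \<ge> 0 \<Longrightarrow> numeral k * (ennreal x + ennreal y) = ennreal (numeral k * (x + y))"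
  "x \<ge> 0 \<Longrightarrow> y \<ge> 0 \<Longrightarrow> z \<ge> 0 \<Longrightarrow> numeral k * (ennreal x + ennreal y + ennreal z) = ennreal (numeral k * (x + y + z))"
  by (simp_all add: ennreal_numeral_mult ennreal_plus[symmetric] del: ennreal_plus)

text \<open>\<open>V\<close> is a discretised diffusion observed on the fine grid and stopped as soon as \<open>good\<close> fails. A function
  \<open>\<Phi>\<close> is expanded along \<open>V\<close> when its increments have the form that Ito's formula predicts:
  \<open>D\<close> is the drift, \<open>S\<close> the diffusion coefficient, \<open>q\<close> the coefficient of the compensated square of the
  Gaussian increment, and \<open>r\<close> the remainder.\<close>

locale grid_process = gaussian_increments M \<G> w \<epsilon>
  for M :: "'a measure" and \<G> :: "nat \<Rightarrow> 'a measure" and w :: "nat \<Rightarrow> 'a \<Rightarrow> real" and \<epsilon> :: real +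
  fixes L N :: nat and \<delta> \<T> K Q :: real and good :: "nat \<Rightarrow> 'a \<Rightarrow> bool" and V :: "nat \<Rightarrow> 'a \<Rightarrow> real"
  assumes L_pos: "L > 0" and delta: "\<delta> = real L * \<epsilon>" "\<delta> \<le> 1" "\<epsilon> \<le> \<delta>\<^sup>2"
    and horizon: "\<T> = real (N * L) * \<epsilon>" "\<T> \<ge> 1"
    and K_nonneg: "K \<ge> 0" and Q_nonneg: "Q \<ge> 0" and Q_small: "8 * Q\<^sup>2 * \<epsilon> \<le> \<delta>"
    and good_antimono: "\<And>j z. good (Suc j) z \<Longrightarrow> good j z"
    and good_measurable: "\<And>j. Measurable.pred (\<G> j) (good j)"
    and V_adapted: "\<And>j. V j \<in> borel_measurable (\<G> j)"
begin

text \<open>Linear growth bound for the coefficients of an expansion along \<open>V\<close>; it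
  vanishes once the path is stopped, as those coefficients do.\<close>

definition weight :: "nat \<Rightarrow> 'a \<Rightarrow> real" where
  "weight i z = (if good i z then K * (1 + \<bar>V i z\<bar>) else 0)"

text \<open>The remainders carry no martingale structure and are summed by Cauchy-Schwarz;
  \<open>\<epsilon>\<^sup>2\<close> for each makes \<open>L\<close> of them amount to
  \<open>\<delta>\<^sup>2\<close>. The bound \<open>Q\<close> may depend on the truncation level,
  because \<open>Q_small\<close> lets the fine step compensate for it.\<close>

definition expands :: "(real \<Rightarrow> real \<Rightarrow> real) \<Rightarrow> (nat \<Rightarrow> 'a \<Rightarrow> real) \<Rightarrow> (nat \<Rightarrow> 'a \<Rightarrow> real) \<Rightarrow> (nat \<Rightarrow> 'a \<Rightarrow> real) \<Rightarrow> (nat \<Rightarrow> 'a \<Rightarrow> real) \<Rightarrow> bool" where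
  "expands \<Phi> D S q r \<longleftrightarrow>
     (\<forall>i. D i \<in> borel_measurable (\<G> i) \<and> S i \<in> borel_measurable (\<G> i) \<and> q i \<in> borel_measurable (\<G> i)
        \<and> r i \<in> borel_measurable M) \<and>
     (\<forall>i<N * L. second_moment M (r i) \<le> ennreal (\<epsilon>\<^sup>2) \<and>
        (\<forall>z\<in>space M. \<bar>D i z\<bar> \<le> weight i z \<and> \<bar>S i z\<bar> \<le> weight i z \<and> \<bar>q i z\<bar> \<le> Q \<and>
          (good i z \<longrightarrow> \<Phi> (real (Suc i) * \<epsilon>) (V (Suc i) z) = \<Phi> (real i * \<epsilon>) (V i z)
             + (D i z * \<epsilon> + S i z * w i z + q i z * ((w i z)\<^sup>2 - \<epsilon>) + r i z))))"

lemma good_mono: "i \<le> j \<Longrightarrow> good j z \<Longrightarrow> good i z"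
  by (induction j) (auto simp: le_Suc_eq dest: good_antimono)

lemma V_measurable [measurable]: "V j \<in> borel_measurable M"
  using V_adapted measurable_G by blast

lemma good_pred [measurable]: "Measurable.pred M (good j)"
  using good_measurable measurable_G by blast

lemma weight_nonneg: "0 \<le> weight i z"
  using K_nonneg by (simp add: weight_def)

lemma delta_pos: "\<delta> > 0"
  using delta L_pos eps_pos by simp

lemma block_length: "real (j - block L j) * \<epsilon> \<le> \<delta>"
  using block_gap[OF L_pos, of j] eps_pos unfolding delta(1) by (intro mult_right_mono) auto

text \<open>The increment since the start of the block without the martingale part driven by
  \<open>S\<close>. Its mean square is of order \<delta>^2, that of the martingale part only of
  order \<delta>.\<close>

definition block_drift :: "(nat \<Rightarrow> 'a \<Rightarrow> real) \<Rightarrow> (nat \<Rightarrow> 'a \<Rightarrow> real) \<Rightarrow> (nat \<Rightarrow> 'a \<Rightarrow> real) \<Rightarrow> nat \<Rightarrow> 'a \<Rightarrow> real" where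
  "block_drift D q r j z = (\<Sum>i\<in>{block L j..<j}. D i z * \<epsilon> + q i z * ((w i z)\<^sup>2 - \<epsilon>) + r i z)"

text \<open>The moment bound \<open>b\<close> is a parameter at this stage;
  \<open>weight_moment\<close> supplies it for the discretised solution.\<close>

context
  fixes b :: real
  assumes b: "b \<ge> 0" "\<And>i. i < N * L \<Longrightarrow> second_moment M (weight i) \<le> ennreal b"
begin

lemma expands_second_moment:
  assumes e: "expands \<Phi> D S q r" and i: "i < N * L"
  shows "second_moment M (D i) \<le> ennreal b" "second_moment M (S i) \<le> ennreal b"
    "second_moment M (q i) \<le> ennreal (Q\<^sup>2)"
proof -
  have le: "\<And>z. z \<in> space M \<Longrightarrow> \<bar>D i z\<bar> \<le> \<bar>weight i z\<bar>" "\<And>z. z \<in> space M \<Longrightarrow> \<bar>S i z\<bar> \<le> \<bar>weight i z\<bar>"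
      "\<And>z. z \<in> space M \<Longrightarrow> \<bar>q i z\<bar> \<le> \<bar>Q\<bar>"
    using e i weight_nonneg[of i] Q_nonneg by (auto simp: expands_def)
  show "second_moment M (D i) \<le> ennreal b" "second_moment M (S i) \<le> ennreal b"
    using second_moment_mono[of M "D i" "weight i", OF le(1)] second_moment_mono[of M "S i" "weight i", OF le(2)] b(2)[OF i]
    by (auto intro: order_trans)
  have "second_moment M (q i) \<le> second_moment M (\<lambda>_. Q)"
    by (rule second_moment_mono[OF le(3)])
  also have "\<dots> = ennreal (Q\<^sup>2)" by (simp add: second_moment_def emeasure_space_1)
  finally show "second_moment M (q i) \<le> ennreal (Q\<^sup>2)" .
qed

lemma block_drift_second_moment:
  assumes e: "expands \<Phi> D S q r" and j: "j < N * L"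
  shows "second_moment M (block_drift D q r j) \<le> ennreal (6 * \<delta>\<^sup>2 * (b + 1))"
proof -
  let ?I = "{block L j..<j}"
  have i: "i < N * L" if "i \<in> ?I" for i using that j by auto
  have [measurable]: "D i \<in> borel_measurable M" "q i \<in> borel_measurable M" "r i \<in> borel_measurable M" for i
    using e measurable_G by (auto simp: expands_def)
  have card: "real (card ?I) \<le> real L" using block_gap[OF L_pos, of j] by simp
  have "second_moment M (\<lambda>z. \<Sum>i\<in>?I. D i z * \<epsilon>) \<le> ennreal ((real L)\<^sup>2 * (\<epsilon>\<^sup>2 * b))"
  proof (rule second_moment_sum_const[where f="\<lambda>i z. D i z * \<epsilon>", OF _ _ _ card])
    fix k assume "k \<in> ?I"
    have "second_moment M (\<lambda>z. \<epsilon> * D k z) \<le> ennreal (\<epsilon>\<^sup>2) * ennreal b"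
      using expands_second_moment(1)[OF e i[OF \<open>k \<in> ?I\<close>]] by (subst second_moment_cmult) (auto intro: mult_left_mono)
    then show "second_moment M (\<lambda>z. D k z * \<epsilon>) \<le> ennreal (\<epsilon>\<^sup>2 * b)"
      using b by (simp add: ennreal_mult mult.commute)
  qed (use b in \<open>auto intro: sum_abs\<close>)
  also have "(real L)\<^sup>2 * (\<epsilon>\<^sup>2 * b) = \<delta>\<^sup>2 * b" by (simp add: delta power_mult_distrib)
  finally have m1: "second_moment M (\<lambda>z. \<Sum>i\<in>?I. D i z * \<epsilon>) \<le> ennreal (\<delta>\<^sup>2 * b)" .
  have "second_moment M (\<lambda>z. \<Sum>i\<in>?I. q i z * ((w i z)\<^sup>2 - \<epsilon>)) \<le> ennreal (8 * \<epsilon> * \<delta> * Q\<^sup>2)"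
    by (rule partial_sum_w_sq)
       (use e expands_second_moment(3)[OF e i] block_length[of j] in \<open>auto simp: expands_def\<close>)
  also have "\<dots> \<le> ennreal (\<delta>\<^sup>2)"
  proof -
    \<comment> \<open>The fine step is small compared with the truncated coefficients.\<close>
    have "8 * \<epsilon> * \<delta> * Q\<^sup>2 = \<delta> * (8 * Q\<^sup>2 * \<epsilon>)" by (simp add: mult_ac)
    also have "\<dots> \<le> \<delta> * \<delta>" using Q_small delta_pos by (intro mult_left_mono) auto
    finally show ?thesis by (simp add: power2_eq_square ennreal_leI)
  qed
  finally have m2: "second_moment M (\<lambda>z. \<Sum>i\<in>?I. q i z * ((w i z)\<^sup>2 - \<epsilon>)) \<le> ennreal (\<delta>\<^sup>2)" .
  have "second_moment M (\<lambda>z. \<Sum>i\<in>?I. r i z) \<le> ennreal ((real L)\<^sup>2 * \<epsilon>\<^sup>2)"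
    by (rule second_moment_sum_const[where f=r, OF _ _ _ card])
       (use e i in \<open>auto simp: expands_def\<close>)
  also have "(real L)\<^sup>2 * \<epsilon>\<^sup>2 = \<delta>\<^sup>2" by (simp add: delta power_mult_distrib)
  finally have m3: "second_moment M (\<lambda>z. \<Sum>i\<in>?I. r i z) \<le> ennreal (\<delta>\<^sup>2)" .
  have "second_moment M (block_drift D q r j) \<le> 3 * (ennreal (\<delta>\<^sup>2 * b) + ennreal (\<delta>\<^sup>2) + ennreal (\<delta>\<^sup>2))"
    by (rule second_moment_le3[OF _ _ _ _ m1 m2 m3])
       (auto simp: block_drift_def sum.distrib intro!: order_trans[OF abs_triangle_ineq] add_mono)
  also have "\<dots> = ennreal (3 * (\<delta>\<^sup>2 * b + \<delta>\<^sup>2 + \<delta>\<^sup>2))"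
    using b by (intro ennreal_numeral_mult_sum) auto
  also have "\<dots> \<le> ennreal (6 * \<delta>\<^sup>2 * (b + 1))"
    using b by (intro ennreal_leI) (simp add: algebra_simps)
  finally show ?thesis .
qed

lemma block_increment:
  assumes e: "expands \<Phi> D S q r" and j: "j < N * L" and z: "z \<in> space M" and g: "good j z"
  shows "\<Phi> (real j * \<epsilon>) (V j z) - \<Phi> (real (block L j) * \<epsilon>) (V (block L j) z)
    = block_drift D q r j z + (\<Sum>i\<in>{block L j..<j}. S i z * w i z)"
proof -
  have "\<Phi> (real j * \<epsilon>) (V j z) - \<Phi> (real (block L j) * \<epsilon>) (V (block L j) z)
    = (\<Sum>i\<in>{block L j..<j}. \<Phi> (real (Suc i) * \<epsilon>) (V (Suc i) z) - \<Phi> (real i * \<epsilon>) (V i z))"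
    using block_le[of L j] by (subst sum_Suc_diff') auto
  also have "\<dots> = (\<Sum>i\<in>{block L j..<j}. D i z * \<epsilon> + q i z * ((w i z)\<^sup>2 - \<epsilon>) + r i z + S i z * w i z)"
  proof (rule sum.cong)
    fix i assume "i \<in> {block L j..<j}"
    then have "i < N * L" "good i z" using j g good_mono[of i j z] by auto
    then show "\<Phi> (real (Suc i) * \<epsilon>) (V (Suc i) z) - \<Phi> (real i * \<epsilon>) (V i z)
      = D i z * \<epsilon> + q i z * ((w i z)\<^sup>2 - \<epsilon>) + r i z + S i z * w i z"
      using e z by (auto simp: expands_def)
  qed simp
  finally show ?thesis by (simp add: block_drift_def sum.distrib)
qed

lemma block_martingale_second_moment:
  assumes e: "expands \<Phi> D S q r" and j: "j < N * L"
  shows "second_moment M (\<lambda>z. \<Sum>i\<in>{block L j..<j}. S i z * w i z) \<le> ennreal (4 * \<delta> * b)"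
  by (rule partial_sum_w)
     (use e b expands_second_moment(2)[OF e] j block_length[of j] in \<open>auto simp: expands_def\<close>)

lemma expands_measurable:
  assumes e: "expands \<Phi> D S q r"
  shows "D i \<in> borel_measurable M" "S i \<in> borel_measurable M" "q i \<in> borel_measurable M" "r i \<in> borel_measurable M"
    "block_drift D q r j \<in> borel_measurable M" "(\<lambda>z. \<Sum>i\<in>{block L j..<j}. S i z * w i z) \<in> borel_measurable M"
proof -
  have [measurable]: "D i \<in> borel_measurable M" "S i \<in> borel_measurable M" "q i \<in> borel_measurable M" "r i \<in> borel_measurable M" for i
    using e measurable_G by (auto simp: expands_def)
  show "D i \<in> borel_measurable M" "S i \<in> borel_measurable M" "q i \<in> borel_measurable M" "r i \<in> borel_measurable M"
    by measurable
  show "block_drift D q r j \<in> borel_measurable M" "(\<lambda>z. \<Sum>i\<in>{block L j..<j}. S i z * w i z) \<in> borel_measurable M"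
    unfolding block_drift_def[abs_def] by measurable
qed

lemma block_total_second_moment:
  assumes e: "expands \<Phi> D S q r" and j: "j < N * L"
  shows "second_moment M (\<lambda>z. block_drift D q r j z + (\<Sum>i\<in>{block L j..<j}. S i z * w i z))
    \<le> ennreal (20 * \<delta> * (b + 1))"
proof -
  have "second_moment M (\<lambda>z. block_drift D q r j z + (\<Sum>i\<in>{block L j..<j}. S i z * w i z))
    \<le> 2 * (ennreal (6 * \<delta>\<^sup>2 * (b + 1)) + ennreal (4 * \<delta> * b))"
    by (rule second_moment_le2[OF expands_measurable(5,6)[OF e] _ block_drift_second_moment[OF e j] block_martingale_second_moment[OF e j]])
       (rule abs_triangle_ineq)
  also have "\<dots> = ennreal (2 * (6 * \<delta>\<^sup>2 * (b + 1) + 4 * \<delta> * b))"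
    using b delta_pos by (intro ennreal_numeral_mult_sum) auto
  also have "\<dots> \<le> ennreal (20 * \<delta> * (b + 1))"
  proof (rule ennreal_leI)
    have "\<delta>\<^sup>2 * (b + 1) \<le> \<delta> * (b + 1)"
      using delta_pos delta(2) b by (intro mult_right_mono) (auto simp: power2_eq_square)
    moreover have "0 \<le> \<delta> * b" using delta_pos b by simp
    ultimately show "2 * (6 * \<delta>\<^sup>2 * (b + 1) + 4 * \<delta> * b) \<le> 20 * \<delta> * (b + 1)"
      using delta_pos by (simp add: algebra_simps)
  qed
  finally show ?thesis .
qed

text \<open>The Lebesgue integral of the increments over the blocks is one order better than each increment:
  the martingale part is first summed by parts.\<close>

lemma integrated_block_bound:
  assumes e: "expands \<Phi> D S q r"
  shows "second_moment M (\<lambda>z. running_max (\<lambda>l. \<epsilon> * (\<Sum>j<l. \<Sum>i\<in>{block L j..<j}. S i z * w i z)) (N * L))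
      \<le> ennreal (40 * \<delta>\<^sup>2 * \<T> * b)"
proof -
  let ?n = "N * L"
  have Sad: "S i \<in> borel_measurable (\<G> i)" for i using e by (auto simp: expands_def)
  have [measurable]: "S i \<in> borel_measurable M" for i using expands_measurable[OF e] by auto
  \<comment> \<open>The time left in the block after step i: the weight produced by summation by
    parts.\<close>
  define c where "c i = \<epsilon> * (real (block L i) + real L - 1 - real i)" for i
  have c: "\<bar>c i\<bar> \<le> \<delta>" for i
  proof -
    have "0 \<le> real (block L i) + real L - 1 - real i" "real (block L i) + real L - 1 - real i \<le> real L"
      using block_gap[OF L_pos, of i] block_le[of L i] by auto
    then show ?thesis unfolding c_def delta(1) using eps_pos by (simp add: abs_mult mult.commute mult_right_mono)
  qed
  define X1 where "X1 z = running_max (\<lambda>l. \<Sum>i<l. (c i * S i z) * w i z) ?n" for z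
  \<comment> \<open>Controls the incomplete last block as a difference of two partial sums, hence
    the factor 2 below.\<close>
  define X2 where "X2 z = running_max (\<lambda>l. \<Sum>i<l. S i z * w i z) ?n" for z
  have m1: "second_moment M X1 \<le> ennreal (4 * \<delta>\<^sup>2 * \<T> * b)"
  proof -
    have "second_moment M X1 \<le> ennreal (4 * \<epsilon>) * (\<Sum>i<?n. second_moment M (\<lambda>z. c i * S i z))"
      unfolding X1_def by (rule doob_w) (use Sad in measurable)
    also have "\<dots> \<le> ennreal (4 * \<epsilon>) * (\<Sum>i<?n. ennreal (\<delta>\<^sup>2 * b))"
    proof (intro mult_left_mono sum_mono)
      fix i assume "i \<in> {..<?n}"
      then have "second_moment M (S i) \<le> ennreal b" using expands_second_moment(2)[OF e] by auto
      moreover have "(c i)\<^sup>2 \<le> \<delta>\<^sup>2" using c[of i] delta_pos by (subst abs_le_square_iff[symmetric]) simp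
      ultimately have "ennreal ((c i)\<^sup>2) * second_moment M (S i) \<le> ennreal (\<delta>\<^sup>2) * ennreal b"
        by (intro mult_mono ennreal_leI) auto
      then show "second_moment M (\<lambda>z. c i * S i z) \<le> ennreal (\<delta>\<^sup>2 * b)"
        using b by (simp add: second_moment_cmult ennreal_mult)
    qed auto
    also have "\<dots> = ennreal (4 * \<delta>\<^sup>2 * \<T> * b)"
      using b eps_pos by (simp add: horizon(1) ennreal_mult[symmetric] ennreal_of_nat_eq_real_of_nat mult_ac)
    finally show ?thesis .
  qed
  have m2: "second_moment M X2 \<le> ennreal (4 * \<T> * b)"
  proof -
    have "second_moment M X2 \<le> ennreal (4 * \<epsilon>) * (\<Sum>i<?n. second_moment M (S i))"
      unfolding X2_def by (rule doob_w) (use Sad in measurable)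
    also have "\<dots> \<le> ennreal (4 * \<epsilon>) * (\<Sum>i<?n. ennreal b)"
      using expands_second_moment(2)[OF e] by (intro mult_left_mono sum_mono) auto
    also have "\<dots> = ennreal (4 * \<T> * b)"
      using b eps_pos by (simp add: horizon(1) ennreal_mult[symmetric] ennreal_of_nat_eq_real_of_nat mult_ac)
    finally show ?thesis .
  qed
  have [measurable]: "X1 \<in> borel_measurable M" "X2 \<in> borel_measurable M"
    unfolding X1_def[abs_def] X2_def[abs_def] by measurable
  have m2': "second_moment M (\<lambda>z. (2 * \<delta>) * X2 z) \<le> ennreal (16 * \<delta>\<^sup>2 * \<T> * b)"
  proof -
    have "second_moment M (\<lambda>z. (2 * \<delta>) * X2 z) \<le> ennreal ((2 * \<delta>)\<^sup>2) * ennreal (4 * \<T> * b)"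
      using m2 by (subst second_moment_cmult) (auto intro: mult_left_mono)
    also have "\<dots> = ennreal (16 * \<delta>\<^sup>2 * \<T> * b)"
      using b horizon(2) by (subst ennreal_mult[symmetric]) (auto simp: power_mult_distrib mult_ac)
    finally show ?thesis .
  qed
  have "second_moment M (\<lambda>z. running_max (\<lambda>l. \<epsilon> * (\<Sum>j<l. \<Sum>i\<in>{block L j..<j}. S i z * w i z)) ?n)
      \<le> 2 * (ennreal (4 * \<delta>\<^sup>2 * \<T> * b) + ennreal (16 * \<delta>\<^sup>2 * \<T> * b))"
  proof (rule second_moment_le2[OF _ _ _ m1 m2'])
    fix z
    have "running_max (\<lambda>l. \<epsilon> * (\<Sum>j<l. \<Sum>i\<in>{block L j..<j}. S i z * w i z)) ?n \<le> X1 z + 2 * \<delta> * X2 z"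
    proof (rule running_max_leI)
      fix l assume l: "l \<le> ?n"
      have eq: "\<epsilon> * (\<Sum>j<l. \<Sum>i\<in>{block L j..<j}. S i z * w i z) = (\<Sum>i<l. (c i * S i z) * w i z)
          - \<epsilon> * (real (block L l) + real L - real l) * (\<Sum>i\<in>{block L l..<l}. S i z * w i z)"
        unfolding block_double_sum[OF L_pos] c_def
        by (simp add: right_diff_distrib sum_distrib_left mult_ac)
      have "\<bar>\<Sum>i<l. (c i * S i z) * w i z\<bar> \<le> X1 z"
        unfolding X1_def using running_max_ge[OF l, of "\<lambda>l. \<Sum>i<l. (c i * S i z) * w i z"] by simp
      moreover have "\<bar>\<epsilon> * (real (block L l) + real L - real l) * (\<Sum>i\<in>{block L l..<l}. S i z * w i z)\<bar> \<le> \<delta> * (2 * X2 z)"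
        unfolding abs_mult[of _ "\<Sum>i\<in>{block L l..<l}. S i z * w i z"]
      proof (rule mult_mono)
        have "0 \<le> real (block L l) + real L - real l" "real (block L l) + real L - real l \<le> real L"
          using block_gap[OF L_pos, of l] block_le[of L l] by auto
        then show "\<bar>\<epsilon> * (real (block L l) + real L - real l)\<bar> \<le> \<delta>"
          unfolding delta(1) using eps_pos by (simp add: abs_mult mult.commute mult_right_mono)
        have "(\<Sum>i\<in>{block L l..<l}. S i z * w i z) = (\<Sum>i<l. S i z * w i z) - (\<Sum>i<block L l. S i z * w i z)"
          using sum_diff_nat_ivl[of 0 "block L l" l "\<lambda>i. S i z * w i z"] block_le[of L l]
          by (simp add: atLeast0LessThan)
        then show "\<bar>\<Sum>i\<in>{block L l..<l}. S i z * w i z\<bar> \<le> 2 * X2 z"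
          unfolding X2_def
          using running_max_ge[OF l, of "\<lambda>l. \<Sum>i<l. S i z * w i z"]
            running_max_ge[OF order_trans[OF block_le l], of "\<lambda>l. \<Sum>i<l. S i z * w i z" L] by linarith
      qed (use delta_pos in auto)
      ultimately show "\<bar>\<epsilon> * (\<Sum>j<l. \<Sum>i\<in>{block L j..<j}. S i z * w i z)\<bar> \<le> X1 z + 2 * \<delta> * X2 z"
        unfolding eq by linarith
    qed
    then show "\<bar>running_max (\<lambda>l. \<epsilon> * (\<Sum>j<l. \<Sum>i\<in>{block L j..<j}. S i z * w i z)) ?n\<bar> \<le> \<bar>X1 z\<bar> + \<bar>2 * \<delta> * X2 z\<bar>"
      using running_max_nonneg[of "\<lambda>l. \<epsilon> * (\<Sum>j<l. \<Sum>i\<in>{block L j..<j}. S i z * w i z)" ?n] by linarith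
  qed measurable
  also have "\<dots> = ennreal (2 * (4 * \<delta>\<^sup>2 * \<T> * b + 16 * \<delta>\<^sup>2 * \<T> * b))"
    using b horizon(2) by (intro ennreal_numeral_mult_sum) auto
  finally show ?thesis by (simp add: algebra_simps)
qed

end

end

text \<open>\<open>Y\<close> is the exact solution on the grid, \<open>V\<close> sums increments
  with coefficients taken at \<open>Y\<close>, \<open>Z\<close> is the Milstein scheme and
  \<open>P\<close> stands for \<open>G_Gx G\<close>. Exchanging \<open>Y\<close> for
  \<open>V\<close> in a coefficient costs \<open>H * \<kappa> \<le> \<delta>\<close>. By
  \<open>SG_close\<close>, the diffusion coefficient of G along the solution is nearly the function
  that the correction term of the scheme integrates.\<close>

locale milstein_error = grid_process M \<G> w \<epsilon> L N \<delta> \<T> K Q good V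
  for M :: "'a measure" and \<G> :: "nat \<Rightarrow> 'a measure" and w :: "nat \<Rightarrow> 'a \<Rightarrow> real" and \<epsilon> :: real
    and L N :: nat and \<delta> \<T> K Q :: real and good :: "nat \<Rightarrow> 'a \<Rightarrow> bool" and V :: "nat \<Rightarrow> 'a \<Rightarrow> real" +
  fixes F G P :: "real \<Rightarrow> real \<Rightarrow> real" and Y Z :: "nat \<Rightarrow> 'a \<Rightarrow> real" and H \<kappa> x0 :: real
    and DF SF qF rF DG SG qG rG DP SP qP rP :: "nat \<Rightarrow> 'a \<Rightarrow> real"
  assumes H_nonneg: "H \<ge> 0" and H_le_K: "H \<le> K"
    and kappa: "0 \<le> \<kappa>" "\<kappa> \<le> 1" "H * \<kappa> \<le> \<delta>"
    and coeff_measurable: "\<And>j. F (real j * \<epsilon>) \<in> borel_measurable borel" "\<And>j. G (real j * \<epsilon>) \<in> borel_measurable borel"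
      "\<And>j. P (real j * \<epsilon>) \<in> borel_measurable borel"
    and lip: "\<And>j x y. j \<le> N * L \<Longrightarrow> \<bar>F (real j * \<epsilon>) x - F (real j * \<epsilon>) y\<bar> \<le> H * \<bar>x - y\<bar>"
      "\<And>j x y. j \<le> N * L \<Longrightarrow> \<bar>G (real j * \<epsilon>) x - G (real j * \<epsilon>) y\<bar> \<le> H * \<bar>x - y\<bar>"
      "\<And>j x y. j \<le> N * L \<Longrightarrow> \<bar>P (real j * \<epsilon>) x - P (real j * \<epsilon>) y\<bar> \<le> H * \<bar>x - y\<bar>"
    and growth: "\<And>j x. j \<le> N * L \<Longrightarrow> \<bar>F (real j * \<epsilon>) x\<bar> \<le> H * (1 + \<bar>x\<bar>)"
      "\<And>j x. j \<le> N * L \<Longrightarrow> \<bar>G (real j * \<epsilon>) x\<bar> \<le> H * (1 + \<bar>x\<bar>)"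
      "\<And>j x. j \<le> N * L \<Longrightarrow> \<bar>P (real j * \<epsilon>) x\<bar> \<le> H * (1 + \<bar>x\<bar>)"
    and Y_adapted: "\<And>j. Y j \<in> borel_measurable (\<G> j)" and Z_adapted: "\<And>j. Z j \<in> borel_measurable (\<G> j)"
    and Y_close: "\<And>j z. z \<in> space M \<Longrightarrow> good j z \<Longrightarrow> \<bar>Y j z - V j z\<bar> \<le> \<kappa>"
    and V_0: "\<And>z. z \<in> space M \<Longrightarrow> V 0 z = x0" and Z_0: "\<And>z. z \<in> space M \<Longrightarrow> Z 0 z = x0"
    and V_Suc: "\<And>j z. z \<in> space M \<Longrightarrow> V (Suc j) z = V j z + (if good j z
        then F (real j * \<epsilon>) (Y j z) * \<epsilon> + G (real j * \<epsilon>) (Y j z) * w j z else 0)"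
    and Z_Suc: "\<And>j z. z \<in> space M \<Longrightarrow> Z (Suc j) z = Z j z
        + (F (real (block L j) * \<epsilon>) (Z (block L j) z) * \<epsilon> + G (real (block L j) * \<epsilon>) (Z (block L j) z) * w j z
        + P (real (block L j) * \<epsilon>) (Z (block L j) z)
            * ((\<Sum>i\<in>{block L j..<j}. w i z) * w j z + 1 / 2 * ((w j z)\<^sup>2 - \<epsilon>)))"
    and expF: "expands F DF SF qF rF" and expG: "expands G DG SG qG rG" and expP: "expands P DP SP qP rP"
    and SG_close: "\<And>i z. z \<in> space M \<Longrightarrow> i < N * L \<Longrightarrow> good i z \<Longrightarrow> \<bar>SG i z - P (real i * \<epsilon>) (V i z)\<bar> \<le> \<delta>"
begin

definition moment_bound :: real where
  "moment_bound = (3 * x0\<^sup>2 + 120 * H\<^sup>2 * \<T>\<^sup>2) * exp (30 * \<T>\<^sup>2 * H\<^sup>2)"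

definition weight_bound :: real where
  "weight_bound = K\<^sup>2 * (2 + 2 * moment_bound)"

text \<open>\<open>V\<close> stops when \<open>good\<close> fails but \<open>Z\<close> runs on, so
  the difference is stopped increment by increment; its coefficients remain adapted.\<close>

definition err :: "nat \<Rightarrow> 'a \<Rightarrow> real" where
  "err l z = (\<Sum>j<l. if good j z then (V (Suc j) z - V j z) - (Z (Suc j) z - Z j z) else 0)"

lemma measurable_YZ [measurable]: "Y j \<in> borel_measurable M" "Z j \<in> borel_measurable M"
  using Y_adapted Z_adapted measurable_G by blast+

lemma measurable_err [measurable]: "err l \<in> borel_measurable M"
  unfolding err_def[abs_def] by measurable

lemma time_le: "l \<le> N * L \<Longrightarrow> real l * \<epsilon> \<le> \<T>"
  unfolding horizon(1) using eps_pos by (intro mult_right_mono of_nat_mono) auto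

lemma err_good:
  assumes z: "z \<in> space M" and g: "good j z" and l: "l \<le> Suc j" shows "err l z = V l z - Z l z"
  using l
proof (induction l)
  case 0
  then show ?case by (simp add: err_def V_0[OF z] Z_0[OF z])
next
  case (Suc l)
  then have "good l z" using g good_mono[of l j] by simp
  then show ?case using Suc by (simp add: err_def)
qed

text \<open>Good indices form an initial segment, so a frozen error equals the error at the stop;
  pathwise estimates then involve good indices only.\<close>

lemma err_stops: "\<exists>l'\<le>l. err l z = err l' z \<and> (\<forall>j<l'. good j z)"
proof (induction l)
  case 0
  then show ?case by simp
next
  case (Suc l)
  show ?case
  proof (cases "good l z")
    case True
    then show ?thesis using good_mono[of _ l z] by (intro exI[of _ "Suc l"]) auto
  next
    case False
    then have "err (Suc l) z = err l z" by (simp add: err_def)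
    then show ?thesis using Suc by (metis le_SucI)
  qed
qed

lemma measurable_weight [measurable]: "weight i \<in> borel_measurable M"
  unfolding weight_def[abs_def] by measurable

text \<open>Cauchy-Schwarz for the drift costs a factor \<open>\<T>\<close>, the noise is bounded by
  Doob's inequality, and Gronwall's lemma turns a rate of order
  \<open>\<T> * H\<^sup>2 * \<epsilon>\<close> over \<open>\<T> / \<epsilon>\<close> steps into the
  exponent of \<open>moment_bound\<close>.\<close>

lemma V_moment:
  assumes "l \<le> N * L" shows "second_moment M (V l) \<le> ennreal moment_bound"
proof -
  let ?f = "\<lambda>j z. if good j z then F (real j * \<epsilon>) (Y j z) else 0"
  let ?g = "\<lambda>j z. if good j z then G (real j * \<epsilon>) (Y j z) else 0"
  have [measurable]: "F (real j * \<epsilon>) \<in> borel_measurable borel" "G (real j * \<epsilon>) \<in> borel_measurable borel" for j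
    using coeff_measurable by auto
  have gad: "?g j \<in> borel_measurable (\<G> j)" for j
  proof -
    have [measurable]: "Y j \<in> borel_measurable (\<G> j)" "Measurable.pred (\<G> j) (good j)"
      using Y_adapted good_measurable by auto
    show ?thesis by measurable
  qed
  have V_eq: "V l z = x0 + (\<Sum>j<l. ?f j z * \<epsilon>) + (\<Sum>j<l. ?g j z * w j z)" if "z \<in> space M" for l z
    using that by (induction l) (auto simp: V_0 V_Suc)
  have fg: "second_moment M (?f j) \<le> ennreal (8 * H\<^sup>2) + ennreal (2 * H\<^sup>2) * second_moment M (V j)"
      "second_moment M (?g j) \<le> ennreal (8 * H\<^sup>2) + ennreal (2 * H\<^sup>2) * second_moment M (V j)" if j: "j < N * L" for j
  proof -
    have main: "second_moment M (\<lambda>z. if good j z then \<Phi> (Y j z) else 0) \<le> ennreal (8 * H\<^sup>2) + ennreal (2 * H\<^sup>2) * second_moment M (V j)"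
      if gr: "\<And>x. \<bar>\<Phi> x\<bar> \<le> H * (1 + \<bar>x\<bar>)" for \<Phi> :: "real \<Rightarrow> real"
    proof -
      \<comment> \<open>The coefficients are evaluated at \<open>Y\<close>, which is within 1 of
        \<open>V\<close>; this gives 2 + |V| instead of 1 + |V|.\<close>
      have "\<bar>if good j z then \<Phi> (Y j z) else 0\<bar> \<le> \<bar>2 * H\<bar> + \<bar>H * V j z\<bar>" if "z \<in> space M" for z
      proof (cases "good j z")
        case True
        then have "\<bar>Y j z - V j z\<bar> \<le> 1" using Y_close[OF that True] kappa by simp
        then have "H * (1 + \<bar>Y j z\<bar>) \<le> H * (2 + \<bar>V j z\<bar>)" using H_nonneg by (intro mult_left_mono) auto
        then show ?thesis using gr[of "Y j z"] True H_nonneg by (simp add: abs_mult algebra_simps)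
      qed (use H_nonneg in auto)
      then have "second_moment M (\<lambda>z. if good j z then \<Phi> (Y j z) else 0)
        \<le> 2 * (ennreal (4 * H\<^sup>2) + ennreal (H\<^sup>2) * second_moment M (V j))"
        by (intro second_moment_le2[where ?f1.0="\<lambda>_. 2 * H" and ?f2.0="\<lambda>z. H * V j z"])
           (auto simp: second_moment_cmult, simp add: second_moment_def emeasure_space_1 power_mult_distrib ennreal_mult)
      then show ?thesis by (simp add: distrib_left ennreal_mult mult.assoc[symmetric])
    qed
    show "second_moment M (?f j) \<le> ennreal (8 * H\<^sup>2) + ennreal (2 * H\<^sup>2) * second_moment M (V j)"
      "second_moment M (?g j) \<le> ennreal (8 * H\<^sup>2) + ennreal (2 * H\<^sup>2) * second_moment M (V j)"
      using main growth j by auto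
  qed
  have step: "second_moment M (V l) \<le> ennreal (3 * x0\<^sup>2 + 120 * H\<^sup>2 * \<T>\<^sup>2) + ennreal (30 * \<T> * H\<^sup>2 * \<epsilon>) * (\<Sum>j<l. second_moment M (V j))"
    if l: "l \<le> N * L" for l
  proof -
    let ?\<Sigma> = "\<Sum>j<l. second_moment M (V j)"
    have le: "real l * \<epsilon> \<le> \<T>" using time_le[OF l] .
    let ?s = "ennreal (8 * H\<^sup>2 * real l) + ennreal (2 * H\<^sup>2) * ?\<Sigma>"
    have sums: "(\<Sum>j<l. second_moment M (?f j)) \<le> ?s" "(\<Sum>j<l. second_moment M (?g j)) \<le> ?s"
    proof -
      have e: "(\<Sum>j<l. ennreal (8 * H\<^sup>2) + ennreal (2 * H\<^sup>2) * second_moment M (V j)) = ?s"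
      proof -
        have "(\<Sum>j<l. ennreal (8 * H\<^sup>2)) = ennreal (8 * H\<^sup>2 * real l)"
          by (simp add: ennreal_mult ennreal_of_nat_eq_real_of_nat mult.commute)
        then show ?thesis by (simp only: sum.distrib sum_distrib_left)
      qed
      show "(\<Sum>j<l. second_moment M (?f j)) \<le> ?s" "(\<Sum>j<l. second_moment M (?g j)) \<le> ?s"
        unfolding e[symmetric] using fg l by (auto intro!: sum_mono)
    qed
    have a: "second_moment M (\<lambda>_. x0) \<le> ennreal (x0\<^sup>2)" by (simp add: second_moment_def emeasure_space_1)
    have f1: "second_moment M (\<lambda>z. \<Sum>j<l. ?f j z * \<epsilon>) \<le> ennreal (real l * \<epsilon>\<^sup>2) * ?s"
    proof -
      have "second_moment M (\<lambda>z. \<Sum>j<l. ?f j z * \<epsilon>) \<le> ennreal (real (card {..<l})) * (\<Sum>j<l. second_moment M (\<lambda>z. ?f j z * \<epsilon>))"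
      proof (rule second_moment_sum_bound)
        show "(\<lambda>z. ?f j z * \<epsilon>) \<in> borel_measurable M" for j by measurable
      qed (rule sum_abs)
      also have "(\<Sum>j<l. second_moment M (\<lambda>z. ?f j z * \<epsilon>)) = ennreal (\<epsilon>\<^sup>2) * (\<Sum>j<l. second_moment M (?f j))"
        unfolding sum_distrib_left by (intro sum.cong refl) (subst mult.commute, rule second_moment_cmult, measurable)
      also have "\<dots> \<le> ennreal (\<epsilon>\<^sup>2) * ?s" by (intro mult_left_mono sums) auto
      finally show ?thesis by (simp add: ennreal_mult mult.assoc mult_left_mono ennreal_of_nat_eq_real_of_nat)
    qed
    have g1: "second_moment M (\<lambda>z. \<Sum>j<l. ?g j z * w j z) \<le> ennreal (4 * \<epsilon>) * ?s"
    proof -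
      have "second_moment M (\<lambda>z. \<Sum>j<l. ?g j z * w j z) \<le> second_moment M (\<lambda>z. running_max (\<lambda>l. \<Sum>j<l. ?g j z * w j z) l)"
      proof (rule second_moment_mono)
        fix z show "\<bar>\<Sum>j<l. ?g j z * w j z\<bar> \<le> \<bar>running_max (\<lambda>l. \<Sum>j<l. ?g j z * w j z) l\<bar>"
          using running_max_ge[of l l "\<lambda>l. \<Sum>j<l. ?g j z * w j z"] by linarith
      qed
      also have "\<dots> \<le> ennreal (4 * \<epsilon>) * (\<Sum>j<l. second_moment M (?g j))"
        by (rule doob_w) (rule gad)
      also have "\<dots> \<le> ennreal (4 * \<epsilon>) * ?s" by (intro mult_left_mono sums) auto
      finally show ?thesis .
    qed
    have "second_moment M (V l) \<le> 3 * (ennreal (x0\<^sup>2) + ennreal (real l * \<epsilon>\<^sup>2) * ?s + ennreal (4 * \<epsilon>) * ?s)"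
      by (rule second_moment_le3[OF _ _ _ _ a f1 g1]) (measurable, auto simp: V_eq)
    also have "\<dots> = 3 * (ennreal (x0\<^sup>2) + ennreal (real l * \<epsilon>\<^sup>2 + 4 * \<epsilon>) * ?s)"
      using eps_pos by (simp add: distrib_right add.assoc)
    also have "\<dots> \<le> 3 * (ennreal (x0\<^sup>2) + ennreal (5 * \<T> * \<epsilon>) * ?s)"
    proof -
      have "real l * \<epsilon>\<^sup>2 \<le> \<T> * \<epsilon>" using le eps_pos by (simp add: power2_eq_square mult.assoc[symmetric])
      moreover have "\<epsilon> \<le> \<T> * \<epsilon>" using horizon(2) eps_pos by simp
      ultimately have "real l * \<epsilon>\<^sup>2 + 4 * \<epsilon> \<le> 5 * \<T> * \<epsilon>" by linarith
      then show ?thesis by (intro mult_left_mono add_left_mono mult_right_mono ennreal_leI) auto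
    qed
    also have "\<dots> = ennreal (3 * x0\<^sup>2) + ennreal (120 * H\<^sup>2 * \<T> * (real l * \<epsilon>)) + ennreal (30 * \<T> * H\<^sup>2 * \<epsilon>) * ?\<Sigma>"
      using horizon(2) eps_pos
      by (simp add: distrib_left add.assoc mult.assoc[symmetric] ennreal_numeral_mult ennreal_mult[symmetric])
         (simp add: mult_ac)
    also have "\<dots> \<le> ennreal (3 * x0\<^sup>2) + ennreal (120 * H\<^sup>2 * \<T> * \<T>) + ennreal (30 * \<T> * H\<^sup>2 * \<epsilon>) * ?\<Sigma>"
      using le horizon(2) by (intro add_mono ennreal_leI mult_left_mono) auto
    also have "\<dots> = ennreal (3 * x0\<^sup>2 + 120 * H\<^sup>2 * \<T>\<^sup>2) + ennreal (30 * \<T> * H\<^sup>2 * \<epsilon>) * ?\<Sigma>"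
    proof -
      have e: "120 * H\<^sup>2 * \<T> * \<T> = 120 * H\<^sup>2 * \<T>\<^sup>2" by (simp add: power2_eq_square)
      show ?thesis unfolding e by (simp add: ennreal_plus)
    qed
    finally show ?thesis .
  qed
  have "second_moment M (V l) \<le> ennreal ((3 * x0\<^sup>2 + 120 * H\<^sup>2 * \<T>\<^sup>2) * exp (30 * \<T> * H\<^sup>2 * \<epsilon> * real l))"
    by (rule gronwall_ennreal[OF step]) (use assms horizon(2) eps_pos in auto)
  also have "\<dots> \<le> ennreal moment_bound"
    unfolding moment_bound_def
  proof (intro ennreal_leI mult_left_mono)
    have "real l * \<epsilon> \<le> \<T>" using time_le[OF assms] .
    then have "30 * \<T> * H\<^sup>2 * (real l * \<epsilon>) \<le> 30 * \<T> * H\<^sup>2 * \<T>" using horizon(2) by (intro mult_left_mono) auto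
    then show "exp (30 * \<T> * H\<^sup>2 * \<epsilon> * real l) \<le> exp (30 * \<T>\<^sup>2 * H\<^sup>2)"
      by (simp add: power2_eq_square mult_ac)
  qed auto
  finally show ?thesis .
qed

lemma moment_bound_nonneg: "0 \<le> moment_bound" and weight_bound_nonneg: "0 \<le> weight_bound"
  by (auto simp: moment_bound_def weight_bound_def)

lemma weight_moment:
  assumes "i < N * L" shows "second_moment M (weight i) \<le> ennreal weight_bound"
proof -
  have a: "second_moment M (\<lambda>_. K) \<le> ennreal (K\<^sup>2)" by (simp add: second_moment_def emeasure_space_1)
  have c: "second_moment M (\<lambda>z. K * V i z) \<le> ennreal (K\<^sup>2 * moment_bound)"
    using V_moment[of i] assms moment_bound_nonneg by (subst second_moment_cmult) (auto simp: ennreal_mult intro: mult_left_mono)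
  have "second_moment M (weight i) \<le> 2 * (ennreal (K\<^sup>2) + ennreal (K\<^sup>2 * moment_bound))"
    by (rule second_moment_le2[OF _ _ _ a c]) (use K_nonneg in \<open>auto simp: weight_def abs_mult algebra_simps\<close>)
  also have "\<dots> = ennreal (2 * (K\<^sup>2 + K\<^sup>2 * moment_bound))"
    using moment_bound_nonneg by (intro ennreal_numeral_mult_sum) auto
  also have "2 * (K\<^sup>2 + K\<^sup>2 * moment_bound) = weight_bound" by (simp add: weight_bound_def algebra_simps)
  finally show ?thesis .
qed

lemma second_moment_if_le:
  assumes "second_moment M f \<le> x"
  shows "second_moment M (\<lambda>z. if good j z then f z else 0) \<le> x"
  by (rule order_trans[OF second_moment_mono assms]) auto

definition max_err :: "nat \<Rightarrow> 'a \<Rightarrow> real" where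
  "max_err l z = running_max (\<lambda>i. err i z) l"

lemma measurable_max_err [measurable]: "max_err l \<in> borel_measurable M"
  unfolding max_err_def[abs_def] by measurable

lemma err_block_moment:
  assumes "i \<le> j" shows "second_moment M (err i) \<le> second_moment M (max_err j)"
  by (rule second_moment_mono)
     (use running_max_ge[OF assms] running_max_nonneg in \<open>auto simp: max_err_def\<close>)

lemma V_minus_Z_block:
  assumes "z \<in> space M" "good j z"
  shows "err (block L j) z = V (block L j) z - Z (block L j) z"
  using assms block_le[of L j] by (intro err_good) auto

text \<open>This and the next two are the coefficients of \<epsilon>, w and w^2 - \<epsilon> in the
  increments of \<open>err\<close>. In \<open>diff_diff\<close> the noise accumulated since the
  start of the block enters through the Milstein correction.\<close>

definition drift_diff :: "nat \<Rightarrow> 'a \<Rightarrow> real" where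
  "drift_diff j z = (if good j z then F (real j * \<epsilon>) (Y j z) - F (real (block L j) * \<epsilon>) (Z (block L j) z) else 0)"

definition diff_diff :: "nat \<Rightarrow> 'a \<Rightarrow> real" where
  "diff_diff j z = (if good j z then G (real j * \<epsilon>) (Y j z) - G (real (block L j) * \<epsilon>) (Z (block L j) z)
      - P (real (block L j) * \<epsilon>) (Z (block L j) z) * (\<Sum>i\<in>{block L j..<j}. w i z) else 0)"

definition sq_diff :: "nat \<Rightarrow> 'a \<Rightarrow> real" where
  "sq_diff j z = (if good j z then - (1 / 2 * P (real (block L j) * \<epsilon>) (Z (block L j) z)) else 0)"

lemma err_eq:
  assumes "z \<in> space M"
  shows "err l z = (\<Sum>j<l. drift_diff j z * \<epsilon>) + (\<Sum>j<l. diff_diff j z * w j z)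
      + (\<Sum>j<l. sq_diff j z * ((w j z)\<^sup>2 - \<epsilon>))"
  unfolding err_def sum.distrib[symmetric]
  by (intro sum.cong refl) (auto simp: V_Suc[OF assms] Z_Suc[OF assms] drift_diff_def diff_diff_def sq_diff_def algebra_simps)

lemma adapted_diffs:
  "drift_diff j \<in> borel_measurable (\<G> j)" "diff_diff j \<in> borel_measurable (\<G> j)" "sq_diff j \<in> borel_measurable (\<G> j)"
proof -
  have [measurable]: "F (real j * \<epsilon>) \<in> borel_measurable borel" "G (real j * \<epsilon>) \<in> borel_measurable borel"
     "P (real j * \<epsilon>) \<in> borel_measurable borel" for j using coeff_measurable by auto
  have [measurable]: "Y j \<in> borel_measurable (\<G> j)" "Measurable.pred (\<G> j) (good j)" using Y_adapted good_measurable by auto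
  have [measurable]: "Z (block L j) \<in> borel_measurable (\<G> j)"
    using measurable_G_mono[OF block_le Z_adapted] .
  have [measurable]: "(\<lambda>z. \<Sum>i\<in>{block L j..<j}. w i z) \<in> borel_measurable (\<G> j)"
    by (intro borel_measurable_sum) (auto intro!: measurable_G_mono[OF _ w_adapted])
  show "drift_diff j \<in> borel_measurable (\<G> j)" "diff_diff j \<in> borel_measurable (\<G> j)" "sq_diff j \<in> borel_measurable (\<G> j)"
    unfolding drift_diff_def[abs_def] diff_diff_def[abs_def] sq_diff_def[abs_def] by measurable
qed

lemma measurable_diffs [measurable]:
  "drift_diff j \<in> borel_measurable M" "diff_diff j \<in> borel_measurable M" "sq_diff j \<in> borel_measurable M"
  using adapted_diffs measurable_G by blast+

text \<open>The bound is not small in \<delta>; smallness comes later from the factor \<epsilon>^2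
  of \<open>doob_w_sq\<close> together with \<epsilon> \<le> \<delta>^2.\<close>

lemma sq_diff_moment:
  assumes j: "j < N * L"
  shows "second_moment M (sq_diff j) \<le> ennreal weight_bound + ennreal (H\<^sup>2) * second_moment M (max_err j)"
proof -
  have bj: "block L j \<le> N * L" "block L j < N * L" using block_le[of L j] j by auto
  have "second_moment M (sq_diff j) \<le> 2 * (ennreal (1/4 * weight_bound) + ennreal (1/4 * H\<^sup>2) * second_moment M (max_err j))"
  proof (rule second_moment_le2[where ?f1.0="\<lambda>z. 1/2 * weight (block L j) z" and ?f2.0="\<lambda>z. H / 2 * err (block L j) z"])
    show "second_moment M (\<lambda>z. 1/2 * weight (block L j) z) \<le> ennreal (1/4 * weight_bound)"
    proof -
      have "second_moment M (\<lambda>z. 1/2 * weight (block L j) z) = ennreal ((1/2)\<^sup>2) * second_moment M (weight (block L j))"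
        by (rule second_moment_cmult) measurable
      also have "\<dots> \<le> ennreal ((1/2)\<^sup>2) * ennreal weight_bound"
        by (intro mult_left_mono weight_moment bj) auto
      also have "\<dots> = ennreal (1/4 * weight_bound)"
        using weight_bound_nonneg by (subst ennreal_mult[symmetric]) (auto simp: power_divide)
      finally show ?thesis .
    qed
    show "second_moment M (\<lambda>z. H / 2 * err (block L j) z) \<le> ennreal (1/4 * H\<^sup>2) * second_moment M (max_err j)"
      using err_block_moment[OF block_le[of L j]]
      by (subst second_moment_cmult) (auto simp: power_divide intro: mult_left_mono)
    fix z assume z: "z \<in> space M"
    show "\<bar>sq_diff j z\<bar> \<le> \<bar>1/2 * weight (block L j) z\<bar> + \<bar>H / 2 * err (block L j) z\<bar>"
    proof (cases "good j z")
      case True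
      let ?b = "block L j"
      have gb: "good ?b z" using good_mono[OF block_le True] .
      have "\<bar>P (real ?b * \<epsilon>) (Z ?b z) - P (real ?b * \<epsilon>) (V ?b z)\<bar> \<le> H * \<bar>err ?b z\<bar>"
        unfolding V_minus_Z_block[OF z True] using lip(3)[OF bj(1)] by (simp add: abs_minus_commute)
      moreover have "\<bar>P (real ?b * \<epsilon>) (V ?b z)\<bar> \<le> weight ?b z"
      proof -
        have "\<bar>P (real ?b * \<epsilon>) (V ?b z)\<bar> \<le> H * (1 + \<bar>V ?b z\<bar>)" by (rule growth(3)[OF bj(1)])
        also have "\<dots> \<le> K * (1 + \<bar>V ?b z\<bar>)" using H_le_K by (intro mult_right_mono) auto
        finally show ?thesis using gb by (simp add: weight_def)
      qed
      ultimately have "\<bar>P (real ?b * \<epsilon>) (Z ?b z)\<bar> \<le> weight ?b z + H * \<bar>err ?b z\<bar>" by linarith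
      then show ?thesis using True H_nonneg weight_nonneg[of ?b z] by (simp add: sq_diff_def abs_mult)
    qed (simp add: sq_diff_def)
  qed auto
  also have "\<dots> = ennreal (1/2 * weight_bound) + ennreal (1/2 * H\<^sup>2) * second_moment M (max_err j)"
    using weight_bound_nonneg by (simp add: distrib_left mult.assoc[symmetric] ennreal_numeral_mult)
  also have "\<dots> \<le> ennreal weight_bound + ennreal (H\<^sup>2) * second_moment M (max_err j)"
    using weight_bound_nonneg by (intro add_mono mult_right_mono ennreal_leI) auto
  finally show ?thesis .
qed

text \<open>The difference splits into G at \<open>Y\<close> against G at \<open>V\<close>, the
  increment of G over the block minus G G_x times the block noise, the propagated error in G, and
  the propagated error in the correction. In the second piece the martingale integrand is itself of
  order sqrt \<delta>, so a block of length \<delta> gives order \<delta>: the gain over the Euler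
  scheme.\<close>

lemma diff_diff_moment:
  assumes j: "j < N * L"
  shows "second_moment M (diff_diff j) \<le> ennreal (1396 * \<delta>\<^sup>2 * (weight_bound + 1)) + ennreal (20 * H\<^sup>2) * second_moment M (max_err j)"
proof -
  let ?b = "block L j" and ?\<phi> = "second_moment M (max_err j)" and ?B = "weight_bound"
  have bj: "?b \<le> N * L" "?b < N * L" "j \<le> N * L" using block_le[of L j] j by auto
  note wb = weight_bound_nonneg weight_moment
  have [measurable]: "F (real j * \<epsilon>) \<in> borel_measurable borel" "G (real j * \<epsilon>) \<in> borel_measurable borel"
     "P (real j * \<epsilon>) \<in> borel_measurable borel" for j using coeff_measurable by auto
  have [measurable]: "SG i \<in> borel_measurable M" "block_drift DP qP rP i \<in> borel_measurable M"
    "block_drift DG qG rG i \<in> borel_measurable M" "SP i \<in> borel_measurable M" for i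
    using expands_measurable[OF wb expG] expands_measurable[OF wb expP] by auto
  \<comment> \<open>The integrand left once the correction is removed. By \<open>SG_close\<close> it
    is an increment of \<open>P\<close> within the block, up to \<delta>.\<close>
  define \<tau> where "\<tau> i z = (if good i z then SG i z - P (real ?b * \<epsilon>) (V ?b z) else 0)" for i z
  have \<tau>ad: "\<tau> i \<in> borel_measurable (\<G> i)" if "i \<in> {?b..<j}" for i
  proof -
    have [measurable]: "SG i \<in> borel_measurable (\<G> i)" "Measurable.pred (\<G> i) (good i)"
      using expG good_measurable by (auto simp: expands_def)
    have [measurable]: "V ?b \<in> borel_measurable (\<G> i)"
      using measurable_G_mono[OF _ V_adapted] that by auto
    show ?thesis unfolding \<tau>_def[abs_def] by measurable
  qed
  have \<tau>m: "second_moment M (\<tau> i) \<le> ennreal (42 * \<delta> * (?B + 1))" if i: "i \<in> {?b..<j}" for i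
  proof -
    have iN: "i < N * L" and ib: "block L i = ?b" using i j block_eq[of L j i] by auto
    have s: "second_moment M (\<lambda>_. \<delta>) \<le> ennreal (\<delta>\<^sup>2)" by (simp add: second_moment_def emeasure_space_1)
    have "second_moment M (\<tau> i) \<le> 2 * (ennreal (\<delta>\<^sup>2) + ennreal (20 * \<delta> * (?B + 1)))"
    proof (rule second_moment_le2[OF _ _ _ s block_total_second_moment[OF wb expP iN]])
      fix z assume z: "z \<in> space M"
      show "\<bar>\<tau> i z\<bar> \<le> \<bar>\<delta>\<bar> + \<bar>block_drift DP qP rP i z + (\<Sum>i = block L i..<i. SP i z * w i z)\<bar>"
      proof (cases "good i z")
        case True
        show ?thesis
          using block_increment[OF wb expP iN z True] SG_close[OF z iN True] True
          unfolding ib \<tau>_def by simp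
      qed (simp add: \<tau>_def)
    qed measurable
    also have "\<dots> = ennreal (2 * (\<delta>\<^sup>2 + 20 * \<delta> * (?B + 1)))"
      using delta_pos wb by (intro ennreal_numeral_mult_sum) auto
    also have "\<dots> \<le> ennreal (42 * \<delta> * (?B + 1))"
    proof (rule ennreal_leI)
      have "\<delta>\<^sup>2 \<le> \<delta> * 1" using delta_pos delta(2) by (simp add: power2_eq_square)
      also have "\<dots> \<le> \<delta> * (?B + 1)" using delta_pos wb by (intro mult_left_mono) auto
      finally show "2 * (\<delta>\<^sup>2 + 20 * \<delta> * (?B + 1)) \<le> 42 * \<delta> * (?B + 1)"
      proof -
        assume "\<delta>\<^sup>2 \<le> \<delta> * (?B + 1)"
        moreover have "2 * (a + 20 * x) \<le> 42 * x" if "a \<le> x" for a x :: real using that by simp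
        ultimately show ?thesis unfolding mult.assoc by blast
      qed
    qed
    finally show ?thesis .
  qed
  define X1 where "X1 z = (if good j z then block_drift DG qG rG j z else 0) + (if good j z then \<Sum>i\<in>{?b..<j}. \<tau> i z * w i z else 0)" for z
  have [measurable]: "\<tau> i \<in> borel_measurable M" for i unfolding \<tau>_def[abs_def] by measurable
  have m1: "second_moment M X1 \<le> ennreal (348 * \<delta>\<^sup>2 * (?B + 1))"
  proof -
    have a: "second_moment M (\<lambda>z. \<Sum>i\<in>{?b..<j}. \<tau> i z * w i z) \<le> ennreal (4 * \<delta> * (42 * \<delta> * (?B + 1)))"
      using \<tau>ad \<tau>m block_length[of j] delta_pos wb by (intro partial_sum_w) auto
    have "second_moment M X1 \<le> 2 * (ennreal (6 * \<delta>\<^sup>2 * (?B + 1)) + ennreal (4 * \<delta> * (42 * \<delta> * (?B + 1))))"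
      unfolding X1_def[abs_def]
      by (rule second_moment_le2[OF _ _ abs_triangle_ineq second_moment_if_le[OF block_drift_second_moment[OF wb expG j]] second_moment_if_le[OF a]])
         measurable
    also have "\<dots> = ennreal (2 * (6 * \<delta>\<^sup>2 * (?B + 1) + 4 * \<delta> * (42 * \<delta> * (?B + 1))))"
      using delta_pos wb by (intro ennreal_numeral_mult_sum) auto
    finally show ?thesis by (simp add: power2_eq_square algebra_simps)
  qed
  have m0: "second_moment M (\<lambda>_. \<delta>) \<le> ennreal (\<delta>\<^sup>2)" by (simp add: second_moment_def emeasure_space_1)
  have m2: "second_moment M (\<lambda>z. H * err ?b z) \<le> ennreal (H\<^sup>2) * ?\<phi>"
    using err_block_moment[OF block_le[of L j]] by (subst second_moment_cmult) (auto intro: mult_left_mono)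
  \<comment> \<open>Known at the start of the block, so its product with the block noise is again a
    martingale transform.\<close>
  define c where "c z = (if good ?b z then P (real ?b * \<epsilon>) (V ?b z) - P (real ?b * \<epsilon>) (Z ?b z) else 0)" for z
  have cad: "c \<in> borel_measurable (\<G> ?b)"
  proof -
    have [measurable]: "V ?b \<in> borel_measurable (\<G> ?b)" "Z ?b \<in> borel_measurable (\<G> ?b)" "Measurable.pred (\<G> ?b) (good ?b)"
      using V_adapted Z_adapted good_measurable by auto
    show ?thesis unfolding c_def[abs_def] by measurable
  qed
  have [measurable]: "c \<in> borel_measurable M" using measurable_G[OF cad] .
  have m3: "second_moment M (\<lambda>z. \<Sum>i\<in>{?b..<j}. c z * w i z) \<le> ennreal (4 * H\<^sup>2) * ?\<phi>"
  proof -
    have cm: "second_moment M c \<le> ennreal (H\<^sup>2) * ?\<phi>"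
    proof -
      have "second_moment M c \<le> second_moment M (\<lambda>z. H * err ?b z)"
      proof (rule second_moment_mono)
        fix z assume z: "z \<in> space M"
        show "\<bar>c z\<bar> \<le> \<bar>H * err ?b z\<bar>"
        proof (cases "good ?b z")
          case True
          have "err ?b z = V ?b z - Z ?b z" using err_good[OF z True, of ?b] by simp
          then show ?thesis using lip(3)[OF bj(1), of "V ?b z" "Z ?b z"] H_nonneg True by (simp add: c_def abs_mult)
        qed (simp add: c_def)
      qed
      then show ?thesis using m2 by simp
    qed
    define g where "g i z = (if ?b \<le> i then c z else 0)" for i z
    have gad: "g i \<in> borel_measurable (\<G> i)" for i
      unfolding g_def by (cases "?b \<le> i") (auto intro: measurable_G_mono[OF _ cad])
    have "second_moment M (\<lambda>z. \<Sum>i\<in>{?b..<j}. c z * w i z) \<le> second_moment M (\<lambda>z. running_max (\<lambda>l. \<Sum>i<l. g i z * w i z) j)"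
    proof (rule second_moment_mono)
      fix z
      have "(\<Sum>i\<in>{?b..<j}. c z * w i z) = (\<Sum>i<j. g i z * w i z)"
        unfolding g_def by (intro sum.mono_neutral_cong_left) auto
      then show "\<bar>\<Sum>i\<in>{?b..<j}. c z * w i z\<bar> \<le> \<bar>running_max (\<lambda>l. \<Sum>i<l. g i z * w i z) j\<bar>"
        using running_max_ge[of j j "\<lambda>l. \<Sum>i<l. g i z * w i z"] by simp
    qed
    also have "\<dots> \<le> ennreal (4 * \<epsilon>) * (\<Sum>i<j. second_moment M (g i))" by (rule doob_w) (rule gad)
    also have "(\<Sum>i<j. second_moment M (g i)) = (\<Sum>i\<in>{?b..<j}. second_moment M c)"
      unfolding g_def by (intro sum.mono_neutral_cong_right) (auto simp: second_moment_def)
    also have "\<dots> = ennreal (real (j - ?b)) * second_moment M c" by (simp add: ennreal_of_nat_eq_real_of_nat)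
    also have "ennreal (4 * \<epsilon>) * (ennreal (real (j - ?b)) * second_moment M c) = ennreal (4 * (real (j - ?b) * \<epsilon>)) * second_moment M c"
      using eps_pos by (simp add: mult.assoc[symmetric] ennreal_mult[symmetric]) (simp add: mult_ac)
    also have "\<dots> \<le> ennreal 4 * (ennreal (H\<^sup>2) * ?\<phi>)"
      using block_length[of j] delta(2) by (intro mult_mono ennreal_leI cm) auto
    also have "\<dots> = ennreal (4 * H\<^sup>2) * ?\<phi>" by (simp add: ennreal_mult mult.assoc)
    finally show ?thesis .
  qed
  have "second_moment M (diff_diff j) \<le> 4 * (ennreal (\<delta>\<^sup>2) + ennreal (348 * \<delta>\<^sup>2 * (?B + 1)) + ennreal (H\<^sup>2) * ?\<phi> + ennreal (4 * H\<^sup>2) * ?\<phi>)"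
  proof (rule second_moment_le4[OF _ _ _ _ _ m0 m1 m2 m3])
    fix z assume z: "z \<in> space M"
    show "\<bar>diff_diff j z\<bar> \<le> \<bar>\<delta>\<bar> + \<bar>X1 z\<bar> + \<bar>H * err ?b z\<bar> + \<bar>\<Sum>i\<in>{?b..<j}. c z * w i z\<bar>"
    proof (cases "good j z")
      case True
      let ?W = "\<Sum>i\<in>{?b..<j}. w i z"
      have gb: "good ?b z" using good_mono[OF block_le True] .
      have x1: "X1 z = G (real j * \<epsilon>) (V j z) - G (real ?b * \<epsilon>) (V ?b z) - P (real ?b * \<epsilon>) (V ?b z) * ?W"
      proof -
        have "(\<Sum>i\<in>{?b..<j}. \<tau> i z * w i z) = (\<Sum>i\<in>{?b..<j}. SG i z * w i z - P (real ?b * \<epsilon>) (V ?b z) * w i z)"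
          using good_mono[OF _ True] by (intro sum.cong) (auto simp: \<tau>_def algebra_simps)
        also have "\<dots> = (\<Sum>i\<in>{?b..<j}. SG i z * w i z) - P (real ?b * \<epsilon>) (V ?b z) * ?W"
          by (simp add: sum_subtractf sum_distrib_left)
        finally show ?thesis using block_increment[OF wb expG j z True] True by (simp add: X1_def)
      qed
      have c1: "(\<Sum>i\<in>{?b..<j}. c z * w i z) = (P (real ?b * \<epsilon>) (V ?b z) - P (real ?b * \<epsilon>) (Z ?b z)) * ?W"
        using gb by (simp add: c_def sum_distrib_left)
      have l1: "\<bar>G (real j * \<epsilon>) (Y j z) - G (real j * \<epsilon>) (V j z)\<bar> \<le> \<delta>"
      proof -
        have "\<bar>G (real j * \<epsilon>) (Y j z) - G (real j * \<epsilon>) (V j z)\<bar> \<le> H * \<bar>Y j z - V j z\<bar>" by (rule lip(2)[OF bj(3)])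
        also have "\<dots> \<le> H * \<kappa>" using Y_close[OF z True] H_nonneg by (intro mult_left_mono) auto
        finally show ?thesis using kappa by simp
      qed
      have l2: "\<bar>G (real ?b * \<epsilon>) (V ?b z) - G (real ?b * \<epsilon>) (Z ?b z)\<bar> \<le> \<bar>H * err ?b z\<bar>"
        unfolding V_minus_Z_block[OF z True] using lip(2)[OF bj(1)] H_nonneg by (simp add: abs_mult)
      have "diff_diff j z = (G (real j * \<epsilon>) (Y j z) - G (real j * \<epsilon>) (V j z)) + X1 z
          + (G (real ?b * \<epsilon>) (V ?b z) - G (real ?b * \<epsilon>) (Z ?b z)) + (\<Sum>i\<in>{?b..<j}. c z * w i z)"
        unfolding c1 x1 using True by (simp add: diff_diff_def algebra_simps)
      then show ?thesis using l1 l2 delta_pos by linarith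
    qed (simp add: diff_diff_def)
  qed (auto simp: X1_def[abs_def])
  also have "\<dots> = 4 * (ennreal (\<delta>\<^sup>2) + ennreal (348 * \<delta>\<^sup>2 * (?B + 1)) + ennreal (5 * H\<^sup>2) * ?\<phi>)"
  proof -
    have "ennreal (5 * H\<^sup>2) = ennreal (H\<^sup>2) + ennreal (4 * H\<^sup>2)" by (simp add: ennreal_plus[symmetric] del: ennreal_plus)
    then show ?thesis by (simp add: distrib_right add.assoc)
  qed
  also have "\<dots> = ennreal (4 * (\<delta>\<^sup>2 + 348 * \<delta>\<^sup>2 * (?B + 1))) + ennreal (20 * H\<^sup>2) * ?\<phi>"
  proof -
    have "4 * (ennreal (\<delta>\<^sup>2) + ennreal (348 * \<delta>\<^sup>2 * (?B + 1))) = ennreal (4 * (\<delta>\<^sup>2 + 348 * \<delta>\<^sup>2 * (?B + 1)))"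
      using wb by (intro ennreal_numeral_mult_sum) auto
    moreover have "4 * (ennreal (5 * H\<^sup>2) * ?\<phi>) = ennreal (20 * H\<^sup>2) * ?\<phi>"
      by (simp add: mult.assoc[symmetric] ennreal_numeral_mult)
    ultimately show ?thesis by (simp only: distrib_left[of 4 "_ + _" "_ * _"])
  qed
  also have "\<dots> \<le> ennreal (1396 * \<delta>\<^sup>2 * (?B + 1)) + ennreal (20 * H\<^sup>2) * ?\<phi>"
    using wb by (intro add_right_mono ennreal_leI) (simp add: algebra_simps)
  finally show ?thesis .
qed

text \<open>33840 is 6 times 5640: six error terms, whose constants 1, 6, 40, 5584 and 8 add up to
  less than 5640. The Gronwall exponent 534 is rounded up to 540.\<close>

definition error_constant :: real where
  "error_constant = 33840 * \<T>\<^sup>2 * (weight_bound + 1) * exp (540 * \<T>\<^sup>2 * H\<^sup>2)"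

text \<open>Expanding F over each block leaves six contributions: \<open>Y\<close> in place of
  \<open>V\<close>, the block drift, the integrated block martingale, the propagated error and two
  martingale terms. The block martingale alone is of order sqrt \<delta>;
  \<open>integrated_block_bound\<close> restores order \<delta>.\<close>

theorem max_err_bound:
  "second_moment M (max_err (N * L)) \<le> ennreal (error_constant * \<delta>\<^sup>2)"
proof -
  let ?n = "N * L" and ?B = "weight_bound"
  note wb = weight_bound_nonneg weight_moment
  define \<phi> where "\<phi> l = second_moment M (max_err l)" for l
  have [measurable]: "block_drift DF qF rF i \<in> borel_measurable M" "SF i \<in> borel_measurable M" for i
    using expands_measurable[OF wb expF] by auto
  define A2 where "A2 z = (\<Sum>j<?n. \<epsilon> * \<bar>block_drift DF qF rF j z\<bar>)" for z
  define A3 where "A3 z = running_max (\<lambda>l. \<epsilon> * (\<Sum>j<l. \<Sum>i\<in>{block L j..<j}. SF i z * w i z)) ?n" for z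
  define A4 where "A4 l z = (\<Sum>j<l. \<epsilon> * (H * \<bar>err (block L j) z\<bar>))" for l z
  define A5 where "A5 l z = running_max (\<lambda>l. \<Sum>j<l. diff_diff j z * w j z) l" for l z
  define A6 where "A6 l z = running_max (\<lambda>l. \<Sum>j<l. sq_diff j z * ((w j z)\<^sup>2 - \<epsilon>)) l" for l z
  have A_meas: "A2 \<in> borel_measurable M" "A3 \<in> borel_measurable M" "A4 l \<in> borel_measurable M" "A5 l \<in> borel_measurable M" "A6 l \<in> borel_measurable M" for l
    unfolding A2_def[abs_def] A3_def[abs_def] A4_def[abs_def] A5_def[abs_def] A6_def[abs_def] by measurable
  have T0: "0 \<le> \<T>" using horizon(2) by simp
  have bound: "max_err l z \<le> \<T> * \<delta> + A2 z + A3 z + A4 l z + A5 l z + A6 l z"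
    if z: "z \<in> space M" and l: "l \<le> ?n" for l z
    unfolding max_err_def
  proof (rule running_max_leI)
    fix l0 assume l0: "l0 \<le> l"
    \<comment> \<open>Replaces the index by one preceded by good indices only, where the expansion
      of F is available.\<close>
    obtain l' where l': "l' \<le> l0" "err l0 z = err l' z" "\<And>j. j < l' \<Longrightarrow> good j z"
      using err_stops[of l0 z] by blast
    have l'n: "l' \<le> l" "l' \<le> ?n" using l' l0 l by auto
    have S5: "\<bar>\<Sum>j<l'. diff_diff j z * w j z\<bar> \<le> A5 l z"
      unfolding A5_def using running_max_ge[OF l'n(1), of "\<lambda>l. \<Sum>j<l. diff_diff j z * w j z"] .
    have S6: "\<bar>\<Sum>j<l'. sq_diff j z * ((w j z)\<^sup>2 - \<epsilon>)\<bar> \<le> A6 l z"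
      unfolding A6_def using running_max_ge[OF l'n(1), of "\<lambda>l. \<Sum>j<l. sq_diff j z * ((w j z)\<^sup>2 - \<epsilon>)"] .
    have S3: "\<bar>\<epsilon> * (\<Sum>j<l'. \<Sum>i\<in>{block L j..<j}. SF i z * w i z)\<bar> \<le> A3 z"
      unfolding A3_def using running_max_ge[OF l'n(2), of "\<lambda>l. \<epsilon> * (\<Sum>j<l. \<Sum>i\<in>{block L j..<j}. SF i z * w i z)"] .
    \<comment> \<open>The drift error without the expansion of F: what remains is the distance of
      \<open>Y\<close> from \<open>V\<close> and the error at the start of the block.\<close>
    define \<rho> where "\<rho> j = drift_diff j z - (block_drift DF qF rF j z + (\<Sum>i\<in>{block L j..<j}. SF i z * w i z))" for j
    have \<rho>: "\<bar>\<rho> j\<bar> \<le> \<delta> + H * \<bar>err (block L j) z\<bar>" if "j < l'" for j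
    proof -
      let ?b = "block L j"
      have g: "good j z" using l'(3)[OF that] .
      have jn: "j < ?n" "j \<le> ?n" "?b \<le> ?n" using that l'n block_le[of L j] by auto
      have l1: "\<bar>F (real j * \<epsilon>) (Y j z) - F (real j * \<epsilon>) (V j z)\<bar> \<le> \<delta>"
      proof -
        have "\<bar>F (real j * \<epsilon>) (Y j z) - F (real j * \<epsilon>) (V j z)\<bar> \<le> H * \<bar>Y j z - V j z\<bar>" by (rule lip(1)[OF jn(2)])
        also have "\<dots> \<le> H * \<kappa>" using Y_close[OF z g] H_nonneg by (intro mult_left_mono) auto
        finally show ?thesis using kappa by simp
      qed
      have l2: "\<bar>F (real ?b * \<epsilon>) (V ?b z) - F (real ?b * \<epsilon>) (Z ?b z)\<bar> \<le> H * \<bar>err ?b z\<bar>"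
        unfolding V_minus_Z_block[OF z g] using lip(1)[OF jn(3)] .
      have "\<rho> j = (F (real j * \<epsilon>) (Y j z) - F (real j * \<epsilon>) (V j z)) + (F (real ?b * \<epsilon>) (V ?b z) - F (real ?b * \<epsilon>) (Z ?b z))"
        using block_increment[OF wb expF jn(1) z g] g by (simp add: \<rho>_def drift_diff_def)
      then show ?thesis using l1 l2 by linarith
    qed
    have "(\<Sum>j<l'. drift_diff j z * \<epsilon>) = (\<Sum>j<l'. \<epsilon> * block_drift DF qF rF j z) + \<epsilon> * (\<Sum>j<l'. \<Sum>i\<in>{block L j..<j}. SF i z * w i z) + (\<Sum>j<l'. \<epsilon> * \<rho> j)"
      unfolding sum_distrib_left sum.distrib[symmetric]
      by (intro sum.cong refl) (simp add: \<rho>_def algebra_simps sum_distrib_left)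
    moreover have "\<bar>\<Sum>j<l'. \<epsilon> * block_drift DF qF rF j z\<bar> \<le> A2 z"
    proof -
      have "\<bar>\<Sum>j<l'. \<epsilon> * block_drift DF qF rF j z\<bar> \<le> (\<Sum>j<l'. \<bar>\<epsilon> * block_drift DF qF rF j z\<bar>)" by (rule sum_abs)
      also have "\<dots> \<le> A2 z" unfolding A2_def using l'n eps_pos
        by (simp add: abs_mult) (intro sum_mono2, auto)
      finally show ?thesis .
    qed
    moreover have "\<bar>\<Sum>j<l'. \<epsilon> * \<rho> j\<bar> \<le> \<T> * \<delta> + A4 l z"
    proof -
      have "\<bar>\<Sum>j<l'. \<epsilon> * \<rho> j\<bar> \<le> (\<Sum>j<l'. \<bar>\<epsilon> * \<rho> j\<bar>)" by (rule sum_abs)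
      also have "\<dots> \<le> (\<Sum>j<l'. \<epsilon> * (\<delta> + H * \<bar>err (block L j) z\<bar>))"
        using \<rho> eps_pos by (intro sum_mono) (auto simp: abs_mult)
      also have "\<dots> = real l' * \<epsilon> * \<delta> + (\<Sum>j<l'. \<epsilon> * (H * \<bar>err (block L j) z\<bar>))"
        by (simp add: distrib_left sum.distrib)
      also have "\<dots> \<le> \<T> * \<delta> + A4 l z"
      proof (rule add_mono)
        show "real l' * \<epsilon> * \<delta> \<le> \<T> * \<delta>" using time_le[OF l'n(2)] delta_pos by (intro mult_right_mono) auto
        show "(\<Sum>j<l'. \<epsilon> * (H * \<bar>err (block L j) z\<bar>)) \<le> A4 l z"
          unfolding A4_def using l'n eps_pos H_nonneg by (intro sum_mono2) auto
      qed
      finally show ?thesis .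
    qed
    ultimately have "\<bar>\<Sum>j<l'. drift_diff j z * \<epsilon>\<bar> \<le> A2 z + A3 z + (\<T> * \<delta> + A4 l z)"
      using S3 by linarith
    then show "\<bar>err l0 z\<bar> \<le> \<T> * \<delta> + A2 z + A3 z + A4 l z + A5 l z + A6 l z"
      unfolding l'(2) unfolding err_eq[OF z, of l'] using S5 S6 by linarith
  qed
  have m1: "second_moment M (\<lambda>_. \<T> * \<delta>) \<le> ennreal (\<T>\<^sup>2 * \<delta>\<^sup>2)"
    by (simp add: second_moment_def emeasure_space_1 power_mult_distrib ennreal_mult)
  have m2: "second_moment M A2 \<le> ennreal (6 * \<T>\<^sup>2 * \<delta>\<^sup>2 * (?B + 1))"
  proof -
    have "second_moment M A2 \<le> ennreal ((real ?n)\<^sup>2 * (\<epsilon>\<^sup>2 * (6 * \<delta>\<^sup>2 * (?B + 1))))"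
    proof (rule second_moment_sum_const[where f="\<lambda>j z. \<epsilon> * block_drift DF qF rF j z" and A="{..<?n}"])
      fix i assume "i \<in> {..<?n}"
      then have "ennreal (\<epsilon>\<^sup>2) * second_moment M (block_drift DF qF rF i) \<le> ennreal (\<epsilon>\<^sup>2) * ennreal (6 * \<delta>\<^sup>2 * (?B + 1))"
        using block_drift_second_moment[OF wb expF, of i] by (intro mult_left_mono) auto
      then show "second_moment M (\<lambda>z. \<epsilon> * block_drift DF qF rF i z) \<le> ennreal (\<epsilon>\<^sup>2 * (6 * \<delta>\<^sup>2 * (?B + 1)))"
        using wb by (simp add: second_moment_cmult ennreal_mult)
    qed (use eps_pos wb in \<open>auto simp: A2_def abs_mult sum_nonneg\<close>)
    also have "(real ?n)\<^sup>2 * (\<epsilon>\<^sup>2 * (6 * \<delta>\<^sup>2 * (?B + 1))) = 6 * \<T>\<^sup>2 * \<delta>\<^sup>2 * (?B + 1)"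
      by (simp add: horizon(1) power_mult_distrib mult_ac)
    finally show ?thesis .
  qed
  have m3: "second_moment M A3 \<le> ennreal (40 * \<T> * \<delta>\<^sup>2 * ?B)"
    using integrated_block_bound[OF wb expF] unfolding A3_def[abs_def] by (simp add: mult_ac)
  have m4: "second_moment M (A4 l) \<le> ennreal (\<T> * H\<^sup>2 * \<epsilon>) * (\<Sum>j<l. \<phi> j)" if l: "l \<le> ?n" for l
  proof -
    have "second_moment M (A4 l) \<le> ennreal (real (card {..<l})) * (\<Sum>j<l. second_moment M (\<lambda>z. (\<epsilon> * H) * err (block L j) z))"
      by (rule second_moment_sum_bound) (use eps_pos H_nonneg in \<open>auto simp: A4_def abs_mult sum_nonneg mult.assoc\<close>)
    also have "\<dots> \<le> ennreal (real l) * (\<Sum>j<l. ennreal ((\<epsilon> * H)\<^sup>2) * \<phi> j)"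
      using err_block_moment[OF block_le] unfolding \<phi>_def
      by (auto simp: second_moment_cmult intro!: mult_left_mono sum_mono)
    also have "\<dots> = ennreal (real l * (\<epsilon> * H)\<^sup>2) * (\<Sum>j<l. \<phi> j)"
      by (simp add: sum_distrib_left ennreal_mult mult.assoc)
    also have "\<dots> \<le> ennreal (\<T> * H\<^sup>2 * \<epsilon>) * (\<Sum>j<l. \<phi> j)"
    proof (intro mult_right_mono ennreal_leI)
      have "real l * \<epsilon> * (\<epsilon> * H\<^sup>2) \<le> \<T> * (\<epsilon> * H\<^sup>2)" using time_le[OF l] eps_pos by (intro mult_right_mono) auto
      then show "real l * (\<epsilon> * H)\<^sup>2 \<le> \<T> * H\<^sup>2 * \<epsilon>" by (simp add: power2_eq_square mult_ac)
    qed auto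
    finally show ?thesis .
  qed
  have m5: "second_moment M (A5 l) \<le> ennreal (5584 * \<T> * \<delta>\<^sup>2 * (?B + 1)) + ennreal (80 * H\<^sup>2 * \<epsilon>) * (\<Sum>j<l. \<phi> j)" if l: "l \<le> ?n" for l
  proof -
    have "second_moment M (A5 l) \<le> ennreal (4 * \<epsilon>) * (\<Sum>j<l. second_moment M (diff_diff j))"
      unfolding A5_def[abs_def] by (rule doob_w) (rule adapted_diffs)
    also have "\<dots> \<le> ennreal (4 * \<epsilon>) * (\<Sum>j<l. ennreal (1396 * \<delta>\<^sup>2 * (?B + 1)) + ennreal (20 * H\<^sup>2) * \<phi> j)"
      using diff_diff_moment l unfolding \<phi>_def by (intro mult_left_mono sum_mono) auto
    also have "\<dots> = ennreal (4 * \<epsilon>) * (ennreal (real l * (1396 * \<delta>\<^sup>2 * (?B + 1))) + ennreal (20 * H\<^sup>2) * (\<Sum>j<l. \<phi> j))"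
      using wb by (simp add: sum.distrib sum_distrib_left[symmetric] ennreal_mult[of "real l"] ennreal_of_nat_eq_real_of_nat)
    also have "\<dots> = ennreal (5584 * (real l * \<epsilon>) * \<delta>\<^sup>2 * (?B + 1)) + ennreal (80 * H\<^sup>2 * \<epsilon>) * (\<Sum>j<l. \<phi> j)"
      using eps_pos wb by (simp add: distrib_left mult.assoc[symmetric] ennreal_mult[symmetric]) (simp add: mult_ac)
    also have "\<dots> \<le> ennreal (5584 * \<T> * \<delta>\<^sup>2 * (?B + 1)) + ennreal (80 * H\<^sup>2 * \<epsilon>) * (\<Sum>j<l. \<phi> j)"
      using time_le[OF l] wb by (intro add_right_mono ennreal_leI mult_right_mono mult_left_mono) auto
    finally show ?thesis .
  qed
  have m6: "second_moment M (A6 l) \<le> ennreal (8 * \<T> * \<delta>\<^sup>2 * ?B) + ennreal (8 * H\<^sup>2 * \<epsilon>) * (\<Sum>j<l. \<phi> j)" if l: "l \<le> ?n" for l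
  proof -
    \<comment> \<open>Here \<epsilon> \<le> \<delta>^2 pays for the missing smallness of
      \<open>sq_diff\<close>.\<close>
    have e1: "\<epsilon>\<^sup>2 \<le> \<epsilon> * \<delta>\<^sup>2" using delta(3) eps_pos by (simp add: power2_eq_square[of \<epsilon>])
    have e2: "\<epsilon>\<^sup>2 \<le> \<epsilon>"
    proof -
      have "\<delta>\<^sup>2 \<le> 1" using delta(2) delta_pos by (simp add: power_le_one)
      then have "\<epsilon> * \<delta>\<^sup>2 \<le> \<epsilon> * 1" using eps_pos by (intro mult_left_mono) auto
      then show ?thesis using e1 by simp
    qed
    have "second_moment M (A6 l) \<le> ennreal (8 * \<epsilon>\<^sup>2) * (\<Sum>j<l. second_moment M (sq_diff j))"
      unfolding A6_def[abs_def] by (rule doob_w_sq) (rule adapted_diffs)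
    also have "\<dots> \<le> ennreal (8 * \<epsilon>\<^sup>2) * (\<Sum>j<l. ennreal ?B + ennreal (H\<^sup>2) * \<phi> j)"
      using sq_diff_moment l unfolding \<phi>_def by (intro mult_left_mono sum_mono) auto
    also have "\<dots> = ennreal (8 * \<epsilon>\<^sup>2) * (ennreal (real l * ?B) + ennreal (H\<^sup>2) * (\<Sum>j<l. \<phi> j))"
      using wb by (simp add: sum.distrib sum_distrib_left[symmetric] ennreal_mult[of "real l"] ennreal_of_nat_eq_real_of_nat)
    also have "\<dots> = ennreal (8 * \<epsilon>\<^sup>2 * (real l * ?B)) + ennreal (8 * \<epsilon>\<^sup>2 * H\<^sup>2) * (\<Sum>j<l. \<phi> j)"
      using eps_pos wb by (simp add: distrib_left mult.assoc[symmetric] ennreal_mult[symmetric])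
    also have "\<dots> \<le> ennreal (8 * \<T> * \<delta>\<^sup>2 * ?B) + ennreal (8 * H\<^sup>2 * \<epsilon>) * (\<Sum>j<l. \<phi> j)"
    proof (intro add_mono ennreal_leI mult_right_mono)
      have "\<epsilon>\<^sup>2 * (real l * ?B) \<le> (\<epsilon> * \<delta>\<^sup>2) * (real l * ?B)" using e1 wb by (intro mult_right_mono) auto
      also have "\<dots> = (real l * \<epsilon>) * (\<delta>\<^sup>2 * ?B)" by (simp add: mult_ac)
      also have "\<dots> \<le> \<T> * (\<delta>\<^sup>2 * ?B)" using time_le[OF l] wb by (intro mult_right_mono) auto
      finally show "8 * \<epsilon>\<^sup>2 * (real l * ?B) \<le> 8 * \<T> * \<delta>\<^sup>2 * ?B" by (simp add: mult_ac)
      show "8 * \<epsilon>\<^sup>2 * H\<^sup>2 \<le> 8 * H\<^sup>2 * \<epsilon>" using mult_right_mono[OF e2, of "H\<^sup>2"] by (simp add: mult_ac)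
    qed auto
    finally show ?thesis .
  qed
  define C where "C = 5640 * \<T>\<^sup>2 * \<delta>\<^sup>2 * (?B + 1)"
  have C0: "0 \<le> C" using wb by (simp add: C_def)
  have step: "\<phi> l \<le> ennreal (6 * C) + ennreal (534 * \<T> * H\<^sup>2 * \<epsilon>) * (\<Sum>j<l. \<phi> j)" if l: "l \<le> ?n" for l
  proof -
    let ?\<Sigma> = "\<Sum>j<l. \<phi> j"
    let ?a1 = "\<T>\<^sup>2 * \<delta>\<^sup>2" and ?a2 = "6 * \<T>\<^sup>2 * \<delta>\<^sup>2 * (?B + 1)" and ?a3 = "40 * \<T> * \<delta>\<^sup>2 * ?B"
      and ?a5 = "5584 * \<T> * \<delta>\<^sup>2 * (?B + 1)" and ?a6 = "8 * \<T> * \<delta>\<^sup>2 * ?B"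
    have "\<phi> l \<le> 6 * (ennreal ?a1 + ennreal ?a2 + ennreal ?a3 + ennreal (\<T> * H\<^sup>2 * \<epsilon>) * ?\<Sigma>
        + (ennreal ?a5 + ennreal (80 * H\<^sup>2 * \<epsilon>) * ?\<Sigma>) + (ennreal ?a6 + ennreal (8 * H\<^sup>2 * \<epsilon>) * ?\<Sigma>))"
      unfolding \<phi>_def[of l]
    proof (rule second_moment_le6[OF _ A_meas _ m1 m2 m3 m4[OF l] m5[OF l] m6[OF l]])
      fix z assume z: "z \<in> space M"
      have "0 \<le> max_err l z" by (simp add: max_err_def running_max_nonneg)
      then show "\<bar>max_err l z\<bar> \<le> \<bar>\<T> * \<delta>\<bar> + \<bar>A2 z\<bar> + \<bar>A3 z\<bar> + \<bar>A4 l z\<bar> + \<bar>A5 l z\<bar> + \<bar>A6 l z\<bar>"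
        using bound[OF z l] by linarith
    qed simp
    also have "\<dots> = 6 * (ennreal (?a1 + ?a2 + ?a3 + ?a5 + ?a6) + ennreal (\<T> * H\<^sup>2 * \<epsilon> + 80 * H\<^sup>2 * \<epsilon> + 8 * H\<^sup>2 * \<epsilon>) * ?\<Sigma>)"
    proof -
      have r: "x1 + x2 + x3 + y4 + (x5 + y5) + (x6 + y6) = (x1 + x2 + x3 + x5 + x6) + (y4 + y5 + y6)"
        for x1 x2 x3 x5 x6 y4 y5 y6 :: ennreal by (simp add: ac_simps)
      have x: "ennreal a + ennreal b + ennreal c + ennreal d + ennreal e = ennreal (a + b + c + d + e)"
        if "0 \<le> a" "0 \<le> b" "0 \<le> c" "0 \<le> d" "0 \<le> e" for a b c d e using that by (simp add: ennreal_plus)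
      have y: "ennreal a * z + ennreal b * z + ennreal c * z = ennreal (a + b + c) * z"
        if "0 \<le> a" "0 \<le> b" "0 \<le> c" for a b c z using that by (simp add: ennreal_plus distrib_right)
      show ?thesis unfolding r
        using T0 wb eps_pos by (intro arg_cong2[where f="(*)"] arg_cong2[where f="(+)"] refl x y) auto
    qed
    also have "\<dots> \<le> 6 * (ennreal C + ennreal (89 * \<T> * H\<^sup>2 * \<epsilon>) * ?\<Sigma>)"
    proof (intro mult_left_mono add_mono mult_right_mono ennreal_leI)
      have t1: "\<T> * (\<delta>\<^sup>2 * (?B + 1)) \<le> \<T>\<^sup>2 * (\<delta>\<^sup>2 * (?B + 1))"
        using horizon(2) wb by (intro mult_right_mono) (auto simp: power2_eq_square)
      have t2: "\<T> * (\<delta>\<^sup>2 * ?B) \<le> \<T> * (\<delta>\<^sup>2 * (?B + 1))" using T0 by (intro mult_left_mono) auto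
      have t3: "?a1 * 1 \<le> ?a1 * (?B + 1)" using wb by (intro mult_left_mono) auto
      have t4: "?a1 * (?B + 1) = \<T>\<^sup>2 * (\<delta>\<^sup>2 * (?B + 1))" by simp
      have t0: "0 \<le> \<T>\<^sup>2 * (\<delta>\<^sup>2 * (?B + 1))" using wb by simp
      have "?a1 + ?a2 + ?a3 + ?a5 + ?a6 = ?a1 * 1 + 6 * (\<T>\<^sup>2 * (\<delta>\<^sup>2 * (?B + 1))) + 40 * (\<T> * (\<delta>\<^sup>2 * ?B))
          + 5584 * (\<T> * (\<delta>\<^sup>2 * (?B + 1))) + 8 * (\<T> * (\<delta>\<^sup>2 * ?B))"
        by (simp add: mult_ac)
      also have "\<dots> \<le> 5640 * (\<T>\<^sup>2 * (\<delta>\<^sup>2 * (?B + 1)))" using t1 t2 t3 t4 t0 by linarith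
      finally show "?a1 + ?a2 + ?a3 + ?a5 + ?a6 \<le> C" by (simp add: C_def mult.assoc)
      have "1 * (H\<^sup>2 * \<epsilon>) \<le> \<T> * (H\<^sup>2 * \<epsilon>)" using horizon(2) eps_pos by (intro mult_right_mono) auto
      then show "\<T> * H\<^sup>2 * \<epsilon> + 80 * H\<^sup>2 * \<epsilon> + 8 * H\<^sup>2 * \<epsilon> \<le> 89 * \<T> * H\<^sup>2 * \<epsilon>"
        unfolding mult.assoc by linarith
    qed auto
    also have "\<dots> = ennreal (6 * C) + ennreal (534 * \<T> * H\<^sup>2 * \<epsilon>) * ?\<Sigma>"
      using C0 T0 eps_pos by (simp add: distrib_left mult.assoc[symmetric] ennreal_numeral_mult)
    finally show ?thesis .
  qed
  have "\<phi> ?n \<le> ennreal (6 * C * exp (534 * \<T> * H\<^sup>2 * \<epsilon> * real ?n))"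
    by (rule gronwall_ennreal[OF step]) (use C0 T0 eps_pos in auto)
  also have "\<dots> \<le> ennreal (error_constant * \<delta>\<^sup>2)"
  proof (rule ennreal_leI)
    have "534 * \<T> * H\<^sup>2 * \<epsilon> * real ?n = 534 * \<T>\<^sup>2 * H\<^sup>2" by (simp add: horizon(1) power2_eq_square mult_ac)
    also have "\<dots> \<le> 540 * \<T>\<^sup>2 * H\<^sup>2" by (intro mult_right_mono) auto
    finally have "6 * C * exp (534 * \<T> * H\<^sup>2 * \<epsilon> * real ?n) \<le> 6 * C * exp (540 * \<T>\<^sup>2 * H\<^sup>2)"
      using C0 by (intro mult_left_mono) auto
    moreover have "6 * C * exp (540 * \<T>\<^sup>2 * H\<^sup>2) = error_constant * \<delta>\<^sup>2"
      by (simp add: error_constant_def C_def)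
    ultimately show "6 * C * exp (534 * \<T> * H\<^sup>2 * \<epsilon> * real ?n) \<le> error_constant * \<delta>\<^sup>2"
      by linarith
  qed
  finally show ?thesis by (simp add: \<phi>_def)
qed

end

section \<open>Coefficient bounds on a finite horizon and the expansions they provide\<close>

locale milstein_coefficients =
  fixes F G :: "real \<Rightarrow> real \<Rightarrow> real" and H K0 \<T> :: real
  assumes smooth: "C12 F" "C12 G" "C12 (G_Gx G)"
    and H_nonneg: "H \<ge> 0" and K0_nonneg: "K0 \<ge> 0"
    and lip: "\<And>u x y. 0 \<le> u \<Longrightarrow> u \<le> \<T> \<Longrightarrow> \<bar>F u x - F u y\<bar> \<le> H * \<bar>x - y\<bar>"
      "\<And>u x y. 0 \<le> u \<Longrightarrow> u \<le> \<T> \<Longrightarrow> \<bar>G u x - G u y\<bar> \<le> H * \<bar>x - y\<bar>"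
      "\<And>u x y. 0 \<le> u \<Longrightarrow> u \<le> \<T> \<Longrightarrow> \<bar>G_Gx G u x - G_Gx G u y\<bar> \<le> H * \<bar>x - y\<bar>"
    and growth: "\<And>u x. 0 \<le> u \<Longrightarrow> u \<le> \<T> \<Longrightarrow> \<bar>F u x\<bar> \<le> H * (1 + \<bar>x\<bar>)"
      "\<And>u x. 0 \<le> u \<Longrightarrow> u \<le> \<T> \<Longrightarrow> \<bar>G u x\<bar> \<le> H * (1 + \<bar>x\<bar>)"
      "\<And>u x. 0 \<le> u \<Longrightarrow> u \<le> \<T> \<Longrightarrow> \<bar>G_Gx G u x\<bar> \<le> H * (1 + \<bar>x\<bar>)"
    and drift_bound: "\<And>u x. 0 \<le> u \<Longrightarrow> u \<le> \<T> \<Longrightarrow>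
        \<bar>partial_u F u x + partial_x F u x * F u x + 1 / 2 * partial_x (partial_x F) u x * (G u x)\<^sup>2\<bar> \<le> K0 * (1 + \<bar>x\<bar>)"
      "\<And>u x. 0 \<le> u \<Longrightarrow> u \<le> \<T> \<Longrightarrow>
        \<bar>partial_u G u x + partial_x G u x * F u x + 1 / 2 * partial_x (partial_x G) u x * (G u x)\<^sup>2\<bar> \<le> K0 * (1 + \<bar>x\<bar>)"
      "\<And>u x. 0 \<le> u \<Longrightarrow> u \<le> \<T> \<Longrightarrow>
        \<bar>partial_u (G_Gx G) u x + partial_x (G_Gx G) u x * F u x
          + 1 / 2 * partial_x (partial_x (G_Gx G)) u x * (G u x)\<^sup>2\<bar> \<le> K0 * (1 + \<bar>x\<bar>)"
    and diffusion_bound: "\<And>u x. 0 \<le> u \<Longrightarrow> u \<le> \<T> \<Longrightarrow> \<bar>partial_x F u x * G u x\<bar> \<le> K0 * (1 + \<bar>x\<bar>)"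
      "\<And>u x. 0 \<le> u \<Longrightarrow> u \<le> \<T> \<Longrightarrow> \<bar>partial_x (G_Gx G) u x * G u x\<bar> \<le> K0 * (1 + \<bar>x\<bar>)"

lemma jointly_continuous_slice:
  assumes "jointly_continuous f" "u \<ge> 0" shows "f u \<in> borel_measurable borel"
proof -
  have "continuous_on UNIV (\<lambda>x::real. (u, x))" by (intro continuous_intros)
  from continuous_on_compose2[OF assms(1)[unfolded jointly_continuous_def] this]
  have "continuous_on UNIV (f u)" using assms(2) by (simp add: image_subset_iff)
  then show ?thesis by (rule borel_measurable_continuous_onI)
qed

text \<open>What the continuous-time problem provides on the fine grid: a discretised solution \<open>V\<close> stopped
  when \<open>good\<close> fails, driven by coefficients evaluated at the exact solution \<open>Y\<close>, and the Milstein scheme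
  \<open>Z\<close> with coarse steps.\<close>

definition milstein_coupling ::
    "'a measure \<Rightarrow> (nat \<Rightarrow> 'a measure) \<Rightarrow> (nat \<Rightarrow> 'a \<Rightarrow> real) \<Rightarrow> real \<Rightarrow> nat \<Rightarrow> (real \<Rightarrow> real \<Rightarrow> real) \<Rightarrow> (real \<Rightarrow> real \<Rightarrow> real)
      \<Rightarrow> real \<Rightarrow> real \<Rightarrow> real \<Rightarrow> (nat \<Rightarrow> 'a \<Rightarrow> bool) \<Rightarrow> (nat \<Rightarrow> 'a \<Rightarrow> real) \<Rightarrow> (nat \<Rightarrow> 'a \<Rightarrow> real) \<Rightarrow> (nat \<Rightarrow> 'a \<Rightarrow> real) \<Rightarrow> bool" where
  "milstein_coupling M \<G> w \<epsilon> L F G x0 R \<kappa> good V Y Z \<longleftrightarrow>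
     (\<forall>j. Measurable.pred (\<G> j) (good j) \<and> V j \<in> borel_measurable (\<G> j) \<and> Y j \<in> borel_measurable (\<G> j)
        \<and> Z j \<in> borel_measurable (\<G> j)) \<and>
     (\<forall>j z. good (Suc j) z \<longrightarrow> good j z) \<and>
     (\<forall>j. \<forall>z\<in>space M. good j z \<longrightarrow> \<bar>Y j z\<bar> \<le> R \<and> \<bar>Y j z - V j z\<bar> \<le> \<kappa>) \<and>
     (\<forall>z\<in>space M. V 0 z = x0 \<and> Z 0 z = x0) \<and>
     (\<forall>j. \<forall>z\<in>space M. V (Suc j) z = V j z + (if good j z
        then F (real j * \<epsilon>) (Y j z) * \<epsilon> + G (real j * \<epsilon>) (Y j z) * w j z else 0)) \<and>
     (\<forall>j. \<forall>z\<in>space M. Z (Suc j) z = Z j z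
        + (F (real (block L j) * \<epsilon>) (Z (block L j) z) * \<epsilon> + G (real (block L j) * \<epsilon>) (Z (block L j) z) * w j z
        + G_Gx G (real (block L j) * \<epsilon>) (Z (block L j) z)
            * ((\<Sum>i\<in>{block L j..<j}. w i z) * w j z + 1 / 2 * ((w j z)\<^sup>2 - \<epsilon>))))"

text \<open>The structural bounds concern F and G at the point where \<Phi> is differentiated,
  whereas the discretised equation uses them at the nearby exact solution; \<kappa> makes the
  exchange cost at most \<eta>. The squared coefficient changes by (g - gv) (g + gv), whence the
  factor \<open>1 + R'\<close>.\<close>

lemma frozen_coefficients:
  fixes A H R' \<kappa> K1 :: real
  assumes A: "\<bar>px\<bar> \<le> A" "\<bar>pxx\<bar> \<le> A" "A \<ge> 1" and H: "H \<ge> 0" and R': "R' \<ge> 1"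
    and f: "\<bar>f - fv\<bar> \<le> H * \<kappa>" and g: "\<bar>g - gv\<bar> \<le> H * \<kappa>" "\<bar>g\<bar> \<le> R'" "\<bar>gv\<bar> \<le> R'"
    and \<kappa>: "A * H * \<kappa> * (1 + R') \<le> \<eta>"
    and d: "\<bar>pu + px * fv + 1 / 2 * pxx * gv\<^sup>2\<bar> \<le> K1" and s: "\<bar>px * gv\<bar> \<le> K1" and k0: "0 \<le> \<kappa>"
  shows "\<bar>pu + px * f + 1 / 2 * pxx * g\<^sup>2\<bar> \<le> K1 + \<eta>" "\<bar>px * g\<bar> \<le> K1 + \<eta>" "\<bar>px * g - px * gv\<bar> \<le> \<eta>"
proof -
  have a: "\<bar>px * (f - fv)\<bar> \<le> A * (H * \<kappa>)" "\<bar>px * (g - gv)\<bar> \<le> A * (H * \<kappa>)"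
    unfolding abs_mult using A f g by (auto intro!: mult_mono)
  have b: "\<bar>pxx * ((g - gv) * (g + gv))\<bar> \<le> A * ((H * \<kappa>) * (2 * R'))"
    unfolding abs_mult using A g H k0 by (intro mult_mono) auto
  have e: "A * (H * \<kappa>) + A * (H * \<kappa>) * R' \<le> \<eta>" using \<kappa> by (simp add: distrib_left mult.assoc)
  have p: "0 \<le> A * (H * \<kappa>) * R'" using A(3) H k0 R' by simp
  have "pu + px * f + 1 / 2 * pxx * g\<^sup>2 = (pu + px * fv + 1 / 2 * pxx * gv\<^sup>2) + px * (f - fv) + 1 / 2 * (pxx * ((g - gv) * (g + gv)))"
    by (simp add: field_simps power2_eq_square)
  moreover have "A * ((H * \<kappa>) * (2 * R')) = 2 * (A * (H * \<kappa>) * R')" by simp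
  ultimately show "\<bar>pu + px * f + 1 / 2 * pxx * g\<^sup>2\<bar> \<le> K1 + \<eta>" using a(1) b d e by linarith
  have "px * g = px * gv + px * (g - gv)" by (simp add: algebra_simps)
  then show "\<bar>px * g\<bar> \<le> K1 + \<eta>" "\<bar>px * g - px * gv\<bar> \<le> \<eta>" using a(2) s e p by linarith+
qed

lemma (in grid_process) expands_of_C12:
  assumes C: "C12 \<Phi>" and FG: "jointly_continuous F" "jointly_continuous G"
    and Y: "\<And>j. Y j \<in> borel_measurable (\<G> j)"
    and V_Suc: "\<And>j z. z \<in> space M \<Longrightarrow> good j z \<Longrightarrow>
        V (Suc j) z = V j z + (F (real j * \<epsilon>) (Y j z) * \<epsilon> + G (real j * \<epsilon>) (Y j z) * w j z)"
    and close: "\<And>j z. z \<in> space M \<Longrightarrow> good j z \<Longrightarrow> \<bar>Y j z\<bar> \<le> R \<and> \<bar>Y j z - V j z\<bar> \<le> \<kappa>"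
    and \<kappa>: "0 \<le> \<kappa>" "\<kappa> \<le> 1" "A * H * \<kappa> * (1 + R') \<le> \<eta>" "\<eta> \<le> 1" and H: "H \<ge> 0"
    and R: "R + 1 \<le> R'" "1 \<le> R'" "H * (2 + R) \<le> R'"
    and lip: "\<And>u x y. 0 \<le> u \<Longrightarrow> u \<le> \<T> \<Longrightarrow> \<bar>F u x - F u y\<bar> \<le> H * \<bar>x - y\<bar>"
      "\<And>u x y. 0 \<le> u \<Longrightarrow> u \<le> \<T> \<Longrightarrow> \<bar>G u x - G u y\<bar> \<le> H * \<bar>x - y\<bar>"
    and growth: "\<And>u x. 0 \<le> u \<Longrightarrow> u \<le> \<T> \<Longrightarrow> \<bar>F u x\<bar> \<le> H * (1 + \<bar>x\<bar>)"
      "\<And>u x. 0 \<le> u \<Longrightarrow> u \<le> \<T> \<Longrightarrow> \<bar>G u x\<bar> \<le> H * (1 + \<bar>x\<bar>)"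
    and A: "A \<ge> 1" "\<And>u x. 0 \<le> u \<Longrightarrow> u \<le> \<T> \<Longrightarrow> \<bar>x\<bar> \<le> R' \<Longrightarrow> \<bar>partial_x \<Phi> u x\<bar> \<le> A"
        "\<And>u x. 0 \<le> u \<Longrightarrow> u \<le> \<T> \<Longrightarrow> \<bar>x\<bar> \<le> R' \<Longrightarrow> \<bar>partial_x (partial_x \<Phi>) u x\<bar> \<le> A"
    and Q: "A * R'\<^sup>2 \<le> Q" and K: "K1 + 1 \<le> K" "0 \<le> K1"
    and drift: "\<And>u x. 0 \<le> u \<Longrightarrow> u \<le> \<T> \<Longrightarrow>
        \<bar>partial_u \<Phi> u x + partial_x \<Phi> u x * F u x + 1 / 2 * partial_x (partial_x \<Phi>) u x * (G u x)\<^sup>2\<bar> \<le> K1 * (1 + \<bar>x\<bar>)"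
    and diffusion: "\<And>u x. 0 \<le> u \<Longrightarrow> u \<le> \<T> \<Longrightarrow> \<bar>partial_x \<Phi> u x * G u x\<bar> \<le> K1 * (1 + \<bar>x\<bar>)"
    and rem: "\<And>u x f g w. 0 \<le> u \<Longrightarrow> u + \<epsilon> \<le> \<T> \<Longrightarrow> \<bar>x\<bar> \<le> R' \<Longrightarrow> \<bar>f\<bar> \<le> R' \<Longrightarrow> \<bar>g\<bar> \<le> R' \<Longrightarrow>
      \<bar>ito_remainder \<Phi> u x \<epsilon> f g w\<bar> \<le> 1 / 8 * (\<epsilon> + w\<^sup>2) + C1 * (\<epsilon> * \<bar>w\<bar> + w ^ 4)"
    and C1: "C1 \<ge> 0" "4 * C1\<^sup>2 * \<epsilon> + 420 * C1\<^sup>2 * \<epsilon>\<^sup>2 \<le> 1 / 2"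
  obtains D S q r where "expands \<Phi> D S q r"
    "\<And>i z. z \<in> space M \<Longrightarrow> i < N * L \<Longrightarrow> good i z \<Longrightarrow>
       \<bar>S i z - partial_x \<Phi> (real i * \<epsilon>) (V i z) * G (real i * \<epsilon>) (V i z)\<bar> \<le> \<eta>"
proof -
  let ?u = "\<lambda>i. real i * \<epsilon>"
  define f where "f i z = F (?u i) (Y i z)" for i z
  define g where "g i z = G (?u i) (Y i z)" for i z
  define D where "D i z = (if good i z \<and> i < N * L then partial_u \<Phi> (?u i) (V i z) + partial_x \<Phi> (?u i) (V i z) * f i z
      + 1 / 2 * partial_x (partial_x \<Phi>) (?u i) (V i z) * (g i z)\<^sup>2 else 0)" for i z
  define S where "S i z = (if good i z \<and> i < N * L then partial_x \<Phi> (?u i) (V i z) * g i z else 0)" for i z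
  define q where "q i z = (if good i z \<and> i < N * L then 1 / 2 * partial_x (partial_x \<Phi>) (?u i) (V i z) * (g i z)\<^sup>2 else 0)" for i z
  define r where "r i z = (if good i z \<and> i < N * L then ito_remainder \<Phi> (?u i) (V i z) \<epsilon> (f i z) (g i z) (w i z) else 0)" for i z
  have u0: "0 \<le> ?u i" for i using eps_pos by simp
  have uT: "?u i \<le> \<T>" "?u i + \<epsilon> \<le> \<T>" if "i < N * L" for i
  proof -
    have "real (Suc i) * \<epsilon> \<le> real (N * L) * \<epsilon>" using that eps_pos by (intro mult_right_mono of_nat_mono) auto
    then show "?u i + \<epsilon> \<le> \<T>" unfolding horizon(1) by (simp add: algebra_simps)
    then show "?u i \<le> \<T>" using eps_pos by linarith
  qed
  have jc: "jointly_continuous \<Phi>" "jointly_continuous (partial_u \<Phi>)" "jointly_continuous (partial_x \<Phi>)" "jointly_continuous (partial_x (partial_x \<Phi>))"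
    using C by (auto simp: C12_def)
  have bounds: "\<bar>V i z\<bar> \<le> R'" "\<bar>f i z\<bar> \<le> R'" "\<bar>g i z\<bar> \<le> R'" "\<bar>G (?u i) (V i z)\<bar> \<le> R'"
      "\<bar>f i z - F (?u i) (V i z)\<bar> \<le> H * \<kappa>" "\<bar>g i z - G (?u i) (V i z)\<bar> \<le> H * \<kappa>"
    if z: "z \<in> space M" and gd: "good i z" and i: "i < N * L" for i z
  proof -
    have c: "\<bar>Y i z\<bar> \<le> R" "\<bar>Y i z - V i z\<bar> \<le> \<kappa>" using close[OF z gd] by auto
    then show "\<bar>V i z\<bar> \<le> R'" using \<kappa>(2) R(1) by linarith
    have y: "H * (1 + \<bar>Y i z\<bar>) \<le> R'" "H * (1 + \<bar>V i z\<bar>) \<le> R'"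
    proof -
      have "H * (1 + \<bar>Y i z\<bar>) \<le> H * (2 + R)" "H * (1 + \<bar>V i z\<bar>) \<le> H * (2 + R)"
        using H c \<kappa>(2) by (auto intro!: mult_left_mono)
      then show "H * (1 + \<bar>Y i z\<bar>) \<le> R'" "H * (1 + \<bar>V i z\<bar>) \<le> R'" using R(3) by linarith+
    qed
    show "\<bar>f i z\<bar> \<le> R'" "\<bar>g i z\<bar> \<le> R'" "\<bar>G (?u i) (V i z)\<bar> \<le> R'"
      using growth[OF u0 uT(1)[OF i]] y unfolding f_def g_def by (meson order_trans)+
    have "H * \<bar>Y i z - V i z\<bar> \<le> H * \<kappa>" using c H by (intro mult_left_mono) auto
    then show "\<bar>f i z - F (?u i) (V i z)\<bar> \<le> H * \<kappa>" "\<bar>g i z - G (?u i) (V i z)\<bar> \<le> H * \<kappa>"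
      using lip[OF u0 uT(1)[OF i]] unfolding f_def g_def by (meson order_trans)+
  qed
  have \<eta>0: "0 \<le> \<eta>"
  proof -
    have "0 \<le> A * H * \<kappa> * (1 + R')" using A(1) H \<kappa>(1) R(2) by simp
    then show ?thesis using \<kappa>(3) by linarith
  qed
  have DS: "\<bar>D i z\<bar> \<le> weight i z" "\<bar>S i z\<bar> \<le> weight i z"
      "good i z \<Longrightarrow> \<bar>S i z - partial_x \<Phi> (?u i) (V i z) * G (?u i) (V i z)\<bar> \<le> \<eta>"
    if z: "z \<in> space M" and i: "i < N * L" for i z
  proof -
    have "\<bar>D i z\<bar> \<le> weight i z \<and> \<bar>S i z\<bar> \<le> weight i z \<and> (good i z \<longrightarrow> \<bar>S i z - partial_x \<Phi> (?u i) (V i z) * G (?u i) (V i z)\<bar> \<le> \<eta>)"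
    proof (cases "good i z")
      case True
      note b = bounds[OF z True i]
      have "K1 * (1 + \<bar>V i z\<bar>) + \<eta> \<le> K1 * (1 + \<bar>V i z\<bar>) + 1 * (1 + \<bar>V i z\<bar>)" using \<kappa>(4) by simp
      also have "\<dots> = (K1 + 1) * (1 + \<bar>V i z\<bar>)" by (simp add: distrib_right)
      also have "\<dots> \<le> weight i z" using True K(1) by (auto simp: weight_def intro!: mult_right_mono)
      finally have k: "K1 * (1 + \<bar>V i z\<bar>) + \<eta> \<le> weight i z" .
      have fc: "\<bar>partial_u \<Phi> (?u i) (V i z) + partial_x \<Phi> (?u i) (V i z) * f i z
          + 1 / 2 * partial_x (partial_x \<Phi>) (?u i) (V i z) * (g i z)\<^sup>2\<bar> \<le> K1 * (1 + \<bar>V i z\<bar>) + \<eta>"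
        "\<bar>partial_x \<Phi> (?u i) (V i z) * g i z\<bar> \<le> K1 * (1 + \<bar>V i z\<bar>) + \<eta>"
        "\<bar>partial_x \<Phi> (?u i) (V i z) * g i z - partial_x \<Phi> (?u i) (V i z) * G (?u i) (V i z)\<bar> \<le> \<eta>"
        using frozen_coefficients[OF A(2)[OF u0 uT(1)[OF i] b(1)] A(3)[OF u0 uT(1)[OF i] b(1)] A(1) H R(2) b(5) b(6) b(3) b(4) \<kappa>(3)
            drift[OF u0 uT(1)[OF i]] diffusion[OF u0 uT(1)[OF i]] \<kappa>(1)] by blast+
      then show ?thesis using k True i by (auto simp: D_def S_def)
    next
      case False
      then show ?thesis by (simp add: D_def S_def weight_def)
    qed
    then show "\<bar>D i z\<bar> \<le> weight i z" "\<bar>S i z\<bar> \<le> weight i z"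
      "good i z \<Longrightarrow> \<bar>S i z - partial_x \<Phi> (?u i) (V i z) * G (?u i) (V i z)\<bar> \<le> \<eta>" by auto
  qed
  have qb: "\<bar>q i z\<bar> \<le> Q" if z: "z \<in> space M" and i: "i < N * L" for i z
  proof (cases "good i z")
    case True
    note b = bounds[OF z True i]
    have "(g i z)\<^sup>2 \<le> R'\<^sup>2" using b(3) R(2) by (subst abs_le_square_iff[symmetric]) simp
    then have "\<bar>partial_x (partial_x \<Phi>) (?u i) (V i z)\<bar> * (g i z)\<^sup>2 \<le> A * R'\<^sup>2"
      using A(3)[OF u0 uT(1)[OF i] b(1)] A(1) by (intro mult_mono) auto
    then show ?thesis using Q Q_nonneg True i by (simp add: q_def abs_mult)
  next
    case False
    have "0 \<le> A * R'\<^sup>2" using A(1) by simp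
    then show ?thesis using Q False by (simp add: q_def)
  qed
  have meas: "D i \<in> borel_measurable (\<G> i)" "S i \<in> borel_measurable (\<G> i)" "q i \<in> borel_measurable (\<G> i)" "r i \<in> borel_measurable M" for i
  proof -
    have [measurable]: "F (?u i) \<in> borel_measurable borel" "G (?u i) \<in> borel_measurable borel" "\<Phi> (?u i) \<in> borel_measurable borel"
      "\<Phi> (?u i + \<epsilon>) \<in> borel_measurable borel"
      "partial_u \<Phi> (?u i) \<in> borel_measurable borel" "partial_x \<Phi> (?u i) \<in> borel_measurable borel"
      "partial_x (partial_x \<Phi>) (?u i) \<in> borel_measurable borel"
      using jointly_continuous_slice[OF _ u0[of i]] FG jc eps_pos u0[of i]
        jointly_continuous_slice[OF jc(1), of "?u i + \<epsilon>"] by auto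
    {
      have [measurable]: "Measurable.pred (\<G> i) (good i)" "V i \<in> borel_measurable (\<G> i)" "Y i \<in> borel_measurable (\<G> i)"
        using good_measurable V_adapted Y by auto
      have [measurable]: "f i \<in> borel_measurable (\<G> i)" "g i \<in> borel_measurable (\<G> i)"
        unfolding f_def[abs_def] g_def[abs_def] by measurable
      show "D i \<in> borel_measurable (\<G> i)" "S i \<in> borel_measurable (\<G> i)" "q i \<in> borel_measurable (\<G> i)"
        unfolding D_def[abs_def] S_def[abs_def] q_def[abs_def] by measurable
    }
    have [measurable]: "Y i \<in> borel_measurable M" using measurable_G[OF Y] .
    show "r i \<in> borel_measurable M"
      unfolding r_def[abs_def] ito_remainder_def f_def g_def by measurable
  qed
  \<comment> \<open>Gaussian moments: the factor 1/8 contributes 4 (1 + 3) / 64 = 1/4, and the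
    higher-order terms at most 1/2 by \<open>C1\<close>.\<close>
  have rm: "second_moment M (r i) \<le> ennreal (\<epsilon>\<^sup>2)" if i: "i < N * L" for i
  proof -
    have cs: "second_moment M (\<lambda>_. 1 / 8 * \<epsilon>) \<le> ennreal (1 / 64 * \<epsilon>\<^sup>2)"
      by (simp add: second_moment_def emeasure_space_1 power_mult_distrib power_divide)
    have c2: "second_moment M (\<lambda>z. 1 / 8 * (w i z)^2) \<le> ennreal (3 / 64 * \<epsilon>\<^sup>2)"
    proof -
      have "second_moment M (\<lambda>z. 1 / 8 * (w i z)^2) = ennreal ((1/8)\<^sup>2) * ennreal (3 * \<epsilon>\<^sup>2)"
        using second_moment_w_power[of i 2] by (subst second_moment_cmult) (auto simp: fact_numeral)
      then show ?thesis by (simp add: ennreal_mult[symmetric] power_divide)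
    qed
    have c3: "second_moment M (\<lambda>z. (C1 * \<epsilon>) * (w i z)^1) \<le> ennreal (C1\<^sup>2 * \<epsilon> * \<epsilon>\<^sup>2)"
    proof -
      have "second_moment M (\<lambda>z. (C1 * \<epsilon>) * (w i z)^1) = ennreal ((C1 * \<epsilon>)\<^sup>2) * ennreal \<epsilon>"
        using second_moment_w_power[of i 1] by (subst second_moment_cmult) (auto simp: numeral_2_eq_2)
      then show ?thesis using eps_pos by (simp add: ennreal_mult[symmetric] power_mult_distrib mult_ac)
    qed
    have c4: "second_moment M (\<lambda>z. C1 * (w i z)^4) \<le> ennreal (105 * C1\<^sup>2 * \<epsilon>\<^sup>2 * \<epsilon>\<^sup>2)"
    proof -
      have "second_moment M (\<lambda>z. C1 * (w i z)^4) = ennreal (C1\<^sup>2) * ennreal (105 * \<epsilon>^4)"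
        using second_moment_w_power[of i 4] by (subst second_moment_cmult) (auto simp: fact_numeral)
      also have "\<dots> = ennreal (C1\<^sup>2 * (105 * \<epsilon>^4))" by (rule ennreal_mult[symmetric]) auto
      also have "C1\<^sup>2 * (105 * \<epsilon>^4) = 105 * C1\<^sup>2 * \<epsilon>\<^sup>2 * \<epsilon>\<^sup>2" by (simp add: power4_eq_xxxx power2_eq_square)
      finally show ?thesis by simp
    qed
    have "second_moment M (r i) \<le> 4 * (ennreal (1 / 64 * \<epsilon>\<^sup>2) + ennreal (3 / 64 * \<epsilon>\<^sup>2) + ennreal (C1\<^sup>2 * \<epsilon> * \<epsilon>\<^sup>2) + ennreal (105 * C1\<^sup>2 * \<epsilon>\<^sup>2 * \<epsilon>\<^sup>2))"
    proof (rule second_moment_le4[OF _ _ _ _ _ cs c2 c3 c4])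
      fix z assume z: "z \<in> space M"
      show "\<bar>r i z\<bar> \<le> \<bar>1 / 8 * \<epsilon>\<bar> + \<bar>1 / 8 * (w i z)\<^sup>2\<bar> + \<bar>C1 * \<epsilon> * (w i z) ^ 1\<bar> + \<bar>C1 * (w i z) ^ 4\<bar>"
      proof (cases "good i z")
        case True
        have "\<bar>r i z\<bar> \<le> 1 / 8 * (\<epsilon> + (w i z)\<^sup>2) + C1 * (\<epsilon> * \<bar>w i z\<bar> + (w i z) ^ 4)"
          using rem[OF u0 uT(2)[OF i] bounds(1-3)[OF z True i]] True i by (simp add: r_def)
        also have "\<dots> = \<bar>1 / 8 * \<epsilon>\<bar> + \<bar>1 / 8 * (w i z)\<^sup>2\<bar> + \<bar>C1 * \<epsilon> * (w i z) ^ 1\<bar> + \<bar>C1 * (w i z) ^ 4\<bar>"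
          using C1(1) eps_pos by (simp add: abs_mult algebra_simps)
        finally show ?thesis .
      qed (simp add: r_def)
    qed auto
    also have "\<dots> = ennreal (4 * (1 / 64 * \<epsilon>\<^sup>2 + 3 / 64 * \<epsilon>\<^sup>2 + C1\<^sup>2 * \<epsilon> * \<epsilon>\<^sup>2 + 105 * C1\<^sup>2 * \<epsilon>\<^sup>2 * \<epsilon>\<^sup>2))"
    proof -
      have q4: "4 * (ennreal a + ennreal b + ennreal c + ennreal d) = ennreal (4 * (a + b + c + d))"
        if "0 \<le> a" "0 \<le> b" "0 \<le> c" "0 \<le> d" for a b c d
        using that by (simp add: ennreal_numeral_mult ennreal_plus[symmetric] del: ennreal_plus)
      show ?thesis by (rule q4) (use eps_pos in auto)
    qed
    also have "4 * (1 / 64 * \<epsilon>\<^sup>2 + 3 / 64 * \<epsilon>\<^sup>2 + C1\<^sup>2 * \<epsilon> * \<epsilon>\<^sup>2 + 105 * C1\<^sup>2 * \<epsilon>\<^sup>2 * \<epsilon>\<^sup>2)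
      = (1 / 4 + (4 * C1\<^sup>2 * \<epsilon> + 420 * C1\<^sup>2 * \<epsilon>\<^sup>2)) * \<epsilon>\<^sup>2" by (simp add: algebra_simps)
    also have "\<dots> \<le> 1 * \<epsilon>\<^sup>2" using C1(2) by (intro mult_right_mono) auto
    finally show ?thesis by (simp add: ennreal_leI)
  qed
  have ex: "\<Phi> (real (Suc i) * \<epsilon>) (V (Suc i) z) = \<Phi> (?u i) (V i z) + (D i z * \<epsilon> + S i z * w i z + q i z * ((w i z)\<^sup>2 - \<epsilon>) + r i z)"
    if z: "z \<in> space M" and i: "i < N * L" and gd: "good i z" for i z
  proof -
    have "real (Suc i) * \<epsilon> = ?u i + \<epsilon>" by (simp add: algebra_simps)
    moreover have "V (Suc i) z = V i z + f i z * \<epsilon> + g i z * w i z" using V_Suc[OF z gd] by (simp add: f_def g_def)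
    ultimately show ?thesis using gd i by (simp add: D_def S_def q_def r_def ito_remainder_def)
  qed
  have "expands \<Phi> D S q r"
    unfolding expands_def using meas rm DS qb ex by blast
  then show ?thesis using DS(3) by (rule that)
qed

text \<open>\<open>error_constant\<close> outside its locale. It involves neither the truncation
  level nor \<kappa> nor the fine grid, which is what permits the limits in all of these.\<close>

definition milstein_constant :: "real \<Rightarrow> real \<Rightarrow> real \<Rightarrow> real \<Rightarrow> real" where
  "milstein_constant x0 \<T> H K =
     33840 * \<T>\<^sup>2 * (K\<^sup>2 * (2 + 2 * ((3 * x0\<^sup>2 + 120 * H\<^sup>2 * \<T>\<^sup>2) * exp (30 * \<T>\<^sup>2 * H\<^sup>2))) + 1) * exp (540 * \<T>\<^sup>2 * H\<^sup>2)"

text \<open>The order of choices matters: \<open>R\<close> fixes a compact set, which fixes \<kappa>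
  and the fineness \<open>L0\<close>. The stopping rule depends on \<kappa> and \<open>R\<close>,
  the bound does not.\<close>

theorem (in milstein_coefficients) milstein_fine_grid:
  fixes M :: "'a measure"
  assumes T: "\<T> = real N * \<delta>" "\<T> \<ge> 1" and \<delta>: "0 < \<delta>" "\<delta> \<le> 1" and R: "R \<ge> 0"
  shows "\<exists>\<kappa> L0. 0 < \<kappa> \<and> \<kappa> \<le> \<delta> \<and> (\<forall>L \<G> w good V Y Z. L \<ge> L0 \<longrightarrow> L > 0 \<longrightarrow>
    gaussian_increments M \<G> w (\<delta> / real L) \<longrightarrow>
    milstein_coupling M \<G> w (\<delta> / real L) L F G x0 R \<kappa> good V Y Z \<longrightarrow>
    second_moment M (\<lambda>z. running_max (\<lambda>l. if \<forall>j<l. good j z then V l z - Z l z else 0) (N * L))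
      \<le> ennreal (milstein_constant x0 \<T> H (K0 + H + 1) * \<delta>\<^sup>2))"
proof -
  have jc: "jointly_continuous F" "jointly_continuous G" "jointly_continuous (G_Gx G)" using smooth by (auto simp: C12_def)
  \<comment> \<open>Bounds the state and the coefficients at all points within distance 1 of
    [-R, R].\<close>
  define R' where "R' = max (R + 1) (H * (2 + R))"
  have R': "R + 1 \<le> R'" "1 \<le> R'" "H * (2 + R) \<le> R'" using R by (auto simp: R'_def)
  define good_bound where "good_bound \<Phi> A \<longleftrightarrow> (\<forall>u x. 0 \<le> u \<longrightarrow> u \<le> \<T> \<longrightarrow> \<bar>x\<bar> \<le> R' \<longrightarrow>
      \<bar>partial_x \<Phi> u x\<bar> \<le> A \<and> \<bar>partial_x (partial_x \<Phi>) u x\<bar> \<le> A)" for \<Phi> A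
  have ex_A: "\<exists>A\<ge>1. good_bound \<Phi> A" if C: "C12 \<Phi>" for \<Phi>
  proof -
    have jcd: "jointly_continuous (partial_x \<Phi>)" "jointly_continuous (partial_x (partial_x \<Phi>))"
      using C by (auto simp: C12_def)
    obtain A1 where A1: "A1 \<ge> 1" "\<And>u x. 0 \<le> u \<Longrightarrow> u \<le> \<T> \<Longrightarrow> \<bar>x\<bar> \<le> R' \<Longrightarrow> \<bar>partial_x \<Phi> u x\<bar> \<le> A1"
      using C12_bounded[OF jcd(1), of \<T> R'] by blast
    obtain A2 where A2: "A2 \<ge> 1" "\<And>u x. 0 \<le> u \<Longrightarrow> u \<le> \<T> \<Longrightarrow> \<bar>x\<bar> \<le> R' \<Longrightarrow> \<bar>partial_x (partial_x \<Phi>) u x\<bar> \<le> A2"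
      using C12_bounded[OF jcd(2), of \<T> R'] by blast
    show ?thesis
      unfolding good_bound_def
      by (rule exI[of _ "max A1 A2"]) (use A1 A2 in \<open>auto simp: le_max_iff_disj\<close>)
  qed
  obtain A1 A2 A3 where A: "A1 \<ge> 1" "good_bound F A1" "A2 \<ge> 1" "good_bound G A2" "A3 \<ge> 1" "good_bound (G_Gx G) A3"
    using ex_A smooth by meson
  define A where "A = max A1 (max A2 A3)"
  have A1': "1 \<le> A" using A by (auto simp: A_def)
  have gb: "good_bound F A" "good_bound G A" "good_bound (G_Gx G) A"
    using A unfolding good_bound_def A_def by (auto simp: le_max_iff_disj)
  define small_rem where "small_rem \<Phi> C e \<longleftrightarrow> (\<forall>u x \<epsilon> f g w. 0 < \<epsilon> \<longrightarrow> \<epsilon> < e \<longrightarrow> 0 \<le> u \<longrightarrow> u + \<epsilon> \<le> \<T> \<longrightarrow> \<bar>x\<bar> \<le> R' \<longrightarrow> \<bar>f\<bar> \<le> R' \<longrightarrow> \<bar>g\<bar> \<le> R' \<longrightarrow>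
      \<bar>ito_remainder \<Phi> u x \<epsilon> f g w\<bar> \<le> 1 / 8 * (\<epsilon> + w\<^sup>2) + C * (\<epsilon> * \<bar>w\<bar> + w ^ 4))" for \<Phi> C e
  have ex_rem: "\<exists>C\<ge>0. \<exists>e>0. small_rem \<Phi> C e"
    if sm: "C12 \<Phi>" and gr: "\<And>u x. 0 \<le> u \<Longrightarrow> u \<le> \<T> \<Longrightarrow> \<bar>\<Phi> u x\<bar> \<le> H * (1 + \<bar>x\<bar>)" for \<Phi>
  proof -
    obtain C e where Ce: "C \<ge> 0" "e > 0" "e \<le> 1"
      "\<And>u x \<epsilon> f g w. 0 < \<epsilon> \<Longrightarrow> \<epsilon> < e \<Longrightarrow> 0 \<le> u \<Longrightarrow> u + \<epsilon> \<le> \<T> \<Longrightarrow> \<bar>x\<bar> \<le> R' \<Longrightarrow> \<bar>f\<bar> \<le> R' \<Longrightarrow> \<bar>g\<bar> \<le> R' \<Longrightarrow>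
      \<bar>ito_remainder \<Phi> u x \<epsilon> f g w\<bar> \<le> 1 / 8 * (\<epsilon> + w\<^sup>2) + C * (\<epsilon> * \<bar>w\<bar> + w ^ 4)"
    proof -
      have "(1 / 8 :: real) > 0" by simp
      from ito_remainder_small[OF sm gr H_nonneg R'(2) this] that show ?thesis by blast
    qed
    then show ?thesis unfolding small_rem_def by blast
  qed
  obtain C1 e1 where r1: "C1 \<ge> 0" "e1 > 0" "small_rem F C1 e1" using ex_rem[OF smooth(1) growth(1)] by blast
  obtain C2 e2 where r2: "C2 \<ge> 0" "e2 > 0" "small_rem G C2 e2" using ex_rem[OF smooth(2) growth(2)] by blast
  obtain C3 e3 where r3: "C3 \<ge> 0" "e3 > 0" "small_rem (G_Gx G) C3 e3" using ex_rem[OF smooth(3) growth(3)] by blast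
  define C where "C = max C1 (max C2 C3)"
  define e where "e = min e1 (min e2 e3)"
  have C0: "C \<ge> 0" and e0: "e > 0" using r1 r2 r3 by (auto simp: C_def e_def)
  have rem_mono: "small_rem \<Phi> C e" if "small_rem \<Phi> C' e'" "C' \<le> C" "e \<le> e'" for \<Phi> C' e'
    unfolding small_rem_def
  proof (intro allI impI)
    fix u x \<epsilon> f g w :: real
    assume a: "0 < \<epsilon>" "\<epsilon> < e" "0 \<le> u" "u + \<epsilon> \<le> \<T>" "\<bar>x\<bar> \<le> R'" "\<bar>f\<bar> \<le> R'" "\<bar>g\<bar> \<le> R'"
    then have "\<bar>ito_remainder \<Phi> u x \<epsilon> f g w\<bar> \<le> 1 / 8 * (\<epsilon> + w\<^sup>2) + C' * (\<epsilon> * \<bar>w\<bar> + w ^ 4)"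
      using that unfolding small_rem_def by auto
    moreover have "C' * (\<epsilon> * \<bar>w\<bar> + w ^ 4) \<le> C * (\<epsilon> * \<bar>w\<bar> + w ^ 4)"
      using that(2) a by (intro mult_right_mono) auto
    ultimately show "\<bar>ito_remainder \<Phi> u x \<epsilon> f g w\<bar> \<le> 1 / 8 * (\<epsilon> + w\<^sup>2) + C * (\<epsilon> * \<bar>w\<bar> + w ^ 4)" by linarith
  qed
  have sr: "small_rem F C e" "small_rem G C e" "small_rem (G_Gx G) C e"
    using rem_mono[OF r1(3)] rem_mono[OF r2(3)] rem_mono[OF r3(3)] by (auto simp: C_def e_def)
  \<comment> \<open>Makes the exchange in \<open>frozen_coefficients\<close> cost at most
    \<delta>.\<close>
  define \<kappa> where "\<kappa> = \<delta> / (A * (1 + H) * (1 + R'))"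
  have den: "1 \<le> A * (1 + H) * (1 + R')"
    using mult_mono[of 1 "A * (1 + H)" 1 "1 + R'"] mult_mono[of 1 A 1 "1 + H"] A1' H_nonneg R'(2) by auto
  have \<kappa>0: "0 < \<kappa>" "\<kappa> \<le> \<delta>"
    using \<delta> den by (auto simp: \<kappa>_def divide_le_eq)
  have \<kappa>1: "A * H * \<kappa> * (1 + R') \<le> \<delta>"
  proof -
    have "A * (1 + H) * \<kappa> * (1 + R') = \<delta>" using den by (simp add: \<kappa>_def field_simps)
    moreover have "A * H * \<kappa> * (1 + R') \<le> A * (1 + H) * \<kappa> * (1 + R')"
      using A1' H_nonneg \<kappa>0 R'(2) by (intro mult_right_mono mult_left_mono) auto
    ultimately show ?thesis by simp
  qed
  have \<kappa>2: "H * \<kappa> \<le> \<delta>"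
  proof -
    have "1 * (H * \<kappa>) \<le> (A * (1 + R')) * (H * \<kappa>)"
      using A1' R'(2) H_nonneg \<kappa>0 mult_mono[of 1 A 1 "1 + R'"] by (intro mult_right_mono) auto
    then show ?thesis using \<kappa>1 by (simp add: mult_ac)
  qed
  define Q where "Q = A * R'\<^sup>2"
  have Q0: "0 \<le> Q" using A1' by (simp add: Q_def)
  \<comment> \<open>In this order: a small Taylor remainder, \<epsilon> \<le> \<delta>^2,
    \<open>Q_small\<close>, and the higher-order moments in \<open>expands_of_C12\<close>.\<close>
  define bd where "bd = min e (min (\<delta>\<^sup>2) (min (\<delta> / (8 * Q\<^sup>2 + 1)) (1 / (2 * (4 * C\<^sup>2 + 420 * C\<^sup>2 + 1)))))"
  have bd: "0 < bd" "bd \<le> e" "bd \<le> \<delta>\<^sup>2" "bd \<le> \<delta> / (8 * Q\<^sup>2 + 1)" "bd \<le> 1 / (2 * (4 * C\<^sup>2 + 420 * C\<^sup>2 + 1))"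
    using e0 \<delta> by (auto simp: bd_def add_pos_nonneg intro!: divide_pos_pos add_nonneg_pos)
  obtain L0 :: nat where L0: "\<delta> / bd < real L0" using reals_Archimedean2 by blast
  have main: "second_moment M (\<lambda>z. running_max (\<lambda>l. if \<forall>j<l. good j z then V l z - Z l z else 0) (N * L))
      \<le> ennreal (milstein_constant x0 \<T> H (K0 + H + 1) * \<delta>\<^sup>2)"
    if L: "L \<ge> L0" "L > 0" and gi: "gaussian_increments M \<G> w (\<delta> / real L)"
      and mc: "milstein_coupling M \<G> w (\<delta> / real L) L F G x0 R \<kappa> good V Y Z" for L \<G> w good V Y Z
  proof -
    define \<epsilon> where "\<epsilon> = \<delta> / real L"
    have \<epsilon>0: "0 < \<epsilon>" using \<delta> L by (simp add: \<epsilon>_def)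
    have \<epsilon>bd: "\<epsilon> < bd"
    proof -
      have "\<delta> / bd < real L" using L0 L(1) by (meson less_le_trans of_nat_mono)
      then show ?thesis using bd(1) L(2) by (simp add: \<epsilon>_def divide_less_eq mult.commute)
    qed
    have d: "\<delta> = real L * \<epsilon>" using L by (simp add: \<epsilon>_def)
    have hor: "\<T> = real (N * L) * \<epsilon>" using T d by simp
    have Qs: "8 * Q\<^sup>2 * \<epsilon> \<le> \<delta>"
    proof -
      have "(8 * Q\<^sup>2 + 1) * \<epsilon> \<le> \<delta>"
      proof -
        have "(8 * Q\<^sup>2 + 1) * \<epsilon> \<le> (8 * Q\<^sup>2 + 1) * bd" using \<epsilon>bd by (intro mult_left_mono) auto
        also have "\<dots> \<le> \<delta>" using bd(4) by (simp add: pos_le_divide_eq add_nonneg_pos mult.commute)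
        finally show ?thesis .
      qed
      then show ?thesis using \<epsilon>0 by (simp add: distrib_right)
    qed
    have Cs: "4 * C\<^sup>2 * \<epsilon> + 420 * C\<^sup>2 * \<epsilon>\<^sup>2 \<le> 1 / 2"
    proof -
      have "\<epsilon> \<le> \<delta>\<^sup>2" using \<epsilon>bd bd(3) by simp
      also have "\<dots> \<le> 1" using \<delta> by (simp add: power_le_one)
      finally have "\<epsilon>\<^sup>2 \<le> \<epsilon>" using \<epsilon>0 by (simp add: power2_eq_square)
      then have "420 * C\<^sup>2 * \<epsilon>\<^sup>2 \<le> 420 * C\<^sup>2 * \<epsilon>" by (intro mult_left_mono) auto
      moreover have "(2 * (4 * C\<^sup>2 + 420 * C\<^sup>2 + 1)) * \<epsilon> \<le> 1"
      proof -
        have "(2 * (4 * C\<^sup>2 + 420 * C\<^sup>2 + 1)) * \<epsilon> \<le> (2 * (4 * C\<^sup>2 + 420 * C\<^sup>2 + 1)) * bd" using \<epsilon>bd by (intro mult_left_mono) auto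
        also have "\<dots> \<le> 1" using bd(5) by (simp add: pos_le_divide_eq add_nonneg_pos mult.commute)
        finally show ?thesis .
      qed
      ultimately show ?thesis using \<epsilon>0 by (simp add: distrib_right)
    qed
    interpret gaussian_increments M \<G> w \<epsilon> using gi by (simp add: \<epsilon>_def)
    note mc' = mc[folded \<epsilon>_def, unfolded milstein_coupling_def]
    interpret grid_process M \<G> w \<epsilon> L N \<delta> \<T> "K0 + H + 1" Q good V
      by unfold_locales (use L d \<delta> \<epsilon>bd bd hor T K0_nonneg H_nonneg Q0 Qs mc' in auto)
    have Yad: "Y j \<in> borel_measurable (\<G> j)" for j using mc' by auto
    have VS: "V (Suc j) z = V j z + (F (real j * \<epsilon>) (Y j z) * \<epsilon> + G (real j * \<epsilon>) (Y j z) * w j z)"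
      if "z \<in> space M" "good j z" for j z using mc' that by auto
    have cl: "\<bar>Y j z\<bar> \<le> R \<and> \<bar>Y j z - V j z\<bar> \<le> \<kappa>" if "z \<in> space M" "good j z" for j z using mc' that by auto
    have ex: "\<exists>D S q r. expands \<Phi> D S q r \<and> (\<forall>i z. z \<in> space M \<longrightarrow> i < N * L \<longrightarrow> good i z \<longrightarrow>
       \<bar>S i z - partial_x \<Phi> (real i * \<epsilon>) (V i z) * G (real i * \<epsilon>) (V i z)\<bar> \<le> \<delta>)"
      if C12: "C12 \<Phi>" and gb: "good_bound \<Phi> A" and sr: "small_rem \<Phi> C e"
        and dr: "\<And>u x. 0 \<le> u \<Longrightarrow> u \<le> \<T> \<Longrightarrow>
        \<bar>partial_u \<Phi> u x + partial_x \<Phi> u x * F u x + 1 / 2 * partial_x (partial_x \<Phi>) u x * (G u x)\<^sup>2\<bar> \<le> (K0 + H) * (1 + \<bar>x\<bar>)"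
        and df: "\<And>u x. 0 \<le> u \<Longrightarrow> u \<le> \<T> \<Longrightarrow> \<bar>partial_x \<Phi> u x * G u x\<bar> \<le> (K0 + H) * (1 + \<bar>x\<bar>)" for \<Phi>
    proof -
      have rem': "\<bar>ito_remainder \<Phi> u x \<epsilon> f g w\<bar> \<le> 1 / 8 * (\<epsilon> + w\<^sup>2) + C * (\<epsilon> * \<bar>w\<bar> + w ^ 4)"
        if "0 \<le> u" "u + \<epsilon> \<le> \<T>" "\<bar>x\<bar> \<le> R'" "\<bar>f\<bar> \<le> R'" "\<bar>g\<bar> \<le> R'" for u x f g w
        using sr \<epsilon>0 \<epsilon>bd bd(2) that unfolding small_rem_def by auto
      have gb': "\<bar>partial_x \<Phi> u x\<bar> \<le> A" "\<bar>partial_x (partial_x \<Phi>) u x\<bar> \<le> A" if "0 \<le> u" "u \<le> \<T>" "\<bar>x\<bar> \<le> R'" for u x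
        using gb that unfolding good_bound_def by auto
      have k': "0 \<le> \<kappa>" "\<kappa> \<le> 1" "A * R'\<^sup>2 \<le> Q" "K0 + H + 1 \<le> K0 + H + 1" "0 \<le> K0 + H"
        using \<kappa>0 \<delta> K0_nonneg H_nonneg by (auto simp: Q_def)
      show ?thesis
        by (rule expands_of_C12[OF C12 jc(1,2) Yad VS cl k'(1,2) \<kappa>1 \<delta>(2) H_nonneg R' lip(1,2) growth(1,2) A1' gb' k'(3-5) dr df rem' C0 Cs])
           blast+
    qed
    \<comment> \<open>Adding \<open>H\<close> serves the expansion of G: its diffusion coefficient
      is G G_x, which is bounded by the growth constant and not by \<open>K0\<close>.\<close>
    have kk: "K0 * (1 + \<bar>x\<bar>) \<le> (K0 + H) * (1 + \<bar>x\<bar>)" "H * (1 + \<bar>x\<bar>) \<le> (K0 + H) * (1 + \<bar>x\<bar>)" for x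
      using K0_nonneg H_nonneg by (auto intro!: mult_right_mono)
    have Pdef: "partial_x G u x * G u x = G_Gx G u x" for u x by (simp add: G_Gx_def)
    obtain DF SF qF rF where eF: "expands F DF SF qF rF"
      using ex[OF smooth(1) gb(1) sr(1) order_trans[OF drift_bound(1) kk(1)] order_trans[OF diffusion_bound(1) kk(1)]] by blast
    obtain DP SP qP rP where eP: "expands (G_Gx G) DP SP qP rP"
      using ex[OF smooth(3) gb(3) sr(3) order_trans[OF drift_bound(3) kk(1)] order_trans[OF diffusion_bound(2) kk(1)]] by blast
    have dG: "\<bar>partial_x G u x * G u x\<bar> \<le> (K0 + H) * (1 + \<bar>x\<bar>)" if "0 \<le> u" "u \<le> \<T>" for u x
      unfolding Pdef using order_trans[OF growth(3)[OF that] kk(2)] .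
    obtain DG SG qG rG where eG: "expands G DG SG qG rG"
      and SGc: "\<And>i z. z \<in> space M \<Longrightarrow> i < N * L \<Longrightarrow> good i z \<Longrightarrow>
       \<bar>SG i z - partial_x G (real i * \<epsilon>) (V i z) * G (real i * \<epsilon>) (V i z)\<bar> \<le> \<delta>"
      using ex[OF smooth(2) gb(2) sr(2) order_trans[OF drift_bound(2) kk(1)] dG] by blast
    have tb: "0 \<le> real j * \<epsilon>" "j \<le> N * L \<Longrightarrow> real j * \<epsilon> \<le> \<T>" for j
      using \<epsilon>0 unfolding hor by (auto intro!: mult_right_mono simp del: of_nat_mult)
    interpret milstein_error M \<G> w \<epsilon> L N \<delta> \<T> "K0 + H + 1" Q good V F G "G_Gx G" Y Z H \<kappa> x0
        DF SF qF rF DG SG qG rG DP SP qP rP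
    proof unfold_locales
      show "F (real j * \<epsilon>) \<in> borel_measurable borel" "G (real j * \<epsilon>) \<in> borel_measurable borel"
        "G_Gx G (real j * \<epsilon>) \<in> borel_measurable borel" for j
        using jointly_continuous_slice jc tb by auto
      show "\<bar>SG i z - G_Gx G (real i * \<epsilon>) (V i z)\<bar> \<le> \<delta>" if "z \<in> space M" "i < N * L" "good i z" for i z
        using SGc[OF that] by (simp add: Pdef)
    qed (use H_nonneg K0_nonneg \<kappa>0 \<kappa>2 \<delta> lip growth tb mc' eF eG eP in \<open>auto\<close>)
    have "second_moment M (\<lambda>z. running_max (\<lambda>l. if \<forall>j<l. good j z then V l z - Z l z else 0) (N * L))
      \<le> second_moment M (max_err (N * L))"
    proof (rule second_moment_mono)
      fix z assume z: "z \<in> space M"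
      have "running_max (\<lambda>l. if \<forall>j<l. good j z then V l z - Z l z else 0) (N * L) \<le> max_err (N * L) z"
      proof (rule running_max_leI)
        fix l assume l: "l \<le> N * L"
        have "\<bar>if \<forall>j<l. good j z then V l z - Z l z else 0\<bar> \<le> \<bar>err l z\<bar>"
        proof (cases "\<forall>j<l. good j z")
          case True
          show ?thesis
          proof (cases l)
            case 0
            then show ?thesis using mc' z by simp
          next
            case (Suc j)
            then show ?thesis using err_good[OF z, of j l] True by simp
          qed
        qed auto
        also have "\<dots> \<le> max_err (N * L) z" unfolding max_err_def by (rule running_max_ge[OF l])
        finally show "\<bar>if \<forall>j<l. good j z then V l z - Z l z else 0\<bar> \<le> max_err (N * L) z" .
      qed
      then show "\<bar>running_max (\<lambda>l. if \<forall>j<l. good j z then V l z - Z l z else 0) (N * L)\<bar> \<le> \<bar>max_err (N * L) z\<bar>"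
        using running_max_nonneg[of "\<lambda>l. if \<forall>j<l. good j z then V l z - Z l z else 0" "N * L"] by linarith
    qed
    also have "\<dots> \<le> ennreal (error_constant * \<delta>\<^sup>2)" by (rule max_err_bound)
    also have "error_constant = milstein_constant x0 \<T> H (K0 + H + 1)"
      by (simp add: error_constant_def milstein_constant_def weight_bound_def moment_bound_def)
    finally show ?thesis .
  qed
  show ?thesis using \<kappa>0 main by blast
qed

section \<open>Inverting a subordinator path\<close>

locale subordinator_path =
  fixes d :: "real \<Rightarrow> real"
  assumes strict: "\<And>u v. 0 \<le> u \<Longrightarrow> u < v \<Longrightarrow> d u < d v"
    and zero: "d 0 = 0"
    and right_cont: "\<And>u. 0 \<le> u \<Longrightarrow> continuous (at_right u) d"
    and unbounded: "\<And>t. \<exists>u>0. d u > t"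
begin

definition e :: "real \<Rightarrow> real" where "e t = Inf {u. u > 0 \<and> d u > t}"

lemma mono: "0 \<le> u \<Longrightarrow> u \<le> v \<Longrightarrow> d u \<le> d v"
  using strict[of u v] by (cases "u = v") auto

lemma e_le: assumes "0 \<le> u" "t < d u" shows "e t \<le> u"
proof (rule field_le_epsilon)
  fix \<epsilon> :: real assume "0 < \<epsilon>"
  then have "u + \<epsilon> \<in> {u. u > 0 \<and> d u > t}" using assms strict[of u "u + \<epsilon>"] by auto
  then show "e t \<le> u + \<epsilon>" unfolding e_def by (intro cInf_lower) (auto intro: bdd_belowI[of _ 0])
qed

lemma le_e: assumes "d u \<le> t" "0 \<le> u" shows "u \<le> e t"
  unfolding e_def
proof (rule cInf_greatest)
  show "{u. u > 0 \<and> d u > t} \<noteq> {}" using unbounded[of t] by auto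
  fix x assume "x \<in> {u. u > 0 \<and> d u > t}"
  then have "0 < x" "t < d x" by auto
  then show "u \<le> x" using mono[of x u] assms by (cases "u \<le> x") auto
qed

lemma e_nonneg: "0 \<le> e t"
  unfolding e_def by (rule cInf_greatest) (use unbounded[of t] in auto)

lemma e_less: "e t < u \<Longrightarrow> t < d u"
  using le_e[of u t] e_nonneg[of t] by (cases "d u \<le> t") auto

lemma e_le_iff: assumes "0 \<le> u" shows "e t \<le> u \<longleftrightarrow> (\<forall>v>u. t < d v)"
proof
  assume "e t \<le> u" then show "\<forall>v>u. t < d v" using e_less by auto
next
  assume *: "\<forall>v>u. t < d v"
  show "e t \<le> u"
  proof (rule field_le_epsilon)
    fix \<epsilon> :: real assume "0 < \<epsilon>"
    then show "e t \<le> u + \<epsilon>" using * assms by (intro e_le) auto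
  qed
qed

lemma e_d: assumes "0 \<le> u" shows "e (d u) = u"
proof (rule antisym)
  show "e (d u) \<le> u" using assms strict by (subst e_le_iff) auto
  show "u \<le> e (d u)" using assms by (intro le_e) auto
qed

lemma e_mono: "s \<le> t \<Longrightarrow> e s \<le> e t"
  unfolding e_le_iff[OF e_nonneg] using e_less[of t] by force

lemma d_nonneg: "0 \<le> u \<Longrightarrow> 0 \<le> d u"
  using mono[of 0 u] zero by simp

lemma d_e_ge: assumes "0 \<le> t" shows "t \<le> d (e t)"
proof (rule ccontr)
  assume "\<not> t \<le> d (e t)"
  then have "d (e t) < t" by simp
  then have "eventually (\<lambda>u. d u < t) (at_right (e t))"
    using right_cont[OF e_nonneg] by (auto simp: continuous_within intro: order_tendstoD)
  then obtain b where "b > e t" "\<And>y. e t < y \<Longrightarrow> y < b \<Longrightarrow> d y < t"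
    unfolding eventually_at_right_field by blast
  then have "d ((e t + b) / 2) < t" by auto
  moreover have "t < d ((e t + b) / 2)" using \<open>b > e t\<close> by (intro e_less) auto
  ultimately show False by simp
qed

lemma d_le: assumes "0 \<le> u" "u < e t" shows "d u \<le> t"
  using e_le[OF assms(1), of t] assms(2) by (cases "t < d u") auto

text \<open>\<open>e\<close> is monotone and inverts \<open>d\<close>, so capping outer time at
  \<open>d u\<close> caps inner time at \<open>u\<close>. This is what turns integrals of simple
  processes in outer time into sums over an inner-time grid.\<close>

lemma e_min: assumes "0 \<le> u" shows "e (min s (d u)) = min (e s) u"
proof (cases "s \<le> d u")
  case True
  then show ?thesis using e_mono[OF True] e_d[OF assms] by (simp add: min_def)
next
  case False
  then show ?thesis using e_mono[of "d u" s] e_d[OF assms] by (simp add: min_def)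
qed

lemma e_pos: assumes "0 < t" shows "0 < e t"
proof (rule ccontr)
  assume "\<not> 0 < e t"
  then have "e t = 0" using e_nonneg[of t] by simp
  then show False using d_e_ge[of t] assms zero by simp
qed

text \<open>Strict growth of \<open>d\<close> excludes jumps of \<open>e\<close>: inner times
  slightly above and below \<open>e t\<close> have images strictly on either side of
  \<open>t\<close>.\<close>

lemma continuous_e: "continuous_on UNIV e"
proof -
  have "isCont e t" for t
    unfolding continuous_at LIM_def dist_real_def
  proof (intro allI impI)
    fix \<epsilon> :: real assume \<epsilon>: "0 < \<epsilon>"
    have up: "t < d (e t + \<epsilon> / 2)" using \<epsilon> by (intro e_less) auto
    show "\<exists>s>0. \<forall>x. x \<noteq> t \<and> \<bar>x - t\<bar> < s \<longrightarrow> \<bar>e x - e t\<bar> < \<epsilon>"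
    proof (cases "e t - \<epsilon> / 2 \<ge> 0")
      case True
      have lo: "d (e t - \<epsilon> / 2) < t"
      proof -
        have "d (e t - \<epsilon> / 2) < d (e t - \<epsilon> / 4)" using True \<epsilon> by (intro strict) auto
        also have "\<dots> \<le> t" using True \<epsilon> by (intro d_le) auto
        finally show ?thesis .
      qed
      show ?thesis
      proof (intro exI conjI allI impI)
        show "0 < min (d (e t + \<epsilon> / 2) - t) (t - d (e t - \<epsilon> / 2))" using up lo by simp
        fix x assume "x \<noteq> t \<and> \<bar>x - t\<bar> < min (d (e t + \<epsilon> / 2) - t) (t - d (e t - \<epsilon> / 2))"
        then have "x < d (e t + \<epsilon> / 2)" "d (e t - \<epsilon> / 2) \<le> x" by linarith+
        then have "e x \<le> e t + \<epsilon> / 2" "e t - \<epsilon> / 2 \<le> e x" using e_le[of "e t + \<epsilon> / 2" x] le_e[of "e t - \<epsilon> / 2" x] True \<epsilon> by auto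
        then show "\<bar>e x - e t\<bar> < \<epsilon>" using \<epsilon> by linarith
      qed
    next
      \<comment> \<open>Near zero, nonnegativity of \<open>e\<close> replaces the lower
        bound.\<close>
      case False
      show ?thesis
      proof (intro exI conjI allI impI)
        show "0 < d (e t + \<epsilon> / 2) - t" using up by simp
        fix x assume "x \<noteq> t \<and> \<bar>x - t\<bar> < d (e t + \<epsilon> / 2) - t"
        then have "x < d (e t + \<epsilon> / 2)" by linarith
        then have "e x \<le> e t + \<epsilon> / 2" using e_le[of "e t + \<epsilon> / 2" x] e_nonneg[of t] \<epsilon> by auto
        then show "\<bar>e x - e t\<bar> < \<epsilon>" using \<epsilon> False e_nonneg[of x] e_nonneg[of t] by linarith
      qed
    qed
  qed
  then show ?thesis by (simp add: continuous_at_imp_continuous_on)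
qed

end

section \<open>Uniform convergence in probability and almost surely\<close>

lemma (in prob_space) measure_tendsto_0_of_AE:
  assumes A: "\<And>n. A n \<in> sets M" and ev: "AE z in M. eventually (\<lambda>n. z \<notin> A n) sequentially"
  shows "(\<lambda>n. emeasure M (A n)) \<longlonglongrightarrow> 0"
proof -
  have "(\<lambda>n. (\<integral>z. indicator (A n) z \<partial>M)) \<longlonglongrightarrow> (\<integral>z. (0::real) \<partial>M)"
  proof (rule integral_dominated_convergence[where w="\<lambda>_. 1"])
    show "AE z in M. (\<lambda>n. indicator (A n) z :: real) \<longlonglongrightarrow> 0"
      using ev
    proof eventually_elim
      case (elim z)
      then have "eventually (\<lambda>n. (indicator (A n) z :: real) = 0) sequentially"
        by eventually_elim auto
      then show ?case by (rule tendsto_eventually)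
    qed
  qed (use A in auto)
  then have "(\<lambda>n. measure M (A n)) \<longlonglongrightarrow> 0" using A by simp
  then have "(\<lambda>n. ennreal (measure M (A n))) \<longlonglongrightarrow> ennreal 0" by (rule tendsto_ennrealI)
  then show ?thesis by (simp add: emeasure_eq_measure)
qed

text \<open>Borel-Cantelli along a subsequence on which the exceptional outer measures decay
  geometrically.\<close>

lemma AE_uniform_subsequence_of_ucp:
  assumes fin: "emeasure M (space M) \<noteq> \<infinity>" and ucp: "ucp_converges M T S H"
  shows "\<exists>\<rho>::nat \<Rightarrow> nat. strict_mono \<rho> \<and>
    (AE z in M. uniform_limit {0..T} (\<lambda>r t. S (\<rho> r) t z) (\<lambda>t. H t z) sequentially)"
proof -
  let ?A = "\<lambda>\<epsilon> j. {z \<in> space M. \<exists>t\<in>{0..T}. \<bar>S j t z - H t z\<bar> > \<epsilon>}"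
  have lim: "(\<lambda>j. outer_measure_of M (?A \<epsilon> j)) \<longlonglongrightarrow> 0" if "\<epsilon> > 0" for \<epsilon>
    using ucp that by (auto simp: ucp_converges_def)
  have ex: "\<exists>j>k. outer_measure_of M (?A ((1/2)^r) j) < ennreal ((1/2)^r)" for k r :: nat
  proof -
    have "eventually (\<lambda>j. outer_measure_of M (?A ((1/2)^r) j) < ennreal ((1/2)^r)) sequentially"
      by (rule order_tendstoD(2)[OF lim]) auto
    then obtain J where "\<And>j. j \<ge> J \<Longrightarrow> outer_measure_of M (?A ((1/2)^r) j) < ennreal ((1/2)^r)"
      unfolding eventually_sequentially by blast
    then show ?thesis by (intro exI[of _ "max J (Suc k)"]) auto
  qed
  define \<rho> where "\<rho> = rec_nat (SOME j. outer_measure_of M (?A ((1/2)^0) j) < ennreal ((1/2)^0))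
      (\<lambda>r k. SOME j. j > k \<and> outer_measure_of M (?A ((1/2)^Suc r) j) < ennreal ((1/2)^Suc r))"
  have \<rho>_Suc: "\<rho> (Suc r) > \<rho> r \<and> outer_measure_of M (?A ((1/2)^Suc r) (\<rho> (Suc r))) < ennreal ((1/2)^Suc r)" for r
    unfolding \<rho>_def using someI_ex[OF ex[of "\<rho> r" "Suc r"]] by (simp add: \<rho>_def)
  have sm: "strict_mono \<rho>" using \<rho>_Suc by (intro strict_monoI_Suc) auto
  \<comment> \<open>The exceptional sets need not be measurable; measurable hulls with the same
    outer measure replace them.\<close>
  have "\<exists>E. E \<in> sets M \<and> ?A ((1/2)^Suc r) (\<rho> (Suc r)) \<subseteq> E \<and> emeasure M E < ennreal ((1/2)^Suc r)" for r
  proof -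
    obtain E where "E \<in> sets M" "?A ((1/2)^Suc r) (\<rho> (Suc r)) \<subseteq> E" "outer_measure_of M (?A ((1/2)^Suc r) (\<rho> (Suc r))) = emeasure M E"
      using outer_measure_of_attain[of "?A ((1/2)^Suc r) (\<rho> (Suc r))" M] by auto
    then show ?thesis using \<rho>_Suc[of r] by auto
  qed
  then have "\<exists>E. \<forall>r. E r \<in> sets M \<and> ?A ((1/2)^Suc r) (\<rho> (Suc r)) \<subseteq> E r \<and> emeasure M (E r) < ennreal ((1/2)^Suc r)"
    by (intro choice allI)
  then obtain E where E: "\<And>r. E r \<in> sets M" "\<And>r. ?A ((1/2)^Suc r) (\<rho> (Suc r)) \<subseteq> E r"
      "\<And>r. emeasure M (E r) < ennreal ((1/2)^Suc r)" by auto
  have "AE z in M. eventually (\<lambda>r. z \<in> space M - E r) sequentially"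
  proof (rule borel_cantelli_AE1)
    show "emeasure M (E r) < \<infinity>" for r using E(3)[of r] by (rule order_less_trans) simp
    have le: "measure M (E r) \<le> (1/2)^Suc r" for r
      unfolding measure_def by (intro enn2real_leI less_imp_le E(3)) auto
    show "summable (\<lambda>r. measure M (E r))"
    proof (rule summable_comparison_test[OF exI[of _ 0]])
      show "\<forall>n\<ge>0. norm (measure M (E n)) \<le> (1/2)^Suc n" using le by simp
      show "summable (\<lambda>n. (1/2::real)^Suc n)" by (simp add: summable_geometric)
    qed
  qed (use E in auto)
  then have "AE z in M. uniform_limit {0..T} (\<lambda>r t. S (\<rho> r) t z) (\<lambda>t. H t z) sequentially"
  proof eventually_elim
    case (elim z)
    show ?case
    proof (rule uniform_limitI)
      fix \<epsilon> :: real assume "\<epsilon> > 0"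
      have "eventually (\<lambda>r. (1/2::real)^r < \<epsilon>) sequentially"
        using order_tendstoD(2)[OF LIMSEQ_power_zero[of "1/2::real"], of \<epsilon>] \<open>\<epsilon> > 0\<close> by simp
      \<comment> \<open>Shift by one: \<open>E r\<close> covers the exceptional set of
        \<open>\<rho> (Suc r)\<close>.\<close>
      moreover have "eventually (\<lambda>r. z \<in> space M - E (r - 1) \<and> r > 0) sequentially"
      proof -
        obtain r0 where "\<And>r. r \<ge> r0 \<Longrightarrow> z \<in> space M - E r" using elim unfolding eventually_sequentially by blast
        then show ?thesis unfolding eventually_sequentially by (intro exI[of _ "Suc r0"]) auto
      qed
      ultimately show "eventually (\<lambda>r. \<forall>t\<in>{0..T}. dist (S (\<rho> r) t z) (H t z) < \<epsilon>) sequentially"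
      proof eventually_elim
        case (elim r)
        then obtain k where r: "r = Suc k" by (cases r) auto
        have "z \<notin> ?A ((1/2)^Suc k) (\<rho> (Suc k))" using E(2)[of k] elim r by auto
        then have "\<forall>t\<in>{0..T}. \<bar>S (\<rho> r) t z - H t z\<bar> \<le> (1/2)^r" using elim r by (auto simp: not_less)
        then show ?case using elim by (force simp: dist_real_def)
      qed
    qed
  qed
  then show ?thesis using sm by blast
qed

lemma left_continuous_simple_process:
  assumes "t > 0"
  shows "((\<lambda>s. simple_process n \<xi>0 \<theta> \<xi> s z) \<longlongrightarrow> simple_process n \<xi>0 \<theta> \<xi> t z) (at_left t)"
proof -
  have "eventually (\<lambda>s. indicator {\<theta> i z<..\<theta> (Suc i) z} s = (indicator {\<theta> i z<..\<theta> (Suc i) z} t :: real)) (at_left t)" for i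
  proof -
    consider "t \<le> \<theta> i z" | "\<theta> i z < t" "t \<le> \<theta> (Suc i) z" | "\<theta> i z < t" "\<theta> (Suc i) z < t" by linarith
    then show ?thesis
    proof cases
      case 1
      then show ?thesis unfolding eventually_at_left_field by (intro exI[of _ "t - 1"]) auto
    next
      case 2
      then show ?thesis unfolding eventually_at_left_field by (intro exI[of _ "\<theta> i z"]) auto
    next
      case 3
      then show ?thesis unfolding eventually_at_left_field by (intro exI[of _ "\<theta> (Suc i) z"]) auto
    qed
  qed
  then have s: "((\<lambda>s. indicator {\<theta> i z<..\<theta> (Suc i) z} s :: real) \<longlongrightarrow> indicator {\<theta> i z<..\<theta> (Suc i) z} t) (at_left t)" for i
    by (rule tendsto_eventually)
  have "eventually (\<lambda>s. (indicator {0} s :: real) = indicator {0} t) (at_left t)"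
    unfolding eventually_at_left_field using assms by (intro exI[of _ 0]) auto
  then have z: "((\<lambda>s. indicator {0} s :: real) \<longlongrightarrow> indicator {0} t) (at_left t)" by (rule tendsto_eventually)
  show ?thesis unfolding simple_process_def by (intro tendsto_intros s z)
qed

text \<open>Left continuity reduces the supremum over \<open>[0,T]\<close> to a countable one, which makes the exceptional
  events measurable.\<close>

lemma (in prob_space) ucp_of_AE_uniform:
  assumes S: "\<And>j t. t \<in> {0..T} \<Longrightarrow> simple_process (n j) (\<xi>0 j) (\<theta> j) (\<xi> j) t \<in> borel_measurable M"
    and H: "\<And>t. t \<in> {0..T} \<Longrightarrow> H t \<in> borel_measurable M"
    and lc: "AE z in M. left_cont_right_lim T (\<lambda>t. H t z)"
    and lim: "AE z in M. uniform_limit {0..T} (\<lambda>j t. simple_process (n j) (\<xi>0 j) (\<theta> j) (\<xi> j) t z) (\<lambda>t. H t z) sequentially"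
  shows "ucp_converges M T (\<lambda>j. simple_process (n j) (\<xi>0 j) (\<theta> j) (\<xi> j)) H"
  unfolding ucp_converges_def
proof (intro allI impI)
  fix \<epsilon> :: real assume \<epsilon>: "\<epsilon> > 0"
  let ?S = "\<lambda>j. simple_process (n j) (\<xi>0 j) (\<theta> j) (\<xi> j)"
  let ?A = "\<lambda>j. {z \<in> space M. \<exists>t\<in>{0..T}. \<bar>?S j t z - H t z\<bar> > \<epsilon>}"
  obtain N0 where N0: "N0 \<in> null_sets M" "{z \<in> space M. \<not> left_cont_right_lim T (\<lambda>t. H t z)} \<subseteq> N0"
    using lc unfolding eventually_ae_filter by blast
  define C where "C = (\<rat> \<inter> {0..T}) \<union> ({0..T} \<inter> {T})"
  have C: "countable C" "C \<subseteq> {0..T}" unfolding C_def by (auto intro: countable_rat countable_subset)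
  define B where "B j = {z \<in> space M. \<exists>t\<in>C. \<bar>?S j t z - H t z\<bar> > \<epsilon>} \<union> N0" for j
  have B_sets: "B j \<in> sets M" for j
  proof -
    have "{z \<in> space M. \<exists>t\<in>C. \<bar>?S j t z - H t z\<bar> > \<epsilon>} = (\<Union>t\<in>C. {z \<in> space M. \<bar>?S j t z - H t z\<bar> > \<epsilon>})"
      by auto
    also have "\<dots> \<in> sets M"
    proof (rule sets.countable_UN''[OF C(1)])
      fix t assume "t \<in> C"
      then have [measurable]: "?S j t \<in> borel_measurable M" "H t \<in> borel_measurable M" using S H C(2) by auto
      show "{z \<in> space M. \<bar>?S j t z - H t z\<bar> > \<epsilon>} \<in> sets M" by measurable
    qed
    finally show ?thesis unfolding B_def using N0 by auto
  qed
  have sub: "?A j \<subseteq> B j" for j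
  proof
    fix z assume z: "z \<in> ?A j"
    show "z \<in> B j"
    proof (cases "z \<in> N0")
      case False
      then have l: "left_cont_right_lim T (\<lambda>t. H t z)" using N0 z by auto
      obtain t where t: "t \<in> {0..T}" "\<bar>?S j t z - H t z\<bar> > \<epsilon>" using z by auto
      show ?thesis
      proof (cases "t \<in> C")
        case True
        then show ?thesis using t z by (auto simp: B_def)
      next
        case False
        then have t0: "t > 0" "t \<le> T" using t by (cases "t = 0"; auto simp: C_def)+
        have "((\<lambda>s. \<bar>?S j s z - H s z\<bar>) \<longlongrightarrow> \<bar>?S j t z - H t z\<bar>) (at_left t)"
          using l t0 by (intro tendsto_intros left_continuous_simple_process) (auto simp: left_cont_right_lim_def)
        then have "eventually (\<lambda>s. \<bar>?S j s z - H s z\<bar> > \<epsilon>) (at_left t)"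
          using t by (intro order_tendstoD(1))
        then obtain b where b: "b < t" "\<And>s. b < s \<Longrightarrow> s < t \<Longrightarrow> \<bar>?S j s z - H s z\<bar> > \<epsilon>"
          unfolding eventually_at_left_field by blast
        obtain q where q: "q \<in> \<rat>" "max b 0 < q" "q < t" using Rats_dense_in_real[of "max b 0" t] b t0 by auto
        then have "q \<in> C" using t0 by (auto simp: C_def)
        then show ?thesis using b(2)[of q] q z by (auto simp: B_def)
      qed
    qed (simp add: B_def)
  qed
  have "AE z in M. eventually (\<lambda>j. z \<notin> B j) sequentially"
    using lim AE_not_in[OF N0(1)]
  proof eventually_elim
    case (elim z)
    have "eventually (\<lambda>j. \<forall>t\<in>{0..T}. dist (?S j t z) (H t z) < \<epsilon>) sequentially"
      using uniform_limitD[OF elim(1) \<epsilon>] .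
    then show ?case
    proof eventually_elim
      case (elim j)
      then show ?case using \<open>z \<notin> N0\<close> C(2) by (force simp: B_def dist_real_def)
    qed
  qed
  then have B0: "(\<lambda>j. emeasure M (B j)) \<longlonglongrightarrow> 0" by (intro measure_tendsto_0_of_AE B_sets)
  have "outer_measure_of M (?A j) \<le> emeasure M (B j)" for j
    using outer_measure_of_mono[OF sub[of j], of M] outer_measure_of_eq[OF B_sets[of j]] by simp
  then show "(\<lambda>j. outer_measure_of M (?A j)) \<longlonglongrightarrow> 0"
    by (intro tendsto_sandwich[OF _ _ tendsto_const B0] always_eventually allI) auto
qed

text \<open>The pathwise form of the defining property of the integral, from which all formulas for
  integrals below are obtained.\<close>

lemma (in prob_space) stochastic_integral_AE_limit:
  assumes si: "stochastic_integral M \<H> T Z H I"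
    and sp: "\<And>j. simple_predictable M \<H> T (n j) (\<xi>0 j) (\<theta> j) (\<xi> j)"
    and S: "\<And>j t. t \<in> {0..T} \<Longrightarrow> simple_process (n j) (\<xi>0 j) (\<theta> j) (\<xi> j) t \<in> borel_measurable M"
    and H: "\<And>t. t \<in> {0..T} \<Longrightarrow> H t \<in> borel_measurable M"
    and lim: "AE z in M. uniform_limit {0..T} (\<lambda>j t. simple_process (n j) (\<xi>0 j) (\<theta> j) (\<xi> j) t z) (\<lambda>t. H t z) sequentially"
  shows "\<exists>\<rho>::nat \<Rightarrow> nat. strict_mono \<rho> \<and>
    (AE z in M. uniform_limit {0..T} (\<lambda>r t. simple_integral Z (n (\<rho> r)) (\<theta> (\<rho> r)) (\<xi> (\<rho> r)) t z) (\<lambda>t. I t z) sequentially)"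
proof -
  have lc: "AE z in M. left_cont_right_lim T (\<lambda>t. H t z)"
    and all: "\<And>n \<xi>0 \<theta> \<xi>. (\<forall>j. simple_predictable M \<H> T (n j) (\<xi>0 j) (\<theta> j) (\<xi> j)) \<Longrightarrow>
        ucp_converges M T (\<lambda>j. simple_process (n j) (\<xi>0 j) (\<theta> j) (\<xi> j)) H \<Longrightarrow>
        ucp_converges M T (\<lambda>j. simple_integral Z (n j) (\<theta> j) (\<xi> j)) I"
    using si unfolding stochastic_integral_def by auto
  have "ucp_converges M T (\<lambda>j. simple_integral Z (n j) (\<theta> j) (\<xi> j)) I"
    by (rule all) (use sp ucp_of_AE_uniform[OF S H lc lim] in auto)
  then show ?thesis by (intro AE_uniform_subsequence_of_ucp) auto
qed

section \<open>The time change\<close>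

text \<open>\<open>\<Omega>1\<close> is a set of full measure on which all paths are regular.\<close>

locale time_changed_brownian = prob_space M for M :: "'a measure" +
  fixes \<F> :: "real \<Rightarrow> 'a measure" and B D :: "real \<Rightarrow> 'a \<Rightarrow> real" and T :: real and \<Omega>1 :: "'a set"
  assumes complete: "complete_measure M" and usual: "usual_conditions M \<F>"
    and BM: "brownian_motion M \<F> B" and D_adapted: "adapted_process \<F> {0..} D"
    and T_pos: "T > 0"
    and Omega1: "\<Omega>1 \<in> sets M" "space M - \<Omega>1 \<in> null_sets M"
    and D_path: "\<And>z. z \<in> \<Omega>1 \<Longrightarrow> subordinator_path (\<lambda>u. D u z)"
    and B_path: "\<And>z. z \<in> \<Omega>1 \<Longrightarrow> continuous_on {0..} (\<lambda>u. B u z)"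
begin

abbreviation "E \<equiv> inverse_process D"
abbreviation "\<H> \<equiv> time_changed_filtration M \<F> D"
abbreviation "W \<equiv> time_changed_process B D"

lemma E_eq: "E t z = Inf {u. u > 0 \<and> D u z > t}"
  by (simp add: inverse_process_def)

sublocale F: filtration "space M" \<F>
  using usual by (simp add: usual_conditions_def)

lemma sets_F: "sets (\<F> t) \<subseteq> sets M" and null_F: "null_sets M \<subseteq> sets (\<F> t)"
  and F_right: "t \<ge> 0 \<Longrightarrow> sets (\<F> t) = (\<Inter>s\<in>{t<..}. sets (\<F> s))"
  using usual by (auto simp: usual_conditions_def)

lemma Omega1_space: "z \<in> \<Omega>1 \<Longrightarrow> z \<in> space M"
  using Omega1(1) sets.sets_into_space by blast

lemma AE_Omega1: "AE z in M. z \<in> \<Omega>1"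
  using AE_not_in[OF Omega1(2)] by (rule AE_mp) (auto intro!: AE_I2)

lemma subset_null_F: "A \<subseteq> space M - \<Omega>1 \<Longrightarrow> A \<in> sets (\<F> t)"
proof -
  assume "A \<subseteq> space M - \<Omega>1"
  then have "A \<in> sets M" using complete Omega1(2) by (auto simp: complete_measure_def)
  then have "A \<in> null_sets M" using null_sets_subset[OF Omega1(2)] \<open>A \<subseteq> _\<close> by auto
  then show ?thesis using null_F by blast
qed

text \<open>The filtration contains all null sets, so measurability has to be checked on regular
  paths only.\<close>

lemma F_modify:
  assumes A: "A \<in> sets (\<F> t)" and sub: "A' \<subseteq> space M" and eq: "\<And>z. z \<in> \<Omega>1 \<Longrightarrow> z \<in> A' \<longleftrightarrow> z \<in> A"
  shows "A' \<in> sets (\<F> t)"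
proof -
  have O1: "\<Omega>1 \<in> sets (\<F> t)"
  proof -
    have "space (\<F> t) - (space M - \<Omega>1) \<in> sets (\<F> t)" using subset_null_F[of "space M - \<Omega>1" t] by (intro sets.compl_sets) auto
    moreover have "space (\<F> t) - (space M - \<Omega>1) = \<Omega>1" using F.space_F Omega1_space by auto
    ultimately show ?thesis by simp
  qed
  have "A' = (A \<inter> \<Omega>1) \<union> (A' - \<Omega>1)" using eq by auto
  moreover have "A' - \<Omega>1 \<in> sets (\<F> t)" using sub by (intro subset_null_F) auto
  ultimately show ?thesis using A O1 by (metis sets.Int sets.Un)
qed

lemma F_mono: "s \<le> t \<Longrightarrow> A \<in> sets (\<F> s) \<Longrightarrow> A \<in> sets (\<F> t)"
  using F.sets_F_mono by blast

lemma measurable_F_mono: "s \<le> t \<Longrightarrow> f \<in> measurable (\<F> s) N \<Longrightarrow> f \<in> measurable (\<F> t) N"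
  by (auto simp: measurable_def F.space_F intro: F_mono[of s t])

lemma measurable_F: "f \<in> measurable (\<F> s) N \<Longrightarrow> f \<in> measurable M N"
  using sets_F by (auto simp: measurable_def F.space_F)

lemma B_adapted: "u \<ge> 0 \<Longrightarrow> B u \<in> borel_measurable (\<F> u)"
  using BM by (auto simp: brownian_motion_def adapted_process_def)

lemma D_F: "u \<ge> 0 \<Longrightarrow> u \<le> v \<Longrightarrow> D u \<in> borel_measurable (\<F> v)"
  using D_adapted measurable_F_mono[of u v] by (auto simp: adapted_process_def)

lemma measurable_modify:
  fixes g f :: "'a \<Rightarrow> real"
  assumes g: "g \<in> borel_measurable (\<F> t)" and eq: "\<And>z. z \<in> \<Omega>1 \<Longrightarrow> f z = g z"
  shows "f \<in> borel_measurable (\<F> t)"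
proof (rule measurableI)
  fix A :: "real set" assume "A \<in> sets borel"
  then have "g -` A \<inter> space (\<F> t) \<in> sets (\<F> t)" using g by (rule measurable_sets[rotated])
  then show "f -` A \<inter> space (\<F> t) \<in> sets (\<F> t)"
    by (rule F_modify) (auto simp: F.space_F eq Omega1_space)
qed auto

lemma E_path: "z \<in> \<Omega>1 \<Longrightarrow> E t z = subordinator_path.e (\<lambda>u. D u z) t"
  using subordinator_path.e_def[OF D_path] by (simp add: E_eq)

lemma
  assumes z: "z \<in> \<Omega>1"
  shows E_nonneg: "0 \<le> E t z"
    and E_mono: "s \<le> t \<Longrightarrow> E s z \<le> E t z"
    and E_D: "0 \<le> u \<Longrightarrow> E (D u z) z = u"
    and E_min: "0 \<le> u \<Longrightarrow> E (min s (D u z)) z = min (E s z) u"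
    and le_E: "0 \<le> u \<Longrightarrow> D u z \<le> t \<Longrightarrow> u \<le> E t z"
    and E_le: "0 \<le> u \<Longrightarrow> t < D u z \<Longrightarrow> E t z \<le> u"
    and E_less: "E t z < u \<Longrightarrow> t < D u z"
    and D_le: "0 \<le> u \<Longrightarrow> u < E t z \<Longrightarrow> D u z \<le> t"
    and E_le_iff: "0 \<le> u \<Longrightarrow> E t z \<le> u \<longleftrightarrow> (\<forall>v>u. t < D v z)"
    and E_cont: "continuous_on UNIV (\<lambda>t. E t z)"
    and E_pos: "t > 0 \<Longrightarrow> E t z > 0"
    and D_E_ge: "0 \<le> t \<Longrightarrow> t \<le> D (E t z) z"
    and D_mono: "0 \<le> u \<Longrightarrow> u \<le> v \<Longrightarrow> D u z \<le> D v z"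
    and D_nonneg: "0 \<le> u \<Longrightarrow> 0 \<le> D u z"
proof -
  interpret p: subordinator_path "\<lambda>u. D u z" by (rule D_path[OF z])
  show "0 \<le> E t z" "s \<le> t \<Longrightarrow> E s z \<le> E t z" "0 \<le> u \<Longrightarrow> E (D u z) z = u"
    "0 \<le> u \<Longrightarrow> E (min s (D u z)) z = min (E s z) u" "0 \<le> u \<Longrightarrow> D u z \<le> t \<Longrightarrow> u \<le> E t z"
    "0 \<le> u \<Longrightarrow> t < D u z \<Longrightarrow> E t z \<le> u" "E t z < u \<Longrightarrow> t < D u z"
    "0 \<le> u \<Longrightarrow> u < E t z \<Longrightarrow> D u z \<le> t" "continuous_on UNIV (\<lambda>t. E t z)"
    "t > 0 \<Longrightarrow> E t z > 0" "0 \<le> t \<Longrightarrow> t \<le> D (E t z) z"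
    "0 \<le> u \<Longrightarrow> u \<le> v \<Longrightarrow> D u z \<le> D v z" "0 \<le> u \<Longrightarrow> 0 \<le> D u z"
    unfolding E_path[OF z]
    using p.e_nonneg p.e_mono p.e_d p.e_min p.le_e p.e_le p.e_less p.d_le p.continuous_e p.e_pos p.d_e_ge p.mono p.d_nonneg
    by auto
  show "0 \<le> u \<Longrightarrow> E t z \<le> u \<longleftrightarrow> (\<forall>v>u. t < D v z)"
    unfolding E_path[OF z] by (rule p.e_le_iff)
qed

text \<open>E t \<le> u means that D exceeds t at every time after u, an event of each later
  \<sigma>-algebra; right-continuity of the filtration brings it down to u.\<close>

lemma E_le_sets: "{z \<in> space M. E t z \<le> u} \<in> sets (\<F> u)"
proof (cases "u < 0")
  case True
  show ?thesis
  proof (rule F_modify[of "{}"])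
    fix z assume "z \<in> \<Omega>1"
    from E_nonneg[OF this, of t] True show "z \<in> {z \<in> space M. E t z \<le> u} \<longleftrightarrow> z \<in> {}" by auto
  qed auto
next
  case False
  then have u: "0 \<le> u" by simp
  have "{z \<in> space M. E t z \<le> u} \<in> sets (\<F> s)" if s: "s > u" for s
  proof -
    \<comment> \<open>The times u + 1/(n+1) with n \<ge> n0 lie before s, and by monotonicity of D
      these countably many suffice.\<close>
    obtain n0 where n0: "inverse (real (Suc n0)) < s - u" using reals_Archimedean[of "s - u"] s by auto
    define A where "A = (\<Inter>n\<in>{n0..}. {z \<in> space M. t < D (u + inverse (real (Suc n))) z})"
    have "{z \<in> space M. t < D (u + inverse (real (Suc n))) z} \<in> sets (\<F> s)" if "n \<in> {n0..}" for n
    proof -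
      have "inverse (real (Suc n)) \<le> inverse (real (Suc n0))" using that by (intro le_imp_inverse_le) auto
      then have "u + inverse (real (Suc n)) \<le> s" using n0 by linarith
      moreover have "0 \<le> u + inverse (real (Suc n))" using u by simp
      ultimately have [measurable]: "D (u + inverse (real (Suc n))) \<in> borel_measurable (\<F> s)"
        by (intro D_F)
      have "{z \<in> space (\<F> s). t < D (u + inverse (real (Suc n))) z} \<in> sets (\<F> s)" by measurable
      then show ?thesis by (simp add: F.space_F)
    qed
    then have "A \<in> sets (\<F> s)"
      unfolding A_def by (intro sets.countable_INT') auto
    then show ?thesis
    proof (rule F_modify)
      fix z assume z: "z \<in> \<Omega>1"
      show "z \<in> {z \<in> space M. E t z \<le> u} \<longleftrightarrow> z \<in> A"
      proof
        assume "z \<in> {z \<in> space M. E t z \<le> u}"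
        then show "z \<in> A" using E_le_iff[OF z u, of t] by (auto simp: A_def)
      next
        assume a: "z \<in> A"
        have "t < D v z" if v: "v > u" for v
        proof -
          obtain n1 where n1: "inverse (real (Suc n1)) < v - u" using reals_Archimedean[of "v - u"] v by auto
          let ?n = "max n0 n1"
          have "inverse (real (Suc ?n)) \<le> inverse (real (Suc n1))" by (intro le_imp_inverse_le) auto
          then have "u + inverse (real (Suc ?n)) \<le> v" using n1 by linarith
          moreover have "0 \<le> u + inverse (real (Suc ?n))" using u by simp
          ultimately have "D (u + inverse (real (Suc ?n))) z \<le> D v z" by (intro D_mono[OF z])
          moreover have "t < D (u + inverse (real (Suc ?n))) z" using a by (auto simp: A_def)
          ultimately show ?thesis by simp
        qed
        then show "z \<in> {z \<in> space M. E t z \<le> u}" using E_le_iff[OF z u, of t] Omega1_space[OF z] by auto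
      qed
    qed auto
  qed
  then show ?thesis unfolding F_right[OF u] by auto
qed

lemma stopping_E: "stopping_time \<F> (E t)"
  using E_le_sets unfolding stopping_time_def pred_def F.space_F by blast

lemma H_def: "\<H> t = F.pre_sigma (E t)"
  by (simp add: time_changed_filtration_def)

lemma sets_H: "sets (\<H> t) = {A. \<forall>u. {z\<in>A. E t z \<le> u} \<in> sets (\<F> u)}"
  unfolding H_def by (rule F.sets_pre_sigma[OF stopping_E])

lemma space_H: "space (\<H> t) = space M"
  unfolding H_def by (rule F.space_pre_sigma)

lemma H_I:
  assumes "A \<subseteq> space M" "\<And>u. u \<ge> 0 \<Longrightarrow> {z\<in>A. E t z \<le> u} \<in> sets (\<F> u)" shows "A \<in> sets (\<H> t)"
proof -
  have "{z\<in>A. E t z \<le> u} \<in> sets (\<F> u)" if "u < 0" for u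
  proof (rule F_modify[of "{}"])
    fix z assume "z \<in> \<Omega>1"
    from E_nonneg[OF this, of t] that show "z \<in> {z \<in> A. E t z \<le> u} \<longleftrightarrow> z \<in> {}" by auto
  qed (use assms(1) in auto)
  then have "{z\<in>A. E t z \<le> u} \<in> sets (\<F> u)" for u
    using assms(2)[of u] by (cases "u < 0") auto
  then show ?thesis unfolding sets_H by blast
qed

lemma H_D: "A \<in> sets (\<H> t) \<Longrightarrow> {z\<in>A. E t z \<le> u} \<in> sets (\<F> u)"
  unfolding sets_H by auto

lemma sets_H_mono: assumes st: "s \<le> t" shows "sets (\<H> s) \<subseteq> sets (\<H> t)"
proof
  fix A assume A: "A \<in> sets (\<H> s)"
  then have As: "A \<subseteq> space M" using sets.sets_into_space[OF A] by (simp add: space_H)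
  show "A \<in> sets (\<H> t)"
  proof (rule H_I[OF As])
    fix u :: real
    have "{z\<in>A. E s z \<le> u} \<inter> {z \<in> space M. E t z \<le> u} \<in> sets (\<F> u)"
      using H_D[OF A] E_le_sets by (intro sets.Int) auto
    then show "{z\<in>A. E t z \<le> u} \<in> sets (\<F> u)"
      by (rule F_modify) (use As E_mono[OF _ st] in \<open>auto intro: order_trans\<close>)
  qed
qed

sublocale H: filtration "space M" \<H>
  by unfold_locales (use space_H sets_H_mono in auto)

lemma H_subset_M: "sets (\<H> t) \<subseteq> sets M"
proof
  fix A assume A: "A \<in> sets (\<H> t)"
  then have As: "A \<subseteq> space M" using sets.sets_into_space[OF A] by (simp add: space_H)
  have "A = (\<Union>n::nat. {z\<in>A. E t z \<le> real n})" using real_arch_simple by auto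
  also have "\<dots> \<in> sets M" using H_D[OF A] sets_F by (intro sets.countable_UN) auto
  finally show "A \<in> sets M" .
qed

lemma measurable_H: "f \<in> measurable (\<H> t) N \<Longrightarrow> f \<in> measurable M N"
  using H_subset_M by (auto simp: measurable_def space_H)

text \<open>Transfers knowledge from outer to inner time: what is known at outer time t is known at
  inner time u on the paths whose clock has not passed u by then.\<close>

lemma measurable_before_E:
  fixes f :: "'a \<Rightarrow> real"
  assumes f: "f \<in> borel_measurable (\<H> t)"
  shows "(\<lambda>z. if E t z \<le> u then f z else 0) \<in> borel_measurable (\<F> u)"
proof (rule measurableI)
  fix C :: "real set" assume C: "C \<in> sets borel"
  have "f -` C \<inter> space M \<in> sets (\<H> t)" using measurable_sets[OF f C] by (simp add: space_H)
  from H_D[OF this, of u] have a: "{z \<in> f -` C \<inter> space M. E t z \<le> u} \<in> sets (\<F> u)" .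
  have b: "space M - {z \<in> space M. E t z \<le> u} \<in> sets (\<F> u)"
    using sets.compl_sets[OF E_le_sets[of t u]] by (simp add: F.space_F)
  have "(\<lambda>z. if E t z \<le> u then f z else 0) -` C \<inter> space (\<F> u) =
    {z \<in> f -` C \<inter> space M. E t z \<le> u} \<union> (if 0 \<in> C then space M - {z \<in> space M. E t z \<le> u} else {})"
    by (auto simp: F.space_F split: if_splits)
  then show "(\<lambda>z. if E t z \<le> u then f z else 0) -` C \<inter> space (\<F> u) \<in> sets (\<F> u)" using a b by auto
qed auto

end

context time_changed_brownian
begin

subsection \<open>Simple integrands on inner-time grids\<close>

text \<open>The value 0 off \<Omega>1 keeps the time in [0, T] on every path, as the definition of
  simple predictable processes demands.\<close>

definition grid_time :: "(nat \<Rightarrow> real) \<Rightarrow> nat \<Rightarrow> 'a \<Rightarrow> real" where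
  "grid_time v i z = (if z \<in> \<Omega>1 then min T (D (v i) z) else 0)"

text \<open>If level \<open>v i\<close> is not reached before T, the interval that carries the value
  is empty; setting the value to 0 there keeps it measurable with respect to the events prior to the
  capped grid time.\<close>

definition grid_value :: "(nat \<Rightarrow> real) \<Rightarrow> (nat \<Rightarrow> 'a \<Rightarrow> real) \<Rightarrow> nat \<Rightarrow> 'a \<Rightarrow> real" where
  "grid_value v \<zeta> i z = (if z \<in> \<Omega>1 \<and> D (v i) z < T then \<zeta> i z else 0)"

lemma Omega1_F: "\<Omega>1 \<in> sets (\<F> t)"
proof -
  have "space (\<F> t) \<in> sets (\<F> t)" by simp
  then show ?thesis by (rule F_modify) (auto simp: F.space_F Omega1_space)
qed

lemma pred_Omega1 [measurable]: "Measurable.pred (\<F> t) (\<lambda>z. z \<in> \<Omega>1)"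
proof -
  have "{z \<in> space (\<F> t). z \<in> \<Omega>1} = \<Omega>1" using Omega1_space F.space_F by auto
  then show ?thesis unfolding pred_def using Omega1_F by simp
qed

lemma grid_time_bounds: "0 \<le> v i \<Longrightarrow> 0 \<le> grid_time v i z \<and> grid_time v i z \<le> T"
  using D_nonneg[of z "v i"] T_pos by (auto simp: grid_time_def)

lemma grid_time_mono: "0 \<le> v i \<Longrightarrow> v i \<le> v (Suc i) \<Longrightarrow> grid_time v i z \<le> grid_time v (Suc i) z"
  using D_mono[of z "v i" "v (Suc i)"] by (auto simp: grid_time_def)

lemma E_le_pred: "Measurable.pred (\<F> u) (\<lambda>z. E t z \<le> u)"
  using E_le_sets[of t u] by (simp add: pred_def F.space_F)

lemma grid_time_measurable:
  assumes "0 \<le> v i" "v i \<le> u" shows "grid_time v i \<in> borel_measurable (\<F> u)"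
proof -
  have [measurable]: "D (v i) \<in> borel_measurable (\<F> u)" using D_F assms by auto
  show ?thesis unfolding grid_time_def[abs_def] by measurable
qed

lemma grid_value_measurable:
  assumes "0 \<le> v i" "v i \<le> u" "\<zeta> i \<in> borel_measurable (\<F> (v i))" shows "grid_value v \<zeta> i \<in> borel_measurable (\<F> u)"
proof -
  have [measurable]: "D (v i) \<in> borel_measurable (\<F> u)" "\<zeta> i \<in> borel_measurable (\<F> u)"
    using D_F assms measurable_F_mono by auto
  show ?thesis unfolding grid_value_def[abs_def] by measurable
qed

text \<open>For t < T the event says that \<open>v i \<le> E t\<close>. Intersected with
  \<open>E t \<le> u\<close> it is decided at inner time u if \<open>v i \<le> u\<close>, and it is
  void otherwise.\<close>

lemma stopping_grid_time:
  assumes v: "0 \<le> v i" shows "stopping_time \<H> (grid_time v i)"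
  unfolding stopping_time_def pred_def space_H
proof
  fix t
  show "{z \<in> space M. grid_time v i z \<le> t} \<in> sets (\<H> t)"
  proof (cases "t < T")
    case False
    then have "{z \<in> space M. grid_time v i z \<le> t} = space (\<H> t)"
      using grid_time_bounds[of v i, OF v] by (auto simp: space_H not_less intro: order_trans)
    then show ?thesis by simp
  next
    case True
    show ?thesis
    proof (rule H_I)
      fix u :: real
      show "{z \<in> {z \<in> space M. grid_time v i z \<le> t}. E t z \<le> u} \<in> sets (\<F> u)"
      proof (cases "v i \<le> u")
        case True
        have [measurable]: "grid_time v i \<in> borel_measurable (\<F> u)" "Measurable.pred (\<F> u) (\<lambda>z. E t z \<le> u)"
          using grid_time_measurable v True E_le_pred by auto
        have "{z \<in> space (\<F> u). grid_time v i z \<le> t \<and> E t z \<le> u} \<in> sets (\<F> u)" by measurable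
        then show ?thesis by (simp add: F.space_F conj_assoc)
      next
        case False
        show ?thesis
        proof (rule F_modify[of "{}"])
          fix z assume z: "z \<in> \<Omega>1"
          show "z \<in> {z \<in> {z \<in> space M. grid_time v i z \<le> t}. E t z \<le> u} \<longleftrightarrow> z \<in> {}"
            using le_E[OF z v, of t] \<open>t < T\<close> False z by (auto simp: grid_time_def min_le_iff_disj)
        qed auto
      qed
    qed auto
  qed
qed

lemma grid_value_pre_sigma:
  assumes v: "0 \<le> v i" and \<zeta>: "\<zeta> i \<in> borel_measurable (\<F> (v i))"
  shows "grid_value v \<zeta> i \<in> borel_measurable (H.pre_sigma (grid_time v i))"
proof (rule measurableI)
  fix C :: "real set" assume C: "C \<in> sets borel"
  show "grid_value v \<zeta> i -` C \<inter> space (H.pre_sigma (grid_time v i)) \<in> sets (H.pre_sigma (grid_time v i))"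
    unfolding H.space_pre_sigma
  proof (rule H.sets_pre_sigmaI[OF stopping_grid_time[of v i, OF v]])
    fix t
    show "{z \<in> grid_value v \<zeta> i -` C \<inter> space M. grid_time v i z \<le> t} \<in> sets (\<H> t)"
    proof (rule H_I)
      fix u :: real
      show "{z \<in> {z \<in> grid_value v \<zeta> i -` C \<inter> space M. grid_time v i z \<le> t}. E t z \<le> u} \<in> sets (\<F> u)"
      proof (cases "v i \<le> u")
        case True
        have [measurable]: "grid_time v i \<in> borel_measurable (\<F> u)" "grid_value v \<zeta> i \<in> borel_measurable (\<F> u)"
            "Measurable.pred (\<F> u) (\<lambda>z. E t z \<le> u)" "C \<in> sets borel"
          using grid_time_measurable grid_value_measurable v True \<zeta> E_le_pred C by auto
        have "{z \<in> space (\<F> u). grid_value v \<zeta> i z \<in> C \<and> grid_time v i z \<le> t \<and> E t z \<le> u} \<in> sets (\<F> u)" by measurable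
        then show ?thesis by (simp add: F.space_F conj_ac Int_def vimage_def)
      next
        case False
        \<comment> \<open>If u < \<open>v i\<close>, then \<open>E t \<le> u\<close> puts
          \<open>D (v i)\<close> after t; the grid time is at most t only if it is T, and there the
          value is 0.\<close>
        define A where "A = (if T \<le> t \<and> 0 \<in> C then {z \<in> space M. E t z \<le> u} else {})"
        have "A \<in> sets (\<F> u)" using E_le_sets by (auto simp: A_def)
        then show ?thesis
        proof (rule F_modify)
          fix z assume z: "z \<in> \<Omega>1"
          have "D (v i) z > t" if "E t z \<le> u" using E_less[OF z, of t "v i"] that False by auto
          then show "z \<in> {z \<in> {z \<in> grid_value v \<zeta> i -` C \<inter> space M. grid_time v i z \<le> t}. E t z \<le> u} \<longleftrightarrow> z \<in> A"
            using z Omega1_space[OF z] by (auto simp: A_def grid_value_def grid_time_def min_le_iff_disj)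
        qed auto
      qed
    qed auto
  qed
qed auto

lemma simple_predictable_grid:
  assumes v: "\<And>i. 0 \<le> v i" "\<And>i. v i \<le> v (Suc i)" and \<zeta>: "\<And>i. \<zeta> i \<in> borel_measurable (\<F> (v i))"
    and \<xi>0: "\<xi>0 \<in> borel_measurable (\<H> 0)"
  shows "simple_predictable M \<H> T n \<xi>0 (grid_time v) (grid_value v \<zeta>)"
  unfolding simple_predictable_def
  using \<xi>0 stopping_grid_time grid_value_pre_sigma grid_time_bounds grid_time_mono v \<zeta> by auto

text \<open>By \<open>E_min\<close>, stopping \<open>W\<close> at a grid time stops the clock at
  \<open>v i\<close>. Where the value was cut to 0, both stopped clocks already show
  \<open>E t\<close>, so the increment of \<open>B\<close> is zero as well.\<close>

lemma simple_integral_grid: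
  assumes z: "z \<in> \<Omega>1" and t: "t \<le> T" and v: "\<And>i. 0 \<le> v i" "\<And>i. v i \<le> v (Suc i)"
  shows "simple_integral W n (grid_time v) (grid_value v \<zeta>) t z
    = (\<Sum>i<n. \<zeta> i z * (B (min (E t z) (v (Suc i))) z - B (min (E t z) (v i)) z))"
  unfolding simple_integral_def
proof (intro sum.cong refl)
  fix i
  have W: "W (min t (grid_time v j z)) z = B (min (E t z) (v j)) z" for j
  proof -
    have "min t (grid_time v j z) = min t (D (v j) z)" using t z by (auto simp: grid_time_def)
    then show ?thesis by (simp add: time_changed_process_def E_min[OF z v(1)])
  qed
  show "grid_value v \<zeta> i z * (W (min t (grid_time v (Suc i) z)) z - W (min t (grid_time v i z)) z)
    = \<zeta> i z * (B (min (E t z) (v (Suc i))) z - B (min (E t z) (v i)) z)"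
  proof (cases "D (v i) z < T")
    case True
    then show ?thesis unfolding W using z by (simp add: grid_value_def)
  next
    case False
    then have tD: "t \<le> D (v i) z" using t by simp
    have "E t z \<le> v i" using E_mono[OF z tD] E_D[OF z v(1), of i] by simp
    then have "min (E t z) (v (Suc i)) = min (E t z) (v i)" using v(2)[of i] by simp
    moreover have "grid_value v \<zeta> i z = 0" using False by (simp add: grid_value_def)
    ultimately show ?thesis by simp
  qed
qed

lemma E_greater_iff: assumes z: "z \<in> \<Omega>1" and a: "0 \<le> a" shows "a < E t z \<longleftrightarrow> D a z < t"
proof
  assume "a < E t z"
  then have "D a z \<le> t" using D_le[OF z a] by simp
  moreover have "D a z \<noteq> t" using E_D[OF z a] \<open>a < E t z\<close> by auto
  ultimately show "D a z < t" by simp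
next
  assume lt: "D a z < t"
  show "a < E t z"
  proof (rule ccontr)
    assume "\<not> a < E t z"
    then have le: "E t z \<le> a" by simp
    have t0: "0 \<le> t" using D_nonneg[OF z a] lt by simp
    have "t \<le> D (E t z) z" using D_E_ge[OF z t0] .
    also have "\<dots> \<le> D a z" using D_mono[OF z E_nonneg[OF z] le] .
    finally show False using lt by simp
  qed
qed

lemma simple_process_grid:
  assumes z: "z \<in> \<Omega>1" and t: "0 < t" "t \<le> T" and v: "\<And>i. 0 \<le> v i" "\<And>i. v i \<le> v (Suc i)"
  shows "i < n \<Longrightarrow> v i < E t z \<Longrightarrow> E t z \<le> v (Suc i) \<Longrightarrow>
      simple_process n \<xi>0 (grid_time v) (grid_value v \<zeta>) t z = \<zeta> i z"
    and "E t z \<le> v 0 \<Longrightarrow> simple_process n \<xi>0 (grid_time v) (grid_value v \<zeta>) t z = 0"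
proof -
  have trm: "grid_value v \<zeta> i z * indicator {grid_time v i z<..grid_time v (Suc i) z} t
      = (if v i < E t z \<and> E t z \<le> v (Suc i) then \<zeta> i z else 0)" for i
  proof -
    have "E t z \<le> v (Suc i) \<longleftrightarrow> t \<le> D (v (Suc i)) z" "v i < E t z \<longleftrightarrow> D (v i) z < t"
      using E_greater_iff[OF z v(1)] by (metis not_less)+
    then show ?thesis using t z by (auto simp: grid_value_def grid_time_def indicator_def)
  qed
  have eq: "simple_process n \<xi>0 (grid_time v) (grid_value v \<zeta>) t z = (\<Sum>i<n. if v i < E t z \<and> E t z \<le> v (Suc i) then \<zeta> i z else 0)"
    unfolding simple_process_def trm using t by simp
  have vm: "i \<le> j \<Longrightarrow> v i \<le> v j" for i j by (rule lift_Suc_mono_le[of v]) (use v in auto)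
  {
    assume i: "i < n" "v i < E t z" "E t z \<le> v (Suc i)"
    have "(v j < E t z \<and> E t z \<le> v (Suc j)) \<longleftrightarrow> j = i" for j
    proof
      assume j: "v j < E t z \<and> E t z \<le> v (Suc j)"
      show "j = i"
      proof (rule ccontr)
        assume "j \<noteq> i"
        then have "Suc j \<le> i \<or> Suc i \<le> j" by linarith
        then show False using vm[of "Suc j" i] vm[of "Suc i" j] i j by auto
      qed
    qed (use i in auto)
    then show "simple_process n \<xi>0 (grid_time v) (grid_value v \<zeta>) t z = \<zeta> i z"
      unfolding eq using i(1) by simp
  }
  assume "E t z \<le> v 0"
  then have "\<not> v i < E t z" for i using vm[of 0 i] by simp
  then show "simple_process n \<xi>0 (grid_time v) (grid_value v \<zeta>) t z = 0" unfolding eq by simp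
qed

lemma simple_process_measurable:
  assumes "\<And>i. i \<le> n \<Longrightarrow> \<theta> i \<in> borel_measurable M" "\<And>i. i < n \<Longrightarrow> \<xi> i \<in> borel_measurable M" "\<xi>0 \<in> borel_measurable M"
  shows "simple_process n \<xi>0 \<theta> \<xi> t \<in> borel_measurable M"
proof -
  have "(\<lambda>z. \<xi> i z * indicator {\<theta> i z<..\<theta> (Suc i) z} t) \<in> borel_measurable M" if "i < n" for i
  proof -
    have [measurable]: "\<theta> i \<in> borel_measurable M" "\<theta> (Suc i) \<in> borel_measurable M" "\<xi> i \<in> borel_measurable M"
      using assms that by auto
    have "(\<lambda>z. \<xi> i z * indicator {\<theta> i z<..\<theta> (Suc i) z} t) = (\<lambda>z. if \<theta> i z < t \<and> t \<le> \<theta> (Suc i) z then \<xi> i z else 0)"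
      by (auto simp: indicator_def)
    then show ?thesis by simp
  qed
  then show ?thesis unfolding simple_process_def[abs_def] using assms(3)
    by (intro borel_measurable_add borel_measurable_sum) auto
qed

text \<open>Integrands that are continuous functions of the inner time: their integrals are limits of Riemann
  sums over deterministic inner-time grids.\<close>

lemma inner_grid_limit:
  assumes si: "stochastic_integral M \<H> T W K I" and a: "0 \<le> a"
    and \<Gamma>: "\<And>u. a \<le> u \<Longrightarrow> \<Gamma> u \<in> borel_measurable (\<F> u)"
    and cont: "AE z in M. continuous_on {a..max a (E T z)} (\<lambda>u. \<Gamma> u z)"
    and K: "AE z in M. \<forall>t\<in>{0<..T}. K t z = (if a < E t z then \<Gamma> (E t z) z else 0)"
    and eps: "\<And>r. \<epsilon> r > 0" "\<epsilon> \<longlonglongrightarrow> 0" and n: "filterlim (\<lambda>r. real (n r) * \<epsilon> r) at_top sequentially"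
  shows "\<exists>\<rho>::nat \<Rightarrow> nat. strict_mono \<rho> \<and> (AE z in M. uniform_limit {0..T}
    (\<lambda>r t. \<Sum>i<n (\<rho> r). \<Gamma> (a + real i * \<epsilon> (\<rho> r)) z * (B (min (E t z) (a + real (Suc i) * \<epsilon> (\<rho> r))) z
        - B (min (E t z) (a + real i * \<epsilon> (\<rho> r))) z)) (\<lambda>t. I t z) sequentially)"
proof -
  define v where "v r i = a + real i * \<epsilon> r" for r i
  have v: "0 \<le> v r i" "v r i \<le> v r (Suc i)" "a \<le> v r i" for r i
    using a eps(1)[of r] by (auto simp: v_def algebra_simps)
  define \<zeta> where "\<zeta> r i = \<Gamma> (v r i)" for r i
  have \<zeta>: "\<zeta> r i \<in> borel_measurable (\<F> (v r i))" for r i using \<Gamma> v by (simp add: \<zeta>_def)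
  have Kad: "K t \<in> borel_measurable (\<H> t)" if "t \<in> {0..T}" for t
    using si that by (auto simp: stochastic_integral_def adapted_process_def)
  have K0: "K 0 \<in> borel_measurable (\<H> 0)" using Kad[of 0] T_pos by auto
  \<comment> \<open>The value at time 0 is taken from \<open>K\<close> itself, since the assumption
    on \<open>K\<close> concerns positive times only.\<close>
  have spg: "simple_predictable M \<H> T m (K 0) (grid_time (v r)) (grid_value (v r) (\<zeta> r))" for m r
    by (rule simple_predictable_grid) (use v \<zeta> K0 in auto)
  have sig: "simple_integral W m (grid_time (v r)) (grid_value (v r) (\<zeta> r)) t z
      = (\<Sum>i<m. \<zeta> r i z * (B (min (E t z) (v r (Suc i))) z - B (min (E t z) (v r i)) z))"
    if "z \<in> \<Omega>1" "t \<le> T" for m r t z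
    by (rule simple_integral_grid) (use v that in auto)
  let ?P = "\<lambda>r. simple_process (n r) (K 0) (grid_time (v r)) (grid_value (v r) (\<zeta> r))"
  have "AE z in M. uniform_limit {0..T} (\<lambda>r t. ?P r t z) (\<lambda>t. K t z) sequentially"
    using AE_Omega1 cont K
  proof eventually_elim
    case (elim z)
    note z = elim(1)
    let ?S = "E T z"
    have uc: "uniformly_continuous_on {a..max a ?S} (\<lambda>u. \<Gamma> u z)"
      using elim(2) by (intro compact_uniformly_continuous) auto
    show ?case
    proof (rule uniform_limitI)
      fix e :: real assume e: "e > 0"
      obtain d where d: "d > 0" "\<And>x y. x \<in> {a..max a ?S} \<Longrightarrow> y \<in> {a..max a ?S} \<Longrightarrow> dist y x < d \<Longrightarrow> dist (\<Gamma> y z) (\<Gamma> x z) < e"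
        using uc e unfolding uniformly_continuous_on_def by meson
      have "eventually (\<lambda>r. \<epsilon> r < d) sequentially" using order_tendstoD(2)[OF eps(2) d(1)] .
      moreover have "eventually (\<lambda>r. real (n r) * \<epsilon> r \<ge> ?S) sequentially"
        using n unfolding filterlim_at_top by blast
      ultimately show "eventually (\<lambda>r. \<forall>t\<in>{0..T}. dist (?P r t z) (K t z) < e) sequentially"
      proof eventually_elim
        case (elim r)
        show ?case
        proof
          fix t assume t: "t \<in> {0..T}"
          show "dist (?P r t z) (K t z) < e"
          proof (cases "t = 0")
            case True
            have "indicator {grid_time (v r) i z<..grid_time (v r) (Suc i) z} (0::real) = (0::real)" for i
              using grid_time_bounds[of "v r" i z] v by (auto simp: indicator_def)
            then show ?thesis using True e by (simp add: simple_process_def)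
          next
            case False
            then have t0: "0 < t" "t \<le> T" using t by auto
            have Kt: "K t z = (if a < E t z then \<Gamma> (E t z) z else 0)" using \<open>\<forall>t\<in>{0<..T}. _ t\<close> t0 by auto
            show ?thesis
            proof (cases "a < E t z")
              case False
              then have "E t z \<le> v r 0" by (simp add: v_def)
              then show ?thesis using simple_process_grid(2)[where v="v r", OF z t0 v(1,2)] Kt False e by simp
            next
              case True
              have ES: "E t z \<le> ?S" using E_mono[OF z t0(2)] .
              \<comment> \<open>Ceiling minus one, because the inner intervals are open on the left
                and closed on the right.\<close>
              define i where "i = nat (\<lceil>(E t z - a) / \<epsilon> r\<rceil> - 1)"
              have pos: "0 < (E t z - a) / \<epsilon> r" using True eps(1)[of r] by simp
              then have c1: "1 \<le> \<lceil>(E t z - a) / \<epsilon> r\<rceil>" by simp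
              then have ri: "real i = of_int \<lceil>(E t z - a) / \<epsilon> r\<rceil> - 1" by (simp add: i_def)
              have "real i < (E t z - a) / \<epsilon> r" "(E t z - a) / \<epsilon> r \<le> real (Suc i)"
                unfolding of_nat_Suc ri using ceiling_correct[of "(E t z - a) / \<epsilon> r"] by auto
              then have i1: "real i * \<epsilon> r < E t z - a" and i2: "E t z - a \<le> real (Suc i) * \<epsilon> r"
                using eps(1)[of r] by (auto simp: pos_less_divide_eq pos_divide_le_eq)
              have iv: "v r i < E t z" "E t z \<le> v r (Suc i)" using i1 i2 by (auto simp: v_def)
              have "real i * \<epsilon> r < real (n r) * \<epsilon> r" using i1 ES elim(2) a by linarith
              then have "i < n r" using eps(1)[of r] by simp
              then have P: "?P r t z = \<Gamma> (v r i) z"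
                using simple_process_grid(1)[where v="v r", OF z t0 v(1,2) _ iv] by (simp add: \<zeta>_def)
              have "v r (Suc i) = v r i + \<epsilon> r" by (simp add: v_def algebra_simps)
              then have "dist (v r i) (E t z) < d" using iv elim(1) by (simp add: dist_real_def)
              moreover have "v r i \<in> {a..max a ?S}" "E t z \<in> {a..max a ?S}" using iv ES True v(3)[of r i] by auto
              ultimately show ?thesis unfolding P Kt using True d(2) by simp
            qed
          qed
        qed
      qed
    qed
  qed
  moreover have "?P j t \<in> borel_measurable M" for j t
    using v \<zeta> by (intro simple_process_measurable measurable_H[OF K0] measurable_F[OF grid_time_measurable]
        measurable_F[OF grid_value_measurable]) auto
  ultimately obtain \<rho> :: "nat \<Rightarrow> nat" where \<rho>: "strict_mono \<rho>"
    "AE z in M. uniform_limit {0..T} (\<lambda>r t. simple_integral W (n (\<rho> r)) (grid_time (v (\<rho> r))) (grid_value (v (\<rho> r)) (\<zeta> (\<rho> r))) t z) (\<lambda>t. I t z) sequentially"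
    using stochastic_integral_AE_limit[OF si, of n "\<lambda>_. K 0" "\<lambda>r. grid_time (v r)" "\<lambda>r. grid_value (v r) (\<zeta> r)"]
      spg measurable_H[OF Kad] by auto
  have "AE z in M. uniform_limit {0..T}
    (\<lambda>r t. \<Sum>i<n (\<rho> r). \<Gamma> (a + real i * \<epsilon> (\<rho> r)) z * (B (min (E t z) (a + real (Suc i) * \<epsilon> (\<rho> r))) z
        - B (min (E t z) (a + real i * \<epsilon> (\<rho> r))) z)) (\<lambda>t. I t z) sequentially"
    using \<rho>(2) AE_Omega1
  proof eventually_elim
    case (elim z)
    show ?case
      by (rule uniform_limit_cong'[THEN iffD1, OF _ _ elim(1)])
         (auto simp: sig[OF elim(2)] v_def \<zeta>_def)
  qed
  then show ?thesis using \<rho>(1) by blast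
qed

text \<open>Riemann sums on a deterministic outer grid depend on t only through \<open>W\<close>
  stopped at grid points, that is through \<open>E t\<close>, and this passes to the limit. It is
  the ingredient that makes X a function of inner time.\<close>

lemma stochastic_integral_flat:
  assumes si: "stochastic_integral M \<H> T W K I"
    and cont: "AE z in M. continuous_on {0..T} (\<lambda>t. K t z)"
  shows "AE z in M. \<forall>s\<in>{0..T}. \<forall>t\<in>{0..T}. E s z = E t z \<longrightarrow> I s z = I t z"
proof -
  define \<theta> :: "nat \<Rightarrow> nat \<Rightarrow> 'a \<Rightarrow> real" where "\<theta> j i z = real i * T / real (Suc j)" for j i z
  define \<xi> where "\<xi> j i = K (real i * T / real (Suc j))" for j i
  have bd: "0 \<le> real i * T / real (Suc j)" "i \<le> Suc j \<Longrightarrow> real i * T / real (Suc j) \<le> T" for i j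
    using T_pos by (auto simp: divide_le_eq mult.commute intro!: mult_left_mono)
  have Kad: "K t \<in> borel_measurable (\<H> t)" if "t \<in> {0..T}" for t
    using si that by (auto simp: stochastic_integral_def adapted_process_def)
  have K0: "K 0 \<in> borel_measurable (\<H> 0)" using Kad[of 0] T_pos by auto
  have pm: "f \<in> borel_measurable (H.pre_sigma (\<lambda>_. c))" if "f \<in> borel_measurable (\<H> c)" for f :: "'a \<Rightarrow> real" and c
  proof (rule measurableI)
    fix C :: "real set" assume C: "C \<in> sets borel"
    have m: "f -` C \<inter> space M \<in> sets (\<H> c)" using measurable_sets[OF that C] by (simp add: space_H)
    show "f -` C \<inter> space (H.pre_sigma (\<lambda>_. c)) \<in> sets (H.pre_sigma (\<lambda>_. c))"
      unfolding H.space_pre_sigma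
    proof (rule H.sets_pre_sigmaI[OF stopping_time_const])
      fix t show "{z \<in> f -` C \<inter> space M. c \<le> t} \<in> sets (\<H> t)"
      proof -
        have "{z \<in> f -` C \<inter> space M. c \<le> t} = (if c \<le> t then f -` C \<inter> space M else {})" by auto
        then show ?thesis using m sets_H_mono[of c t] by auto
      qed
    qed
  qed auto
  have sp: "simple_predictable M \<H> T (Suc j) (K 0) (\<theta> j) (\<xi> j)" for j
    unfolding simple_predictable_def
  proof (intro conjI allI impI ballI)
    show "K 0 \<in> borel_measurable (\<H> 0)" by (rule K0)
    fix i
    show "stopping_time \<H> (\<theta> j i)" unfolding \<theta>_def by (rule stopping_time_const)
    show "0 \<le> \<theta> j i z" for z unfolding \<theta>_def by (rule bd)
    show "\<theta> j i z \<le> T" if "i \<le> Suc j" for z unfolding \<theta>_def by (rule bd(2)[OF that])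
    show "\<theta> j i z \<le> \<theta> j (Suc i) z" for z unfolding \<theta>_def using T_pos by (intro divide_right_mono mult_right_mono) auto
    show "\<xi> j i \<in> borel_measurable (H.pre_sigma (\<theta> j i))" if "i < Suc j"
      unfolding \<theta>_def \<xi>_def using that bd by (intro pm Kad) auto
  qed
  let ?P = "\<lambda>j. simple_process (Suc j) (K 0) (\<theta> j) (\<xi> j)"
  have "AE z in M. uniform_limit {0..T} (\<lambda>j t. ?P j t z) (\<lambda>t. K t z) sequentially"
    using cont
  proof eventually_elim
    case (elim z)
    have uc: "uniformly_continuous_on {0..T} (\<lambda>t. K t z)" using elim by (intro compact_uniformly_continuous) auto
    show ?case
    proof (rule uniform_limitI)
      fix e :: real assume e: "e > 0"
      obtain d where d: "d > 0" "\<And>x y. x \<in> {0..T} \<Longrightarrow> y \<in> {0..T} \<Longrightarrow> dist y x < d \<Longrightarrow> dist (K y z) (K x z) < e"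
        using uc e unfolding uniformly_continuous_on_def by meson
      have "(\<lambda>j. T / real (Suc j)) \<longlonglongrightarrow> 0"
        using LIMSEQ_Suc[OF lim_const_over_n[of T]] by simp
      then have "eventually (\<lambda>j. T / real (Suc j) < d) sequentially" using order_tendstoD(2) d(1) by blast
      then show "eventually (\<lambda>j. \<forall>t\<in>{0..T}. dist (?P j t z) (K t z) < e) sequentially"
      proof eventually_elim
        case (elim j)
        show ?case
        proof
          fix t assume t: "t \<in> {0..T}"
          define h where "h = T / real (Suc j)"
          have h0: "0 < h" using T_pos by (simp add: h_def)
          have \<theta>h: "\<theta> j i z = real i * h" and \<xi>h: "\<xi> j i = K (real i * h)" for i
            by (simp_all add: \<theta>_def \<xi>_def h_def)
          have Th: "T = real (Suc j) * h" by (simp add: h_def)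
          have mono: "real k * h \<le> real l * h" if "k \<le> l" for k l
            using that h0 by (intro mult_right_mono) auto
          show "dist (?P j t z) (K t z) < e"
          proof (cases "t = 0")
            case True
            have "indicator {\<theta> j i z<..\<theta> j (Suc i) z} (0::real) = (0::real)" for i
              using bd(1)[of i j] by (auto simp: indicator_def \<theta>_def)
            then show ?thesis using True e by (simp add: simple_process_def)
          next
            case False
            then have t0: "0 < t" "t \<le> T" using t by auto
            define i where "i = nat (\<lceil>t / h\<rceil> - 1)"
            have pos: "0 < t / h" using t0 h0 by simp
            then have c1: "1 \<le> \<lceil>t / h\<rceil>" by linarith
            then have ri: "real i = of_int \<lceil>t / h\<rceil> - 1" by (simp add: i_def)
            have "real i < t / h" "t / h \<le> real (Suc i)"
              unfolding of_nat_Suc ri using ceiling_correct[of "t / h"] by linarith+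
            then have i1: "real i * h < t" and i2: "t \<le> real (Suc i) * h"
              using pos_less_divide_eq[OF h0] pos_divide_le_eq[OF h0] by blast+
            have ij: "i < Suc j"
            proof (rule ccontr)
              assume "\<not> i < Suc j"
              then have "T \<le> real i * h" unfolding Th by (intro mono) auto
              then show False using i1 t0 by simp
            qed
            have ind: "indicator {\<theta> j l z<..\<theta> j (Suc l) z} t = (if l = i then 1 else (0::real))" for l
            proof (cases "l = i")
              case True
              then show ?thesis using i1 i2 unfolding \<theta>h by simp
            next
              case False
              then consider "Suc l \<le> i" | "Suc i \<le> l" by linarith
              then show ?thesis
              proof cases
                case 1
                then have "\<not> t \<le> real (Suc l) * h" using mono[OF 1] i1 by linarith
                then show ?thesis using False unfolding \<theta>h by (simp add: indicator_def)
              next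
                case 2
                then have "\<not> real l * h < t" using mono[OF 2] i2 by linarith
                then show ?thesis using False unfolding \<theta>h by (simp add: indicator_def)
              qed
            qed
            have P: "?P j t z = K (real i * h) z"
              unfolding simple_process_def ind \<xi>h using ij t0
              by (simp add: if_distrib[of "(*) _"] sum.delta del: sum.lessThan_Suc cong: if_cong)
            have "real (Suc i) * h = real i * h + h" unfolding of_nat_Suc distrib_right by simp
            then have "dist (real i * h) t < d" using i1 i2 elim unfolding dist_real_def h_def[symmetric] by linarith
            moreover have "real i * h \<in> {0..T}" using i1 t0 h0 by auto
            ultimately show ?thesis unfolding P using d(2)[OF t] by simp
          qed
        qed
      qed
    qed
  qed
  moreover have "?P j t \<in> borel_measurable M" for j t
    using bd by (intro simple_process_measurable measurable_H[OF K0])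
       (auto simp: \<theta>_def[abs_def] \<xi>_def intro!: measurable_H[OF Kad])
  ultimately obtain \<rho> :: "nat \<Rightarrow> nat" where \<rho>: "strict_mono \<rho>"
    "AE z in M. uniform_limit {0..T} (\<lambda>r t. simple_integral W (Suc (\<rho> r)) (\<theta> (\<rho> r)) (\<xi> (\<rho> r)) t z) (\<lambda>t. I t z) sequentially"
    using stochastic_integral_AE_limit[OF si, of Suc "\<lambda>_. K 0" \<theta> \<xi>] sp measurable_H[OF Kad] by auto
  show ?thesis using \<rho>(2) AE_Omega1
  proof eventually_elim
    case (elim z)
    show ?case
    proof (intro ballI impI)
      fix s t assume s: "s \<in> {0..T}" and t: "t \<in> {0..T}" and eq: "E s z = E t z"
      have Wm: "W (min s c) z = W (min t c) z" for c
      proof -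
        have m: "E (min x c) z = min (E x z) (E c z)" for x
          using E_mono[OF elim(2), of x c] E_mono[OF elim(2), of c x] by (cases "x \<le> c") (auto simp: min_def)
        show ?thesis unfolding time_changed_process_def m eq ..
      qed
      have "simple_integral W (Suc (\<rho> r)) (\<theta> (\<rho> r)) (\<xi> (\<rho> r)) s z = simple_integral W (Suc (\<rho> r)) (\<theta> (\<rho> r)) (\<xi> (\<rho> r)) t z" for r
        unfolding simple_integral_def Wm ..
      then show "I s z = I t z"
        using tendsto_uniform_limitI[OF elim(1) s] tendsto_uniform_limitI[OF elim(1) t] by (auto intro: LIMSEQ_unique)
    qed
  qed
qed

end

section \<open>Stieltjes integrals with respect to a continuous integrator\<close>

locale continuous_integrator =
  fixes A :: "real \<Rightarrow> real"
  assumes A_mono: "\<And>s t. s \<le> t \<Longrightarrow> A s \<le> A t" and A_cont: "continuous_on UNIV A"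
begin

lemma A_right: "continuous (at_right t) A"
  using A_cont by (metis UNIV_I continuous_at_imp_continuous_within continuous_on_eq_continuous_at open_UNIV)

lemma emeasure_Ioc: "s \<le> t \<Longrightarrow> emeasure (interval_measure A) {s<..t} = ennreal (A t - A s)"
  by (rule emeasure_interval_measure_Ioc[OF _ A_mono A_right])

lemma measure_Ioc: "s \<le> t \<Longrightarrow> measure (interval_measure A) {s<..t} = A t - A s"
  using emeasure_Ioc[of s t] A_mono[of s t] by (simp add: measure_def)

context
  fixes f :: "real \<Rightarrow> real" and T :: real
  assumes f: "continuous_on {0..T} f"
begin

lemma set_integrable_Ioc:
  assumes "0 \<le> s" "t \<le> T" shows "set_integrable (interval_measure A) {s<..t} f"
proof -
  define g where "g x = indicator {0..T} x *\<^sub>R f x" for x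
  have g: "g \<in> borel_measurable borel" unfolding g_def
    by (rule borel_measurable_continuous_on_indicator) (use f in auto)
  have "bounded (f ` {0..T})" using compact_imp_bounded[OF compact_continuous_image[OF f]] by simp
  then obtain B where "\<forall>y\<in>f ` {0..T}. norm y \<le> B" unfolding bounded_iff by blast
  then have B: "\<And>x. x \<in> {0..T} \<Longrightarrow> norm (f x) \<le> B" by blast
  have "integrable (interval_measure A) (\<lambda>x. indicator {s<..t} x *\<^sub>R g x)"
  proof (rule integrableI_bounded_set_indicator[where B=B])
    show "emeasure (interval_measure A) {s<..t} < \<infinity>"
      using emeasure_Ioc[of s t] by (cases "s \<le> t") auto
    show "g \<in> borel_measurable (interval_measure A)" using g by simp
    show "AE x in interval_measure A. x \<in> {s<..t} \<longrightarrow> norm (g x) \<le> B"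
      using assms B by (intro AE_I2) (auto simp: g_def indicator_def)
  qed auto
  moreover have "(\<lambda>x. indicator {s<..t} x *\<^sub>R g x) = (\<lambda>x. indicator {s<..t} x *\<^sub>R f x)"
    using assms by (auto simp: g_def indicator_def)
  ultimately show ?thesis by (simp add: set_integrable_def)
qed

lemma stieltjes_diff:
  assumes "0 \<le> s" "s \<le> t" "t \<le> T"
  shows "stieltjes_integral A 0 t f - stieltjes_integral A 0 s f = (LINT r:{s<..t}|interval_measure A. f r)"
proof -
  have "{0<..t} = {0<..s} \<union> {s<..t}" using assms by auto
  then have "stieltjes_integral A 0 t f = (LINT r:{0<..s} \<union> {s<..t}|interval_measure A. f r)"
    by (simp add: stieltjes_integral_def)
  also have "\<dots> = (LINT r:{0<..s}|interval_measure A. f r) + (LINT r:{s<..t}|interval_measure A. f r)"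
    by (rule set_integral_Un) (use assms set_integrable_Ioc in auto)
  finally show ?thesis by (simp add: stieltjes_integral_def)
qed

lemma stieltjes_step_bound:
  assumes st: "0 \<le> s" "s \<le> t" "t \<le> T" and c: "\<And>r. s < r \<Longrightarrow> r \<le> t \<Longrightarrow> \<bar>f r - c\<bar> \<le> e"
  shows "\<bar>(stieltjes_integral A 0 t f - stieltjes_integral A 0 s f) - c * (A t - A s)\<bar> \<le> e * (A t - A s)"
proof -
  let ?M = "interval_measure A"
  have fin: "emeasure ?M {s<..t} < \<infinity>" using emeasure_Ioc st by simp
  have int_const: "set_integrable ?M {s<..t} (\<lambda>_. k)" for k :: real
    unfolding set_integrable_def using fin by (intro integrable_scaleR_left integrable_real_indicator) auto
  have const: "(LINT r:{s<..t}|?M. k) = k * (A t - A s)" for k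
    using measure_Ioc st by (simp add: set_lebesgue_integral_def mult.commute)
  have fi: "set_integrable ?M {s<..t} f" using st by (intro set_integrable_Ioc)
  have "(stieltjes_integral A 0 t f - stieltjes_integral A 0 s f) - c * (A t - A s) = (LINT r:{s<..t}|?M. f r - c)"
    unfolding stieltjes_diff[OF st] const[symmetric] by (rule set_integral_diff(2)[symmetric, OF fi int_const])
  also have "\<bar>\<dots>\<bar> \<le> (LINT r:{s<..t}|?M. e)"
  proof -
    have "norm (LINT r:{s<..t}|?M. f r - c) \<le> (LINT r:{s<..t}|?M. norm (f r - c))"
      by (rule set_integral_norm_bound) (rule set_integral_diff(1)[OF fi int_const])
    also have "\<dots> \<le> (LINT r:{s<..t}|?M. e)"
    proof (rule set_integral_mono[OF _ int_const])
      show "set_integrable ?M {s<..t} (\<lambda>r. norm (f r - c))"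
        using set_integral_diff(1)[OF fi int_const] by (rule set_integrable_norm)
    qed (use c in auto)
    finally show ?thesis by simp
  qed
  finally show ?thesis unfolding const .
qed

lemma stieltjes_riemann_sum:
  assumes s: "s 0 = 0" "\<And>i. i < n \<Longrightarrow> s i \<le> s (Suc i)" "s n \<le> T"
    and c: "\<And>i r. i < n \<Longrightarrow> s i < r \<Longrightarrow> r \<le> s (Suc i) \<Longrightarrow> \<bar>f r - c i\<bar> \<le> e"
  shows "\<bar>stieltjes_integral A 0 (s n) f - (\<Sum>i<n. c i * (A (s (Suc i)) - A (s i)))\<bar> \<le> e * (A (s n) - A 0)"
proof -
  have s_mono: "i \<le> j \<Longrightarrow> j \<le> n \<Longrightarrow> s i \<le> s j" for i j
  proof (induction j)
    case (Suc j)
    then show ?case using s(2)[of j] by (cases "i = Suc j") auto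
  qed auto
  have s0: "0 \<le> s i" "s i \<le> T" if "i \<le> n" for i using s_mono[of 0 i] s_mono[of i n] that s by auto
  let ?J = "\<lambda>t. stieltjes_integral A 0 t f"
  have z: "?J 0 = 0" by (simp add: stieltjes_integral_def set_lebesgue_integral_def)
  have "?J (s n) = (\<Sum>i<n. ?J (s (Suc i)) - ?J (s i))"
    unfolding sum_lessThan_telescope[of "\<lambda>i. ?J (s i)" n] by (simp add: s(1) z)
  then have "\<bar>?J (s n) - (\<Sum>i<n. c i * (A (s (Suc i)) - A (s i)))\<bar>
      = \<bar>\<Sum>i<n. (?J (s (Suc i)) - ?J (s i)) - c i * (A (s (Suc i)) - A (s i))\<bar>"
    by (simp add: sum_subtractf)
  also have "\<dots> \<le> (\<Sum>i<n. \<bar>(?J (s (Suc i)) - ?J (s i)) - c i * (A (s (Suc i)) - A (s i))\<bar>)" by (rule sum_abs)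
  also have "\<dots> \<le> (\<Sum>i<n. e * (A (s (Suc i)) - A (s i)))"
    using s0 s(2) c by (intro sum_mono stieltjes_step_bound) auto
  also have "\<dots> = e * (A (s n) - A 0)"
    unfolding sum_distrib_left[symmetric] sum_lessThan_telescope[of "\<lambda>i. A (s i)"] by (simp add: s(1))
  finally show ?thesis .
qed

end

end

section \<open>The solution in inner time\<close>

text \<open>\<open>X_flat\<close> is derived from the equation in \<open>sde_paths_exists\<close>:
  while the clock stands still, neither integral moves.\<close>

locale sde_paths = time_changed_brownian M \<F> B D T \<Omega>1
  for M :: "'a measure" and \<F> :: "real \<Rightarrow> 'a measure" and B D :: "real \<Rightarrow> 'a \<Rightarrow> real" and T :: real and \<Omega>1 :: "'a set" +
  fixes F G :: "real \<Rightarrow> real \<Rightarrow> real" and x0 :: real and X I :: "real \<Rightarrow> 'a \<Rightarrow> real"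
  assumes coeff: "jointly_continuous F" "jointly_continuous G"
    and X_adapted: "adapted_process \<H> {0..T} X"
    and X_cont: "\<And>z. z \<in> \<Omega>1 \<Longrightarrow> continuous_on {0..T} (\<lambda>t. X t z)"
    and X_flat: "\<And>z s t. z \<in> \<Omega>1 \<Longrightarrow> s \<in> {0..T} \<Longrightarrow> t \<in> {0..T} \<Longrightarrow> E s z = E t z \<Longrightarrow> X s z = X t z"
    and I: "stochastic_integral M \<H> T W (\<lambda>r z. G (E r z) (X r z)) I"
    and X_eq: "\<And>z t. z \<in> \<Omega>1 \<Longrightarrow> t \<in> {0..T} \<Longrightarrow>
        X t z = x0 + stieltjes_integral (\<lambda>r. E r z) 0 t (\<lambda>r. F (E r z) (X r z)) + I t z"
begin

text \<open>The clamp keeps the time argument in [0, T] on irregular paths too; on \<Omega>1 and for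
  u \<ge> 0 it reduces to \<open>min T (D u z)\<close>.\<close>

definition Y :: "real \<Rightarrow> 'a \<Rightarrow> real" where
  "Y u z = X (max 0 (min T (D u z))) z"

lemma Y_eq: "z \<in> \<Omega>1 \<Longrightarrow> 0 \<le> u \<Longrightarrow> Y u z = X (min T (D u z)) z"
  using D_nonneg[of z u] T_pos by (simp add: Y_def max_def)

lemma X_eq_Y: assumes z: "z \<in> \<Omega>1" and t: "t \<in> {0..T}" shows "X t z = Y (E t z) z"
proof -
  have e0: "0 \<le> E t z" by (rule E_nonneg[OF z])
  have "E (min T (D (E t z) z)) z = E t z"
    using E_min[OF z e0, of T] E_mono[OF z, of t T] t by simp
  moreover have "min T (D (E t z) z) \<in> {0..T}" using D_nonneg[OF z e0] T_pos by auto
  ultimately show ?thesis unfolding Y_eq[OF z e0] using X_flat[OF z t] by simp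
qed

lemma E_image: assumes z: "z \<in> \<Omega>1" shows "(\<lambda>t. E t z) ` {0..T} = {0..E T z}"
proof
  show "(\<lambda>t. E t z) ` {0..T} \<subseteq> {0..E T z}" using E_nonneg[OF z] E_mono[OF z] by auto
  show "{0..E T z} \<subseteq> (\<lambda>t. E t z) ` {0..T}"
  proof
    fix u assume u: "u \<in> {0..E T z}"
    then have "E (min T (D u z)) z = u" using E_min[OF z, of u T] by simp
    moreover have "min T (D u z) \<in> {0..T}" using u D_nonneg[OF z, of u] T_pos by auto
    ultimately show "u \<in> (\<lambda>t. E t z) ` {0..T}"
      by (intro image_eqI[of u "\<lambda>t. E t z" "min T (D u z)"]) auto
  qed
qed

text \<open>D jumps, so continuity does not come from composition. Instead, the clock maps [0, T]
  continuously onto the range of inner times, and the preimage of a closed set under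
  \<open>Y\<close> is the image of a compact set under the clock.\<close>

lemma Y_cont: assumes z: "z \<in> \<Omega>1" shows "continuous_on {0..E T z} (\<lambda>u. Y u z)"
  unfolding continuous_on_closed_vimage[OF closed_atLeastAtMost]
proof (intro allI impI)
  fix C :: "real set" assume C: "closed C"
  have "(\<lambda>u. Y u z) -` C \<inter> {0..E T z} = (\<lambda>t. E t z) ` ((\<lambda>t. X t z) -` C \<inter> {0..T})"
    unfolding E_image[OF z, symmetric] using X_eq_Y[OF z] by force
  moreover have "closed ((\<lambda>t. X t z) -` C \<inter> {0..T})"
    using X_cont[OF z] C continuous_on_closed_vimage[OF closed_atLeastAtMost] by blast
  then have "compact ((\<lambda>t. X t z) -` C \<inter> {0..T})"
    using compact_Int_closed[of "{0..T}"] by (metis Int_absorb Int_assoc Int_commute compact_Icc)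
  then have "compact ((\<lambda>t. E t z) ` ((\<lambda>t. X t z) -` C \<inter> {0..T}))"
    by (intro compact_continuous_image continuous_on_subset[OF E_cont[OF z]]) auto
  ultimately show "closed ((\<lambda>u. Y u z) -` C \<inter> {0..E T z})" by (simp add: compact_imp_closed)
qed

lemma X_measurable: "t \<in> {0..T} \<Longrightarrow> X t \<in> borel_measurable (\<H> t)"
  using X_adapted by (auto simp: adapted_process_def)

text \<open>\<open>Y u\<close> is approximated from the left along deterministic outer times \<open>t \<le> D u\<close>, at which \<open>E t \<le> u\<close>.\<close>

lemma Y_measurable: assumes u: "0 \<le> u" shows "Y u \<in> borel_measurable (\<F> u)"
proof -
  define h where "h k = T / real (Suc k)" for k
  have h0: "0 < h k" for k using T_pos by (simp add: h_def)
  \<comment> \<open>\<open>D u\<close> is rounded down to a grid of outer times. On regular paths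
    the tests on \<open>E\<close> hold automatically, but they make each summand measurable at inner
    time u through \<open>measurable_before_E\<close>.\<close>
  define g where "g k z = (if z \<in> \<Omega>1 then
      (\<Sum>i<Suc k. if real i * h k \<le> D u z \<and> D u z < real (Suc i) * h k
          then (if E (real i * h k) z \<le> u then X (real i * h k) z else 0) else 0)
      + (if T \<le> D u z then (if E T z \<le> u then X T z else 0) else 0) else 0)" for k z
  have ih: "real i * h k \<in> {0..T}" if "i < Suc k" for i k
  proof -
    have "real i * T \<le> real (Suc k) * T" using that T_pos by (intro mult_right_mono) auto
    then show ?thesis using T_pos by (auto simp: h_def divide_le_eq mult.commute)
  qed
  have gm: "g k \<in> borel_measurable (\<F> u)" for k
  proof -
    have [measurable]: "(\<lambda>z. if E (real i * h k) z \<le> u then X (real i * h k) z else 0) \<in> borel_measurable (\<F> u)" if "i < Suc k" for i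
      using measurable_before_E[OF X_measurable[OF ih[OF that]]] .
    have [measurable]: "(\<lambda>z. if E T z \<le> u then X T z else 0) \<in> borel_measurable (\<F> u)"
      using measurable_before_E[OF X_measurable[of T]] T_pos by auto
    have [measurable]: "D u \<in> borel_measurable (\<F> u)" using D_F u by auto
    have "(\<lambda>z. if real i * h k \<le> D u z \<and> D u z < real (Suc i) * h k
          then (if E (real i * h k) z \<le> u then X (real i * h k) z else 0) else 0) \<in> borel_measurable (\<F> u)" if "i < Suc k" for i
      using that by measurable
    then have [measurable]: "(\<lambda>z. \<Sum>i<Suc k. if real i * h k \<le> D u z \<and> D u z < real (Suc i) * h k
          then (if E (real i * h k) z \<le> u then X (real i * h k) z else 0) else 0) \<in> borel_measurable (\<F> u)"
      by (intro borel_measurable_sum) auto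
    show ?thesis unfolding g_def[abs_def] by measurable
  qed
  have g_near: "\<exists>s\<in>{0..T}. g k z = X s z \<and> \<bar>s - min T (D u z)\<bar> \<le> h k" if z: "z \<in> \<Omega>1" for k z
  proof -
    have Eu: "E t z \<le> u" if "t \<le> D u z" for t using E_mono[OF z that] E_D[OF z u] by simp
    have Th: "T = real (Suc k) * h k" by (simp add: h_def)
    have mono: "real a * h k \<le> real b * h k" if "a \<le> b" for a b using that h0[of k] by (intro mult_right_mono) auto
    show ?thesis
    proof (cases "T \<le> D u z")
      case True
      have "\<not> D u z < real (Suc i) * h k" if "i < Suc k" for i
        using mono[of "Suc i" "Suc k"] that True Th by auto
      then have "g k z = X T z" using True Eu[of T] z unfolding g_def by (simp del: of_nat_Suc sum.lessThan_Suc)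
      then show ?thesis using True T_pos h0[of k] by (intro bexI[of _ T]) auto
    next
      case False
      define i where "i = nat \<lfloor>D u z / h k\<rfloor>"
      have "0 \<le> D u z / h k" using D_nonneg[OF z u] h0[of k] by simp
      then have ri: "real i = of_int \<lfloor>D u z / h k\<rfloor>" by (simp add: i_def)
      have "real i \<le> D u z / h k" "D u z / h k < real i + 1"
        unfolding ri by linarith+
      then have i1: "real i * h k \<le> D u z" and i2: "D u z < real (Suc i) * h k"
        using h0[of k] by (simp_all add: pos_le_divide_eq pos_divide_less_eq add.commute)
      have ik: "i < Suc k"
      proof (rule ccontr)
        assume "\<not> i < Suc k"
        then have "T \<le> real i * h k" unfolding Th by (intro mono) auto
        then show False using i1 False by simp
      qed
      have uniq: "real l * h k \<le> D u z \<and> D u z < real (Suc l) * h k \<longleftrightarrow> l = i" for l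
      proof
        assume l: "real l * h k \<le> D u z \<and> D u z < real (Suc l) * h k"
        show "l = i"
        proof (rule ccontr)
          assume "l \<noteq> i"
          then consider "Suc l \<le> i" | "Suc i \<le> l" by linarith
          then show False using mono[of "Suc l" i] mono[of "Suc i" l] l i1 i2 by cases linarith+
        qed
      qed (use i1 i2 in auto)
      have "g k z = X (real i * h k) z"
        using False z ik Eu[OF i1] unfolding g_def uniq
        by (simp add: sum.delta del: sum.lessThan_Suc)
      moreover have "real (Suc i) * h k = real i * h k + h k" by (simp add: algebra_simps)
      ultimately show ?thesis using i1 i2 False ih[OF ik] by (intro bexI[of _ "real i * h k"]) auto
    qed
  qed
  define y where "y z = (if z \<in> \<Omega>1 then Y u z else 0)" for z
  have "y \<in> borel_measurable (\<F> u)"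
  proof (rule borel_measurable_LIMSEQ_real[OF _ gm])
    fix z assume "z \<in> space (\<F> u)"
    show "(\<lambda>k. g k z) \<longlonglongrightarrow> y z"
    proof (cases "z \<in> \<Omega>1")
      case False
      then show ?thesis by (simp add: g_def y_def)
    next
      case True
      obtain s where s: "\<And>k. s k \<in> {0..T}" "\<And>k. g k z = X (s k) z" "\<And>k. \<bar>s k - min T (D u z)\<bar> \<le> h k"
        using g_near[OF True] by metis
      have "h \<longlonglongrightarrow> 0" unfolding h_def[abs_def] using LIMSEQ_Suc[OF lim_const_over_n[of T]] by simp
      then have "(\<lambda>k. s k - min T (D u z)) \<longlonglongrightarrow> 0"
        by (rule Lim_null_comparison[rotated]) (use s in auto)
      then have "s \<longlonglongrightarrow> min T (D u z)" using LIM_zero_iff by blast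
      moreover have "min T (D u z) \<in> {0..T}" using D_nonneg[OF True u] T_pos by auto
      ultimately have "(\<lambda>k. X (s k) z) \<longlonglongrightarrow> X (min T (D u z)) z"
        using X_cont[OF True] s(1) unfolding continuous_on_sequentially comp_def by auto
      then show ?thesis using s(2) True by (simp add: y_def Y_eq[OF True u])
    qed
  qed
  then show ?thesis by (rule measurable_modify) (simp add: y_def)
qed

lemma continuous_coeff:
  assumes "jointly_continuous \<Phi>" and z: "z \<in> \<Omega>1"
  shows "continuous_on {0..E T z} (\<lambda>u. \<Phi> u (Y u z))"
proof -
  have "continuous_on {0..E T z} (\<lambda>u. (u, Y u z))" by (intro continuous_intros Y_cont[OF z])
  from continuous_on_compose2[OF assms(1)[unfolded jointly_continuous_def] this] show ?thesis by (simp add: image_subset_iff)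
qed

text \<open>The coefficients are taken along the exact solution, so this is not a recursion;
  convergence to \<open>Y\<close> follows from that of the two integrals, without a stability
  estimate.\<close>

definition U :: "real \<Rightarrow> nat \<Rightarrow> 'a \<Rightarrow> real" where
  "U \<epsilon> l z = x0 + (\<Sum>i<l. F (real i * \<epsilon>) (Y (real i * \<epsilon>) z) * \<epsilon>
      + G (real i * \<epsilon>) (Y (real i * \<epsilon>) z) * (B (real (Suc i) * \<epsilon>) z - B (real i * \<epsilon>) z))"

lemma integrator: "z \<in> \<Omega>1 \<Longrightarrow> continuous_integrator (\<lambda>t. E t z)"
  by unfold_locales (use E_mono E_cont in auto)

text \<open>The mesh depends on the path through the modulus of continuity of the drift in inner
  time, but it serves all t and n at once.\<close>

lemma drift_riemann:
  assumes z: "z \<in> \<Omega>1" and e: "e > 0"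
  shows "\<exists>d>0. \<forall>\<epsilon> n t. 0 < \<epsilon> \<longrightarrow> \<epsilon> < d \<longrightarrow> E T z \<le> real n * \<epsilon> \<longrightarrow> t \<in> {0..T} \<longrightarrow>
    \<bar>stieltjes_integral (\<lambda>r. E r z) 0 t (\<lambda>r. F (E r z) (X r z))
      - (\<Sum>i<n. F (real i * \<epsilon>) (Y (real i * \<epsilon>) z) * (min (E t z) (real (Suc i) * \<epsilon>) - min (E t z) (real i * \<epsilon>)))\<bar> \<le> e"
proof -
  interpret continuous_integrator "\<lambda>t. E t z" by (rule integrator[OF z])
  let ?\<phi> = "\<lambda>u. F u (Y u z)" and ?S = "E T z"
  have S0: "0 \<le> ?S" by (rule E_nonneg[OF z])
  have fc: "continuous_on {0..T} (\<lambda>r. F (E r z) (X r z))"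
  proof -
    have "continuous_on {0..T} (\<lambda>r. (E r z, X r z))"
      by (intro continuous_intros X_cont[OF z] continuous_on_subset[OF E_cont[OF z]]) auto
    from continuous_on_compose2[OF coeff(1)[unfolded jointly_continuous_def] this] show ?thesis
      using E_nonneg[OF z] by auto
  qed
  have uc: "uniformly_continuous_on {0..?S} ?\<phi>"
    using continuous_coeff[OF coeff(1) z] by (intro compact_uniformly_continuous) auto
  have e': "e / (?S + 1) > 0" using e S0 by simp
  obtain d where d: "d > 0" "\<And>x y. x \<in> {0..?S} \<Longrightarrow> y \<in> {0..?S} \<Longrightarrow> dist y x < d \<Longrightarrow> dist (?\<phi> y) (?\<phi> x) < e / (?S + 1)"
    using uc e' unfolding uniformly_continuous_on_def by meson
  show ?thesis
  proof (intro exI[of _ d] conjI allI impI d(1))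
    fix \<epsilon> n t assume \<epsilon>: "0 < \<epsilon>" "\<epsilon> < d" and n: "?S \<le> real n * \<epsilon>" and t: "t \<in> {0..T}"
    define s where "s i = min t (D (real i * \<epsilon>) z)" for i
    have v0: "0 \<le> real i * \<epsilon>" for i using \<epsilon> by simp
    have vm: "real i * \<epsilon> \<le> real (Suc i) * \<epsilon>" for i using \<epsilon> by (intro mult_right_mono) auto
    have Es: "E (s i) z = min (E t z) (real i * \<epsilon>)" for i unfolding s_def by (rule E_min[OF z v0])
    have s0: "s 0 = 0" using E_D[OF z, of 0] subordinator_path.zero[OF D_path[OF z]] t by (simp add: s_def)
    have sm: "s i \<le> s (Suc i)" for i unfolding s_def using D_mono[OF z v0 vm] by (auto simp: min_def intro: order_trans)
    have sn: "s n \<le> T" using t by (auto simp: s_def)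
    \<comment> \<open>The grid may end before t, but the clock is flat on the rest and the integral
      over it vanishes.\<close>
    have Jt: "stieltjes_integral (\<lambda>r. E r z) 0 t (\<lambda>r. F (E r z) (X r z)) = stieltjes_integral (\<lambda>r. E r z) 0 (s n) (\<lambda>r. F (E r z) (X r z))"
    proof -
      have "E (s n) z = E t z" unfolding Es using E_mono[OF z, of t T] t n by simp
      moreover have "0 \<le> s n" "s n \<le> t" using t D_nonneg[OF z v0[of n]] by (auto simp: s_def)
      moreover have "\<exists>c. \<forall>r. s n < r \<longrightarrow> r \<le> t \<longrightarrow> \<bar>F (E r z) (X r z) - 0\<bar> \<le> c"
      proof -
        have "bounded ((\<lambda>r. F (E r z) (X r z)) ` {0..T})"
          using compact_imp_bounded[OF compact_continuous_image[OF fc]] by simp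
        then obtain c where "\<forall>y\<in>(\<lambda>r. F (E r z) (X r z)) ` {0..T}. norm y \<le> c" unfolding bounded_iff by blast
        then have c: "\<And>r. r \<in> {0..T} \<Longrightarrow> norm (F (E r z) (X r z)) \<le> c" by blast
        show ?thesis
        proof (intro exI[of _ c] allI impI)
          fix r assume "s n < r" "r \<le> t"
          then have "r \<in> {0..T}" using t \<open>0 \<le> s n\<close> by auto
          from c[OF this] show "\<bar>F (E r z) (X r z) - 0\<bar> \<le> c" by simp
        qed
      qed
      ultimately obtain c where "\<And>r. s n < r \<Longrightarrow> r \<le> t \<Longrightarrow> \<bar>F (E r z) (X r z) - 0\<bar> \<le> c" "0 \<le> s n" "s n \<le> t" "E (s n) z = E t z" by blast
      then show ?thesis using stieltjes_step_bound[OF fc, of "s n" t 0 c] t by simp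
    qed
    have "\<bar>stieltjes_integral (\<lambda>r. E r z) 0 (s n) (\<lambda>r. F (E r z) (X r z)) - (\<Sum>i<n. ?\<phi> (real i * \<epsilon>) * (E (s (Suc i)) z - E (s i) z))\<bar>
        \<le> e / (?S + 1) * (E (s n) z - E 0 z)"
    proof (rule stieltjes_riemann_sum[OF fc s0 sm sn])
      fix i r assume r: "s i < r" "r \<le> s (Suc i)"
      have "0 \<le> s i" using t D_nonneg[OF z v0[of i]] by (auto simp: s_def)
      then have rT: "r \<in> {0..T}" using r t by (auto simp: s_def)
      have "r \<le> t" using r by (simp add: s_def)
      then have "D (real i * \<epsilon>) z < r" using r by (auto simp: s_def min_def split: if_splits)
      then have lo: "real i * \<epsilon> < E r z" using E_greater_iff[OF z v0] by blast
      have "E r z \<le> E (D (real (Suc i) * \<epsilon>) z) z" using r by (intro E_mono[OF z]) (auto simp: s_def)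
      then have hi: "E r z \<le> real i * \<epsilon> + \<epsilon>" using E_D[OF z v0, of "Suc i"] by (simp add: algebra_simps)
      have rS: "E r z \<le> ?S" using rT by (intro E_mono[OF z]) auto
      have "dist (?\<phi> (E r z)) (?\<phi> (real i * \<epsilon>)) < e / (?S + 1)"
        using lo hi rS \<epsilon> v0[of i] E_nonneg[OF z, of r] by (intro d(2)) (auto simp: dist_real_def)
      then show "\<bar>F (E r z) (X r z) - ?\<phi> (real i * \<epsilon>)\<bar> \<le> e / (?S + 1)"
        using X_eq_Y[OF z rT] by (simp add: dist_real_def)
    qed
    also have "\<dots> \<le> e / (?S + 1) * (?S + 1)"
      using e' E_mono[OF z sn] E_nonneg[OF z, of 0] by (intro mult_left_mono) linarith+
    also have "\<dots> = e" using S0 by simp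
    finally show "\<bar>stieltjes_integral (\<lambda>r. E r z) 0 t (\<lambda>r. F (E r z) (X r z))
      - (\<Sum>i<n. ?\<phi> (real i * \<epsilon>) * (min (E t z) (real (Suc i) * \<epsilon>) - min (E t z) (real i * \<epsilon>)))\<bar> \<le> e"
      unfolding Jt Es .
  qed
qed

text \<open>Each grid point up to \<open>E T\<close> is the clock reading at some outer time, so
  uniformity in t of the two limits becomes uniformity over the grid. The subsequence is the one
  prescribed by the stochastic integral.\<close>

lemma sde_grid:
  assumes eps: "\<And>r. \<epsilon> r > 0" "\<epsilon> \<longlonglongrightarrow> 0"
  shows "\<exists>\<rho>::nat \<Rightarrow> nat. strict_mono \<rho> \<and> (AE z in M. \<forall>e>0. eventually (\<lambda>r. \<forall>l. real l * \<epsilon> (\<rho> r) \<le> E T z \<longrightarrow>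
      \<bar>U (\<epsilon> (\<rho> r)) l z - Y (real l * \<epsilon> (\<rho> r)) z\<bar> < e) sequentially)"
proof -
  \<comment> \<open>Enough points for the r-th grid to reach inner time r.\<close>
  define n where "n r = nat \<lceil>real r / \<epsilon> r\<rceil>" for r
  have nr: "real r \<le> real (n r) * \<epsilon> r" for r
  proof -
    have "real r / \<epsilon> r \<le> real (n r)" unfolding n_def by linarith
    then show ?thesis using eps(1)[of r] by (simp add: pos_divide_le_eq)
  qed
  have n: "filterlim (\<lambda>r. real (n r) * \<epsilon> r) at_top sequentially"
    by (rule filterlim_at_top_mono[OF filterlim_real_sequentially]) (use nr in auto)
  have "AE z in M. \<forall>t\<in>{0<..T}. G (E t z) (X t z) = (if 0 < E t z then G (E t z) (Y (E t z) z) else 0)"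
    using AE_Omega1
  proof eventually_elim
    case (elim z)
    then show ?case using E_pos[OF elim] X_eq_Y[OF elim] by auto
  qed
  moreover have "AE z in M. continuous_on {0..max 0 (E T z)} (\<lambda>u. G u (Y u z))"
    using AE_Omega1
  proof eventually_elim
    case (elim z)
    then show ?case using continuous_coeff[OF coeff(2) elim] E_nonneg[OF elim, of T] by (simp add: max_absorb2)
  qed
  moreover have "(\<lambda>z. G u (Y u z)) \<in> borel_measurable (\<F> u)" if "0 \<le> u" for u
    using measurable_compose[OF Y_measurable[OF that] jointly_continuous_slice[OF coeff(2) that]] .
  ultimately obtain \<rho> :: "nat \<Rightarrow> nat" where \<rho>: "strict_mono \<rho>" and lim: "AE z in M. uniform_limit {0..T}
    (\<lambda>r t. \<Sum>i<n (\<rho> r). G (0 + real i * \<epsilon> (\<rho> r)) (Y (0 + real i * \<epsilon> (\<rho> r)) z) * (B (min (E t z) (0 + real (Suc i) * \<epsilon> (\<rho> r))) z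
        - B (min (E t z) (0 + real i * \<epsilon> (\<rho> r))) z)) (\<lambda>t. I t z) sequentially"
    using inner_grid_limit[OF I order_refl, where \<Gamma>="\<lambda>u z. G u (Y u z)", OF _ _ _ eps n] by blast
  have eps\<rho>: "(\<lambda>r. \<epsilon> (\<rho> r)) \<longlonglongrightarrow> 0" using LIMSEQ_subseq_LIMSEQ[OF eps(2) \<rho>] by (simp add: comp_def)
  have n\<rho>: "filterlim (\<lambda>r. real (n (\<rho> r)) * \<epsilon> (\<rho> r)) at_top sequentially"
    using filterlim_compose[OF n filterlim_subseq[OF \<rho>]] by simp
  have "AE z in M. \<forall>e>0. eventually (\<lambda>r. \<forall>l. real l * \<epsilon> (\<rho> r) \<le> E T z \<longrightarrow>
      \<bar>U (\<epsilon> (\<rho> r)) l z - Y (real l * \<epsilon> (\<rho> r)) z\<bar> < e) sequentially"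
    using lim AE_Omega1
  proof eventually_elim
    case (elim z)
    note z = elim(2)
    show ?case
    proof (intro allI impI)
      fix e :: real assume e: "e > 0"
      then have e2: "e / 2 > 0" by simp
      obtain d where d: "d > 0" "\<And>\<epsilon> n t. 0 < \<epsilon> \<Longrightarrow> \<epsilon> < d \<Longrightarrow> E T z \<le> real n * \<epsilon> \<Longrightarrow> t \<in> {0..T} \<Longrightarrow>
        \<bar>stieltjes_integral (\<lambda>r. E r z) 0 t (\<lambda>r. F (E r z) (X r z))
        - (\<Sum>i<n. F (real i * \<epsilon>) (Y (real i * \<epsilon>) z) * (min (E t z) (real (Suc i) * \<epsilon>) - min (E t z) (real i * \<epsilon>)))\<bar> \<le> e / 2"
        using drift_riemann[OF z e2] by blast
      have "eventually (\<lambda>r. \<epsilon> (\<rho> r) < d) sequentially" using order_tendstoD(2)[OF eps\<rho> d(1)] .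
      moreover have "eventually (\<lambda>r. E T z \<le> real (n (\<rho> r)) * \<epsilon> (\<rho> r)) sequentially"
        using n\<rho> unfolding filterlim_at_top by blast
      moreover have "eventually (\<lambda>r. \<forall>t\<in>{0..T}. dist (\<Sum>i<n (\<rho> r). G (0 + real i * \<epsilon> (\<rho> r)) (Y (0 + real i * \<epsilon> (\<rho> r)) z) *
          (B (min (E t z) (0 + real (Suc i) * \<epsilon> (\<rho> r))) z - B (min (E t z) (0 + real i * \<epsilon> (\<rho> r))) z)) (I t z) < e / 2) sequentially"
        using uniform_limitD[OF elim(1) e2] .
      ultimately show "eventually (\<lambda>r. \<forall>l. real l * \<epsilon> (\<rho> r) \<le> E T z \<longrightarrow>
        \<bar>U (\<epsilon> (\<rho> r)) l z - Y (real l * \<epsilon> (\<rho> r)) z\<bar> < e) sequentially"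
      proof eventually_elim
        case (elim r)
        show ?case
        proof (intro allI impI)
          fix l assume l: "real l * \<epsilon> (\<rho> r) \<le> E T z"
          let ?\<epsilon> = "\<epsilon> (\<rho> r)" and ?n = "n (\<rho> r)"
          have \<epsilon>0: "0 < ?\<epsilon>" by (rule eps)
          have vl0: "0 \<le> real l * ?\<epsilon>" using \<epsilon>0 by simp
          \<comment> \<open>An outer time at which the clock shows the l-th grid point.\<close>
          define t where "t = min T (D (real l * ?\<epsilon>) z)"
          have t: "t \<in> {0..T}" using D_nonneg[OF z vl0] T_pos by (auto simp: t_def)
          have Et: "E t z = real l * ?\<epsilon>" unfolding t_def E_min[OF z vl0] using l by simp
          have Xt: "X t z = Y (real l * ?\<epsilon>) z" using X_eq_Y[OF z t] Et by simp
          have ln: "l \<le> ?n"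
          proof -
            have "real l * ?\<epsilon> \<le> real ?n * ?\<epsilon>" using l elim(2) by linarith
            then show ?thesis using \<epsilon>0 by simp
          qed
          have mins: "min (real l * ?\<epsilon>) (real i * ?\<epsilon>) = real (min l i) * ?\<epsilon>" for i
            using \<epsilon>0 by (auto simp: min_def)
          \<comment> \<open>The terms from index l on vanish, because the clock has stopped at the
            l-th grid point.\<close>
          have restrict: "(\<Sum>i<?n. c i * (g (real (min l (Suc i)) * ?\<epsilon>) - g (real (min l i) * ?\<epsilon>)))
              = (\<Sum>i<l. c i * (g (real (Suc i) * ?\<epsilon>) - g (real i * ?\<epsilon>)))" for c g :: "_ \<Rightarrow> real"
          proof -
            have "(\<Sum>i<l. c i * (g (real (Suc i) * ?\<epsilon>) - g (real i * ?\<epsilon>)))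
                = (\<Sum>i<l. c i * (g (real (min l (Suc i)) * ?\<epsilon>) - g (real (min l i) * ?\<epsilon>)))"
              by (intro sum.cong refl) (simp add: min_absorb2 Suc_le_eq)
            also have "\<dots> = (\<Sum>i<?n. c i * (g (real (min l (Suc i)) * ?\<epsilon>) - g (real (min l i) * ?\<epsilon>)))"
              using ln by (intro sum.mono_neutral_left) (auto simp: min_def)
            finally show ?thesis by simp
          qed
          have a: "\<bar>stieltjes_integral (\<lambda>r. E r z) 0 t (\<lambda>r. F (E r z) (X r z))
            - (\<Sum>i<l. F (real i * ?\<epsilon>) (Y (real i * ?\<epsilon>) z) * (real (Suc i) * ?\<epsilon> - real i * ?\<epsilon>))\<bar> \<le> e / 2"
            using d(2)[OF \<epsilon>0 elim(1,2) t] unfolding Et mins restrict[of _ "\<lambda>x. x"] .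
          have b: "\<bar>(\<Sum>i<l. G (real i * ?\<epsilon>) (Y (real i * ?\<epsilon>) z) * (B (real (Suc i) * ?\<epsilon>) z - B (real i * ?\<epsilon>) z)) - I t z\<bar> < e / 2"
            using bspec[OF elim(3) t] unfolding add_0 Et mins restrict[of _ "\<lambda>x. B x z"] dist_real_def .
          have c: "(\<Sum>i<l. F (real i * ?\<epsilon>) (Y (real i * ?\<epsilon>) z) * (real (Suc i) * ?\<epsilon> - real i * ?\<epsilon>)) = (\<Sum>i<l. F (real i * ?\<epsilon>) (Y (real i * ?\<epsilon>) z) * ?\<epsilon>)"
            by (intro sum.cong refl) (simp add: algebra_simps)
          have "U ?\<epsilon> l z - Y (real l * ?\<epsilon>) z =
             ((\<Sum>i<l. F (real i * ?\<epsilon>) (Y (real i * ?\<epsilon>) z) * ?\<epsilon>) - stieltjes_integral (\<lambda>r. E r z) 0 t (\<lambda>r. F (E r z) (X r z)))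
            + ((\<Sum>i<l. G (real i * ?\<epsilon>) (Y (real i * ?\<epsilon>) z) * (B (real (Suc i) * ?\<epsilon>) z - B (real i * ?\<epsilon>) z)) - I t z)"
            unfolding U_def Xt[symmetric] X_eq[OF z t] sum.distrib by simp
          then show "\<bar>U ?\<epsilon> l z - Y (real l * ?\<epsilon>) z\<bar> < e" using a b unfolding c by linarith
        qed
      qed
    qed
  qed
  then show ?thesis using \<rho> by blast
qed

end

section \<open>The Milstein approximation in inner time\<close>

context time_changed_brownian
begin

lemma gaussian_grid:
  assumes a: "0 \<le> a" and \<epsilon>: "0 < \<epsilon>"
  shows "gaussian_increments M (\<lambda>j. \<F> (a + real j * \<epsilon>)) (\<lambda>j z. B (a + real (Suc j) * \<epsilon>) z - B (a + real j * \<epsilon>) z) \<epsilon>"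
proof unfold_locales
  fix j
  have t: "0 \<le> a + real j * \<epsilon>" "a + real j * \<epsilon> < a + real (Suc j) * \<epsilon>" "a + real (Suc j) * \<epsilon> - (a + real j * \<epsilon>) = \<epsilon>"
    using a \<epsilon> by (auto simp: algebra_simps)
  show "space (\<F> (a + real j * \<epsilon>)) = space M" by (rule F.space_F)
  show "sets (\<F> (a + real j * \<epsilon>)) \<subseteq> sets (\<F> (a + real (Suc j) * \<epsilon>))" using t by (intro F.sets_F_mono) auto
  show "sets (\<F> (a + real j * \<epsilon>)) \<subseteq> sets M" by (rule sets_F)
  have [measurable]: "B (a + real (Suc j) * \<epsilon>) \<in> borel_measurable (\<F> (a + real (Suc j) * \<epsilon>))"
    "B (a + real j * \<epsilon>) \<in> borel_measurable (\<F> (a + real (Suc j) * \<epsilon>))"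
    using B_adapted[of "a + real (Suc j) * \<epsilon>"] measurable_F_mono[OF less_imp_le[OF t(2)] B_adapted[OF t(1)]] t by auto
  show "(\<lambda>z. B (a + real (Suc j) * \<epsilon>) z - B (a + real j * \<epsilon>) z) \<in> borel_measurable (\<F> (a + real (Suc j) * \<epsilon>))"
    by measurable
  have bm: "distributed M lborel (\<lambda>z. B t z - B s z) (normal_density 0 (sqrt (t - s))) \<and>
        indep_set (sets (\<F> s)) {(\<lambda>z. B t z - B s z) -` A \<inter> space M | A. A \<in> sets borel}" if "0 \<le> s" "s < t" for s t
    using BM that by (auto simp: brownian_motion_def)
  show "distributed M lborel (\<lambda>z. B (a + real (Suc j) * \<epsilon>) z - B (a + real j * \<epsilon>) z) (normal_density 0 (sqrt \<epsilon>))"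
    using bm[OF t(1,2)] unfolding t(3) by blast
  show "indep_set (sets (\<F> (a + real j * \<epsilon>)))
     {(\<lambda>z. B (a + real (Suc j) * \<epsilon>) z - B (a + real j * \<epsilon>) z) -` A \<inter> space M |A. A \<in> sets borel}"
    using bm[OF t(1,2)] by blast
qed (rule \<epsilon>)

text \<open>The mean squares are at most 8 m 2^(-r), hence summable, so convergence holds along the
  full dyadic sequence and along whatever subsequence an integral prescribes later. The maximum
  gives uniformity in the end point.\<close>

lemma quadratic_variation:
  assumes a: "0 \<le> a"
  shows "AE z in M. \<forall>m::nat. (\<lambda>r. running_max (\<lambda>l. \<Sum>i<l. (B (a + real (Suc i) * (1/2)^r) z - B (a + real i * (1/2)^r) z)\<^sup>2 - (1/2)^r) (m * 2^r)) \<longlonglongrightarrow> 0"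
  unfolding AE_all_countable
proof
  fix m :: nat
  let ?R = "\<lambda>r z. running_max (\<lambda>l. \<Sum>i<l. (B (a + real (Suc i) * (1/2)^r) z - B (a + real i * (1/2)^r) z)\<^sup>2 - (1/2)^r) (m * 2^r)"
  have sm: "second_moment M (?R r) \<le> ennreal (8 * real m * (1/2)^r)" for r
  proof -
    define \<epsilon> :: real where "\<epsilon> = (1/2)^r"
    have \<epsilon>: "0 < \<epsilon>" by (simp add: \<epsilon>_def)
    interpret g: gaussian_increments M "\<lambda>j. \<F> (a + real j * \<epsilon>)" "\<lambda>j z. B (a + real (Suc j) * \<epsilon>) z - B (a + real j * \<epsilon>) z" \<epsilon>
      by (rule gaussian_grid[OF a \<epsilon>])
    have "second_moment M (\<lambda>z. running_max (\<lambda>l. \<Sum>j<l. 1 * ((B (a + real (Suc j) * \<epsilon>) z - B (a + real j * \<epsilon>) z)\<^sup>2 - \<epsilon>)) (m * 2^r))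
      \<le> ennreal (8 * \<epsilon>\<^sup>2) * (\<Sum>j<m * 2^r. second_moment M (\<lambda>_. 1))"
      by (rule g.doob_w_sq) auto
    also have "\<dots> = ennreal (8 * \<epsilon>\<^sup>2) * ennreal (real (m * 2^r))"
      by (simp add: second_moment_def emeasure_space_1 ennreal_of_nat_eq_real_of_nat)
    also have "\<dots> = ennreal (8 * \<epsilon>\<^sup>2 * real (m * 2^r))" by (rule ennreal_mult[symmetric]) auto
    also have "8 * \<epsilon>\<^sup>2 * real (m * 2^r) = 8 * real m * (1/2)^r"
      by (simp add: \<epsilon>_def power2_eq_square power_divide)
    finally show ?thesis by (simp add: \<epsilon>_def)
  qed
  have B_M: "B t \<in> borel_measurable M" if "0 \<le> t" for t using measurable_F[OF B_adapted[OF that]] .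
  have [measurable]: "?R r \<in> borel_measurable M" for r
    by (intro measurable_running_max borel_measurable_sum borel_measurable_diff borel_measurable_power B_M) (use a in auto)
  have "(\<integral>\<^sup>+ z. (\<Sum>r. ennreal ((?R r z)\<^sup>2)) \<partial>M) = (\<Sum>r. second_moment M (?R r))"
    unfolding second_moment_def by (rule nn_integral_suminf) measurable
  also have "\<dots> \<le> (\<Sum>r. ennreal (8 * real m * (1/2)^r))" by (rule suminf_le[OF sm]) auto
  also have "\<dots> = ennreal (\<Sum>r. 8 * real m * (1/2)^r)"
    by (rule suminf_ennreal2) (auto intro!: summable_mult summable_geometric)
  finally have "(\<integral>\<^sup>+ z. (\<Sum>r. ennreal ((?R r z)\<^sup>2)) \<partial>M) \<noteq> \<infinity>" by (auto simp: top_unique)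
  moreover have "(\<lambda>z. \<Sum>r. ennreal ((?R r z)\<^sup>2)) \<in> borel_measurable M" by measurable
  ultimately have "AE z in M. (\<Sum>r. ennreal ((?R r z)\<^sup>2)) \<noteq> \<infinity>"
    by (intro nn_integral_PInf_AE)
  then show "AE z in M. (\<lambda>r. ?R r z) \<longlonglongrightarrow> 0"
  proof eventually_elim
    case (elim z)
    then have "summable (\<lambda>r. (?R r z)\<^sup>2)" by (intro summable_suminf_not_top) auto
    then have "(\<lambda>r. (?R r z)\<^sup>2) \<longlonglongrightarrow> 0" by (rule summable_LIMSEQ_zero)
    then have "(\<lambda>r. sqrt ((?R r z)\<^sup>2)) \<longlonglongrightarrow> sqrt 0" by (rule tendsto_real_sqrt)
    then show ?case using running_max_nonneg by simp
  qed
qed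

section \<open>Closed forms of the single and the iterated integral\<close>

lemma dyadic_time:
  "filterlim (\<lambda>r. real ((4::nat) ^ r) * (1/2::real) ^ r) at_top sequentially"
proof -
  \<comment> \<open>4^r steps of mesh 2^(-r) cover a length 2^r, so refinement and exhaustion happen
    together.\<close>
  have "real ((4::nat) ^ r) * (1/2::real) ^ r = 2 ^ r" for r
    by (simp add: power_mult_distrib[symmetric])
  moreover have "filterlim (\<lambda>r. (2::real) ^ r) at_top sequentially"
    by (rule filterlim_at_top_mono[OF filterlim_real_sequentially]) (auto intro!: always_eventually less_imp_le of_nat_less_two_power)
  ultimately show ?thesis by simp
qed

lemma dyadic_tendsto: "(\<lambda>r. (1/2::real) ^ r) \<longlonglongrightarrow> 0"
  by (rule LIMSEQ_power_zero) simp

text \<open>The Riemann sums telescope and agree with the claimed value as soon as the grid extends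
  beyond \<open>E t\<close>.\<close>

lemma integral_frozen:
  assumes si: "stochastic_integral M \<H> T W K I" and a: "0 \<le> a"
    and \<zeta>: "\<zeta> \<in> borel_measurable (\<F> a)"
    and K: "AE z in M. \<forall>t\<in>{0<..T}. K t z = (if a < E t z then \<zeta> z else 0)"
  shows "AE z in M. \<forall>t\<in>{0..T}. I t z = \<zeta> z * (B (E t z) z - B (min (E t z) a) z)"
proof -
  have "\<exists>\<rho>::nat \<Rightarrow> nat. strict_mono \<rho> \<and> (AE z in M. uniform_limit {0..T}
    (\<lambda>r t. \<Sum>i<4 ^ \<rho> r. \<zeta> z * (B (min (E t z) (a + real (Suc i) * (1/2) ^ \<rho> r)) z
        - B (min (E t z) (a + real i * (1/2) ^ \<rho> r)) z)) (\<lambda>t. I t z) sequentially)"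
    by (rule inner_grid_limit[OF si a, where \<Gamma>="\<lambda>u z. \<zeta> z", OF _ _ K _ dyadic_tendsto dyadic_time])
       (use measurable_F_mono[OF _ \<zeta>] in auto)
  then obtain \<rho> :: "nat \<Rightarrow> nat" where \<rho>: "strict_mono \<rho>" and lim: "AE z in M. uniform_limit {0..T}
    (\<lambda>r t. \<Sum>i<4 ^ \<rho> r. \<zeta> z * (B (min (E t z) (a + real (Suc i) * (1/2) ^ \<rho> r)) z
        - B (min (E t z) (a + real i * (1/2) ^ \<rho> r)) z)) (\<lambda>t. I t z) sequentially" by blast
  have big: "filterlim (\<lambda>r. real ((4::nat) ^ \<rho> r) * (1/2::real) ^ \<rho> r) at_top sequentially"
    using filterlim_compose[OF dyadic_time filterlim_subseq[OF \<rho>]] by simp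
  show ?thesis using lim AE_Omega1
  proof eventually_elim
    case (elim z)
    show ?case
    proof
      fix t assume t: "t \<in> {0..T}"
      let ?s = "\<lambda>r. \<Sum>i<4 ^ \<rho> r. \<zeta> z * (B (min (E t z) (a + real (Suc i) * (1/2) ^ \<rho> r)) z
        - B (min (E t z) (a + real i * (1/2) ^ \<rho> r)) z)"
      have "eventually (\<lambda>r. E t z \<le> real ((4::nat) ^ \<rho> r) * (1/2::real) ^ \<rho> r) sequentially"
        using big unfolding filterlim_at_top by blast
      then have "eventually (\<lambda>r. ?s r = \<zeta> z * (B (E t z) z - B (min (E t z) a) z)) sequentially"
      proof eventually_elim
        case (elim r)
        have "?s r = \<zeta> z * (B (min (E t z) (a + real ((4::nat) ^ \<rho> r) * (1/2) ^ \<rho> r)) z - B (min (E t z) (a + real 0 * (1/2) ^ \<rho> r)) z)"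
          unfolding sum_distrib_left[symmetric]
          using sum_lessThan_telescope[of "\<lambda>i. B (min (E t z) (a + real i * (1/2) ^ \<rho> r)) z" "4 ^ \<rho> r"] by simp
        moreover have "min (E t z) (a + real ((4::nat) ^ \<rho> r) * (1/2) ^ \<rho> r) = E t z" using elim a by simp
        ultimately show ?case by simp
      qed
      then have "?s \<longlonglongrightarrow> \<zeta> z * (B (E t z) z - B (min (E t z) a) z)" by (rule tendsto_eventually)
      moreover have "?s \<longlonglongrightarrow> I t z" using tendsto_uniform_limitI[OF elim(1) t] .
      ultimately show "I t z = \<zeta> z * (B (E t z) z - B (min (E t z) a) z)" by (rule LIMSEQ_unique[symmetric])
    qed
  qed
qed

text \<open>Discrete Ito formula for the square: 2 a (b - a) = b^2 - a^2 - (b - a)^2, summed over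
  the steps.\<close>

lemma sum_self_increment:
  fixes b :: "nat \<Rightarrow> real"
  shows "(\<Sum>i<n. (b i - b 0) * (b (Suc i) - b i)) = 1 / 2 * ((b n - b 0)\<^sup>2 - (\<Sum>i<n. (b (Suc i) - b i)\<^sup>2))"
  by (induction n) (auto simp: power2_eq_square field_simps)

text \<open>By \<open>sum_self_increment\<close> the Riemann sums are half of a squared increment
  minus a sum of squares; the latter tends to the elapsed inner time by
  \<open>quadratic_variation\<close>.\<close>

lemma integral_of_increment:
  assumes si: "stochastic_integral M \<H> T W K I" and a: "0 \<le> a"
    and \<zeta>: "\<zeta> \<in> borel_measurable (\<F> a)"
    and K: "AE z in M. \<forall>t\<in>{0<..T}. K t z = (if a < E t z then \<zeta> z * (B (E t z) z - B a z) else 0)"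
  shows "AE z in M. \<forall>t\<in>{0..T}. a \<le> E t z \<longrightarrow> I t z = 1 / 2 * \<zeta> z * ((B (E t z) z - B a z)\<^sup>2 - (E t z - a))"
proof -
  have \<Gamma>m: "(\<lambda>z. \<zeta> z * (B u z - B a z)) \<in> borel_measurable (\<F> u)" if u: "a \<le> u" for u
  proof -
    have [measurable]: "\<zeta> \<in> borel_measurable (\<F> u)" "B a \<in> borel_measurable (\<F> u)" "B u \<in> borel_measurable (\<F> u)"
      using measurable_F_mono[OF u \<zeta>] measurable_F_mono[OF u B_adapted[OF a]] B_adapted[of u] a u by auto
    show ?thesis by measurable
  qed
  have \<Gamma>c: "AE z in M. continuous_on {a..max a (E T z)} (\<lambda>u. \<zeta> z * (B u z - B a z))"
    using AE_Omega1
  proof eventually_elim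
    case (elim z)
    show ?case by (intro continuous_intros continuous_on_subset[OF B_path[OF elim]]) (use a in auto)
  qed
  have "\<exists>\<rho>::nat \<Rightarrow> nat. strict_mono \<rho> \<and> (AE z in M. uniform_limit {0..T}
    (\<lambda>r t. \<Sum>i<4 ^ \<rho> r. \<zeta> z * (B (a + real i * (1/2) ^ \<rho> r) z - B a z) * (B (min (E t z) (a + real (Suc i) * (1/2) ^ \<rho> r)) z
        - B (min (E t z) (a + real i * (1/2) ^ \<rho> r)) z)) (\<lambda>t. I t z) sequentially)"
    by (rule inner_grid_limit[OF si a, where \<Gamma>="\<lambda>u z. \<zeta> z * (B u z - B a z)", OF \<Gamma>m \<Gamma>c K _ dyadic_tendsto dyadic_time]) auto
  then obtain \<rho> :: "nat \<Rightarrow> nat" where \<rho>: "strict_mono \<rho>" and lim: "AE z in M. uniform_limit {0..T}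
    (\<lambda>r t. \<Sum>i<4 ^ \<rho> r. \<zeta> z * (B (a + real i * (1/2) ^ \<rho> r) z - B a z) * (B (min (E t z) (a + real (Suc i) * (1/2) ^ \<rho> r)) z
        - B (min (E t z) (a + real i * (1/2) ^ \<rho> r)) z)) (\<lambda>t. I t z) sequentially" by blast
  have big: "filterlim (\<lambda>r. real ((4::nat) ^ \<rho> r) * (1/2::real) ^ \<rho> r) at_top sequentially"
    using filterlim_compose[OF dyadic_time filterlim_subseq[OF \<rho>]] by simp
  have small: "(\<lambda>r. (1/2::real) ^ \<rho> r) \<longlonglongrightarrow> 0"
    using LIMSEQ_subseq_LIMSEQ[OF dyadic_tendsto \<rho>] by (simp add: comp_def)
  show ?thesis using lim AE_Omega1 quadratic_variation[OF a]
  proof eventually_elim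
    case (elim z)
    note z = elim(2)
    show ?case
    proof (intro ballI impI)
      fix t assume t: "t \<in> {0..T}" and at: "a \<le> E t z"
      define e where "e = E t z"
      have ae: "a \<le> e" using at by (simp add: e_def)
      obtain m :: nat where m: "e - a \<le> real m" using real_arch_simple by blast
      define Q where "Q r = running_max (\<lambda>l. \<Sum>i<l. (B (a + real (Suc i) * (1/2)^r) z - B (a + real i * (1/2)^r) z)\<^sup>2 - (1/2)^r) (m * 2^r)" for r
      have Q0: "(\<lambda>r. Q (\<rho> r)) \<longlonglongrightarrow> 0"
        using LIMSEQ_subseq_LIMSEQ[OF elim(3)[rule_format, of m] \<rho>] by (simp add: Q_def comp_def)
      let ?v = "\<lambda>r i. a + real i * (1/2) ^ r :: real"
      define S where "S r = (\<Sum>i<4 ^ r. (B (min e (?v r (Suc i))) z - B (min e (?v r i)) z)\<^sup>2)" for r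
      have sum_eq: "(\<Sum>i<4 ^ r. \<zeta> z * (B (?v r i) z - B a z) * (B (min e (?v r (Suc i))) z - B (min e (?v r i)) z))
          = \<zeta> z * (1 / 2 * ((B e z - B a z)\<^sup>2 - S r))" if le: "e \<le> real ((4::nat) ^ r) * (1/2) ^ r" for r
      proof -
        have "(\<Sum>i<4 ^ r. \<zeta> z * (B (?v r i) z - B a z) * (B (min e (?v r (Suc i))) z - B (min e (?v r i)) z))
            = (\<Sum>i<4 ^ r. \<zeta> z * ((B (min e (?v r i)) z - B (min e (?v r 0)) z) * (B (min e (?v r (Suc i))) z - B (min e (?v r i)) z)))"
        proof (intro sum.cong refl)
          fix i
          have a0: "min e (?v r 0) = a" using ae by simp
          show "\<zeta> z * (B (?v r i) z - B a z) * (B (min e (?v r (Suc i))) z - B (min e (?v r i)) z)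
            = \<zeta> z * ((B (min e (?v r i)) z - B (min e (?v r 0)) z) * (B (min e (?v r (Suc i))) z - B (min e (?v r i)) z))"
          proof (cases "?v r i \<le> e")
            case True
            then show ?thesis unfolding a0 by (simp add: min_absorb2)
          next
            \<comment> \<open>Past e the stopped increment is zero, so the first factor may be
              stopped at e as well.\<close>
            case False
            have "?v r i \<le> ?v r (Suc i)" by (intro add_left_mono mult_right_mono) auto
            then have "e \<le> ?v r (Suc i)" "e \<le> ?v r i" using False by linarith+
            then have "min e (?v r (Suc i)) = e" "min e (?v r i) = e" by (simp_all only: min_absorb1)
            then show ?thesis by simp
          qed
        qed
        also have "\<dots> = \<zeta> z * (1 / 2 * ((B (min e (?v r (4 ^ r))) z - B (min e (?v r 0)) z)\<^sup>2 - S r))"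
          unfolding sum_distrib_left[symmetric] S_def
          by (subst sum_self_increment[of "\<lambda>i. B (min e (?v r i)) z"]) simp
        also have "min e (?v r (4 ^ r)) = e" using le a by simp
        also have "min e (?v r 0) = a" using ae by simp
        finally show ?thesis .
      qed
      have S_lim: "(\<lambda>r. S (\<rho> r)) \<longlonglongrightarrow> e - a"
      proof (rule LIMSEQ_I)
        fix \<eta> :: real assume \<eta>: "0 < \<eta>"
        have "uniformly_continuous_on {0..e} (\<lambda>u. B u z)"
          by (intro compact_uniformly_continuous continuous_on_subset[OF B_path[OF z]]) auto
        moreover have "sqrt (\<eta> / 3) > 0" using \<eta> by simp
        ultimately obtain d where d: "d > 0" "\<And>x y. x \<in> {0..e} \<Longrightarrow> y \<in> {0..e} \<Longrightarrow> dist y x < d \<Longrightarrow> dist (B y z) (B x z) < sqrt (\<eta> / 3)"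
          unfolding uniformly_continuous_on_def by meson
        have "eventually (\<lambda>r. (1/2::real) ^ \<rho> r < min d (\<eta> / 3)) sequentially"
          using order_tendstoD(2)[OF small, of "min d (\<eta> / 3)"] d(1) \<eta> by simp
        moreover have "eventually (\<lambda>r. Q (\<rho> r) < \<eta> / 3) sequentially"
          using order_tendstoD(2)[OF Q0, of "\<eta> / 3"] \<eta> by simp
        \<comment> \<open>e + 1 instead of e: the index l below then lies strictly before the end of
          the grid.\<close>
        moreover have "eventually (\<lambda>r. e + 1 \<le> real ((4::nat) ^ \<rho> r) * (1/2::real) ^ \<rho> r) sequentially"
          using big unfolding filterlim_at_top by blast
        ultimately have "eventually (\<lambda>r. norm (S (\<rho> r) - (e - a)) < \<eta>) sequentially"
        proof eventually_elim
          case (elim r)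
          define k where "k = \<rho> r"
          define h :: real where "h = (1/2) ^ k"
          have h0: "0 < h" by (simp add: h_def)
          define l where "l = nat \<lfloor>(e - a) / h\<rfloor>"
          have "0 \<le> (e - a) / h" using ae h0 by simp
          then have rl: "real l = of_int \<lfloor>(e - a) / h\<rfloor>" by (simp add: l_def)
          have "real l \<le> (e - a) / h" "(e - a) / h < real l + 1" unfolding rl by linarith+
          then have l1: "real l * h \<le> e - a" and l2: "e - a < (real l + 1) * h"
            using h0 by (simp_all add: pos_le_divide_eq pos_divide_less_eq)
          have l2': "e - a < real l * h + h" using l2 by (simp add: algebra_simps)
          have lm: "l \<le> m * 2 ^ k"
          proof -
            have "real m = real (m * 2 ^ k) * h" by (simp add: h_def power_divide)
            then have "real l * h \<le> real (m * 2 ^ k) * h" using l1 m by linarith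
            then show ?thesis using h0 by (simp del: of_nat_mult of_nat_power)
          qed
          have ln: "l < 4 ^ k"
          proof (rule ccontr)
            assume "\<not> l < 4 ^ k"
            then have "real ((4::nat) ^ k) * h \<le> real l * h" using h0 by (intro mult_right_mono of_nat_mono) auto
            then show False using elim(3) l1 a unfolding h_def k_def by linarith
          qed
          have vh: "?v k i = a + real i * h" for i by (simp add: h_def)
          \<comment> \<open>l full steps and one incomplete step before e: \<open>Q\<close> governs
            the former, continuity of B the latter.\<close>
          have S_eq: "S k = (\<Sum>i<l. (B (?v k (Suc i)) z - B (?v k i) z)\<^sup>2) + (B e z - B (?v k l) z)\<^sup>2"
          proof -
            have mono: "real i * h \<le> real j * h" if "i \<le> j" for i j using that h0 by (intro mult_right_mono) auto
            have vl: "min e (?v k i) = ?v k i" if "i \<le> l" for i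
              using mono[OF that] l1 unfolding vh by (intro min_absorb2) linarith
            have vg: "min e (?v k i) = e" if "l < i" for i
            proof -
              have "real (Suc l) * h = real l * h + h" by (simp add: algebra_simps)
              then have "e \<le> a + real i * h" using mono[of "Suc l" i] that l2' by linarith
              then show ?thesis unfolding vh by (rule min_absorb1)
            qed
            have "S k = (\<Sum>i<Suc l. (B (min e (?v k (Suc i))) z - B (min e (?v k i)) z)\<^sup>2)"
              unfolding S_def
            proof (rule sum.mono_neutral_right)
              show "\<forall>i\<in>{..<4 ^ k} - {..<Suc l}. (B (min e (?v k (Suc i))) z - B (min e (?v k i)) z)\<^sup>2 = 0"
              proof
                fix i assume "i \<in> {..<4 ^ k} - {..<Suc l}"
                then have "l < i" "l < Suc i" by auto
                then show "(B (min e (?v k (Suc i))) z - B (min e (?v k i)) z)\<^sup>2 = 0"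
                  unfolding vg[OF \<open>l < i\<close>] vg[OF \<open>l < Suc i\<close>] by simp
              qed
            qed (use ln in auto)
            also have "\<dots> = (\<Sum>i<l. (B (min e (?v k (Suc i))) z - B (min e (?v k i)) z)\<^sup>2)
                + (B (min e (?v k (Suc l))) z - B (min e (?v k l)) z)\<^sup>2" by (rule sum.lessThan_Suc)
            also have "(\<Sum>i<l. (B (min e (?v k (Suc i))) z - B (min e (?v k i)) z)\<^sup>2) = (\<Sum>i<l. (B (?v k (Suc i)) z - B (?v k i) z)\<^sup>2)"
            proof (intro sum.cong refl)
              fix i assume "i \<in> {..<l}"
              then have "i \<le> l" "Suc i \<le> l" by auto
              then show "(B (min e (?v k (Suc i))) z - B (min e (?v k i)) z)\<^sup>2 = (B (?v k (Suc i)) z - B (?v k i) z)\<^sup>2"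
                unfolding vl[OF \<open>i \<le> l\<close>] vl[OF \<open>Suc i \<le> l\<close>] by simp
            qed
            finally show ?thesis unfolding vl[OF order_refl] vg[OF lessI] .
          qed
          have b1: "\<bar>(\<Sum>i<l. (B (?v k (Suc i)) z - B (?v k i) z)\<^sup>2) - real l * h\<bar> < \<eta> / 3"
          proof -
            have "(\<Sum>i<l. (B (?v k (Suc i)) z - B (?v k i) z)\<^sup>2 - h) = (\<Sum>i<l. (B (?v k (Suc i)) z - B (?v k i) z)\<^sup>2) - real l * h"
              by (simp only: sum_subtractf sum_constant card_lessThan)
            moreover have "\<bar>\<Sum>i<l. (B (?v k (Suc i)) z - B (?v k i) z)\<^sup>2 - h\<bar> \<le> Q k"
              unfolding Q_def h_def using running_max_ge[OF lm, of "\<lambda>l. \<Sum>i<l. (B (?v k (Suc i)) z - B (?v k i) z)\<^sup>2 - (1/2)^k"] .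
            ultimately show ?thesis using elim(2) unfolding k_def by linarith
          qed
          have b2: "(B e z - B (?v k l) z)\<^sup>2 < \<eta> / 3"
          proof -
            have "dist (B e z) (B (?v k l) z) < sqrt (\<eta> / 3)"
            proof (rule d(2))
              have "0 \<le> real l * h" using h0 by simp
              then show "?v k l \<in> {0..e}" unfolding vh using a l1 by simp
              show "e \<in> {0..e}" using a ae by simp
              show "dist e (?v k l) < d" unfolding vh dist_real_def using l1 l2' elim(1) unfolding h_def k_def by linarith
            qed
            then have "\<bar>B e z - B (?v k l) z\<bar>\<^sup>2 < (sqrt (\<eta> / 3))\<^sup>2" unfolding dist_real_def by (intro power_strict_mono) auto
            then show ?thesis using \<eta> by simp
          qed
          have b3: "\<bar>real l * h - (e - a)\<bar> < \<eta> / 3" using l1 l2' elim(1) unfolding h_def k_def by linarith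
          have "0 \<le> (B e z - B (?v k l) z)\<^sup>2" by simp
          then show ?case unfolding k_def[symmetric] S_eq real_norm_def using b1 b2 b3 by linarith
        qed
        then show "\<exists>no. \<forall>n\<ge>no. norm (S (\<rho> n) - (e - a)) < \<eta>" unfolding eventually_sequentially .
      qed
      let ?s = "\<lambda>r. \<Sum>i<4 ^ \<rho> r. \<zeta> z * (B (?v (\<rho> r) i) z - B a z) * (B (min e (?v (\<rho> r) (Suc i))) z - B (min e (?v (\<rho> r) i)) z)"
      have "(\<lambda>r. \<zeta> z * (1 / 2 * ((B e z - B a z)\<^sup>2 - S (\<rho> r)))) \<longlonglongrightarrow> \<zeta> z * (1 / 2 * ((B e z - B a z)\<^sup>2 - (e - a)))"
        by (intro tendsto_intros S_lim)
      moreover have "eventually (\<lambda>r. ?s r = \<zeta> z * (1 / 2 * ((B e z - B a z)\<^sup>2 - S (\<rho> r)))) sequentially"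
      proof -
        have "eventually (\<lambda>r. e \<le> real ((4::nat) ^ \<rho> r) * (1/2::real) ^ \<rho> r) sequentially"
          using big unfolding filterlim_at_top by blast
        then show ?thesis by eventually_elim (rule sum_eq)
      qed
      ultimately have "?s \<longlonglongrightarrow> \<zeta> z * (1 / 2 * ((B e z - B a z)\<^sup>2 - (e - a)))"
        by (subst tendsto_cong)
      moreover have "?s \<longlonglongrightarrow> I t z" unfolding e_def using tendsto_uniform_limitI[OF elim(1) t] .
      ultimately have "I t z = \<zeta> z * (1 / 2 * ((B e z - B a z)\<^sup>2 - (e - a)))" by (rule LIMSEQ_unique[symmetric])
      then show "I t z = 1 / 2 * \<zeta> z * ((B (E t z) z - B a z)\<^sup>2 - (E t z - a))"
        by (simp add: e_def)
    qed
  qed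
qed

text \<open>The continuous interpolation with the iterated integrals evaluated in closed form.\<close>

definition milstein_step :: "(real \<Rightarrow> real \<Rightarrow> real) \<Rightarrow> (real \<Rightarrow> real \<Rightarrow> real) \<Rightarrow> real \<Rightarrow> real \<Rightarrow> nat \<Rightarrow> real \<Rightarrow> 'a \<Rightarrow> real" where
  "milstein_step F G x0 \<delta> n u z =
     (let y = milstein_grid B x0 F G \<delta> n z; t = real n * \<delta>
      in y + F t y * (u - t) + G t y * (B u z - B t z) + 1 / 2 * G_Gx G t y * ((B u z - B t z)\<^sup>2 - (u - t)))"

lemma milstein_step_0: "milstein_step F G x0 \<delta> n (real n * \<delta>) z = milstein_grid B x0 F G \<delta> n z"
  by (simp add: milstein_step_def Let_def)

lemma milstein_step_Suc: "milstein_step F G x0 \<delta> n (real (Suc n) * \<delta>) z = milstein_grid B x0 F G \<delta> (Suc n) z"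
proof -
  have "real (Suc n) * \<delta> - real n * \<delta> = \<delta>" by (simp add: algebra_simps)
  then show ?thesis by (simp add: milstein_step_def Let_def del: of_nat_Suc)
qed

lemma milstein_grid_measurable:
  assumes jc: "jointly_continuous F" "jointly_continuous G" "jointly_continuous (G_Gx G)" and \<delta>: "\<delta> > 0"
  shows "milstein_grid B x0 F G \<delta> n \<in> borel_measurable (\<F> (real n * \<delta>))"
proof (induction n)
  case 0
  have "milstein_grid B x0 F G \<delta> 0 = (\<lambda>_. x0)" by (simp add: fun_eq_iff)
  then show ?case by simp
next
  case (Suc n)
  let ?s = "real n * \<delta>" and ?t = "real (Suc n) * \<delta>"
  have st: "0 \<le> ?s" "?s \<le> ?t" "0 \<le> ?t" using \<delta> by (auto intro!: mult_right_mono)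
  have [measurable]: "milstein_grid B x0 F G \<delta> n \<in> borel_measurable (\<F> ?t)" "B ?s \<in> borel_measurable (\<F> ?t)" "B ?t \<in> borel_measurable (\<F> ?t)"
    using measurable_F_mono[OF st(2) Suc] measurable_F_mono[OF st(2) B_adapted[OF st(1)]] B_adapted[OF st(3)] by auto
  have [measurable]: "F ?s \<in> borel_measurable borel" "G ?s \<in> borel_measurable borel" "G_Gx G ?s \<in> borel_measurable borel"
    using jointly_continuous_slice[OF _ st(1)] jc by auto
  have eq: "milstein_grid B x0 F G \<delta> (Suc n) = (\<lambda>z. milstein_grid B x0 F G \<delta> n z + F ?s (milstein_grid B x0 F G \<delta> n z) * \<delta>
      + G ?s (milstein_grid B x0 F G \<delta> n z) * (B ?t z - B ?s z) + 1 / 2 * G_Gx G ?s (milstein_grid B x0 F G \<delta> n z) * ((B ?t z - B ?s z)\<^sup>2 - \<delta>))"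
    by (simp add: fun_eq_iff Let_def)
  show ?case unfolding eq by measurable
qed

definition milstein_path :: "(real \<Rightarrow> real \<Rightarrow> real) \<Rightarrow> (real \<Rightarrow> real \<Rightarrow> real) \<Rightarrow> real \<Rightarrow> real \<Rightarrow> real \<Rightarrow> 'a \<Rightarrow> real" where
  "milstein_path F G x0 \<delta> u z = milstein_step F G x0 \<delta> (nat \<lfloor>u / \<delta>\<rfloor>) u z"

text \<open>The interval may be closed on the right, because neighbouring steps agree at their
  common grid point by \<open>milstein_step_0\<close> and \<open>milstein_step_Suc\<close>.\<close>

lemma milstein_path_eq:
  assumes \<delta>: "\<delta> > 0" and u: "real n * \<delta> \<le> u" "u \<le> real (Suc n) * \<delta>"
  shows "milstein_path F G x0 \<delta> u z = milstein_step F G x0 \<delta> n u z"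
proof (cases "u = real (Suc n) * \<delta>")
  case True
  then have "nat \<lfloor>u / \<delta>\<rfloor> = Suc n" using \<delta> by (simp del: of_nat_Suc)
  then show ?thesis unfolding milstein_path_def True by (simp only: milstein_step_0 milstein_step_Suc)
next
  case False
  have "real n \<le> u / \<delta>" "u / \<delta> < real n + 1" using u False \<delta> by (auto simp: field_simps)
  then have "\<lfloor>u / \<delta>\<rfloor> = int n" by linarith
  then show ?thesis by (simp add: milstein_path_def)
qed

text \<open>The definition merely asserts that \<open>I\<close>, \<open>K\<close> and
  \<open>J\<close> exist; \<open>integral_frozen\<close> and \<open>integral_of_increment\<close>
  determine them almost surely, which makes the interpolation an explicit function of inner
  time.\<close>

lemma milstein_approximation_path:
  assumes jc: "jointly_continuous F" "jointly_continuous G" "jointly_continuous (G_Gx G)" and \<delta>: "\<delta> > 0"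
    and ma: "milstein_approximation M \<F> B D T x0 F G \<delta> X\<delta>"
  shows "AE z in M. \<forall>t\<in>{0..T}. X\<delta> t z = milstein_path F G x0 \<delta> (E t z) z"
proof -
  have "AE z in M. \<forall>s\<in>{0..T} \<inter> {D (real n * \<delta>) z..<D (real (Suc n) * \<delta>) z}. X\<delta> s z = milstein_step F G x0 \<delta> n (E s z) z" for n
  proof -
    let ?a = "real n * \<delta>" and ?y = "milstein_grid B x0 F G \<delta> n"
    have a: "0 \<le> ?a" using \<delta> by simp
    obtain I K J where si:
        "stochastic_integral M \<H> T W (\<lambda>r z. indicator {D ?a z<..} r * G (E (D ?a z) z) (?y z)) I"
        "stochastic_integral M \<H> T W (\<lambda>r z. indicator {D ?a z<..} r * G_Gx G (E (D ?a z) z) (?y z)) K"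
        "stochastic_integral M \<H> T W (\<lambda>r z. indicator {D ?a z<..} r * K r z) J"
      and eq: "AE z in M. \<forall>s\<in>{0..T} \<inter> {D ?a z..<D (real (Suc n) * \<delta>) z}.
           X\<delta> s z = ?y z + stieltjes_integral (\<lambda>r. E r z) (D ?a z) s (\<lambda>r. F (E (D ?a z) z) (?y z)) + I s z + J s z"
      using ma unfolding milstein_approximation_def Let_def by blast
    have ym: "?y \<in> borel_measurable (\<F> ?a)" by (rule milstein_grid_measurable[OF jc \<delta>])
    have Gm: "(\<lambda>z. G ?a (?y z)) \<in> borel_measurable (\<F> ?a)" "(\<lambda>z. G_Gx G ?a (?y z)) \<in> borel_measurable (\<F> ?a)"
      using measurable_compose[OF ym jointly_continuous_slice[OF jc(2) a]] measurable_compose[OF ym jointly_continuous_slice[OF jc(3) a]] by auto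
    \<comment> \<open>Outer times after the n-th grid time are those at which the clock has passed
      \<open>real n * \<delta>\<close>.\<close>
    have ind: "AE z in M. \<forall>t\<in>{0<..T}. indicator {D ?a z<..} t * \<Phi> (E (D ?a z) z) (?y z) = (if ?a < E t z then \<Phi> ?a (?y z) else 0)"
      for \<Phi> :: "real \<Rightarrow> real \<Rightarrow> real"
      using AE_Omega1
    proof eventually_elim
      case (elim z)
      show ?case using E_greater_iff[OF elim a] E_D[OF elim a] by (auto simp: indicator_def)
    qed
    have I: "AE z in M. \<forall>t\<in>{0..T}. I t z = G ?a (?y z) * (B (E t z) z - B (min (E t z) ?a) z)"
      by (rule integral_frozen[OF si(1) a Gm(1) ind])
    have K: "AE z in M. \<forall>t\<in>{0..T}. K t z = G_Gx G ?a (?y z) * (B (E t z) z - B (min (E t z) ?a) z)"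
      by (rule integral_frozen[OF si(2) a Gm(2) ind])
    have "AE z in M. \<forall>t\<in>{0<..T}. indicator {D ?a z<..} t * K t z = (if ?a < E t z then G_Gx G ?a (?y z) * (B (E t z) z - B ?a z) else 0)"
      using AE_Omega1 K
    proof eventually_elim
      case (elim z)
      show ?case
      proof
        fix t assume t: "t \<in> {0<..T}"
        then have "K t z = G_Gx G ?a (?y z) * (B (E t z) z - B (min (E t z) ?a) z)" using elim(2) by auto
        then show "indicator {D ?a z<..} t * K t z = (if ?a < E t z then G_Gx G ?a (?y z) * (B (E t z) z - B ?a z) else 0)"
          using E_greater_iff[OF elim(1) a, of t] by (auto simp: indicator_def min_absorb2)
      qed
    qed
    from integral_of_increment[OF si(3) a Gm(2) this]
    have J: "AE z in M. \<forall>t\<in>{0..T}. ?a \<le> E t z \<longrightarrow> J t z = 1 / 2 * G_Gx G ?a (?y z) * ((B (E t z) z - B ?a z)\<^sup>2 - (E t z - ?a))" .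
    show ?thesis using AE_Omega1 eq I J
    proof eventually_elim
      case (elim z)
      show ?case
      proof
        fix s assume s: "s \<in> {0..T} \<inter> {D ?a z..<D (real (Suc n) * \<delta>) z}"
        interpret ci: continuous_integrator "\<lambda>t. E t z"
          by unfold_locales (use E_mono[OF elim(1)] E_cont[OF elim(1)] in auto)
        have sa: "D ?a z \<le> s" "s \<in> {0..T}" using s by auto
        have Ea: "?a \<le> E s z" by (rule le_E[OF elim(1) a sa(1)])
        have st: "stieltjes_integral (\<lambda>r. E r z) (D ?a z) s (\<lambda>r. c) = c * (E s z - ?a)" for c
          using ci.measure_Ioc[OF sa(1)] E_D[OF elim(1) a] by (simp add: stieltjes_integral_def set_lebesgue_integral_def mult.commute)
        have X: "X\<delta> s z = ?y z + F ?a (?y z) * (E s z - ?a) + I s z + J s z"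
          using bspec[OF elim(2) s] unfolding E_D[OF elim(1) a] st .
        have Is: "I s z = G ?a (?y z) * (B (E s z) z - B ?a z)" using elim(3) sa(2) Ea by (simp add: min_absorb2)
        have Js: "J s z = 1 / 2 * G_Gx G ?a (?y z) * ((B (E s z) z - B ?a z)\<^sup>2 - (E s z - ?a))" using elim(4) sa(2) Ea by blast
        show "X\<delta> s z = milstein_step F G x0 \<delta> n (E s z) z"
          unfolding X Is Js milstein_step_def Let_def ..
      qed
    qed
  qed
  then have "AE z in M. \<forall>n. \<forall>s\<in>{0..T} \<inter> {D (real n * \<delta>) z..<D (real (Suc n) * \<delta>) z}. X\<delta> s z = milstein_step F G x0 \<delta> n (E s z) z"
    unfolding AE_all_countable by blast
  then show ?thesis using AE_Omega1
  proof eventually_elim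
    case (elim z)
    note z = elim(2)
    show ?case
    proof
      fix t assume t: "t \<in> {0..T}"
      define P where "P n \<longleftrightarrow> t < D (real (Suc n) * \<delta>) z" for n
      obtain u where u: "u > 0" "t < D u z" using subordinator_path.unbounded[OF D_path[OF z], of t] by blast
      obtain n0 :: nat where "u / \<delta> < real n0" using reals_Archimedean2 by blast
      then have "u \<le> real (Suc n0) * \<delta>" using \<delta> by (simp add: field_simps)
      then have "P n0" unfolding P_def using D_mono[OF z, of u "real (Suc n0) * \<delta>"] u by simp
      \<comment> \<open>The step that contains t: the first one whose right end lies after
        t.\<close>
      define n where "n = (LEAST n. P n)"
      have Pn: "P n" unfolding n_def using \<open>P n0\<close> by (rule LeastI)
      have lo: "D (real n * \<delta>) z \<le> t"
      proof (cases n)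
        case 0
        then show ?thesis using subordinator_path.zero[OF D_path[OF z]] t by simp
      next
        case (Suc k)
        then have "\<not> P k" unfolding n_def using not_less_Least[of k P] by simp
        then show ?thesis unfolding Suc P_def by simp
      qed
      have "X\<delta> t z = milstein_step F G x0 \<delta> n (E t z) z" using elim(1) t lo Pn unfolding P_def by auto
      moreover have "real n * \<delta> \<le> E t z" using lo \<delta> by (intro le_E[OF z]) auto
      moreover have "E t z \<le> real (Suc n) * \<delta>" using Pn \<delta> unfolding P_def by (intro E_le[OF z]) auto
      ultimately show "X\<delta> t z = milstein_path F G x0 \<delta> (E t z) z" using milstein_path_eq[OF \<delta>] by simp
    qed
  qed
qed

end

section \<open>The error on a bounded range of inner times\<close>

context sde_paths
begin

abbreviation "sq_err \<delta> u z \<equiv> ennreal ((Y u z - milstein_path F G x0 \<delta> u z)\<^sup>2)"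

lemma milstein_path_measurable:
  assumes G: "jointly_continuous (G_Gx G)" and \<delta>: "\<delta> > 0" and u: "0 \<le> u"
  shows "milstein_path F G x0 \<delta> u \<in> borel_measurable (\<F> u)"
proof -
  define n where "n = nat \<lfloor>u / \<delta>\<rfloor>"
  let ?t = "real n * \<delta>"
  have "0 \<le> u / \<delta>" using \<delta> u by simp
  then have "real n \<le> u / \<delta>" unfolding n_def by linarith
  then have t: "0 \<le> ?t" "?t \<le> u" using \<delta> by (auto simp: pos_le_divide_eq)
  have [measurable]: "milstein_grid B x0 F G \<delta> n \<in> borel_measurable (\<F> u)" "B ?t \<in> borel_measurable (\<F> u)" "B u \<in> borel_measurable (\<F> u)"
    using measurable_F_mono[OF t(2) milstein_grid_measurable[OF coeff G \<delta>]] measurable_F_mono[OF t(2) B_adapted[OF t(1)]] B_adapted[OF u] by auto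
  have [measurable]: "F ?t \<in> borel_measurable borel" "G ?t \<in> borel_measurable borel" "G_Gx G ?t \<in> borel_measurable borel"
    using jointly_continuous_slice[OF _ t(1)] coeff G by auto
  have "milstein_path F G x0 \<delta> u = (\<lambda>z. milstein_grid B x0 F G \<delta> n z + F ?t (milstein_grid B x0 F G \<delta> n z) * (u - ?t)
      + G ?t (milstein_grid B x0 F G \<delta> n z) * (B u z - B ?t z)
      + 1 / 2 * G_Gx G ?t (milstein_grid B x0 F G \<delta> n z) * ((B u z - B ?t z)\<^sup>2 - (u - ?t)))"
    unfolding milstein_path_def milstein_step_def n_def Let_def by (rule refl)
  then show ?thesis by simp
qed

text \<open>Fine grid points approach u from the left, so a single step of the scheme is involved in
  the limit.\<close>

lemma milstein_path_left_limit:
  fixes z :: 'a and v :: "nat \<Rightarrow> real"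
  assumes z: "z \<in> \<Omega>1" and \<delta>: "\<delta> > 0" and u: "0 \<le> u"
    and v: "v \<longlonglongrightarrow> u" "\<And>r. 0 \<le> v r" "\<And>r. v r \<le> u"
  shows "(\<lambda>r. milstein_path F G x0 \<delta> (v r) z) \<longlonglongrightarrow> milstein_path F G x0 \<delta> u z"
proof (cases "u = 0")
  case True
  then have "v = (\<lambda>_. 0)" using v(2,3) by (auto simp: fun_eq_iff intro: antisym)
  then show ?thesis using True by simp
next
  case False
  \<comment> \<open>u lies in the half-open interval from n \<delta>, excluded, to (n + 1) \<delta>;
    points slightly to its left belong to the same step.\<close>
  define n where "n = nat (\<lceil>u / \<delta>\<rceil> - 1)"
  have "0 < u / \<delta>" using \<delta> u False by simp
  then have "real n < u / \<delta>" "u / \<delta> \<le> real n + 1" unfolding n_def by linarith+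
  then have n: "real n * \<delta> < u" "u \<le> (real n + 1) * \<delta>" using \<delta> by (auto simp: pos_less_divide_eq pos_divide_le_eq)
  then have n2: "u \<le> real (Suc n) * \<delta>" by (simp add: add.commute)
  have "eventually (\<lambda>r. real n * \<delta> < v r) sequentially" using order_tendstoD(1)[OF v(1) n(1)] .
  then have ev: "eventually (\<lambda>r. milstein_step F G x0 \<delta> n (v r) z = milstein_path F G x0 \<delta> (v r) z) sequentially"
  proof eventually_elim
    case (elim r)
    show ?case using milstein_path_eq[OF \<delta> less_imp_le[OF elim]] order_trans[OF v(3) n2] by simp
  qed
  have Bl: "(\<lambda>r. B (v r) z) \<longlonglongrightarrow> B u z"
    by (rule continuous_on_tendsto_compose[OF B_path[OF z] v(1)]) (use u v(2) in auto)
  have "(\<lambda>r. milstein_step F G x0 \<delta> n (v r) z) \<longlonglongrightarrow> milstein_step F G x0 \<delta> n u z"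
    unfolding milstein_step_def Let_def by (intro tendsto_intros Bl v(1))
  then show ?thesis using milstein_path_eq[OF \<delta> less_imp_le[OF n(1)] n2] Lim_transform_eventually[OF _ ev] by simp
qed

text \<open>Within a coarse step the scheme is a quadratic polynomial in the accumulated noise W,
  and (W + w)^2 - W^2 = 2 W w + w^2 gives its update by one fine increment.\<close>

lemma milstein_path_step:
  fixes z :: 'a
  assumes \<delta>: "\<delta> > 0" and L: "L > 0"
  defines "\<epsilon> \<equiv> \<delta> / real L" and "w \<equiv> \<lambda>j. B (0 + real (Suc j) * (\<delta> / real L)) z - B (0 + real j * (\<delta> / real L)) z" and "Z \<equiv> \<lambda>j. milstein_path F G x0 \<delta> (real j * (\<delta> / real L)) z"
  shows "Z (Suc j) = Z j + (F (real (block L j) * \<epsilon>) (Z (block L j)) * \<epsilon> + G (real (block L j) * \<epsilon>) (Z (block L j)) * w j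
        + G_Gx G (real (block L j) * \<epsilon>) (Z (block L j)) * ((\<Sum>i\<in>{block L j..<j}. w i) * w j + 1 / 2 * ((w j)\<^sup>2 - \<epsilon>)))"
proof -
  define n where "n = j div L"
  have \<epsilon>: "\<epsilon> > 0" and L\<epsilon>: "real L * \<epsilon> = \<delta>" using \<delta> L by (simp_all add: \<epsilon>_def)
  have bl: "block L j = n * L" by (simp add: block_def n_def)
  have bn: "real (block L j) * \<epsilon> = real n * \<delta>" unfolding bl using L\<epsilon> by (simp add: mult.assoc)
  have le: "n * L \<le> j" "Suc j \<le> Suc n * L" unfolding n_def using L by (auto simp: div_times_less_eq_dividend dividend_less_div_times Suc_leI add.commute)
  have mono: "real a * \<epsilon> \<le> real b * \<epsilon>" if "a \<le> b" for a b using that \<epsilon> by (intro mult_right_mono) auto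
  have b: "real n * \<delta> \<le> real j * \<epsilon>" "real j * \<epsilon> \<le> real (Suc j) * \<epsilon>" "real (Suc j) * \<epsilon> \<le> real (Suc n) * \<delta>"
    using mono[OF le(1)] mono[OF le(2)] mono[of j "Suc j"] L\<epsilon>
    by (simp_all only: of_nat_mult mult.assoc le_Suc_eq simp_thms order_refl)
  have Zj: "Z j = milstein_step F G x0 \<delta> n (real j * \<epsilon>) z" and ZS: "Z (Suc j) = milstein_step F G x0 \<delta> n (real (Suc j) * \<epsilon>) z"
    unfolding Z_def \<epsilon>_def[symmetric] using b by (auto intro!: milstein_path_eq[OF \<delta>] simp del: of_nat_Suc)
  have "Z (block L j) = milstein_step F G x0 \<delta> n (real n * \<delta>) z"
    unfolding Z_def \<epsilon>_def[symmetric] bn using \<delta> by (intro milstein_path_eq[OF \<delta>]) (auto intro!: mult_right_mono)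
  then have Zb: "Z (block L j) = milstein_grid B x0 F G \<delta> n z" by (simp only: milstein_step_0)
  have "(\<Sum>i\<in>{block L j..<j}. w i) = B (real j * \<epsilon>) z - B (real (block L j) * \<epsilon>) z"
    unfolding w_def \<epsilon>_def[symmetric] using sum_Suc_diff'[of "block L j" j "\<lambda>i. B (real i * \<epsilon>) z"] le(1) bl by (simp del: of_nat_Suc)
  then have sw: "(\<Sum>i\<in>{block L j..<j}. w i) = B (real j * \<epsilon>) z - B (real n * \<delta>) z" unfolding bn .
  have wj: "B (real (Suc j) * \<epsilon>) z = B (real j * \<epsilon>) z + w j" unfolding w_def \<epsilon>_def[symmetric] by simp
  have ej: "real (Suc j) * \<epsilon> = real j * \<epsilon> + \<epsilon>" by (simp add: algebra_simps)
  show ?thesis unfolding sw bn Zb Zj ZS milstein_step_def Let_def wj unfolding ej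
    by (simp add: field_simps power2_eq_square)
qed

text \<open>Whether \<open>E T\<close> exceeds the grid time is decided at that inner time, since
  \<open>E T\<close> is a stopping time; beyond it \<open>Y\<close> no longer follows the equation.
  \<open>R\<close> provides the compact set for the Taylor expansion, and \<kappa> makes up for the
  missing rate in \<open>sde_grid\<close>.\<close>

definition good :: "real \<Rightarrow> real \<Rightarrow> real \<Rightarrow> nat \<Rightarrow> 'a \<Rightarrow> bool" where
  "good \<epsilon> R \<kappa> j z \<longleftrightarrow> real j * \<epsilon> < E T z \<and> (\<forall>i\<le>j. \<bar>Y (real i * \<epsilon>) z\<bar> \<le> R \<and> \<bar>Y (real i * \<epsilon>) z - U \<epsilon> i z\<bar> \<le> \<kappa>)"

text \<open>\<open>U\<close> stopped when \<open>good\<close> fails. The leading \<open>0 +\<close>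
  matches \<open>gaussian_grid\<close> with a = 0.\<close>

definition V :: "real \<Rightarrow> real \<Rightarrow> real \<Rightarrow> nat \<Rightarrow> 'a \<Rightarrow> real" where
  "V \<epsilon> R \<kappa> j z = x0 + (\<Sum>i<j. if good \<epsilon> R \<kappa> i z then F (real i * \<epsilon>) (Y (real i * \<epsilon>) z) * \<epsilon>
      + G (real i * \<epsilon>) (Y (real i * \<epsilon>) z) * (B (0 + real (Suc i) * \<epsilon>) z - B (0 + real i * \<epsilon>) z) else 0)"

lemma good_mono: "\<epsilon> > 0 \<Longrightarrow> good \<epsilon> R \<kappa> j z \<Longrightarrow> i \<le> j \<Longrightarrow> good \<epsilon> R \<kappa> i z"
proof -
  assume \<epsilon>: "\<epsilon> > 0" and g: "good \<epsilon> R \<kappa> j z" and ij: "i \<le> j"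
  have "real i * \<epsilon> \<le> real j * \<epsilon>" using ij \<epsilon> by (intro mult_right_mono) auto
  then show "good \<epsilon> R \<kappa> i z" using g ij unfolding good_def by auto
qed

lemma V_eq_U: "(\<And>i. i < j \<Longrightarrow> good \<epsilon> R \<kappa> i z) \<Longrightarrow> V \<epsilon> R \<kappa> j z = U \<epsilon> j z"
  unfolding V_def U_def by (intro arg_cong2[where f="(+)"] refl sum.cong) (auto simp del: of_nat_Suc)

lemma coupling:
  fixes \<delta> R \<kappa> :: real and L :: nat
  assumes G: "jointly_continuous (G_Gx G)" and \<delta>: "\<delta> > 0" and L: "L > 0"
  defines "\<epsilon> \<equiv> \<delta> / real L"
  shows "milstein_coupling M (\<lambda>j. \<F> (0 + real j * \<epsilon>)) (\<lambda>j z. B (0 + real (Suc j) * \<epsilon>) z - B (0 + real j * \<epsilon>) z) \<epsilon> L F G x0 R \<kappa>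
    (good \<epsilon> R \<kappa>) (V \<epsilon> R \<kappa>) (\<lambda>j. Y (real j * \<epsilon>)) (\<lambda>j. milstein_path F G x0 \<delta> (real j * \<epsilon>))"
proof -
  have \<epsilon>: "\<epsilon> > 0" using \<delta> L by (simp add: \<epsilon>_def)
  have j0: "0 \<le> real j * \<epsilon>" for j using \<epsilon> by simp
  have mono: "real i * \<epsilon> \<le> real j * \<epsilon>" if "i \<le> j" for i j using that \<epsilon> by (intro mult_right_mono) auto
  have Ym: "Y (real i * \<epsilon>) \<in> borel_measurable (\<F> (real j * \<epsilon>))" if "i \<le> j" for i j
    by (rule measurable_F_mono[OF mono[OF that] Y_measurable[OF j0]])
  have Bm: "B (real i * \<epsilon>) \<in> borel_measurable (\<F> (real j * \<epsilon>))" if "i \<le> j" for i j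
    by (rule measurable_F_mono[OF mono[OF that] B_adapted[OF j0]])
  have inc: "(\<lambda>z. F (real i * \<epsilon>) (Y (real i * \<epsilon>) z) * \<epsilon> + G (real i * \<epsilon>) (Y (real i * \<epsilon>) z)
      * (B (real (Suc i) * \<epsilon>) z - B (real i * \<epsilon>) z)) \<in> borel_measurable (\<F> (real j * \<epsilon>))" if "i < j" for i j
  proof -
    have [measurable]: "Y (real i * \<epsilon>) \<in> borel_measurable (\<F> (real j * \<epsilon>))" "B (real i * \<epsilon>) \<in> borel_measurable (\<F> (real j * \<epsilon>))"
        "B (real (Suc i) * \<epsilon>) \<in> borel_measurable (\<F> (real j * \<epsilon>))"
      using Ym[of i j] Bm[of i j] Bm[of "Suc i" j] that by auto
    have [measurable]: "F (real i * \<epsilon>) \<in> borel_measurable borel" "G (real i * \<epsilon>) \<in> borel_measurable borel"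
      using jointly_continuous_slice[OF _ j0] coeff by auto
    show ?thesis by measurable
  qed
  have Um: "U \<epsilon> i \<in> borel_measurable (\<F> (real j * \<epsilon>))" if "i \<le> j" for i j
    unfolding U_def[abs_def] by (intro borel_measurable_add borel_measurable_const borel_measurable_sum inc) (use that in auto)
  have gm: "Measurable.pred (\<F> (real j * \<epsilon>)) (good \<epsilon> R \<kappa> i)" if "i \<le> j" for i j
  proof -
    have [measurable]: "Measurable.pred (\<F> (real j * \<epsilon>)) (\<lambda>z. E T z \<le> real i * \<epsilon>)"
      by (rule measurable_F_mono[OF mono[OF that] E_le_pred])
    have [measurable]: "Measurable.pred (\<F> (real j * \<epsilon>)) (\<lambda>z. \<bar>Y (real l * \<epsilon>) z\<bar> \<le> R \<and> \<bar>Y (real l * \<epsilon>) z - U \<epsilon> l z\<bar> \<le> \<kappa>)" if "l \<in> {..i}" for l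
    proof -
      have [measurable]: "Y (real l * \<epsilon>) \<in> borel_measurable (\<F> (real j * \<epsilon>))" "U \<epsilon> l \<in> borel_measurable (\<F> (real j * \<epsilon>))"
        using Ym[of l j] Um[of l j] that \<open>i \<le> j\<close> by auto
      show ?thesis by measurable
    qed
    have "Measurable.pred (\<F> (real j * \<epsilon>)) (\<lambda>z. \<forall>l\<in>{..i}. \<bar>Y (real l * \<epsilon>) z\<bar> \<le> R \<and> \<bar>Y (real l * \<epsilon>) z - U \<epsilon> l z\<bar> \<le> \<kappa>)"
      by (intro pred_intros_finite) auto
    then have [measurable]: "Measurable.pred (\<F> (real j * \<epsilon>)) (\<lambda>z. \<forall>l\<le>i. \<bar>Y (real l * \<epsilon>) z\<bar> \<le> R \<and> \<bar>Y (real l * \<epsilon>) z - U \<epsilon> l z\<bar> \<le> \<kappa>)"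
      by (simp add: Ball_def)
    have "good \<epsilon> R \<kappa> i = (\<lambda>z. \<not> E T z \<le> real i * \<epsilon> \<and> (\<forall>l\<le>i. \<bar>Y (real l * \<epsilon>) z\<bar> \<le> R \<and> \<bar>Y (real l * \<epsilon>) z - U \<epsilon> l z\<bar> \<le> \<kappa>))"
      by (auto simp: good_def fun_eq_iff)
    then show ?thesis by simp
  qed
  have Vm: "V \<epsilon> R \<kappa> j \<in> borel_measurable (\<F> (real j * \<epsilon>))" for j
  proof -
    have "(\<lambda>z. if good \<epsilon> R \<kappa> i z then F (real i * \<epsilon>) (Y (real i * \<epsilon>) z) * \<epsilon> + G (real i * \<epsilon>) (Y (real i * \<epsilon>) z)
      * (B (real (Suc i) * \<epsilon>) z - B (real i * \<epsilon>) z) else 0) \<in> borel_measurable (\<F> (real j * \<epsilon>))" if "i < j" for i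
      using gm[of i j] inc[OF that] that by (intro measurable_If) auto
    then show ?thesis unfolding V_def[abs_def] add_0
      by (intro borel_measurable_add borel_measurable_const borel_measurable_sum) auto
  qed
  show ?thesis unfolding milstein_coupling_def add_0
  proof (intro conjI allI ballI impI)
    fix j
    show "Measurable.pred (\<F> (real j * \<epsilon>)) (good \<epsilon> R \<kappa> j)" by (rule gm) simp
    show "V \<epsilon> R \<kappa> j \<in> borel_measurable (\<F> (real j * \<epsilon>))" by (rule Vm)
    show "Y (real j * \<epsilon>) \<in> borel_measurable (\<F> (real j * \<epsilon>))" by (rule Ym) simp
    show "milstein_path F G x0 \<delta> (real j * \<epsilon>) \<in> borel_measurable (\<F> (real j * \<epsilon>))" by (rule milstein_path_measurable[OF G \<delta> j0])
  next
    fix j z assume "good \<epsilon> R \<kappa> (Suc j) z"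
    then show "good \<epsilon> R \<kappa> j z" by (rule good_mono[OF \<epsilon>]) simp
  next
    fix j z assume g: "good \<epsilon> R \<kappa> j z"
    then have "V \<epsilon> R \<kappa> j z = U \<epsilon> j z" by (intro V_eq_U good_mono[OF \<epsilon> g]) auto
    then show "\<bar>Y (real j * \<epsilon>) z\<bar> \<le> R" "\<bar>Y (real j * \<epsilon>) z - V \<epsilon> R \<kappa> j z\<bar> \<le> \<kappa>" using g by (auto simp: good_def)
  next
    fix z
    show "V \<epsilon> R \<kappa> 0 z = x0" by (simp add: V_def)
    show "milstein_path F G x0 \<delta> (real 0 * \<epsilon>) z = x0" by (simp add: milstein_path_def milstein_step_def)
  next
    fix j z
    show "V \<epsilon> R \<kappa> (Suc j) z = V \<epsilon> R \<kappa> j z + (if good \<epsilon> R \<kappa> j z then F (real j * \<epsilon>) (Y (real j * \<epsilon>) z) * \<epsilon>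
        + G (real j * \<epsilon>) (Y (real j * \<epsilon>) z) * (B (real (Suc j) * \<epsilon>) z - B (real j * \<epsilon>) z) else 0)"
      unfolding V_def add_0 sum.lessThan_Suc add.assoc ..
  next
    fix j z
    show "milstein_path F G x0 \<delta> (real (Suc j) * \<epsilon>) z = milstein_path F G x0 \<delta> (real j * \<epsilon>) z +
       (F (real (block L j) * \<epsilon>) (milstein_path F G x0 \<delta> (real (block L j) * \<epsilon>) z) * \<epsilon> +
        G (real (block L j) * \<epsilon>) (milstein_path F G x0 \<delta> (real (block L j) * \<epsilon>) z) * (B (real (Suc j) * \<epsilon>) z - B (real j * \<epsilon>) z) +
        G_Gx G (real (block L j) * \<epsilon>) (milstein_path F G x0 \<delta> (real (block L j) * \<epsilon>) z) *
        ((\<Sum>i = block L j..<j. B (real (Suc i) * \<epsilon>) z - B (real i * \<epsilon>) z) * (B (real (Suc j) * \<epsilon>) z - B (real j * \<epsilon>) z) +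
         1 / 2 * ((B (real (Suc j) * \<epsilon>) z - B (real j * \<epsilon>) z)\<^sup>2 - \<epsilon>)))"
      using milstein_path_step[OF \<delta> L, where z=z and j=j] unfolding add_0 \<epsilon>_def[symmetric] .
  qed
qed

text \<open>Fatou's lemma along refinements of the fine grid.\<close>

lemma error_before_exit:
  assumes mc: "milstein_coefficients F G H K0 (real N * \<delta>)" and \<delta>: "0 < \<delta>" "\<delta> \<le> 1" and N: "1 \<le> real N * \<delta>" and R: "0 \<le> R"
  shows "\<exists>g\<in>borel_measurable M. (\<integral>\<^sup>+ z. g z \<partial>M) \<le> ennreal (milstein_constant x0 (real N * \<delta>) H (K0 + H + 1) * \<delta>\<^sup>2) \<and>
    (AE z in M. E T z \<le> real N * \<delta> \<longrightarrow> (\<forall>u\<in>{0..E T z}. \<bar>Y u z\<bar> \<le> R) \<longrightarrow>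
      (\<forall>u\<in>{0..E T z}. sq_err \<delta> u z \<le> g z))"
proof -
  let ?C = "milstein_constant x0 (real N * \<delta>) H (K0 + H + 1) * \<delta>\<^sup>2"
  have jcG: "jointly_continuous (G_Gx G)" using mc by (auto simp: milstein_coefficients_def C12_def)
  have "\<exists>\<kappa> L0. 0 < \<kappa> \<and> \<kappa> \<le> \<delta> \<and> (\<forall>L \<G> w good V Y Z. L0 \<le> L \<longrightarrow> 0 < L \<longrightarrow> gaussian_increments M \<G> w (\<delta> / real L) \<longrightarrow>
      milstein_coupling M \<G> w (\<delta> / real L) L F G x0 R \<kappa> good V Y Z \<longrightarrow>
      second_moment M (\<lambda>z. running_max (\<lambda>l. if \<forall>j<l. good j z then V l z - Z l z else 0) (N * L)) \<le> ennreal ?C)"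
    using milstein_coefficients.milstein_fine_grid[OF mc refl N \<delta> R, of M x0] by blast
  then obtain \<kappa> L0 where \<kappa>: "0 < \<kappa>" and fine: "\<And>L \<G> w good V Y Z. L0 \<le> L \<Longrightarrow> 0 < L \<Longrightarrow> gaussian_increments M \<G> w (\<delta> / real L) \<Longrightarrow>
      milstein_coupling M \<G> w (\<delta> / real L) L F G x0 R \<kappa> good V Y Z \<Longrightarrow>
      second_moment M (\<lambda>z. running_max (\<lambda>l. if \<forall>j<l. good j z then V l z - Z l z else 0) (N * L)) \<le> ennreal ?C" by meson
  define \<epsilon> where "\<epsilon> r = \<delta> / real (Suc r)" for r
  have \<epsilon>0: "\<epsilon> r > 0" for r using \<delta> by (simp add: \<epsilon>_def)
  have \<epsilon>lim: "\<epsilon> \<longlonglongrightarrow> 0" unfolding \<epsilon>_def[abs_def] by (rule LIMSEQ_Suc[OF lim_const_over_n])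
  obtain \<rho> :: "nat \<Rightarrow> nat" where \<rho>: "strict_mono \<rho>" and grid: "AE z in M. \<forall>e>0. eventually (\<lambda>r. \<forall>l. real l * \<epsilon> (\<rho> r) \<le> E T z \<longrightarrow>
      \<bar>U (\<epsilon> (\<rho> r)) l z - Y (real l * \<epsilon> (\<rho> r)) z\<bar> < e) sequentially"
    using sde_grid[of \<epsilon>, OF \<epsilon>0 \<epsilon>lim] by meson
  define \<mu> where "\<mu> r z = running_max (\<lambda>l. if \<forall>j<l. good (\<epsilon> (\<rho> r)) R \<kappa> j z then V (\<epsilon> (\<rho> r)) R \<kappa> l z - milstein_path F G x0 \<delta> (real l * \<epsilon> (\<rho> r)) z else 0) (N * Suc (\<rho> r))" for r z
  have cp: "milstein_coupling M (\<lambda>j. \<F> (0 + real j * \<epsilon> (\<rho> r))) (\<lambda>j z. B (0 + real (Suc j) * \<epsilon> (\<rho> r)) z - B (0 + real j * \<epsilon> (\<rho> r)) z) (\<epsilon> (\<rho> r)) (Suc (\<rho> r)) F G x0 R \<kappa>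
    (good (\<epsilon> (\<rho> r)) R \<kappa>) (V (\<epsilon> (\<rho> r)) R \<kappa>) (\<lambda>j. Y (real j * \<epsilon> (\<rho> r))) (\<lambda>j. milstein_path F G x0 \<delta> (real j * \<epsilon> (\<rho> r)))" for r
    using coupling[OF jcG \<delta>(1), of "Suc (\<rho> r)" R \<kappa>] unfolding \<epsilon>_def[symmetric] by simp
  have [measurable]: "\<mu> r \<in> borel_measurable M" for r
  proof -
    have [measurable]: "Measurable.pred M (good (\<epsilon> (\<rho> r)) R \<kappa> j)" "V (\<epsilon> (\<rho> r)) R \<kappa> j \<in> borel_measurable M"
        "milstein_path F G x0 \<delta> (real j * \<epsilon> (\<rho> r)) \<in> borel_measurable M" for j
      using cp[of r] unfolding milstein_coupling_def by (blast intro: measurable_F)+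
    show ?thesis unfolding \<mu>_def[abs_def] by (intro measurable_running_max) measurable
  qed
  have \<mu>_le: "second_moment M (\<mu> r) \<le> ennreal ?C" if "L0 \<le> r" for r
    unfolding \<mu>_def[abs_def]
  proof (rule fine)
    show "L0 \<le> Suc (\<rho> r)" using that seq_suble[OF \<rho>, of r] by simp
    show "gaussian_increments M (\<lambda>j. \<F> (0 + real j * \<epsilon> (\<rho> r))) (\<lambda>j z. B (0 + real (Suc j) * \<epsilon> (\<rho> r)) z - B (0 + real j * \<epsilon> (\<rho> r)) z) (\<delta> / real (Suc (\<rho> r)))"
      unfolding \<epsilon>_def[symmetric] by (rule gaussian_grid[OF order_refl \<epsilon>0])
  qed (use cp[of r] in \<open>simp_all only: \<epsilon>_def[symmetric] zero_less_Suc\<close>)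
  \<comment> \<open>One measurable function that dominates the squared error at all inner times
    simultaneously, in place of the supremum over u.\<close>
  define g where "g z = liminf (\<lambda>r. ennreal ((\<mu> r z)\<^sup>2))" for z
  have gm: "g \<in> borel_measurable M" unfolding g_def[abs_def] by measurable
  have "(\<integral>\<^sup>+ z. g z \<partial>M) \<le> liminf (\<lambda>r. second_moment M (\<mu> r))"
    unfolding g_def second_moment_def by (rule nn_integral_liminf) measurable
  also have "\<dots> \<le> liminf (\<lambda>r. ennreal ?C)"
    by (rule Liminf_mono) (use \<mu>_le in \<open>auto simp: eventually_sequentially\<close>)
  finally have gC: "(\<integral>\<^sup>+ z. g z \<partial>M) \<le> ennreal ?C" by (simp add: Liminf_const)
  have "AE z in M. E T z \<le> real N * \<delta> \<longrightarrow> (\<forall>u\<in>{0..E T z}. \<bar>Y u z\<bar> \<le> R) \<longrightarrow>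
      (\<forall>u\<in>{0..E T z}. sq_err \<delta> u z \<le> g z)"
    using grid AE_Omega1
  proof eventually_elim
    case (elim z)
    note z = elim(2)
    show ?case
    proof (intro impI ballI)
      fix u assume EN: "E T z \<le> real N * \<delta>" and bd: "\<forall>u\<in>{0..E T z}. \<bar>Y u z\<bar> \<le> R" and u: "u \<in> {0..E T z}"
      let ?Z = "\<lambda>u. milstein_path F G x0 \<delta> u z"
      \<comment> \<open>Index of the largest fine grid point not after u.\<close>
      define l where "l r = nat \<lfloor>u / \<epsilon> (\<rho> r)\<rfloor>" for r
      define v where "v r = real (l r) * \<epsilon> (\<rho> r)" for r
      have \<epsilon>\<rho>: "(\<lambda>r. \<epsilon> (\<rho> r)) \<longlonglongrightarrow> 0" using LIMSEQ_subseq_LIMSEQ[OF \<epsilon>lim \<rho>] by (simp add: comp_def)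
      have vb: "v r \<le> u" "u - \<epsilon> (\<rho> r) \<le> v r" for r
      proof -
        have "0 \<le> u / \<epsilon> (\<rho> r)" using u \<epsilon>0[of "\<rho> r"] by simp
        then have "real (l r) \<le> u / \<epsilon> (\<rho> r)" "u / \<epsilon> (\<rho> r) \<le> real (l r) + 1" unfolding l_def by linarith+
        then have "v r \<le> u" "u \<le> (real (l r) + 1) * \<epsilon> (\<rho> r)" unfolding v_def using \<epsilon>0[of "\<rho> r"] by (simp_all add: pos_le_divide_eq pos_divide_le_eq)
        then show "v r \<le> u" "u - \<epsilon> (\<rho> r) \<le> v r" unfolding v_def by (simp_all add: distrib_right)
      qed
      have v0: "0 \<le> v r" for r unfolding v_def using \<epsilon>0[of "\<rho> r"] by simp
      have vlim: "v \<longlonglongrightarrow> u"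
      proof (rule real_tendsto_sandwich[of "\<lambda>r. u - \<epsilon> (\<rho> r)" _ _ "\<lambda>_. u"])
        show "(\<lambda>r. u - \<epsilon> (\<rho> r)) \<longlonglongrightarrow> u" using tendsto_diff[OF tendsto_const \<epsilon>\<rho>, of u] by simp
      qed (use vb in auto)
      have "(\<lambda>r. Y (v r) z) \<longlonglongrightarrow> Y u z"
        by (rule continuous_on_tendsto_compose[OF Y_cont[OF z] vlim u]) (use v0 order_trans[OF vb(1)] u in auto)
      moreover have "(\<lambda>r. ?Z (v r)) \<longlonglongrightarrow> ?Z u"
        by (rule milstein_path_left_limit[OF z \<delta>(1) _ vlim v0 vb(1)]) (use u in simp)
      ultimately have lim: "(\<lambda>r. \<bar>Y (v r) z - ?Z (v r)\<bar>) \<longlonglongrightarrow> \<bar>Y u z - ?Z u\<bar>" by (intro tendsto_intros)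
      \<comment> \<open>On a fine enough grid the stopping rule does not act before u: the path is
        bounded by R by assumption, and within \<kappa> of the sums by \<open>sde_grid\<close>.
        There \<open>V\<close> coincides with \<open>U\<close>.\<close>
      have close: "eventually (\<lambda>r. \<bar>Y (v r) z - ?Z (v r)\<bar> \<le> \<mu> r z + e) sequentially" if e: "e > 0" for e
      proof -
        have "eventually (\<lambda>r. \<forall>l. real l * \<epsilon> (\<rho> r) \<le> E T z \<longrightarrow> \<bar>U (\<epsilon> (\<rho> r)) l z - Y (real l * \<epsilon> (\<rho> r)) z\<bar> < min e \<kappa>) sequentially"
          by (rule elim(1)[rule_format]) (use e \<kappa> in simp)
        then show ?thesis
        proof eventually_elim
          case (elim r)
          let ?\<epsilon> = "\<epsilon> (\<rho> r)"
          have mono: "real i * ?\<epsilon> \<le> real j * ?\<epsilon>" if "i \<le> j" for i j using that \<epsilon>0[of "\<rho> r"] by (intro mult_right_mono) auto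
          have lu: "real (l r) * ?\<epsilon> \<le> E T z" using vb(1)[of r] u unfolding v_def by simp
          have gd: "good ?\<epsilon> R \<kappa> j z" if "j < l r" for j
            unfolding good_def
          proof (intro conjI allI impI)
            have "real j * ?\<epsilon> < real (l r) * ?\<epsilon>" using that \<epsilon>0[of "\<rho> r"] by (intro mult_strict_right_mono) auto
            then show "real j * ?\<epsilon> < E T z" using lu by simp
            fix i assume "i \<le> j"
            then have i: "real i * ?\<epsilon> \<le> E T z" using mono[of i "l r"] that lu by simp
            show "\<bar>Y (real i * ?\<epsilon>) z\<bar> \<le> R" using bd i \<epsilon>0[of "\<rho> r"] by simp
            have "\<bar>U ?\<epsilon> i z - Y (real i * ?\<epsilon>) z\<bar> < \<kappa>" using elim i by simp
            then show "\<bar>Y (real i * ?\<epsilon>) z - U ?\<epsilon> i z\<bar> \<le> \<kappa>" by linarith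
          qed
          have lN: "l r \<le> N * Suc (\<rho> r)"
          proof -
            have "real N * \<delta> = real (N * Suc (\<rho> r)) * ?\<epsilon>" unfolding of_nat_mult \<epsilon>_def by (simp del: of_nat_Suc)
            then have "real (l r) * ?\<epsilon> \<le> real (N * Suc (\<rho> r)) * ?\<epsilon>" using lu EN by linarith
            then show ?thesis using \<epsilon>0[of "\<rho> r"] by (simp del: of_nat_mult of_nat_Suc)
          qed
          have VU: "V ?\<epsilon> R \<kappa> (l r) z = U ?\<epsilon> (l r) z" by (rule V_eq_U[OF gd])
          have "\<bar>U ?\<epsilon> (l r) z - ?Z (v r)\<bar> \<le> \<mu> r z"
            using running_max_ge[OF lN, of "\<lambda>l. if \<forall>j<l. good ?\<epsilon> R \<kappa> j z then V ?\<epsilon> R \<kappa> l z - ?Z (real l * ?\<epsilon>) else 0"] gd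
            unfolding \<mu>_def v_def VU[symmetric] by simp
          moreover have "\<bar>U ?\<epsilon> (l r) z - Y (v r) z\<bar> < e" using elim lu unfolding v_def by simp
          ultimately show ?case by linarith
        qed
      qed
      have gc: "ennreal (c\<^sup>2) \<le> g z" if c: "0 \<le> c" "c < \<bar>Y u z - ?Z u\<bar>" for c
      proof -
        define e where "e = (\<bar>Y u z - ?Z u\<bar> - c) / 2"
        have e: "e > 0" "c + e < \<bar>Y u z - ?Z u\<bar>" using c by (auto simp: e_def field_simps)
        have "eventually (\<lambda>r. ennreal (c\<^sup>2) \<le> ennreal ((\<mu> r z)\<^sup>2)) sequentially"
          using order_tendstoD(1)[OF lim e(2)] close[OF e(1)]
        proof eventually_elim
          case (elim r)
          then have "c \<le> \<mu> r z" by linarith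
          then show ?case using c(1) by (intro ennreal_leI power_mono)
        qed
        then show ?thesis unfolding g_def by (rule Liminf_bounded)
      qed
      show "ennreal ((Y u z - ?Z u)\<^sup>2) \<le> g z"
      proof (cases "Y u z - ?Z u = 0")
        case False
        let ?b = "\<bar>Y u z - ?Z u\<bar>"
        have b: "?b > 0" using False by simp
        \<comment> \<open>\<open>gc\<close> covers only values strictly below the error; the factors
          i / (i + 1) exhaust them.\<close>
        have "(\<lambda>i. ennreal ((?b * (real i / real (Suc i)))\<^sup>2)) \<longlonglongrightarrow> ennreal ((?b * 1)\<^sup>2)"
          by (intro tendsto_intros tendsto_ennrealI) (use LIMSEQ_n_over_Suc_n in simp)
        moreover have "ennreal ((?b * (real i / real (Suc i)))\<^sup>2) \<le> g z" for i
        proof (rule gc)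
          have "?b * (real i / real (Suc i)) < ?b * 1" using b by (intro mult_strict_left_mono) auto
          then show "?b * (real i / real (Suc i)) < ?b" by simp
        qed simp
        ultimately have "ennreal ((?b * 1)\<^sup>2) \<le> g z" using LIMSEQ_le_const2 by blast
        then show ?thesis by simp
      qed simp
    qed
  qed
  then show ?thesis using gm gC by blast
qed

text \<open>Each path is continuous on the compact range of inner times, hence bounded by some level
  R, and the constant does not depend on R; Fatou's lemma removes the truncation.\<close>

theorem inner_error:
  assumes mc: "milstein_coefficients F G H K0 (real N * \<delta>)" and \<delta>: "0 < \<delta>" "\<delta> \<le> 1" and N: "1 \<le> real N * \<delta>"
  shows "\<exists>g\<in>borel_measurable M. (\<integral>\<^sup>+ z. g z \<partial>M) \<le> ennreal (milstein_constant x0 (real N * \<delta>) H (K0 + H + 1) * \<delta>\<^sup>2) \<and>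
    (AE z in M. E T z \<le> real N * \<delta> \<longrightarrow> (\<forall>u\<in>{0..E T z}. sq_err \<delta> u z \<le> g z))"
proof -
  let ?C = "ennreal (milstein_constant x0 (real N * \<delta>) H (K0 + H + 1) * \<delta>\<^sup>2)"
  have "\<forall>R::nat. \<exists>g\<in>borel_measurable M. (\<integral>\<^sup>+ z. g z \<partial>M) \<le> ?C \<and>
    (AE z in M. E T z \<le> real N * \<delta> \<longrightarrow> (\<forall>u\<in>{0..E T z}. \<bar>Y u z\<bar> \<le> real R) \<longrightarrow>
      (\<forall>u\<in>{0..E T z}. sq_err \<delta> u z \<le> g z))"
    using error_before_exit[OF mc \<delta> N] by simp
  then obtain g where g: "\<And>R::nat. g R \<in> borel_measurable M" "\<And>R. (\<integral>\<^sup>+ z. g R z \<partial>M) \<le> ?C"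
    and ae: "\<And>R. AE z in M. E T z \<le> real N * \<delta> \<longrightarrow> (\<forall>u\<in>{0..E T z}. \<bar>Y u z\<bar> \<le> real R) \<longrightarrow>
      (\<forall>u\<in>{0..E T z}. sq_err \<delta> u z \<le> g R z)"
    unfolding Bex_def by meson
  define g' where "g' z = liminf (\<lambda>R. g R z)" for z
  have m: "g' \<in> borel_measurable M" unfolding g'_def[abs_def] using g(1) by measurable
  have "(\<integral>\<^sup>+ z. g' z \<partial>M) \<le> liminf (\<lambda>R. \<integral>\<^sup>+ z. g R z \<partial>M)"
    unfolding g'_def by (rule nn_integral_liminf[OF g(1)])
  also have "\<dots> \<le> liminf (\<lambda>R. ?C)" by (rule Liminf_mono) (use g(2) in auto)
  finally have C: "(\<integral>\<^sup>+ z. g' z \<partial>M) \<le> ?C" by (simp add: Liminf_const)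
  have "AE z in M. \<forall>R. E T z \<le> real N * \<delta> \<longrightarrow> (\<forall>u\<in>{0..E T z}. \<bar>Y u z\<bar> \<le> real R) \<longrightarrow>
      (\<forall>u\<in>{0..E T z}. sq_err \<delta> u z \<le> g R z)"
    unfolding AE_all_countable using ae by blast
  then have "AE z in M. E T z \<le> real N * \<delta> \<longrightarrow> (\<forall>u\<in>{0..E T z}. sq_err \<delta> u z \<le> g' z)"
    using AE_Omega1
  proof eventually_elim
    case (elim z)
    show ?case
    proof (intro impI ballI)
      fix u assume EN: "E T z \<le> real N * \<delta>" and u: "u \<in> {0..E T z}"
      have "bounded ((\<lambda>u. Y u z) ` {0..E T z})"
        using compact_imp_bounded[OF compact_continuous_image[OF Y_cont[OF elim(2)]]] by simp
      then obtain b where b: "\<forall>u\<in>{0..E T z}. \<bar>Y u z\<bar> \<le> b" unfolding bounded_iff by auto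
      obtain R0 :: nat where R0: "b \<le> real R0" using real_arch_simple by blast
      have "eventually (\<lambda>R. sq_err \<delta> u z \<le> g R z) sequentially"
        unfolding eventually_sequentially
      proof (intro exI allI impI)
        fix R assume "R0 \<le> R"
        then have "\<forall>u\<in>{0..E T z}. \<bar>Y u z\<bar> \<le> real R" using b R0 by force
        then show "sq_err \<delta> u z \<le> g R z" using elim(1) EN u by blast
      qed
      then show "sq_err \<delta> u z \<le> g' z" unfolding g'_def by (rule Liminf_bounded)
    qed
  qed
  then show ?thesis using m C by blast
qed

end

section \<open>Regularly varying monotone functions\<close>

lemma dyadic_bracket:
  fixes s s0 :: real assumes "0 < s0" "s0 \<le> s"
  shows "\<exists>n::nat. 2 ^ n * s0 \<le> s \<and> s < 2 ^ Suc n * s0"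
proof -
  define P where "P n \<longleftrightarrow> s < 2 ^ n * s0" for n :: nat
  obtain n where "s / s0 < 2 ^ n" using real_arch_pow[of 2 "s / s0"] by auto
  then have "P n" unfolding P_def using assms by (simp add: pos_divide_less_eq)
  define m where "m = (LEAST n. P n)"
  have m: "P m" unfolding m_def using \<open>P n\<close> by (rule LeastI)
  then obtain k where k: "m = Suc k" using assms unfolding P_def by (cases m) auto
  have "\<not> P k" using not_less_Least[of k P] k unfolding m_def by simp
  then show ?thesis using m k unfolding P_def by (intro exI[of _ k]) auto
qed

lemma regularly_varying_doubling:
  assumes rv: "regularly_varying f p"
  shows "b < p \<Longrightarrow> \<exists>s0>0. \<forall>s\<ge>s0. 2 powr b * f s \<le> f (2 * s)"
    and "p < b \<Longrightarrow> \<exists>s0>0. \<forall>s\<ge>s0. f (2 * s) \<le> 2 powr b * f s"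
proof -
  have pos: "f s > 0" if "s > 0" for s using rv that by (auto simp: regularly_varying_def)
  have lim: "((\<lambda>s. f (2 * s) / f s) \<longlongrightarrow> 2 powr p) at_top" using rv by (auto simp: regularly_varying_def)
  show "\<exists>s0>0. \<forall>s\<ge>s0. 2 powr b * f s \<le> f (2 * s)" if b: "b < p"
  proof -
    have "2 powr b < 2 powr p" using b by simp
    then have "eventually (\<lambda>s. 2 powr b < f (2 * s) / f s) at_top" using order_tendstoD(1)[OF lim] by blast
    then obtain s1 where s1: "\<And>s. s \<ge> s1 \<Longrightarrow> 2 powr b < f (2 * s) / f s" unfolding eventually_at_top_linorder by blast
    show ?thesis
    proof (intro exI[of _ "max 1 s1"] conjI allI impI)
      fix s assume "max 1 s1 \<le> s"
      then show "2 powr b * f s \<le> f (2 * s)" using s1[of s] pos[of s] by (simp add: pos_less_divide_eq)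
    qed simp
  qed
  show "\<exists>s0>0. \<forall>s\<ge>s0. f (2 * s) \<le> 2 powr b * f s" if b: "p < b"
  proof -
    have "2 powr p < 2 powr b" using b by simp
    then have "eventually (\<lambda>s. f (2 * s) / f s < 2 powr b) at_top" using order_tendstoD(2)[OF lim] by blast
    then obtain s1 where s1: "\<And>s. s \<ge> s1 \<Longrightarrow> f (2 * s) / f s < 2 powr b" unfolding eventually_at_top_linorder by blast
    show ?thesis
    proof (intro exI[of _ "max 1 s1"] conjI allI impI)
      fix s assume "max 1 s1 \<le> s"
      then show "f (2 * s) \<le> 2 powr b * f s" using s1[of s] pos[of s] by (simp add: pos_divide_less_eq)
    qed simp
  qed
qed

text \<open>One half of Potter's bounds, for monotone functions: the limit relation for c = 2 is
  iterated along dyadic points, and monotonicity fills the gaps.\<close>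

lemma regularly_varying_lower:
  assumes rv: "regularly_varying f p" and mono: "mono_on {0<..} f" and b: "b < p" "0 \<le> b"
  shows "\<exists>c>0. \<exists>s0>0. \<forall>s\<ge>s0. c * s powr b \<le> f s"
proof -
  obtain s0 where s0: "s0 > 0" and dbl: "\<And>s. s \<ge> s0 \<Longrightarrow> 2 powr b * f s \<le> f (2 * s)"
    using regularly_varying_doubling(1)[OF rv b(1)] by auto
  have pos: "f s0 > 0" using rv s0 by (auto simp: regularly_varying_def)
  have it: "(2 powr b) ^ n * f s0 \<le> f (2 ^ n * s0)" for n
  proof (induction n)
    case (Suc n)
    have "1 * s0 \<le> 2 ^ n * s0" using s0 by (intro mult_right_mono) auto
    then have "s0 \<le> 2 ^ n * s0" by simp
    from dbl[OF this] have "2 powr b * f (2 ^ n * s0) \<le> f (2 ^ Suc n * s0)" by (simp add: mult.assoc)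
    moreover have "2 powr b * ((2 powr b) ^ n * f s0) \<le> 2 powr b * f (2 ^ n * s0)" using Suc by (intro mult_left_mono) auto
    ultimately show ?case unfolding power_Suc mult.assoc by linarith
  qed simp
  have "f s0 / (2 * s0) powr b * s powr b \<le> f s" if s: "s \<ge> s0" for s
  proof -
    obtain n where n: "2 ^ n * s0 \<le> s" "s < 2 ^ Suc n * s0" using dyadic_bracket[OF s0 s] by blast
    have "s powr b \<le> (2 ^ n * (2 * s0)) powr b" using n s s0 b(2) by (intro powr_mono2) auto
    also have "\<dots> = (2 ^ n) powr b * (2 * s0) powr b" using s0 by (simp add: powr_mult)
    also have "(2 ^ n) powr b = (2 powr b :: real) ^ n" by (simp add: powr_powr powr_realpow[symmetric] mult.commute)
    finally have "s powr b * f s0 \<le> (2 powr b) ^ n * (2 * s0) powr b * f s0" using pos by (intro mult_right_mono) auto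
    also have "\<dots> \<le> f (2 ^ n * s0) * (2 * s0) powr b" using mult_right_mono[OF it[of n], of "(2 * s0) powr b"] by (simp add: ac_simps)
    also have "\<dots> \<le> f s * (2 * s0) powr b"
      using n s0 s by (intro mult_right_mono mono_onD[OF mono]) auto
    finally show ?thesis using s0 by (simp add: pos_divide_le_eq mult.commute)
  qed
  moreover have "f s0 / (2 * s0) powr b > 0" using pos s0 by simp
  ultimately show ?thesis using s0 by blast
qed

lemma regularly_varying_upper:
  assumes rv: "regularly_varying f p" and mono: "mono_on {0<..} f" and b: "p < b" "0 \<le> b"
  shows "\<exists>c>0. \<exists>s0>0. \<forall>s\<ge>s0. f s \<le> c * s powr b"
proof -
  obtain s0 where s0: "s0 > 0" and dbl: "\<And>s. s \<ge> s0 \<Longrightarrow> f (2 * s) \<le> 2 powr b * f s"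
    using regularly_varying_doubling(2)[OF rv b(1)] by auto
  have pos: "f s0 > 0" using rv s0 by (auto simp: regularly_varying_def)
  have it: "f (2 ^ n * s0) \<le> (2 powr b) ^ n * f s0" for n
  proof (induction n)
    case (Suc n)
    have "1 * s0 \<le> 2 ^ n * s0" using s0 by (intro mult_right_mono) auto
    then have "s0 \<le> 2 ^ n * s0" by simp
    from dbl[OF this] have "f (2 ^ Suc n * s0) \<le> 2 powr b * f (2 ^ n * s0)" by (simp add: mult.assoc)
    moreover have "2 powr b * f (2 ^ n * s0) \<le> 2 powr b * ((2 powr b) ^ n * f s0)" using Suc by (intro mult_left_mono) auto
    ultimately show ?case unfolding power_Suc mult.assoc by linarith
  qed simp
  have "f s \<le> f s0 * (2 / s0) powr b * s powr b" if s: "s \<ge> s0" for s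
  proof -
    obtain n where n: "2 ^ n * s0 \<le> s" "s < 2 ^ Suc n * s0" using dyadic_bracket[OF s0 s] by blast
    have "f s \<le> f (2 ^ Suc n * s0)" using n s0 s by (intro mono_onD[OF mono]) auto
    also have "\<dots> \<le> (2 powr b) ^ Suc n * f s0" by (rule it)
    also have "(2 powr b :: real) ^ Suc n = (2 * 2 ^ n) powr b" unfolding power_Suc[symmetric]
      by (simp only: powr_realpow[symmetric] powr_powr zero_less_numeral powr_gt_zero mult.commute)
    also have "(2 * 2 ^ n) powr b * f s0 \<le> (2 / s0 * s) powr b * f s0"
    proof -
      have "2 * 2 ^ n \<le> 2 / s0 * s" using n(1) s0 by (simp add: field_simps)
      then show ?thesis using pos b(2) by (intro mult_right_mono powr_mono2) auto
    qed
    also have "\<dots> = f s0 * (2 / s0) powr b * s powr b" using s0 s by (subst powr_mult) auto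
    finally show ?thesis .
  qed
  moreover have "f s0 * (2 / s0) powr b > 0" using pos s0 by simp
  ultimately show ?thesis using s0 by blast
qed

section \<open>Regular paths\<close>

text \<open>Strict growth at rational times and unboundedness along the integers are countably many
  conditions, so they can hold almost surely all at once; monotonicity extends them to real
  times.\<close>

lemma subordinator_pathI:
  assumes zero: "d 0 = 0" and mono: "mono_on {0..} d" and right: "\<And>u. 0 \<le> u \<Longrightarrow> continuous (at_right u) d"
    and strict: "\<And>p q :: rat. 0 \<le> p \<Longrightarrow> p < q \<Longrightarrow> d (real_of_rat p) < d (real_of_rat q)"
    and unb: "\<And>n::nat. \<exists>k::nat. real n < d (real k)"
  shows "subordinator_path d"
proof
  fix u v :: real assume uv: "0 \<le> u" "u < v"
  obtain p where p: "u < real_of_rat p" "real_of_rat p < v" using of_rat_dense[OF uv(2)] by blast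
  obtain q where q: "real_of_rat p < real_of_rat q" "real_of_rat q < v" using of_rat_dense[OF p(2)] by blast
  have "0 < real_of_rat p" "0 < real_of_rat q" using uv p q by linarith+
  then have p0: "0 \<le> p" "0 \<le> q" by simp_all
  have "d u \<le> d (real_of_rat p)" using mono_onD[OF mono, of u "real_of_rat p"] uv p p0 by auto
  also have "\<dots> < d (real_of_rat q)" using strict[OF p0(1), of q] q by (simp add: of_rat_less)
  also have "\<dots> \<le> d v" using mono_onD[OF mono, of "real_of_rat q" v] q p0 uv by auto
  finally show "d u < d v" .
next
  fix t :: real
  obtain n :: nat where n: "max t (d 0) \<le> real n" using real_arch_simple by blast
  obtain k where k: "real n < d (real k)" using unb[of n] by blast
  then have "k \<noteq> 0" using n by (cases k) auto
  then show "\<exists>u>0. t < d u" using k n by (intro exI[of _ "real k"]) auto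
qed (use zero right in auto)

section \<open>Almost sure properties of the subordinator\<close>

context time_change_setting
begin

lemma prob_M: "prob_space M"
  using prob_space.prob_space_completion[OF prob_space_pair[OF prob_PB prob_PD]] by (simp add: M_eq)

lemma complete_M: "complete_measure M"
  unfolding M_eq by (rule completion.complete_measure_axioms)

sublocale prob_space M by (rule prob_M)

lemma D_measurable: "0 \<le> t \<Longrightarrow> D t \<in> borel_measurable M"
  using sub by (auto simp: driftless_subordinator_def)

lemma laplace: "0 \<le> s \<Longrightarrow> 0 \<le> t \<Longrightarrow> (LINT z|M. exp (- s * D t z)) = exp (- t * laplace_exponent \<nu> s)"
  using sub by (auto simp: driftless_subordinator_def)

text \<open>Chernoff bound from the Laplace transform.\<close>

lemma D_tail:
  assumes s: "0 \<le> s" and t: "0 \<le> t"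
  shows "measure M {z\<in>space M. D t z \<le> a} \<le> exp (s * a - t * laplace_exponent \<nu> s)"
proof -
  have [measurable]: "D t \<in> borel_measurable M" by (rule D_measurable[OF t])
  \<comment> \<open>A function that is not integrable has integral 0 by convention, whereas the
    Laplace transform is positive.\<close>
  have int: "integrable M (\<lambda>z. exp (- s * D t z))"
  proof (rule ccontr)
    assume "\<not> integrable M (\<lambda>z. exp (- s * D t z))"
    then have "(LINT z|M. exp (- s * D t z)) = 0" by (rule not_integrable_integral_eq)
    then show False using laplace[OF s t] by simp
  qed
  have "measure M {z\<in>space M. D t z \<le> a} = (LINT z|M. indicator {z\<in>space M. D t z \<le> a} z)" by simp
  also have "\<dots> \<le> (LINT z|M. exp (s * a) * exp (- s * D t z))"
  proof (intro integral_mono)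
    show "integrable M (\<lambda>z. exp (s * a) * exp (- s * D t z))" using int by (rule integrable_mult_right)
    fix z
    have "1 \<le> exp (s * a) * exp (- s * D t z)" if "D t z \<le> a"
      using mult_left_mono[OF that s] unfolding exp_add[symmetric] by simp
    then show "indicat_real {z\<in>space M. D t z \<le> a} z \<le> exp (s * a) * exp (- s * D t z)"
      by (auto simp: indicator_def)
  qed (simp add: emeasure_eq_measure)
  also have "\<dots> = exp (s * a) * exp (- t * laplace_exponent \<nu> s)" using laplace[OF s t] by simp
  also have "\<dots> = exp (s * a - t * laplace_exponent \<nu> s)" unfolding exp_add[symmetric] by simp
  finally show ?thesis .
qed

text \<open>Read off from the Laplace transform of \<open>D 1\<close>, which decreases in its
  argument, instead of from the Levy measure.\<close>

lemma laplace_exponent_mono: "mono_on {0<..} (laplace_exponent \<nu>)"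
proof (rule mono_onI)
  fix r s :: real assume rs: "r \<in> {0<..}" "r \<le> s"
  have [measurable]: "D 1 \<in> borel_measurable M" by (rule D_measurable) simp
  have pos: "AE z in M. 0 \<le> D 1 z"
  proof -
    have "AE z in M. D 0 z = 0" "AE z in M. mono_on {0..} (\<lambda>t. D t z)"
      using sub by (auto simp: driftless_subordinator_def)
    then show ?thesis
    proof eventually_elim
      case (elim z)
      then show ?case using mono_onD[OF elim(2), of 0 1] by simp
    qed
  qed
  have int: "integrable M (\<lambda>z. exp (- a * D 1 z))" if "0 \<le> a" for a
  proof (rule ccontr)
    assume "\<not> integrable M (\<lambda>z. exp (- a * D 1 z))"
    then have "(LINT z|M. exp (- a * D 1 z)) = 0" by (rule not_integrable_integral_eq)
    then show False using laplace[OF that, of 1] by simp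
  qed
  have "(LINT z|M. exp (- s * D 1 z)) \<le> (LINT z|M. exp (- r * D 1 z))"
  proof (rule integral_mono_AE)
    show "AE z in M. exp (- s * D 1 z) \<le> exp (- r * D 1 z)" using pos
    proof eventually_elim
      case (elim z)
      show ?case using mult_right_mono[OF rs(2) elim] by simp
    qed
  qed (use int rs in auto)
  then show "laplace_exponent \<nu> r \<le> laplace_exponent \<nu> s" using laplace[of r 1] laplace[of s 1] rs by simp
qed

text \<open>At level 0 the Chernoff bound is exp (- t \<psi>(s)) for every s, and a positive index
  of regular variation forces \<psi>(s) to infinity.\<close>

lemma D_positive:
  assumes rv: "regularly_varying (laplace_exponent \<nu>) \<beta>" and \<beta>: "0 < \<beta>" and t: "0 < t"
  shows "AE z in M. 0 < D t z"
proof -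
  have [measurable]: "D t \<in> borel_measurable M" using t by (intro D_measurable) simp
  obtain c s0 where c: "c > 0" and s0: "s0 > 0" and low: "\<And>s. s \<ge> s0 \<Longrightarrow> c * s powr (\<beta> / 2) \<le> laplace_exponent \<nu> s"
    using regularly_varying_lower[OF rv laplace_exponent_mono, of "\<beta> / 2"] \<beta> by auto
  have "((\<lambda>s. exp (- (t * c) * s powr (\<beta> / 2))) \<longlongrightarrow> 0) at_top"
    using t c \<beta> by real_asymp
  moreover have "eventually (\<lambda>s. measure M {z\<in>space M. D t z \<le> 0} \<le> exp (- (t * c) * s powr (\<beta> / 2))) at_top"
    using eventually_ge_at_top[of s0]
  proof eventually_elim
    case (elim s)
    have "measure M {z\<in>space M. D t z \<le> 0} \<le> exp (s * 0 - t * laplace_exponent \<nu> s)"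
      by (rule D_tail) (use elim s0 t in auto)
    also have "\<dots> \<le> exp (- (t * c) * s powr (\<beta> / 2))" using mult_left_mono[OF low[OF elim], of t] t by (simp add: mult.assoc)
    finally show ?case .
  qed
  ultimately have "measure M {z\<in>space M. D t z \<le> 0} \<le> 0" by (intro tendsto_lowerbound[where F=at_top]) auto
  then have "emeasure M {z\<in>space M. D t z \<le> 0} = 0" by (simp add: emeasure_eq_measure measure_le_0_iff)
  then have "AE z in M. \<not> D t z \<le> 0" by (intro AE_I[where N="{z\<in>space M. D t z \<le> 0}"]) auto
  then show ?thesis by eventually_elim simp
qed

lemma D_unbounded:
  assumes rv: "regularly_varying (laplace_exponent \<nu>) \<beta>"
  shows "AE z in M. \<exists>k::nat. a < D (real k) z"
proof -
  have Dm [measurable]: "D (real k) \<in> borel_measurable M" for k by (rule D_measurable) simp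
  have p: "laplace_exponent \<nu> 1 > 0" using rv by (auto simp: regularly_varying_def)
  let ?A = "{z\<in>space M. \<forall>k::nat. D (real k) z \<le> a}"
  have "(\<lambda>k. exp (a - real k * laplace_exponent \<nu> 1)) \<longlonglongrightarrow> 0"
    using p by real_asymp
  moreover have "measure M ?A \<le> exp (a - real k * laplace_exponent \<nu> 1)" for k
  proof -
    have "measure M ?A \<le> measure M {z\<in>space M. D (real k) z \<le> a}" by (intro finite_measure_mono) auto
    also have "\<dots> \<le> exp (1 * a - real k * laplace_exponent \<nu> 1)" by (rule D_tail) auto
    finally show ?thesis by simp
  qed
  ultimately have "measure M ?A \<le> 0" by (intro LIMSEQ_le_const) auto
  then have "emeasure M ?A = 0" by (simp add: emeasure_eq_measure measure_le_0_iff)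
  then have "AE z in M. \<not> (\<forall>k::nat. D (real k) z \<le> a)" by (intro AE_I[where N="?A"]) auto
  then show ?thesis by eventually_elim (simp add: not_le)
qed

lemma D_increment_positive:
  assumes rv: "regularly_varying (laplace_exponent \<nu>) \<beta>" and \<beta>: "0 < \<beta>" and st: "0 \<le> s" "s < t"
  shows "AE z in M. D s z < D t z"
proof -
  have [measurable]: "D s \<in> borel_measurable M" "D t \<in> borel_measurable M" "D (t - s) \<in> borel_measurable M" using st by (auto intro: D_measurable)
  have "AE x in distr M borel (D (t - s)). 0 < x" using D_positive[OF rv \<beta>, of "t - s"] st by (subst AE_distr_iff) auto
  moreover have "distr M borel (D (t - s)) = distr M borel (\<lambda>z. D t z - D s z)" using sub st by (auto simp: driftless_subordinator_def)
  ultimately have "AE x in distr M borel (\<lambda>z. D t z - D s z). 0 < x" by (rule subst[rotated])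
  then have "AE z in M. 0 < D t z - D s z" by (subst (asm) AE_distr_iff) auto
  then show ?thesis by eventually_elim simp
qed

lemma AE_subordinator_path:
  assumes rv: "regularly_varying (laplace_exponent \<nu>) \<beta>" and \<beta>: "0 < \<beta>"
  shows "AE z in M. subordinator_path (\<lambda>u. D u z)"
proof -
  have "AE z in M. \<forall>p q :: rat. 0 \<le> p \<longrightarrow> p < q \<longrightarrow> D (real_of_rat p) z < D (real_of_rat q) z"
    unfolding AE_all_countable by (auto intro!: D_increment_positive[OF rv \<beta>] simp: of_rat_less)
  moreover have "AE z in M. \<forall>n::nat. \<exists>k::nat. real n < D (real k) z"
    unfolding AE_all_countable using D_unbounded[OF rv] by blast
  moreover have "AE z in M. D 0 z = 0" "AE z in M. mono_on {0..} (\<lambda>t. D t z) \<and> (\<forall>t\<ge>0. continuous (at_right t) (\<lambda>r. D r z))"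
    using sub by (auto simp: driftless_subordinator_def)
  ultimately show ?thesis
  proof eventually_elim
    case (elim z)
    show ?case by (rule subordinator_pathI) (use elim in auto)
  qed
qed

lemma full_set:
  assumes "AE z in M. P z"
  shows "\<exists>A\<in>sets M. space M - A \<in> null_sets M \<and> (\<forall>z\<in>A. P z)"
proof -
  obtain N where N: "{z\<in>space M. \<not> P z} \<subseteq> N" "N \<in> null_sets M" using assms by (auto elim!: AE_E3 simp: AE_iff_null)
  have "space M - (space M - N) = N" using null_setsD2[OF N(2)] sets.sets_into_space by blast
  then show ?thesis using N null_setsD2[OF N(2)] by (intro bexI[of _ "space M - N"]) auto
qed

text \<open>Two exceptional sets in succession: regular paths of D and B give the time change and
  with it flatness of the stochastic integral; \<Omega>1 then keeps the paths on which this flatness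
  and the equation hold too.\<close>

lemma sde_paths_exists:
  assumes rv: "regularly_varying (laplace_exponent \<nu>) \<beta>" and \<beta>: "0 < \<beta>" and T: "T > 0"
    and jc: "jointly_continuous F" "jointly_continuous G" and X: "sde_solution M \<F> B D T x0 F G X"
  shows "\<exists>\<Omega>1 I. sde_paths M \<F> B D T \<Omega>1 F G x0 X I"
proof -
  have "AE z in M. subordinator_path (\<lambda>u. D u z) \<and> continuous_on {0..} (\<lambda>u. B u z)"
    using AE_subordinator_path[OF rv \<beta>] BM unfolding brownian_motion_def by (auto intro: AE_conjI)
  then obtain \<Omega>0 where \<Omega>0: "\<Omega>0 \<in> sets M" "space M - \<Omega>0 \<in> null_sets M"
    and p0: "\<And>z. z \<in> \<Omega>0 \<Longrightarrow> subordinator_path (\<lambda>u. D u z)" "\<And>z. z \<in> \<Omega>0 \<Longrightarrow> continuous_on {0..} (\<lambda>u. B u z)"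
    using full_set[where P="\<lambda>z. subordinator_path (\<lambda>u. D u z) \<and> continuous_on {0..} (\<lambda>u. B u z)"] by meson
  interpret t: time_changed_brownian M \<F> B D T \<Omega>0
    by (rule time_changed_brownian.intro[OF prob_M time_changed_brownian_axioms.intro]) (fact complete_M usual BM D_adapted T \<Omega>0 p0)+
  obtain I where Xa: "adapted_process t.\<H> {0..T} X" and Xc: "AE z in M. continuous_on {0..T} (\<lambda>t. X t z)"
    and I: "stochastic_integral M t.\<H> T t.W (\<lambda>r z. G (t.E r z) (X r z)) I"
    and Xe: "AE z in M. \<forall>t\<in>{0..T}. X t z = x0 + stieltjes_integral (\<lambda>r. t.E r z) 0 t (\<lambda>r. F (t.E r z) (X r z)) + I t z"
    using X unfolding sde_solution_def Let_def by blast
  have cc: "continuous_on {0..T} (\<lambda>t. \<Phi> (t.E t z) (X t z))"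
    if \<Phi>: "jointly_continuous \<Phi>" and z: "z \<in> \<Omega>0" and c: "continuous_on {0..T} (\<lambda>t. X t z)" for \<Phi> z
  proof -
    have "continuous_on {0..T} (\<lambda>t. (t.E t z, X t z))"
      by (intro continuous_on_Pair c continuous_on_subset[OF t.E_cont[OF z]]) auto
    from continuous_on_compose2[OF \<Phi>[unfolded jointly_continuous_def] this] show ?thesis
      using t.E_nonneg[OF z] by (auto simp: image_subset_iff)
  qed
  have "AE z in M. continuous_on {0..T} (\<lambda>t. G (t.E t z) (X t z))"
    using Xc t.AE_Omega1 by eventually_elim (rule cc[OF jc(2)])
  note flatI = t.stochastic_integral_flat[OF I this]
  define P where "P z \<longleftrightarrow> z \<in> \<Omega>0 \<and> continuous_on {0..T} (\<lambda>t. X t z)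
      \<and> (\<forall>s\<in>{0..T}. \<forall>t\<in>{0..T}. t.E s z = t.E t z \<longrightarrow> I s z = I t z)
      \<and> (\<forall>t\<in>{0..T}. X t z = x0 + stieltjes_integral (\<lambda>r. t.E r z) 0 t (\<lambda>r. F (t.E r z) (X r z)) + I t z)" for z
  have "AE z in M. P z"
    using flatI t.AE_Omega1 Xc Xe unfolding P_def by eventually_elim (intro conjI)
  then obtain \<Omega>1 where \<Omega>1: "\<Omega>1 \<in> sets M" "space M - \<Omega>1 \<in> null_sets M" and "\<forall>z\<in>\<Omega>1. P z"
    using full_set[of P] by blast
  then have p1: "\<And>z. z \<in> \<Omega>1 \<Longrightarrow> z \<in> \<Omega>0" "\<And>z. z \<in> \<Omega>1 \<Longrightarrow> continuous_on {0..T} (\<lambda>t. X t z)"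
    and Iflat: "\<And>z s t. z \<in> \<Omega>1 \<Longrightarrow> s \<in> {0..T} \<Longrightarrow> t \<in> {0..T} \<Longrightarrow> t.E s z = t.E t z \<Longrightarrow> I s z = I t z"
    and eq: "\<And>z t. z \<in> \<Omega>1 \<Longrightarrow> t \<in> {0..T} \<Longrightarrow> X t z = x0 + stieltjes_integral (\<lambda>r. t.E r z) 0 t (\<lambda>r. F (t.E r z) (X r z)) + I t z"
    unfolding P_def by blast+
  \<comment> \<open>The drift integral is bounded by a multiple of the increment of the clock, which
    is zero here.\<close>
  have flat: "X s z = X t z" if z: "z \<in> \<Omega>1" and st: "0 \<le> s" "s \<le> t" "t \<le> T" and e: "t.E s z = t.E t z" for z s t
  proof -
    interpret ci: continuous_integrator "\<lambda>t. t.E t z"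
      by unfold_locales (use t.E_mono[OF p1(1)[OF z]] t.E_cont[OF p1(1)[OF z]] in auto)
    have Fc: "continuous_on {0..T} (\<lambda>r. F (t.E r z) (X r z))" by (rule cc[OF jc(1) p1(1)[OF z] p1(2)[OF z]])
    have "bounded ((\<lambda>r. F (t.E r z) (X r z)) ` {0..T})" using compact_imp_bounded[OF compact_continuous_image[OF Fc]] by simp
    then obtain b where b: "\<forall>r\<in>{0..T}. \<bar>F (t.E r z) (X r z)\<bar> \<le> b" unfolding bounded_iff by auto
    have "\<bar>(stieltjes_integral (\<lambda>r. t.E r z) 0 t (\<lambda>r. F (t.E r z) (X r z)) - stieltjes_integral (\<lambda>r. t.E r z) 0 s (\<lambda>r. F (t.E r z) (X r z)))
        - 0 * (t.E t z - t.E s z)\<bar> \<le> b * (t.E t z - t.E s z)"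
      by (rule ci.stieltjes_step_bound[OF Fc st]) (use b st in auto)
    then show ?thesis using eq[OF z, of s] eq[OF z, of t] Iflat[OF z, of s t] e st by simp
  qed
  have tcb: "time_changed_brownian M \<F> B D T \<Omega>1"
    by (rule time_changed_brownian.intro[OF prob_M time_changed_brownian_axioms.intro])
       (fact complete_M usual BM D_adapted T \<Omega>1 p0[OF p1(1)])+
  have "sde_paths M \<F> B D T \<Omega>1 F G x0 X I"
  proof (rule sde_paths.intro[OF tcb sde_paths_axioms.intro])
    fix z s t assume "z \<in> \<Omega>1" "s \<in> {0..T}" "t \<in> {0..T}" "t.E s z = t.E t z"
    then have st: "0 \<le> s" "s \<le> T" "0 \<le> t" "t \<le> T" by (simp_all only: atLeastAtMost_iff)
    show "X s z = X t z"
    proof (cases "s \<le> t")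
      case True
      show ?thesis by (rule flat[OF \<open>z \<in> \<Omega>1\<close> st(1) True st(4) \<open>t.E s z = t.E t z\<close>])
    next
      case False
      then have ts: "t \<le> s" by (simp only: not_le less_imp_le)
      show ?thesis by (rule flat[OF \<open>z \<in> \<Omega>1\<close> st(3) ts st(2) \<open>t.E s z = t.E t z\<close>[symmetric], symmetric])
    qed
  qed (fact p1(2) jc Xa I eq)+
  then show ?thesis by blast
qed

end

section \<open>Summing over the range of the inverse subordinator\<close>

lemma milstein_coefficients_mono:
  assumes "milstein_coefficients F G H K \<T>" "\<T>' \<le> \<T>"
  shows "milstein_coefficients F G H K \<T>'"
proof -
  interpret milstein_coefficients F G H K \<T> by fact
  show ?thesis
    by unfold_locales (rule smooth H_nonneg K0_nonneg lip growth drift_bound diffusion_bound;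
        (assumption | rule order_trans[OF _ assms(2)], assumption))+
qed

lemma milstein_constant_nonneg: "0 \<le> milstein_constant x0 \<T> H K"
  unfolding milstein_constant_def by (intro mult_nonneg_nonneg add_nonneg_nonneg) auto

lemma milstein_constant_mono:
  assumes "0 \<le> \<T>" "\<T> \<le> \<T>'"
  shows "milstein_constant x0 \<T> H K \<le> milstein_constant x0 \<T>' H K"
proof -
  have T: "\<T>\<^sup>2 \<le> \<T>'\<^sup>2" using assms by (intro power_mono) auto
  have e: "exp (30 * \<T>\<^sup>2 * H\<^sup>2) \<le> exp (30 * \<T>'\<^sup>2 * H\<^sup>2)" "exp (540 * \<T>\<^sup>2 * H\<^sup>2) \<le> exp (540 * \<T>'\<^sup>2 * H\<^sup>2)"
    using mult_right_mono[OF T, of "H\<^sup>2"] by simp_all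
  show ?thesis unfolding milstein_constant_def
    by (intro mult_mono add_mono mult_left_mono order_refl T e add_nonneg_nonneg mult_nonneg_nonneg) auto
qed

text \<open>A single parameter w dominates the horizon, the Gronwall exponent and the logarithm of
  \<open>K0\<close>, so the constant is at most exponential in w. The exponent is 575 = 2 + (2 + 31)
  + 540, from the square of the horizon, the weights and the last Gronwall factor.\<close>

lemma milstein_constant_le:
  assumes \<T>: "1 \<le> \<T>" "\<T> \<le> w" and H: "0 \<le> H" "\<T>\<^sup>2 * H\<^sup>2 \<le> w" and K0: "0 \<le> K0" "K0 \<le> exp w"
  shows "milstein_constant x0 \<T> H (K0 + H + 1) \<le> 33840 * (9 * (2 + 2 * (3 * x0\<^sup>2 + 120)) + 1) * exp (575 * w)"
proof -
  have w1: "1 \<le> w" using \<T> by simp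
  have we: "1 + w \<le> exp w" by simp
  have e1: "1 \<le> exp w" using w1 by simp
  have "1 * H\<^sup>2 \<le> \<T>\<^sup>2 * H\<^sup>2" using \<T>(1) by (intro mult_right_mono one_le_power) auto
  then have "H\<^sup>2 \<le> w" using H(2) by simp
  moreover have "H \<le> 1 + H\<^sup>2" using zero_le_power2[of "H - 1"] H(1) by (simp add: power2_diff)
  ultimately have "K0 + H + 1 \<le> 3 * exp w" using K0(2) we e1 by linarith
  then have "(K0 + H + 1)\<^sup>2 \<le> (3 * exp w)\<^sup>2" using K0(1) H(1) by (intro power_mono) auto
  also have "\<dots> = 9 * exp (2 * w)" by (simp add: power_mult_distrib exp_double)
  finally have K: "(K0 + H + 1)\<^sup>2 \<le> 9 * exp (2 * w)" .
  have "\<T> \<le> exp w" using \<T>(2) we by linarith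
  then have "\<T>\<^sup>2 \<le> (exp w)\<^sup>2" using \<T>(1) by (intro power_mono) auto
  then have T2: "\<T>\<^sup>2 \<le> exp (2 * w)" by (simp add: exp_double)
  have "120 * H\<^sup>2 * \<T>\<^sup>2 \<le> 120 * exp w" using H(2) we unfolding mult.assoc mult.commute[of "H\<^sup>2"] by linarith
  moreover have "3 * x0\<^sup>2 * 1 \<le> 3 * x0\<^sup>2 * exp w" using e1 by (intro mult_left_mono) auto
  ultimately have a: "3 * x0\<^sup>2 + 120 * H\<^sup>2 * \<T>\<^sup>2 \<le> (3 * x0\<^sup>2 + 120) * exp w" by (simp add: distrib_right)
  have ex: "exp (30 * \<T>\<^sup>2 * H\<^sup>2) \<le> exp (30 * w)" "exp (540 * \<T>\<^sup>2 * H\<^sup>2) \<le> exp (540 * w)" using H(2) by simp_all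
  have "(3 * x0\<^sup>2 + 120 * H\<^sup>2 * \<T>\<^sup>2) * exp (30 * \<T>\<^sup>2 * H\<^sup>2) \<le> (3 * x0\<^sup>2 + 120) * exp w * exp (30 * w)"
    by (intro mult_mono a ex) auto
  also have "\<dots> = (3 * x0\<^sup>2 + 120) * exp (31 * w)" unfolding mult.assoc exp_add[symmetric] by simp
  finally have b: "(3 * x0\<^sup>2 + 120 * H\<^sup>2 * \<T>\<^sup>2) * exp (30 * \<T>\<^sup>2 * H\<^sup>2) \<le> (3 * x0\<^sup>2 + 120) * exp (31 * w)" .
  have o: "1 \<le> exp (31 * w)" "1 \<le> exp (33 * w)" using w1 by simp_all
  define p where "p = 2 + 2 * (3 * x0\<^sup>2 + 120)"
  have p0: "0 \<le> p" unfolding p_def by simp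
  have c: "2 + 2 * ((3 * x0\<^sup>2 + 120 * H\<^sup>2 * \<T>\<^sup>2) * exp (30 * \<T>\<^sup>2 * H\<^sup>2)) \<le> p * exp (31 * w)"
  proof -
    have "p * exp (31 * w) = 2 * exp (31 * w) + 2 * ((3 * x0\<^sup>2 + 120) * exp (31 * w))" by (simp add: p_def algebra_simps)
    then show ?thesis using b o(1) by linarith
  qed
  have "(K0 + H + 1)\<^sup>2 * (2 + 2 * ((3 * x0\<^sup>2 + 120 * H\<^sup>2 * \<T>\<^sup>2) * exp (30 * \<T>\<^sup>2 * H\<^sup>2))) \<le> 9 * exp (2 * w) * (p * exp (31 * w))"
    by (intro mult_mono K c add_nonneg_nonneg mult_nonneg_nonneg) auto
  also have "\<dots> = 9 * p * (exp (2 * w) * exp (31 * w))" by (simp add: ac_simps)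
  also have "\<dots> = 9 * p * exp (33 * w)" unfolding exp_add[symmetric] by simp
  finally have "(K0 + H + 1)\<^sup>2 * (2 + 2 * ((3 * x0\<^sup>2 + 120 * H\<^sup>2 * \<T>\<^sup>2) * exp (30 * \<T>\<^sup>2 * H\<^sup>2))) + 1 \<le> (9 * p + 1) * exp (33 * w)"
    using o(2) unfolding distrib_right[of "9 * p"] mult_1_left by linarith
  then have "milstein_constant x0 \<T> H (K0 + H + 1) \<le> 33840 * exp (2 * w) * ((9 * p + 1) * exp (33 * w)) * exp (540 * w)"
    unfolding milstein_constant_def
    by (intro mult_mono T2 ex mult_left_mono add_nonneg_nonneg mult_nonneg_nonneg) (use p0 in auto)
  also have "\<dots> = 33840 * (9 * p + 1) * (exp (2 * w) * exp (33 * w) * exp (540 * w))" by (simp add: ac_simps)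
  also have "\<dots> = 33840 * (9 * p + 1) * exp (575 * w)" unfolding exp_add[symmetric] by simp
  finally show ?thesis unfolding p_def .
qed

text \<open>On \<open>m < E T \<le> m + 1\<close> the mean square error is weighted against the probability of that event
  by \<open>2 a \<le> \<lambda> + a\<^sup>2 / \<lambda>\<close> with \<open>\<lambda> = \<delta> r\<^sub>m\<close>.\<close>

lemma (in sde_paths) mean_sup_error_le:
  assumes mc: "\<And>m::nat. milstein_coefficients F G (H m) (K m) (real m + 2)" and \<delta>: "0 < \<delta>" "\<delta> < 1"
    and path: "AE z in M. \<forall>t\<in>{0..T}. X\<delta> t z = milstein_path F G x0 \<delta> (E t z) z"
    and r: "\<And>m. 0 < r m" and p: "summable (\<lambda>m. r m * measure M {z\<in>space M. real m < E T z})"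
    and c: "summable (\<lambda>m. milstein_constant x0 (real m + 2) (H m) (K m + H m + 1) / r m)"
  shows "mean_sup_error M T X X\<delta> \<le> ennreal (((\<Sum>m. r m * measure M {z\<in>space M. real m < E T z})
      + (\<Sum>m. milstein_constant x0 (real m + 2) (H m) (K m + H m + 1) / r m)) / 2 * \<delta>)"
proof -
  define C where "C m = milstein_constant x0 (real m + 2) (H m) (K m + H m + 1)" for m
  define A where "A m = {z\<in>space M. real m < E T z}" for m
  have C0: "0 \<le> C m" for m unfolding C_def by (rule milstein_constant_nonneg)
  have A: "A m \<in> sets M" for m
  proof -
    have "Measurable.pred M (\<lambda>z. E T z \<le> real m)" by (rule measurable_F[OF E_le_pred])
    then have "Measurable.pred M (\<lambda>z. \<not> E T z \<le> real m)" by measurable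
    then show ?thesis unfolding A_def by (simp add: not_le pred_def)
  qed
  have "\<exists>g\<in>borel_measurable M. (\<integral>\<^sup>+ z. g z \<partial>M) \<le> ennreal (C m * \<delta>\<^sup>2) \<and>
    (AE z in M. E T z \<le> real m + 1 \<longrightarrow> (\<forall>u\<in>{0..E T z}. sq_err \<delta> u z \<le> g z))" for m
  proof -
    \<comment> \<open>The smallest number of coarse steps that reaches m + 1; since \<delta> < 1 it
      does not exceed m + 2, the horizon of the constants.\<close>
    define N where "N = nat \<lceil>(real m + 1) / \<delta>\<rceil>"
    have "0 \<le> (real m + 1) / \<delta>" using \<delta> by simp
    then have "(real m + 1) / \<delta> \<le> real N" "real N \<le> (real m + 1) / \<delta> + 1" unfolding N_def by linarith+
    then have "real m + 1 \<le> real N * \<delta>" "real N * \<delta> \<le> real m + 1 + \<delta>" using \<delta> by (simp_all add: field_simps)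
    then have N: "real m + 1 \<le> real N * \<delta>" "real N * \<delta> \<le> real m + 2" using \<delta> by simp_all
    obtain g where g: "g \<in> borel_measurable M"
      and i: "(\<integral>\<^sup>+ z. g z \<partial>M) \<le> ennreal (milstein_constant x0 (real N * \<delta>) (H m) (K m + H m + 1) * \<delta>\<^sup>2)"
      and ae: "AE z in M. E T z \<le> real N * \<delta> \<longrightarrow> (\<forall>u\<in>{0..E T z}. sq_err \<delta> u z \<le> g z)"
      using inner_error[OF milstein_coefficients_mono[OF mc[of m] N(2)] \<delta>(1)] \<delta> N(1) by auto
    note i
    also have "ennreal (milstein_constant x0 (real N * \<delta>) (H m) (K m + H m + 1) * \<delta>\<^sup>2) \<le> ennreal (C m * \<delta>\<^sup>2)"
      unfolding C_def using N \<delta> by (intro ennreal_leI mult_right_mono milstein_constant_mono) auto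
    finally have "(\<integral>\<^sup>+ z. g z \<partial>M) \<le> ennreal (C m * \<delta>\<^sup>2)" .
    moreover have "AE z in M. E T z \<le> real m + 1 \<longrightarrow> (\<forall>u\<in>{0..E T z}. sq_err \<delta> u z \<le> g z)"
      using ae by eventually_elim (use N(1) in auto)
    ultimately show ?thesis using g by blast
  qed
  then obtain g where gm: "\<And>m. g m \<in> borel_measurable M" and gi: "\<And>m. (\<integral>\<^sup>+ z. g m z \<partial>M) \<le> ennreal (C m * \<delta>\<^sup>2)"
    and ae: "\<And>m. AE z in M. E T z \<le> real m + 1 \<longrightarrow> (\<forall>u\<in>{0..E T z}. sq_err \<delta> u z \<le> g m z)"
    unfolding Bex_def by meson
  define \<theta> where "\<theta> m = \<delta> * r m" for m
  have l0: "\<theta> m > 0" for m using \<delta> r by (simp add: \<theta>_def)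
  \<comment> \<open>On m < E T \<le> m + 1 the m-th term alone dominates the error at all times,
    hence so does the series.\<close>
  define \<phi> where "\<phi> m z = ennreal (\<theta> m / 2) * indicator (A m) z + ennreal (1 / (2 * \<theta> m)) * g m z" for m z
  have \<phi>m: "\<phi> m \<in> borel_measurable M" for m
    unfolding \<phi>_def[abs_def] using A gm by measurable
  have \<phi>i: "(\<integral>\<^sup>+ z. \<phi> m z \<partial>M) \<le> ennreal (\<delta> / 2 * (r m * measure M (A m) + C m / r m))" for m
  proof -
    have "(\<integral>\<^sup>+ z. \<phi> m z \<partial>M) = ennreal (\<theta> m / 2) * emeasure M (A m) + ennreal (1 / (2 * \<theta> m)) * (\<integral>\<^sup>+ z. g m z \<partial>M)"
      unfolding \<phi>_def using A gm by (subst nn_integral_add) (auto simp: nn_integral_cmult nn_integral_cmult_indicator)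
    also have "\<dots> \<le> ennreal (\<theta> m / 2) * ennreal (measure M (A m)) + ennreal (1 / (2 * \<theta> m)) * ennreal (C m * \<delta>\<^sup>2)"
      using gi by (intro add_mono mult_left_mono) (auto simp: emeasure_eq_measure)
    also have "\<dots> = ennreal (\<theta> m / 2 * measure M (A m) + 1 / (2 * \<theta> m) * (C m * \<delta>\<^sup>2))"
      using l0[of m] C0[of m] by (simp add: ennreal_mult[symmetric] ennreal_plus[symmetric] del: ennreal_plus)
    also have "\<theta> m / 2 * measure M (A m) + 1 / (2 * \<theta> m) * (C m * \<delta>\<^sup>2) = \<delta> / 2 * (r m * measure M (A m) + C m / r m)"
      using \<delta> r[of m] by (simp add: \<theta>_def field_simps power2_eq_square)
    finally show ?thesis .
  qed
  have ae': "AE z in M. \<forall>m. E T z \<le> real m + 1 \<longrightarrow> (\<forall>u\<in>{0..E T z}. sq_err \<delta> u z \<le> g m z)"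
    unfolding AE_all_countable using ae by blast
  have "AE z in M. (SUP t\<in>{0..T}. ennreal \<bar>X t z - X\<delta> t z\<bar>) \<le> (\<Sum>m. \<phi> m z)"
    using ae' path AE_Omega1
  proof eventually_elim
    case (elim z)
    note z = elim(3)
    define m where "m = nat (\<lceil>E T z\<rceil> - 1)"
    have "0 < E T z" by (rule E_pos[OF z T_pos])
    then have m: "real m < E T z" "E T z \<le> real m + 1" unfolding m_def by linarith+
    show ?case
    proof (rule SUP_least)
      fix t assume t: "t \<in> {0..T}"
      define d where "d = Y (E t z) z - milstein_path F G x0 \<delta> (E t z) z"
      have "E t z \<in> {0..E T z}" using t E_nonneg[OF z] E_mono[OF z, of t T] by simp
      then have dg: "ennreal (d\<^sup>2) \<le> g m z" unfolding d_def using elim(1) m(2) by blast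
      have "X t z - X\<delta> t z = d" unfolding d_def using X_eq_Y[OF z t] elim(2) t by simp
      moreover have "\<bar>d\<bar> \<le> \<theta> m / 2 + 1 / (2 * \<theta> m) * d\<^sup>2"
      proof -
        have "0 \<le> (\<bar>d\<bar> - \<theta> m)\<^sup>2 / (2 * \<theta> m)" using l0[of m] by simp
        also have "\<dots> = \<theta> m / 2 + 1 / (2 * \<theta> m) * d\<^sup>2 - \<bar>d\<bar>"
          using l0[of m] by (simp add: field_simps power2_diff power2_eq_square)
        finally show ?thesis by simp
      qed
      then have "ennreal \<bar>d\<bar> \<le> ennreal (\<theta> m / 2) + ennreal (1 / (2 * \<theta> m)) * ennreal (d\<^sup>2)"
        using l0[of m] by (simp add: ennreal_mult[symmetric] ennreal_plus[symmetric] del: ennreal_plus)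
      moreover have "\<dots> \<le> \<phi> m z"
        unfolding \<phi>_def using m(1) Omega1_space[OF z] dg by (intro add_mono mult_left_mono) (auto simp: A_def)
      moreover have "\<phi> m z \<le> (\<Sum>m. \<phi> m z)" using sum_le_suminf[of "\<lambda>m. \<phi> m z" "{m}"] by simp
      ultimately show "ennreal \<bar>X t z - X\<delta> t z\<bar> \<le> (\<Sum>m. \<phi> m z)" by (metis order_trans)
    qed
  qed
  then have "mean_sup_error M T X X\<delta> \<le> (\<integral>\<^sup>+ z. (\<Sum>m. \<phi> m z) \<partial>M)"
    unfolding mean_sup_error_def by (rule nn_integral_mono_AE)
  also have "\<dots> = (\<Sum>m. \<integral>\<^sup>+ z. \<phi> m z \<partial>M)" by (rule nn_integral_suminf[OF \<phi>m])
  also have "\<dots> \<le> (\<Sum>m. ennreal (\<delta> / 2 * (r m * measure M (A m) + C m / r m)))" by (rule suminf_le[OF \<phi>i]) auto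
  also have "\<dots> = ennreal (\<Sum>m. \<delta> / 2 * (r m * measure M (A m) + C m / r m))"
  proof (rule suminf_ennreal2)
    show "0 \<le> \<delta> / 2 * (r m * measure M (A m) + C m / r m)" for m using \<delta> r[of m] C0[of m] by simp
    show "summable (\<lambda>m. \<delta> / 2 * (r m * measure M (A m) + C m / r m))"
      using p c unfolding A_def[symmetric] C_def[symmetric] by (intro summable_mult summable_add)
  qed
  also have "(\<Sum>m. \<delta> / 2 * (r m * measure M (A m) + C m / r m)) = \<delta> / 2 * ((\<Sum>m. r m * measure M (A m)) + (\<Sum>m. C m / r m))"
    using p c unfolding A_def[symmetric] C_def[symmetric] by (subst suminf_mult[OF summable_add]) (auto simp: suminf_add)
  finally show ?thesis unfolding A_def C_def by (simp add: mult.commute)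
qed

section \<open>Tails of the inverse subordinator\<close>

text \<open>Chernoff bound with \<psi>(a) \<ge> c0 a^b. The choice of a makes the loss a T half of
  the gain c0 m a^b, and a^b is a multiple of m^(b/(1-b)).\<close>

lemma (in time_change_setting) D_tail_powr:
  assumes rv: "regularly_varying (laplace_exponent \<nu>) \<beta>" and b: "0 < b" "b < \<beta>" "b < 1" and T: "0 < T"
  shows "\<exists>c>0. eventually (\<lambda>m. measure M {z\<in>space M. D (real m) z \<le> T} \<le> exp (- c * real m powr (1 / (1 - b)))) sequentially"
proof -
  obtain c0 s0 where c0: "c0 > 0" and s0: "s0 > 0" and low: "\<And>s. s \<ge> s0 \<Longrightarrow> c0 * s powr b \<le> laplace_exponent \<nu> s"
    using regularly_varying_lower[OF rv laplace_exponent_mono b(2)] b(1) by auto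
  define p where "p = 1 / (1 - b)"
  have p: "p > 0" "(1 - b) * p = 1" using b by (auto simp: p_def)
  \<comment> \<open>The solution of a^(1-b) = c0 m / (2 T).\<close>
  define a where "a m = (c0 / (2 * T) * real m) powr p" for m :: nat
  define c where "c = c0 / 2 * (c0 / (2 * T)) powr (b * p)"
  have c: "c > 0" unfolding c_def using c0 T by simp
  have "eventually (\<lambda>m. s0 \<le> a m) sequentially"
  proof -
    have "filterlim a at_top sequentially" unfolding a_def[abs_def] using c0 T p(1) by real_asymp
    then show ?thesis unfolding filterlim_at_top by blast
  qed
  then have "eventually (\<lambda>m. measure M {z\<in>space M. D (real m) z \<le> T} \<le> exp (- c * real m powr p)) sequentially"
    using eventually_gt_at_top[of 0]
  proof eventually_elim
    case (elim m)
    let ?v = "c0 / (2 * T) * real m"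
    have v: "?v > 0" using elim c0 T by simp
    have am: "a m = ?v * a m powr b"
    proof -
      have "a m = a m powr (1 - b) * a m powr b" using elim s0 by (simp add: powr_add[symmetric])
      also have "a m powr (1 - b) = ?v" unfolding a_def powr_powr mult.commute[of p] p(2) using v by (intro powr_one) simp
      finally show ?thesis .
    qed
    have ab: "a m powr b = (c0 / (2 * T)) powr (b * p) * real m powr (b * p)"
      unfolding a_def powr_powr using c0 T by (subst powr_mult) (auto simp: mult.commute)
    have "1 + b * p = p" using p(2) by (simp add: algebra_simps)
    then have mp: "real m * real m powr (b * p) = real m powr p"
      using elim powr_add[of "real m" 1 "b * p"] by simp
    have "measure M {z\<in>space M. D (real m) z \<le> T} \<le> exp (a m * T - real m * laplace_exponent \<nu> (a m))"
      by (rule D_tail) (use elim s0 in auto)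
    also have "a m * T - real m * laplace_exponent \<nu> (a m) \<le> a m * T - real m * (c0 * a m powr b)"
      using mult_left_mono[OF low[OF elim(1)], of "real m"] by simp
    also have "a m * T = c0 / 2 * (real m * a m powr b)"
      using T by (subst am) (simp add: field_simps)
    also have "c0 / 2 * (real m * a m powr b) - real m * (c0 * a m powr b) = - c * (real m * real m powr (b * p))"
      unfolding ab c_def by (simp add: field_simps)
    finally show ?case unfolding mp by simp
  qed
  then show ?thesis using c unfolding p_def by blast
qed

text \<open>Adding \<open>f s0\<close> to the constant covers the arguments between 1 and
  \<open>s0\<close>, by monotonicity.\<close>

lemma regularly_varying_powr_bound:
  assumes "regularly_varying f p" "mono_on {0<..} f" "p < b" "0 \<le> b"
  shows "\<exists>A>0. \<forall>u\<ge>1. f u \<le> A * u powr b"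
proof -
  obtain c s0 where c: "c > 0" "s0 > 0" and le: "\<And>s. s \<ge> s0 \<Longrightarrow> f s \<le> c * s powr b"
    using regularly_varying_upper[OF assms] by auto
  have f0: "f s0 > 0" using assms(1) c(2) by (auto simp: regularly_varying_def)
  have "f u \<le> (c + f s0) * u powr b" if u: "u \<ge> 1" for u
  proof (cases "u \<ge> s0")
    case True
    have "c * u powr b \<le> (c + f s0) * u powr b" using f0 by (intro mult_right_mono) auto
    then show ?thesis using le[OF True] by linarith
  next
    case False
    have "f u \<le> f s0 * 1" using False u c by (auto intro!: mono_onD[OF assms(2)])
    also have "\<dots> \<le> f s0 * u powr b" using f0 u assms(4) by (intro mult_left_mono ge_one_powr_ge_zero) auto
    also have "\<dots> \<le> (c + f s0) * u powr b" using c by (intro mult_right_mono) auto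
    finally show ?thesis .
  qed
  then show ?thesis using c f0 by (intro exI[of _ "c + f s0"]) auto
qed

text \<open>Brings both alternatives to one form: \<rho> bounds the growth exponents of u^2 h(u)^2
  and log k(u), the quantities that enter \<open>milstein_constant_le\<close>, and stays below the
  limiting tail exponent 1 / (1 - \<beta>).\<close>

lemma coefficient_growth:
  fixes h k :: "real \<Rightarrow> real"
  assumes h: "mono_on {0..} h" "\<And>u. u \<ge> 0 \<Longrightarrow> h u \<ge> 0" and k: "mono_on {0..} k" "\<And>u. u \<ge> 0 \<Longrightarrow> k u > 0"
    and \<beta>: "\<beta> < 1"
    and cases: "((\<exists>c. \<forall>u\<ge>0. h u = c) \<and> (\<exists>c. \<forall>u\<ge>0. k u = c) \<and> \<beta> \<in> {1 / 2<..<1}) \<or>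
       (\<exists>q q'. q \<ge> 0 \<and> q' \<ge> 0 \<and> regularly_varying h q \<and> regularly_varying (\<lambda>u. ln (k u)) q' \<and>
          \<beta> \<in> {(max (2 * q + 2) q' - 1) / max (2 * q + 2) q'<..<1})"
  shows "\<exists>\<rho> A. 1 \<le> \<rho> \<and> \<rho> < 1 / (1 - \<beta>) \<and> 1 \<le> A \<and> (\<forall>u\<ge>1. u\<^sup>2 * (h u)\<^sup>2 \<le> A * u powr \<rho> \<and> k u \<le> exp (A * u powr \<rho>))"
  using cases
proof
  assume "(\<exists>c. \<forall>u\<ge>0. h u = c) \<and> (\<exists>c. \<forall>u\<ge>0. k u = c) \<and> \<beta> \<in> {1 / 2<..<1}"
  then obtain c d where c: "\<And>u. u \<ge> 0 \<Longrightarrow> h u = c" and d: "\<And>u. u \<ge> 0 \<Longrightarrow> k u = d" and b: "1 / 2 < \<beta>" by auto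
  have d0: "d > 0" using k(2)[of 0] d[of 0] by simp
  define A where "A = 1 + c\<^sup>2 + \<bar>ln d\<bar>"
  show ?thesis
  \<comment> \<open>For constant h and k only u^2 grows, so \<rho> = 2, and 2 < 1 / (1 - \<beta>)
    means \<beta> > 1/2.\<close>
  proof (rule exI[of _ 2], rule exI[of _ A], intro conjI allI impI)
    show "2 < 1 / (1 - \<beta>)" using b \<beta> by (simp add: field_simps)
    show "1 \<le> A" by (simp add: A_def)
    fix u :: real assume u: "1 \<le> u"
    have u2: "u powr 2 = u\<^sup>2" using u by (simp add: powr_numeral)
    have "c\<^sup>2 * u\<^sup>2 \<le> A * u\<^sup>2" by (intro mult_right_mono) (auto simp: A_def)
    then show "u\<^sup>2 * (h u)\<^sup>2 \<le> A * u powr 2" using c[of u] u u2 by (simp add: mult.commute)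
    have "ln d \<le> \<bar>ln d\<bar>" by simp
    also have "\<dots> \<le> A * 1" by (simp add: A_def)
    also have "\<dots> \<le> A * u powr 2" unfolding u2 using u by (intro mult_left_mono one_le_power) (auto simp: A_def)
    finally have "exp (ln d) \<le> exp (A * u powr 2)" by simp
    then show "k u \<le> exp (A * u powr 2)" using d0 d[of u] u by simp
  qed simp
next
  assume "\<exists>q q'. q \<ge> 0 \<and> q' \<ge> 0 \<and> regularly_varying h q \<and> regularly_varying (\<lambda>u. ln (k u)) q' \<and>
          \<beta> \<in> {(max (2 * q + 2) q' - 1) / max (2 * q + 2) q'<..<1}"
  then obtain q q' where q: "q \<ge> 0" "q' \<ge> 0" and rh: "regularly_varying h q" and rk: "regularly_varying (\<lambda>u. ln (k u)) q'"
    and b: "(max (2 * q + 2) q' - 1) / max (2 * q + 2) q' < \<beta>" by auto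
  define Q where "Q = max (2 * q + 2) q'"
  have Q: "Q \<ge> 2" "2 * q + 2 \<le> Q" "q' \<le> Q" using q by (auto simp: Q_def)
  \<comment> \<open>\<beta> > (Q - 1) / Q is equivalent to Q < 1 / (1 - \<beta>), which leaves room
    for \<rho>.\<close>
  have "Q - 1 < \<beta> * Q" using b Q unfolding Q_def[symmetric] by (simp add: pos_divide_less_eq)
  then have "Q * (1 - \<beta>) < 1" by (simp add: algebra_simps)
  then have "Q < 1 / (1 - \<beta>)" using \<beta> by (simp add: pos_less_divide_eq)
  then obtain \<rho> where \<rho>: "Q < \<rho>" "\<rho> < 1 / (1 - \<beta>)" using dense by blast
  have "mono_on {0<..} h" using h(1) by (rule mono_on_subset) auto
  \<comment> \<open>The exponent exceeds q because \<rho> > 2 q + 2, and its double plus 2 is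
    \<rho>.\<close>
  then obtain a where a: "a > 0" "\<And>u. u \<ge> 1 \<Longrightarrow> h u \<le> a * u powr ((\<rho> - 2) / 2)"
    using regularly_varying_powr_bound[OF rh, of "(\<rho> - 2) / 2"] \<rho> Q by auto
  have "mono_on {0<..} (\<lambda>u. ln (k u))"
    by (intro mono_onI) (use mono_onD[OF k(1)] k(2) in \<open>auto intro!: ln_mono\<close>)
  then obtain d where d: "d > 0" "\<And>u. u \<ge> 1 \<Longrightarrow> ln (k u) \<le> d * u powr \<rho>"
    using regularly_varying_powr_bound[OF rk, of \<rho>] \<rho> Q q by auto
  define A where "A = 1 + a\<^sup>2 + d"
  show ?thesis
  proof (rule exI[of _ \<rho>], rule exI[of _ A], intro conjI allI impI)
    show "1 \<le> \<rho>" using \<rho> Q by simp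
    show "\<rho> < 1 / (1 - \<beta>)" by (rule \<rho>(2))
    show "1 \<le> A" using d by (simp add: A_def)
    fix u :: real assume u: "1 \<le> u"
    have "(h u)\<^sup>2 \<le> (a * u powr ((\<rho> - 2) / 2))\<^sup>2" using a(2)[OF u] h(2)[of u] u by (intro power_mono) auto
    also have "\<dots> = a\<^sup>2 * u powr (\<rho> - 2)" by (simp add: power_mult_distrib power2_eq_square powr_add[symmetric])
    finally have "u\<^sup>2 * (h u)\<^sup>2 \<le> u powr 2 * (a\<^sup>2 * u powr (\<rho> - 2))" using u by (intro mult_mono) (auto simp: powr_numeral)
    also have "\<dots> = a\<^sup>2 * u powr \<rho>" using powr_add[of u 2 "\<rho> - 2"] by (simp add: ac_simps)
    also have "\<dots> \<le> A * u powr \<rho>" using d by (intro mult_right_mono) (auto simp: A_def)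
    finally show "u\<^sup>2 * (h u)\<^sup>2 \<le> A * u powr \<rho>" .
    have "ln (k u) \<le> d * u powr \<rho>" by (rule d(2)[OF u])
    also have "\<dots> \<le> A * u powr \<rho>" by (intro mult_right_mono) (auto simp: A_def)
    finally have "exp (ln (k u)) \<le> exp (A * u powr \<rho>)" by simp
    then show "k u \<le> exp (A * u powr \<rho>)" using k(2)[of u] u by simp
  qed
qed

theorem theorem5p1:
  fixes PB :: "'b measure" and PD :: "'d measure" and M :: "('b \<times> 'd) measure"
    and \<F> :: "real \<Rightarrow> ('b \<times> 'd) measure"
    and B D :: "real \<Rightarrow> 'b \<times> 'd \<Rightarrow> real" and \<nu> :: "real measure"
    and T x0 \<beta> :: real
    and F G :: "real \<Rightarrow> real \<Rightarrow> real" and h k :: "real \<Rightarrow> real"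
    and X :: "real \<Rightarrow> 'b \<times> 'd \<Rightarrow> real"
    and X\<delta> :: "real \<Rightarrow> real \<Rightarrow> 'b \<times> 'd \<Rightarrow> real"
  assumes setting: "time_change_setting PB PD M \<F> B D \<nu>"
    and T: "T > 0"
    and cont: "jointly_continuous F" "jointly_continuous G"
    and smooth: "C12 F" "C12 G" "C12 (G_Gx G)"
    and h: "continuous_on {0..} h" "mono_on {0..} h" "\<And>u. u \<ge> 0 \<Longrightarrow> h u \<ge> 0"
    and k: "continuous_on {0..} k" "mono_on {0..} k" "\<And>u. u \<ge> 0 \<Longrightarrow> k u > 0"
    and lip: "\<And>u x y. u \<ge> 0 \<Longrightarrow> \<bar>F u x - F u y\<bar> + \<bar>G u x - G u y\<bar> \<le> h u * \<bar>x - y\<bar>"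
    and growth: "\<And>u x. u \<ge> 0 \<Longrightarrow> \<bar>F u x\<bar> + \<bar>G u x\<bar> \<le> h u * (1 + \<bar>x\<bar>)"
    and lip': "\<And>u x y. u \<ge> 0 \<Longrightarrow> \<bar>G_Gx G u x - G_Gx G u y\<bar> \<le> h u * \<bar>x - y\<bar>"
    and growth': "\<And>u x. u \<ge> 0 \<Longrightarrow> \<bar>G_Gx G u x\<bar> \<le> h u * (1 + \<bar>x\<bar>)"
    and g1: "\<And>u x. u \<ge> 0 \<Longrightarrow>
      \<bar>partial_u F u x + partial_x F u x * F u x + 1 / 2 * partial_x (partial_x F) u x * (G u x)\<^sup>2\<bar>
        \<le> k u * (1 + \<bar>x\<bar>)"
    and g2: "\<And>u x. u \<ge> 0 \<Longrightarrow> \<bar>partial_x F u x * G u x\<bar> \<le> k u * (1 + \<bar>x\<bar>)"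
    and g3: "\<And>u x. u \<ge> 0 \<Longrightarrow>
      \<bar>partial_u G u x + partial_x G u x * F u x + 1 / 2 * (G u x)\<^sup>2 * partial_x (partial_x G) u x\<bar>
        \<le> k u * (1 + \<bar>x\<bar>)"
    and g4: "\<And>u x. u \<ge> 0 \<Longrightarrow>
      \<bar>partial_u (G_Gx G) u x + partial_x (G_Gx G) u x * F u x
          + 1 / 2 * partial_x (partial_x (G_Gx G)) u x * (G u x)\<^sup>2\<bar>
        \<le> k u * (1 + \<bar>x\<bar>)"
    and g5: "\<And>u x. u \<ge> 0 \<Longrightarrow> \<bar>partial_x (G_Gx G) u x * G u x\<bar> \<le> k u * (1 + \<bar>x\<bar>)"
    and X: "sde_solution M \<F> B D T x0 F G X"
    and \<beta>: "0 < \<beta>" "\<beta> < 1" "regularly_varying (laplace_exponent \<nu>) \<beta>"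
    and cases:
      "((\<exists>c. \<forall>u\<ge>0. h u = c) \<and> (\<exists>c. \<forall>u\<ge>0. k u = c) \<and> \<beta> \<in> {1 / 2<..<1}) \<or>
       (\<exists>q q'. q \<ge> 0 \<and> q' \<ge> 0 \<and>
          regularly_varying h q \<and> regularly_varying (\<lambda>u. ln (k u)) q' \<and>
          \<beta> \<in> {(max (2 * q + 2) q' - 1) / max (2 * q + 2) q'<..<1})"
    and X\<delta>: "\<And>\<delta>. \<delta> \<in> {0<..<1} \<Longrightarrow> milstein_approximation M \<F> B D T x0 F G \<delta> (X\<delta> \<delta>)"
  shows "(\<exists>C>0. \<forall>\<delta>\<in>{0<..<1}. mean_sup_error M T X (X\<delta> \<delta>) \<le> ennreal (C * \<delta>)) \<and>
         strongly_converges_with_order M T X\<delta> X 1"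
proof -
  interpret s: time_change_setting PB PD M \<F> B D \<nu> by (rule setting)
  have "\<exists>\<Omega>1 I. sde_paths M \<F> B D T \<Omega>1 F G x0 X I" by (rule s.sde_paths_exists[OF \<beta>(3,1) T cont X])
  then obtain \<Omega>1 I where sp: "sde_paths M \<F> B D T \<Omega>1 F G x0 X I" by blast
  interpret p: sde_paths M \<F> B D T \<Omega>1 F G x0 X I by (rule sp)
  have "\<exists>\<rho> A. 1 \<le> \<rho> \<and> \<rho> < 1 / (1 - \<beta>) \<and> 1 \<le> A \<and> (\<forall>u\<ge>1. u\<^sup>2 * (h u)\<^sup>2 \<le> A * u powr \<rho> \<and> k u \<le> exp (A * u powr \<rho>))"
    by (rule coefficient_growth[OF h(2,3) k(2,3) \<beta>(2) cases])
  then obtain \<rho> A where \<rho>: "1 \<le> \<rho>" "\<rho> < 1 / (1 - \<beta>)" and A: "1 \<le> A"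
    and hA: "\<And>u. 1 \<le> u \<Longrightarrow> u\<^sup>2 * (h u)\<^sup>2 \<le> A * u powr \<rho>" and kA: "\<And>u. 1 \<le> u \<Longrightarrow> k u \<le> exp (A * u powr \<rho>)" by blast
  \<comment> \<open>b is placed below \<beta> but close enough that \<rho> < 1 / (1 - b): the tail
    still beats the constants.\<close>
  have "1 - 1 / \<rho> < \<beta>" using \<rho> \<beta> by (simp add: field_simps)
  moreover have "0 < \<beta>" by (rule \<beta>(1))
  ultimately obtain b where b: "max 0 (1 - 1 / \<rho>) < b" "b < \<beta>" using dense[of "max 0 (1 - 1 / \<rho>)" \<beta>] by auto
  define \<alpha> where "\<alpha> = 1 / (1 - b)"
  have "\<rho> * (1 - b) < 1" using b \<rho> by (simp add: field_simps)
  then have \<rho>\<alpha>: "\<rho> < \<alpha>" unfolding \<alpha>_def using b \<beta> by (simp add: pos_less_divide_eq)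
  have b': "0 < b" "b < \<beta>" "b < 1" using b \<beta>(2) by auto
  obtain c where c: "c > 0" and tail: "eventually (\<lambda>m. measure M {z\<in>space M. D (real m) z \<le> T} \<le> exp (- c * real m powr \<alpha>)) sequentially"
    using s.D_tail_powr[OF \<beta>(3) b' T] unfolding \<alpha>_def by blast
  \<comment> \<open>The weight takes half of the tail exponent. The other half keeps the first
    series summable, and in the second the weight beats the constants because \<rho> <
    \<alpha>.\<close>
  define r where "r m = exp (c / 2 * real m powr \<alpha>)" for m :: nat
  \<comment> \<open>h and k are nondecreasing, so their values at the right end of the horizon serve
    as constants on all of it.\<close>
  define H where "H m = h (real m + 2)" for m :: nat
  define K where "K m = k (real m + 2)" for m :: nat
  have mc: "milstein_coefficients F G (H m) (K m) (real m + 2)" for m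
  proof
    have hm: "h u * c \<le> H m * c" and km: "k u * c \<le> K m * c" if "0 \<le> u" "u \<le> real m + 2" "0 \<le> c" for u c
      using mono_onD[OF h(2), of u "real m + 2"] mono_onD[OF k(2), of u "real m + 2"] that
      by (auto simp: H_def K_def intro!: mult_right_mono)
    show "C12 F" "C12 G" "C12 (G_Gx G)" by (fact smooth)+
    show "0 \<le> H m" "0 \<le> K m" using h(3)[of "real m + 2"] k(3)[of "real m + 2"] by (auto simp: H_def K_def)
    fix u x y :: real assume u: "0 \<le> u" "u \<le> real m + 2"
    show "\<bar>F u x - F u y\<bar> \<le> H m * \<bar>x - y\<bar>" "\<bar>G u x - G u y\<bar> \<le> H m * \<bar>x - y\<bar>" "\<bar>G_Gx G u x - G_Gx G u y\<bar> \<le> H m * \<bar>x - y\<bar>"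
      using lip[OF u(1), of x y] lip'[OF u(1), of x y] hm[OF u, of "\<bar>x - y\<bar>"] by linarith+
    show "\<bar>F u x\<bar> \<le> H m * (1 + \<bar>x\<bar>)" "\<bar>G u x\<bar> \<le> H m * (1 + \<bar>x\<bar>)" "\<bar>G_Gx G u x\<bar> \<le> H m * (1 + \<bar>x\<bar>)"
      using growth[OF u(1), of x] growth'[OF u(1), of x] hm[OF u, of "1 + \<bar>x\<bar>"] by linarith+
    have kx: "k u * (1 + \<bar>x\<bar>) \<le> K m * (1 + \<bar>x\<bar>)" by (rule km[OF u]) simp
    show "\<bar>partial_u F u x + partial_x F u x * F u x + 1 / 2 * partial_x (partial_x F) u x * (G u x)\<^sup>2\<bar> \<le> K m * (1 + \<bar>x\<bar>)"
      using g1[OF u(1), of x] kx by (rule order_trans)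
    have "1 / 2 * partial_x (partial_x G) u x * (G u x)\<^sup>2 = 1 / 2 * (G u x)\<^sup>2 * partial_x (partial_x G) u x" by (simp only: ac_simps)
    then show "\<bar>partial_u G u x + partial_x G u x * F u x + 1 / 2 * partial_x (partial_x G) u x * (G u x)\<^sup>2\<bar> \<le> K m * (1 + \<bar>x\<bar>)"
      using order_trans[OF g3[OF u(1), of x] kx] by (simp only:)
    show "\<bar>partial_u (G_Gx G) u x + partial_x (G_Gx G) u x * F u x
          + 1 / 2 * partial_x (partial_x (G_Gx G)) u x * (G u x)\<^sup>2\<bar> \<le> K m * (1 + \<bar>x\<bar>)"
      using g4[OF u(1), of x] kx by (rule order_trans)
    show "\<bar>partial_x F u x * G u x\<bar> \<le> K m * (1 + \<bar>x\<bar>)" using g2[OF u(1), of x] kx by (rule order_trans)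
    show "\<bar>partial_x (G_Gx G) u x * G u x\<bar> \<le> K m * (1 + \<bar>x\<bar>)" using g5[OF u(1), of x] kx by (rule order_trans)
  qed
  have exit: "measure M {z\<in>space M. real m < p.E T z} \<le> measure M {z\<in>space M. D (real m) z \<le> T}" for m :: nat
  proof (rule s.finite_measure_mono_AE)
    show "AE z in M. z \<in> {z\<in>space M. real m < p.E T z} \<longrightarrow> z \<in> {z\<in>space M. D (real m) z \<le> T}"
      using p.AE_Omega1 by eventually_elim (auto simp: p.E_greater_iff)
    have "D (real m) \<in> borel_measurable M" by (rule s.D_measurable) simp
    then show "{z\<in>space M. D (real m) z \<le> T} \<in> sets M" by measurable
  qed
  have geo: "summable (\<lambda>m. exp (- real m))"
  proof -
    have "exp (- real m) = exp (- 1) ^ m" for m by (simp add: exp_of_nat_mult[symmetric])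
    then show ?thesis by (simp add: summable_geometric)
  qed
  have sum_p: "summable (\<lambda>m. r m * measure M {z\<in>space M. real m < p.E T z})"
  proof (rule summable_comparison_test_ev[OF _ geo])
    have "eventually (\<lambda>m. - (c / 2 * real m powr \<alpha>) \<le> - real m) sequentially" using c \<rho>\<alpha> \<rho> by real_asymp
    then show "eventually (\<lambda>m. norm (r m * measure M {z\<in>space M. real m < p.E T z}) \<le> exp (- real m)) sequentially"
      using tail
    proof eventually_elim
      case (elim m)
      have "r m * measure M {z\<in>space M. real m < p.E T z} \<le> exp (c / 2 * real m powr \<alpha>) * exp (- c * real m powr \<alpha>)"
        unfolding r_def using order_trans[OF exit elim(2)] by (intro mult_left_mono) auto
      also have "\<dots> = exp (- (c / 2 * real m powr \<alpha>))" unfolding exp_add[symmetric] by (simp add: field_simps)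
      also have "\<dots> \<le> exp (- real m)" using elim(1) by simp
      finally show ?case by (simp add: r_def)
    qed
  qed
  define K1 where "K1 = 33840 * (9 * (2 + 2 * (3 * x0\<^sup>2 + 120)) + 1)"
  have K1: "K1 \<ge> 0" unfolding K1_def by simp
  have sum_c: "summable (\<lambda>m. milstein_constant x0 (real m + 2) (H m) (K m + H m + 1) / r m)"
  proof (rule summable_comparison_test_ev[OF _ summable_mult[OF geo, of K1]])
    have "eventually (\<lambda>m. 575 * (A * (real m + 2) powr \<rho>) - c / 2 * real m powr \<alpha> \<le> - real m) sequentially"
      using c \<rho>\<alpha> \<rho> A by real_asymp
    then show "eventually (\<lambda>m. norm (milstein_constant x0 (real m + 2) (H m) (K m + H m + 1) / r m) \<le> K1 * exp (- real m)) sequentially"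
    proof eventually_elim
      case (elim m)
      let ?u = "real m + 2"
      have u: "1 \<le> ?u" by simp
      have "1 * ?u powr 1 \<le> A * ?u powr \<rho>" using A \<rho> by (intro mult_mono powr_mono) auto
      then have "milstein_constant x0 ?u (H m) (K m + H m + 1) \<le> K1 * exp (575 * (A * ?u powr \<rho>))"
        unfolding K1_def H_def K_def using hA[OF u] kA[OF u] h(3)[of ?u] k(3)[of ?u]
        by (intro milstein_constant_le) auto
      then have "milstein_constant x0 ?u (H m) (K m + H m + 1) / r m \<le> K1 * exp (575 * (A * ?u powr \<rho>)) / r m"
        by (intro divide_right_mono) (auto simp: r_def)
      also have "\<dots> = K1 * exp (575 * (A * ?u powr \<rho>) - c / 2 * real m powr \<alpha>)"
        by (simp add: r_def exp_diff)
      also have "\<dots> \<le> K1 * exp (- real m)" using elim K1 by (intro mult_left_mono) auto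
      finally show ?case using milstein_constant_nonneg[of x0 ?u "H m" "K m + H m + 1"] by (simp add: r_def)
    qed
  qed
  define S where "S = ((\<Sum>m. r m * measure M {z\<in>space M. real m < p.E T z})
      + (\<Sum>m. milstein_constant x0 (real m + 2) (H m) (K m + H m + 1) / r m)) / 2"
  \<comment> \<open>|S| + 1 makes the constant strictly positive.\<close>
  have main: "mean_sup_error M T X (X\<delta> \<delta>) \<le> ennreal ((\<bar>S\<bar> + 1) * \<delta>)" if \<delta>: "\<delta> \<in> {0<..<1}" for \<delta>
  proof -
    have \<delta>': "0 < \<delta>" "\<delta> < 1" using \<delta> by auto
    have jG: "jointly_continuous (G_Gx G)" using smooth(3) by (simp add: C12_def)
    have "mean_sup_error M T X (X\<delta> \<delta>) \<le> ennreal (S * \<delta>)"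
      unfolding S_def
      by (rule p.mean_sup_error_le[OF mc \<delta>' p.milstein_approximation_path[OF cont jG \<delta>'(1) X\<delta>[OF \<delta>]] _ sum_p sum_c])
         (simp add: r_def)
    also have "\<dots> \<le> ennreal ((\<bar>S\<bar> + 1) * \<delta>)" using \<delta>' by (intro ennreal_leI mult_right_mono) auto
    finally show ?thesis .
  qed
  have "mean_sup_error M T X (X\<delta> \<delta>) \<le> ennreal ((\<bar>S\<bar> + 1) * \<delta> powr 1)" if "\<delta> \<in> {0<..<1}" for \<delta>
    using main[OF that] that by simp
  then have "\<bar>S\<bar> + 1 > 0 \<and> (1::real) > 0 \<and> (\<forall>\<delta>\<in>{0<..<1}. mean_sup_error M T X (X\<delta> \<delta>) \<le> ennreal ((\<bar>S\<bar> + 1) * \<delta> powr 1))"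
    by auto
  then have "strongly_converges_with_order M T X\<delta> X 1"
    unfolding strongly_converges_with_order_def using zero_less_one by blast
  moreover have "\<exists>C>0. \<forall>\<delta>\<in>{0<..<1}. mean_sup_error M T X (X\<delta> \<delta>) \<le> ennreal (C * \<delta>)"
    using main by (intro exI[of _ "\<bar>S\<bar> + 1"]) auto
  ultimately show ?thesis by blast
qed

end
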